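(* For every integer $d\ge 2$ there exists an extreme bounded quadrature domain of order $d$ and an extreme unbounded quadrature domain of order $d$.
   Context: A bounded connected open set $\Omega\subset\mathbb C$ with $\mathop{\rm int}\mathop{\rm clos}\Omega=\Omega$ is a bounded quadrature domain (BQD) if there is a rational function $r_\Omega$ with $r_\Omega(\infty)=0$, poles in $\Omega$, such that $\int_\Omega f\,dA=\frac{1}{2i}\oint_{\partial\Omega}f r_\Omega\,dz$ for all $f$ analytic in $\Omega$ and continuous up to the boundary. A domain $\Omega\subset\widehat{\mathbb C}$ with $\infty\in\Omega$, $\mathop{\rm int}\mathop{\rm clos}\Omega=\Omega$, is an unbounded quadrature domain (UQD) if there is a rational $r_\Omega$ with poles in $\Omega$ such that the same identity holds (area integral in principal value sense) for all such $f$ with $f(\infty)=0$. The order is $\deg r_\Omega$, and the nodes are the poles of $r_\Omega$. The boundary of a quadrature domain is a real-analytic curve except at finitely many singular points, which are cusps or double points. A simply connected BQD of order $d$ is extreme if the origin is its only node and its boundary has $d-1$ cusps and $d-2$ double points. A simply connected UQD of order $d$ is extreme if $\infty$ is its only node and its boundary has $d+1$ cusps and $d-2$ double points. *)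

theory Defs
  imports "HOL-Complex_Analysis.Complex_Analysis" "HOL-Computational_Algebra.Polynomial_Factorial"
begin

text \<open>A real-analytic arc parametrised by the open interval (-1,1): the restriction to
  the real segment of a function holomorphic on an open neighbourhood of that segment
  (a map from an interval of R to C is real-analytic iff it extends holomorphically),
  injective on the interval.\<close>
definition analytic_arc :: "(real \<Rightarrow> complex) \<Rightarrow> bool" where
  "analytic_arc \<gamma> \<longleftrightarrow>
     (\<exists>S h. open S \<and> complex_of_real ` {-1<..<1} \<subseteq> S \<and> h holomorphic_on S \<and>
            (\<forall>t\<in>{-1<..<1}. \<gamma> t = h (complex_of_real t))) \<and>
     inj_on \<gamma> {-1<..<1}"

definition regular_arc :: "(real \<Rightarrow> complex) \<Rightarrow> bool" where
  "regular_arc \<gamma> \<longleftrightarrow> analytic_arc \<gamma> \<and> (\<forall>t\<in>{-1<..<1}. vector_derivative \<gamma> (at t) \<noteq> 0)"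

definition regular_boundary_point :: "complex set \<Rightarrow> complex \<Rightarrow> bool" where
  "regular_boundary_point \<Omega> z \<longleftrightarrow> z \<in> frontier \<Omega> \<and>
     (\<exists>U \<gamma>. open U \<and> z \<in> U \<and> regular_arc \<gamma> \<and> \<gamma> 0 = z \<and> frontier \<Omega> \<inter> U = \<gamma> ` {-1<..<1})"

definition boundary_cusp :: "complex set \<Rightarrow> complex \<Rightarrow> bool" where
  "boundary_cusp \<Omega> z \<longleftrightarrow> z \<in> frontier \<Omega> \<and> \<not> regular_boundary_point \<Omega> z \<and>
     (\<exists>U \<gamma>. open U \<and> z \<in> U \<and> analytic_arc \<gamma> \<and> \<gamma> 0 = z \<and>
        (\<forall>t\<in>{-1<..<1} - {0}. vector_derivative \<gamma> (at t) \<noteq> 0) \<and>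
        frontier \<Omega> \<inter> U = \<gamma> ` {-1<..<1})"

definition boundary_double_point :: "complex set \<Rightarrow> complex \<Rightarrow> bool" where
  "boundary_double_point \<Omega> z \<longleftrightarrow> z \<in> frontier \<Omega> \<and>
     (\<exists>U \<gamma>1 \<gamma>2. open U \<and> z \<in> U \<and> regular_arc \<gamma>1 \<and> regular_arc \<gamma>2 \<and>
        \<gamma>1 0 = z \<and> \<gamma>2 0 = z \<and> \<gamma>1 ` {-1<..<1} \<inter> \<gamma>2 ` {-1<..<1} = {z} \<and>
        frontier \<Omega> \<inter> U = \<gamma>1 ` {-1<..<1} \<union> \<gamma>2 ` {-1<..<1})"

text \<open>Bounded quadrature domain with quadrature function r = p/q (lowest terms,
  r(\<infinity>)=0, poles = zeros of q in \<Omega>). The boundary integral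
  (1/2i) \<ointegral>_{\<partial>\<Omega>} f r dz is evaluated by the residue theorem as
  \<pi> \<Sum>_{poles a} Res(f r, a).\<close>
definition BQD_with :: "complex set \<Rightarrow> complex poly \<Rightarrow> complex poly \<Rightarrow> bool" where
  "BQD_with \<Omega> p q \<longleftrightarrow>
     bounded \<Omega> \<and> open \<Omega> \<and> connected \<Omega> \<and> \<Omega> \<noteq> {} \<and> interior (closure \<Omega>) = \<Omega> \<and>
     q \<noteq> 0 \<and> coprime p q \<and> degree p < degree q \<and> {z. poly q z = 0} \<subseteq> \<Omega> \<and>
     (\<forall>f. f holomorphic_on \<Omega> \<and> continuous_on (closure \<Omega>) f \<longrightarrow>
        (f has_integral
           (pi * (\<Sum>a\<in>{z. poly q z = 0}. residue (\<lambda>z. f z * (poly p z / poly q z)) a))) \<Omega>)"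

text \<open>Unbounded quadrature domain; \<Omega> here denotes the finite part (the domain minus
  \<infinity>) of a domain in the Riemann sphere containing \<infinity>. Poles of r = p/q at finite
  points are zeros of q (must lie in \<Omega>); a pole at \<infinity> (deg p > deg q) is allowed.
  Test functions are analytic in \<Omega>, continuous up to the boundary and analytic at \<infinity>
  with value 0 there. The area integral is the principal value over \<Omega> \<inter> D(0,R), R\<rightarrow>\<infinity>.
  By the residue theorem on \<Omega> \<inter> D(0,R0), the boundary integral (1/2i)\<ointegral>_{\<partial>\<Omega>} f r dz
  equals \<pi> \<Sum> Res(f r, finite poles) - (1/2i)\<ointegral>_{|z|=R0} f r dz for every R0 large.\<close>
definition UQD_with :: "complex set \<Rightarrow> complex poly \<Rightarrow> complex poly \<Rightarrow> bool" where
  "UQD_with \<Omega> p q \<longleftrightarrow>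
     open \<Omega> \<and> connected \<Omega> \<and> bounded (- \<Omega>) \<and> interior (closure \<Omega>) = \<Omega> \<and>
     q \<noteq> 0 \<and> coprime p q \<and> {z. poly q z = 0} \<subseteq> \<Omega> \<and>
     (\<forall>f. f holomorphic_on \<Omega> \<and> continuous_on (closure \<Omega>) f \<and>
          (\<exists>e>0. \<exists>g. g holomorphic_on ball 0 e \<and> g 0 = 0 \<and>
              (\<forall>w\<in>ball 0 e - {0}. inverse w \<in> \<Omega> \<longrightarrow> g w = f (inverse w)))
        \<longrightarrow> (\<forall>R0>0. - \<Omega> \<union> {z. poly q z = 0} \<subseteq> ball 0 R0 \<longrightarrow>
              ((\<lambda>R. integral (\<Omega> \<inter> ball 0 R) f) \<longlongrightarrow>
                 pi * (\<Sum>a\<in>{z. poly q z = 0}. residue (\<lambda>z. f z * (poly p z / poly q z)) a)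
                 - contour_integral (circlepath 0 R0) (\<lambda>z. f z * (poly p z / poly q z)) / (2 * \<i>))
              at_top))"

definition extreme_BQD :: "complex set \<Rightarrow> nat \<Rightarrow> bool" where
  "extreme_BQD \<Omega> d \<longleftrightarrow> simply_connected \<Omega> \<and>
     (\<exists>p q. BQD_with \<Omega> p q \<and> max (degree p) (degree q) = d \<and> {z. poly q z = 0} = {0}) \<and>
     finite {z. boundary_cusp \<Omega> z} \<and> card {z. boundary_cusp \<Omega> z} = d - 1 \<and>
     finite {z. boundary_double_point \<Omega> z} \<and> card {z. boundary_double_point \<Omega> z} = d - 2"

text \<open>Extreme UQD of order d: \<Omega> \<union> {\<infinity>} simply connected (expressed via the Moebius chart
  z \<mapsto> 1/(z-a), a \<notin> \<Omega>, sending \<infinity> to 0), order deg r = max(deg p, deg q) = d,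
  \<infinity> is the only node (no finite poles, pole at \<infinity>), d+1 cusps and d-2 double points.\<close>
definition extreme_UQD :: "complex set \<Rightarrow> nat \<Rightarrow> bool" where
  "extreme_UQD \<Omega> d \<longleftrightarrow>
     (\<exists>a. a \<notin> \<Omega> \<and> simply_connected (insert 0 ((\<lambda>z. inverse (z - a)) ` \<Omega>))) \<and>
     (\<exists>p q. UQD_with \<Omega> p q \<and> max (degree p) (degree q) = d \<and>
            {z. poly q z = 0} = {} \<and> degree p > degree q) \<and>
     finite {z. boundary_cusp \<Omega> z} \<and> card {z. boundary_cusp \<Omega> z} = d + 1 \<and>
     finite {z. boundary_double_point \<Omega> z} \<and> card {z. boundary_double_point \<Omega> z} = d - 2"

end

theory Submission
  imports Defs "HOL-Computational_Algebra.Fundamental_Theorem_Algebra"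
begin

text \<open>Put \<kappa> = 0 in the bounded and \<kappa> = 1 in the unbounded case. The domain is the image of the (punctured) unit
  disc under a univalent map g(z) = p(z) - \<kappa>/z, where p is a polynomial of degree d and z g'(z) is self-reciprocal
  up to a power of z. On the circle z g'(z) is then a real factor times exp (i N t / 2), so all d + 2 \<kappa> - 1 critical
  points of g lie on the circle, where they are simple and become the cusps, and a double point of the boundary is a
  tangency of two arcs whose parameters differ by a multiple of 2 pi / N.

  By the Jordan curve theorem the tangencies form a laminar system of parameter intervals. Their lengths are multiples
  of 2 pi / N and their endpoints are distinct, so a generic coset of the lattice of step 2 pi / N meets their union in at
  least as many points as there are intervals. It has N points on the circle, and 1 (unbounded case) or 3 (bounded
  case, by supporting lines) of them can be kept outside the union, which leaves at most d - 2 tangencies.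
  Conversely, the univalent maps of this form are parametrised by a compact subset of the space of d - 2 real parameters.
  At a point of it of maximal Euclidean norm there are at least d - 2 tangencies: with fewer of them the linear
  conditions that a perturbation h has no normal displacement at any tangency have a nonzero solution h; then
  g + \<epsilon> h stays univalent for all small \<epsilon> of either sign, and one sign increases the norm.

  The quadrature identity follows by integrating over circles |z| = r: there the conjugate of z g'(z) is a Laurent
  polynomial in z, so that the integral is a finite combination of Taylor coefficients of f at the node.\<close>

text \<open>What makes both bounds meet is a coincidence of dimensions: N = d + 1 - 2\<kappa>, so N
  - 3 in the bounded and N - 1 in the unbounded case both equal d - 2, the number of free real
  coefficients. The self-reciprocal form fixes the tangent direction at parameter t, up to sign,
  independently of the coefficients. A small perturbation in the family keeps the simple critical
  points on the circle, so cusps survive, and two tangent arcs keep parallel tangents at the same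
  two parameters. Both arcs curve away from their tangents, so whether they cross is decided by the
  relative displacement along the normal, which is linear in the perturbation; hence first-order
  conditions give univalence for both signs of \<epsilon>. The norm serves only as a strictly convex
  function, never maximal in the middle of a segment. A separate obstacle is the literal wording of
  the boundary definitions: a figure-eight is the injective image of an open interval, so its double
  point can satisfy the formal definition of a cusp. It is excluded because the curve has a genuine
  cusp elsewhere, through which no regular arc passes.\<close>

section \<open>Boundary curves with a reflected tangent\<close>

text \<open>Near t the function minus its value is the n-th power of a local coordinate, so the
  upper half disc, a half plane of directions, is opened up to an angle of n * pi around the value.
  The map \<phi> is that coordinate turned so that its derivative at t is positive; it remembers
  from which direction \<alpha> a preimage came, which the value alone forgets once the opening
  exceeds a full turn.\<close>

lemma half_plane_cover:
  fixes f :: "complex \<Rightarrow> complex" and t :: real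
  assumes hol: "f holomorphic_on S" and S: "open S" "of_real t \<in> S" and n: "0 < n"
    and nz: "(deriv ^^ n) f (of_real t) \<noteq> 0"
    and z: "\<And>i. 0 < i \<Longrightarrow> i < n \<Longrightarrow> (deriv ^^ i) f (of_real t) = 0"
  obtains \<phi> :: "complex \<Rightarrow> complex" and c :: complex where "norm c = 1" "n = 1 \<Longrightarrow> c = sgn (deriv f (of_real t))"
    "\<And>\<alpha> r. 0 < \<alpha> \<Longrightarrow> \<alpha> < pi \<Longrightarrow> 0 < r \<Longrightarrow>
      \<exists>\<delta>>0. \<forall>\<rho>. 0 < \<rho> \<and> \<rho> < \<delta> \<longrightarrow> (\<exists>\<zeta>\<in>ball (of_real t) r. Im \<zeta> > 0 \<and>
         f \<zeta> = f (of_real t) + of_real \<rho> * cis (n * \<alpha>) * c \<and> \<phi> \<zeta> = of_real (root n \<rho>) * cis \<alpha>)"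
proof -
  let ?t = "complex_of_real t"
  obtain g r0 where r0: "0 < r0" and holg: "g holomorphic_on ball ?t r0"
    and feq: "\<And>w. w \<in> ball ?t r0 \<Longrightarrow> f w - f ?t = ((w - ?t) * g w) ^ n"
    and gnz: "\<And>w. w \<in> ball ?t r0 \<Longrightarrow> g w \<noteq> 0"
    by (rule holomorphic_factor_order_of_zero_strong[OF hol S n nz z]) (assumption | rule that)+
  define \<psi> where "\<psi> w = (w - ?t) * g w" for w
  define \<mu> where "\<mu> = g ?t"
  have \<mu>: "\<mu> \<noteq> 0" using gnz r0 unfolding \<mu>_def by simp
  have hol\<psi>: "\<psi> holomorphic_on ball ?t r0"
    unfolding \<psi>_def by (intro holomorphic_intros holg)
  have d\<psi>: "(\<psi> has_field_derivative \<mu>) (at ?t)"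
  proof -
    have "(g has_field_derivative deriv g ?t) (at ?t)"
      using holg r0 holomorphic_derivI by (metis open_ball centre_in_ball)
    then have "(\<psi> has_field_derivative (1 * g ?t + deriv g ?t * (?t - ?t))) (at ?t)"
      unfolding \<psi>_def by (auto intro!: derivative_eq_intros)
    then show ?thesis by (simp add: \<mu>_def)
  qed
  have "deriv \<psi> ?t \<noteq> 0" using DERIV_imp_deriv[OF d\<psi>] \<mu> by simp
  then obtain r1 where r1: "r1 > 0" "ball ?t r1 \<subseteq> ball ?t r0" "open (\<psi> ` ball ?t r1)" "inj_on \<psi> (ball ?t r1)"
    using has_complex_derivative_locally_invertible[OF hol\<psi> _ open_ball] r0 by (metis centre_in_ball)
  have "\<psi> holomorphic_on ball ?t r1" using hol\<psi> r1(2) holomorphic_on_subset by blast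
  then obtain q where q: "q holomorphic_on \<psi> ` ball ?t r1"
     "\<And>w. w \<in> ball ?t r1 \<Longrightarrow> deriv \<psi> w * deriv q (\<psi> w) = 1" "\<And>w. w \<in> ball ?t r1 \<Longrightarrow> q (\<psi> w) = w"
    using holomorphic_has_inverse[OF _ open_ball r1(4)] by metis
  have \<psi>0: "\<psi> ?t = 0" by (simp add: \<psi>_def)
  have q0: "q 0 = ?t" using q(3)[of ?t] r1 \<psi>0 by simp
  have in0: "0 \<in> \<psi> ` ball ?t r1" using \<psi>0 r1 by (metis centre_in_ball imageI)
  have "deriv q 0 = 1 / \<mu>" using q(2)[of ?t] r1 \<psi>0 DERIV_imp_deriv[OF d\<psi>] \<mu> by (simp add: field_simps)
  then have dq: "(q has_field_derivative 1 / \<mu>) (at 0)"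
    using q(1) r1(3) in0 holomorphic_derivI by fastforce
  define c where "c = (\<mu> / norm \<mu>) ^ n"
  define \<phi> where "\<phi> \<zeta> = \<psi> \<zeta> * norm \<mu> / \<mu>" for \<zeta>
  show ?thesis
  proof (rule that[of c \<phi>])
    show "norm c = 1" using \<mu> by (simp add: c_def norm_power norm_divide)
    show "c = sgn (deriv f ?t)" if "n = 1"
    proof -
      have "((\<lambda>w. f ?t + \<psi> w) has_field_derivative \<mu>) (at ?t)"
        using d\<psi> by (auto intro!: derivative_eq_intros)
      then have "(f has_field_derivative \<mu>) (at ?t)"
      proof (rule has_field_derivative_transform_within[OF _ r0])
        fix w assume "dist w ?t < r0"
        then show "f ?t + \<psi> w = f w" using feq[of w] that by (simp add: \<psi>_def dist_commute algebra_simps)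
      qed simp
      then show ?thesis using that by (simp add: DERIV_imp_deriv c_def sgn_eq)
    qed
    fix \<alpha> r :: real assume \<alpha>: "0 < \<alpha>" "\<alpha> < pi" and r: "0 < r"
    have s\<alpha>: "sin \<alpha> > 0" using \<alpha> by (simp add: sin_gt_zero)
    \<comment> \<open>Half the height that the linear part gives per unit of s: the linearisation
      error then cannot push \<zeta> out of the upper half plane.\<close>
    define e where "e = sin \<alpha> / (2 * norm \<mu>)"
    have e: "e > 0" using s\<alpha> \<mu> by (simp add: e_def)
    obtain d1 where d1: "d1 > 0" "\<And>u. norm u < d1 \<Longrightarrow> norm (q u - q 0 - u / \<mu>) \<le> e * norm u"
      using dq e unfolding has_field_derivative_def has_derivative_at_alt
      by (auto simp: mult.commute divide_inverse)
    obtain d2 where d2: "d2 > 0" "ball 0 d2 \<subseteq> \<psi> ` ball ?t r1" using r1(3) in0 openE by blast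
    define M where "M = 1 / norm \<mu> + e"
    have M: "M > 0" using e by (simp add: M_def add_nonneg_pos)
    define s0 where "s0 = min (min d1 d2) (r / M)"
    have s0: "s0 > 0" using d1 d2 r M by (simp add: s0_def)
    have main: "\<exists>\<zeta>\<in>ball ?t r. Im \<zeta> > 0 \<and> f \<zeta> = f ?t + of_real \<rho> * cis (n * \<alpha>) * c \<and> \<phi> \<zeta> = of_real (root n \<rho>) * cis \<alpha>"
      if \<rho>: "0 < \<rho>" "\<rho> < s0 ^ n" for \<rho>
    proof -
      define s where "s = root n \<rho>"
      have s: "0 < s" "s < s0" "s ^ n = \<rho>"
      proof -
        show "0 < s" using \<rho> n by (simp add: s_def)
        show sn: "s ^ n = \<rho>" using \<rho> n by (simp add: s_def)
        show "s < s0" using \<rho> sn s0 by (metis less_eq_real_def power_less_imp_less_base)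
      qed
      define u where "u = of_real s * cis \<alpha> * \<mu> / norm \<mu>"
      have nu: "norm u = s" using s \<mu> by (simp add: u_def norm_mult norm_divide)
      have ud: "u / \<mu> = of_real (s / norm \<mu>) * cis \<alpha>" using \<mu> by (simp add: u_def)
      define \<zeta> where "\<zeta> = q u"
      have uim: "u \<in> \<psi> ` ball ?t r1" using d2 nu s by (auto simp: s0_def)
      then obtain w where w: "w \<in> ball ?t r1" "u = \<psi> w" by blast
      have \<zeta>w: "\<zeta> = w" using w q(3) by (simp add: \<zeta>_def)
      have err: "norm (\<zeta> - ?t - u / \<mu>) \<le> e * s" using d1(2)[of u] nu s q0 by (simp add: \<zeta>_def s0_def)
      have "norm (\<zeta> - ?t) \<le> norm (u / \<mu>) + e * s"
        using err norm_triangle_sub[of "\<zeta> - ?t" "u/\<mu>"] by linarith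
      also have "\<dots> = M * s" using nu by (simp add: M_def norm_divide algebra_simps)
      also have "\<dots> < r" using s M by (simp add: s0_def field_simps)
      finally have "\<zeta> \<in> ball ?t r" by (simp add: dist_norm norm_minus_commute)
      moreover have "Im \<zeta> > 0"
      proof -
        have "Im (\<zeta> - ?t - u / \<mu>) \<ge> - (e * s)" using err abs_Im_le_cmod[of "\<zeta> - ?t - u / \<mu>"] by linarith
        moreover have "Im (u / \<mu>) = 2 * (e * s)" using ud by (simp add: e_def)
        moreover have "e * s > 0" using e s by simp
        ultimately show ?thesis by simp
      qed
      moreover have "f \<zeta> = f ?t + of_real \<rho> * cis (n * \<alpha>) * c"
      proof -
        have "f \<zeta> - f ?t = u ^ n" using feq[of w] w r1(2) \<zeta>w by (auto simp: \<psi>_def)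
        also have "\<dots> = of_real (s ^ n) * cis \<alpha> ^ n * c" by (simp add: u_def c_def power_mult_distrib power_divide)
        finally have "f \<zeta> = f ?t + of_real \<rho> * cis \<alpha> ^ n * c" using s(3) by (simp add: diff_eq_eq add.commute)
        then show ?thesis by (simp only: Complex.DeMoivre)
      qed
      moreover have "\<phi> \<zeta> = of_real (root n \<rho>) * cis \<alpha>"
        using w \<zeta>w \<mu> by (simp add: \<phi>_def flip: s_def) (simp add: u_def flip: w(2))
      ultimately show ?thesis by blast
    qed
    then show "\<exists>\<delta>>0. \<forall>\<rho>. 0 < \<rho> \<and> \<rho> < \<delta> \<longrightarrow> (\<exists>\<zeta>\<in>ball ?t r. Im \<zeta> > 0 \<and>
         f \<zeta> = f ?t + of_real \<rho> * cis (n * \<alpha>) * c \<and> \<phi> \<zeta> = of_real (root n \<rho>) * cis \<alpha>)"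
      using s0 by (metis zero_less_power)
  qed
qed

definition punctured_disc :: "nat \<Rightarrow> complex set" where
  "punctured_disc \<kappa> = {z. norm z < 1 \<and> (\<kappa> = 0 \<or> z \<noteq> 0)}"

lemma open_punctured_disc [simp]: "open (punctured_disc \<kappa>)"
proof -
  have "punctured_disc \<kappa> = (if \<kappa> = 0 then ball 0 1 else ball 0 1 - {0})"
    by (auto simp: punctured_disc_def)
  then show ?thesis by (simp add: open_delete)
qed

lemma connected_punctured_disc: "connected (punctured_disc \<kappa>)"
proof -
  have "punctured_disc \<kappa> = (if \<kappa> = 0 then ball 0 1 else ball 0 1 - {0})"
    by (auto simp: punctured_disc_def)
  then show ?thesis by (simp add: connected_punctured_ball)
qed

text \<open>\<open>real_tangent\<close> says that z g'(z), for g(z) = p(z) - \<kappa> / z, is a real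
  number times exp (i N t / 2) at z = exp (i t). The direction of the boundary curve is thus known
  up to sign from t alone, and at regular points parallel tangents occur exactly at parameters that
  differ by multiples of 2 pi / N.\<close>

locale reflected_curve =
  fixes \<kappa> N :: nat and p :: "complex \<Rightarrow> complex"
  assumes kappa: "\<kappa> \<le> 1" and N_pos: "N > 0" and p_hol: "p holomorphic_on UNIV"
    and real_tangent: "\<And>t::real. Im (exp (- (\<i> * N * t / 2)) *
          (exp (\<i> * t) * deriv p (exp (\<i> * t)) + \<kappa> * exp (- (\<i> * t)))) = 0"
begin

text \<open>In the coordinate z = exp (i \<zeta>) the circle becomes the real line and the inside of
  the disc the upper half plane. \<open>F\<close> is the entire function that continues the real
  factor of the tangent.\<close>

definition g :: "complex \<Rightarrow> complex" where "g z = p z - of_nat \<kappa> / z"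
definition G :: "complex \<Rightarrow> complex" where "G \<zeta> = g (exp (\<i> * \<zeta>))"
definition F :: "complex \<Rightarrow> complex" where
  "F \<zeta> = exp (- (\<i> * N * \<zeta> / 2)) * (exp (\<i> * \<zeta>) * deriv p (exp (\<i> * \<zeta>)) + \<kappa> * exp (- (\<i> * \<zeta>)))"

abbreviation D where "D \<equiv> punctured_disc \<kappa>"

lemma p_deriv: "(p has_field_derivative deriv p z) (at z)"
  using p_hol holomorphic_derivI by blast

lemma g_deriv:
  assumes "\<kappa> = 0 \<or> z \<noteq> 0"
  shows "(g has_field_derivative deriv p z + of_nat \<kappa> / z^2) (at z)"
proof (cases "\<kappa> = 0")
  case True
  have "g z = p z" for z unfolding g_def using True by simp
  then have "g = p" by blast
  then show ?thesis using True p_deriv by simp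
next
  case False
  then show ?thesis unfolding g_def using assms p_deriv
    by (auto intro!: derivative_eq_intros simp: power2_eq_square)
qed

lemma g_isCont: "\<kappa> = 0 \<or> z \<noteq> 0 \<Longrightarrow> isCont g z"
  using g_deriv DERIV_isCont by blast

lemma g_hol: "g holomorphic_on {z. \<kappa> = 0 \<or> z \<noteq> 0}"
proof -
  have "open {z::complex. \<kappa> = 0 \<or> z \<noteq> 0}"
    by (cases "\<kappa> = 0") (auto simp: Collect_neg_eq intro: open_Compl)
  then show ?thesis using g_deriv by (auto simp: holomorphic_on_open)
qed

lemma g_hol_D: "g holomorphic_on D"
  by (rule holomorphic_on_subset[OF g_hol]) (auto simp: punctured_disc_def)

lemma G_eq: "G \<zeta> = p (exp (\<i> * \<zeta>)) - of_nat \<kappa> * exp (- (\<i> * \<zeta>))"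
  by (simp add: G_def g_def exp_minus field_simps)

lemma G_deriv: "(G has_field_derivative \<i> * exp (\<i> * of_nat N * \<zeta> / 2) * F \<zeta>) (at \<zeta>)"
proof -
  have "((\<lambda>\<zeta>. p (exp (\<i> * \<zeta>)) - of_nat \<kappa> * exp (- (\<i> * \<zeta>))) has_field_derivative
     deriv p (exp (\<i> * \<zeta>)) * (exp (\<i> * \<zeta>) * \<i>) - of_nat \<kappa> * (exp (- (\<i> * \<zeta>)) * (- \<i>))) (at \<zeta>)"
    by (auto intro!: derivative_eq_intros DERIV_chain'[OF _ p_deriv])
  moreover have "deriv p (exp (\<i> * \<zeta>)) * (exp (\<i> * \<zeta>) * \<i>) - of_nat \<kappa> * (exp (- (\<i> * \<zeta>)) * (- \<i>))
      = \<i> * (exp (\<i> * of_nat N * \<zeta> / 2) * exp (- (\<i> * of_nat N * \<zeta> / 2))) *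
         (exp (\<i> * \<zeta>) * deriv p (exp (\<i> * \<zeta>)) + of_nat \<kappa> * exp (- (\<i> * \<zeta>)))"
    by (simp add: exp_minus field_simps)
  ultimately show ?thesis unfolding F_def
    by (simp add: G_eq[abs_def] mult.assoc)
qed

lemma F_hol: "F holomorphic_on UNIV"
proof -
  have "deriv p holomorphic_on UNIV" using p_hol holomorphic_deriv by blast
  then have "(\<lambda>\<zeta>. deriv p (exp (\<i> * \<zeta>))) holomorphic_on UNIV"
    using holomorphic_on_compose_gen[of "\<lambda>\<zeta>. exp (\<i> * \<zeta>)" UNIV "deriv p" UNIV]
    by (auto simp: o_def intro!: holomorphic_intros)
  then show ?thesis unfolding F_def by (intro holomorphic_intros) auto
qed

lemma G_hol: "G holomorphic_on UNIV"
  using G_deriv by (auto simp: holomorphic_on_open)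

lemma F_deriv: "(F has_field_derivative deriv F \<zeta>) (at \<zeta>)"
  using F_hol holomorphic_derivI by blast

lemma F_isCont [continuous_intros]: "isCont F \<zeta>" using F_deriv DERIV_isCont by blast
lemma G_isCont: "isCont G \<zeta>" using G_deriv DERIV_isCont by blast

definition f :: "real \<Rightarrow> real" where "f t = Re (F (of_real t))"

lemma F_of_real: "F (of_real t) = of_real (f t)"
  using real_tangent[of t] by (simp add: f_def F_def complex_eq_iff)

text \<open>The outward unit normal: the boundary runs in direction i * \<open>T\<close> with the
  domain on its left. At a zero of \<open>f\<close> it is 0, because sgn 0 = 0.\<close>

definition T :: "real \<Rightarrow> complex" where "T t = cis (real N * t / 2) * of_real (sgn (f t))"

lemma sgn_deriv_G: "sgn (deriv G (of_real t)) = \<i> * T t"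
proof -
  have "deriv G (of_real t) = \<i> * cis (real N * t / 2) * of_real (f t)"
    using DERIV_imp_deriv[OF G_deriv, of "of_real t"] by (simp add: F_of_real cis_conv_exp mult.assoc)
  then show ?thesis by (simp add: T_def sgn_mult sgn_of_real) (simp add: sgn_eq)
qed

lemma f_zero_iff: "f t = 0 \<longleftrightarrow> deriv p (cis t) + of_nat \<kappa> / (cis t)^2 = 0"
proof -
  have "F (of_real t) = exp (- (\<i> * N * t / 2)) * cis t * (deriv p (cis t) + of_nat \<kappa> / (cis t)^2)"
    by (simp add: F_def cis_conv_exp exp_minus field_simps power2_eq_square)
  moreover have "F (of_real t) = 0 \<longleftrightarrow> f t = 0" by (simp add: F_of_real)
  ultimately show ?thesis by auto
qed

end

lemma exp_i_inj_near:
  assumes "exp (\<i> * \<zeta>) = exp (\<i> * \<omega>)" "dist \<zeta> \<omega> < 2 * pi" shows "\<zeta> = \<omega>"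
proof -
  obtain k :: int where k: "\<i> * \<zeta> = \<i> * \<omega> + of_int (2 * k) * pi * \<i>" using assms(1) by (auto simp: exp_eq)
  then have "\<i> * \<zeta> = \<i> * (\<omega> + of_int (2 * k) * pi)" by (simp add: algebra_simps)
  then have e: "\<zeta> = \<omega> + of_int (2 * k) * pi" by (simp only: mult_cancel_left) simp
  then have "norm (complex_of_real (of_int (2 * k) * pi)) < 2 * pi" using assms(2) by (simp add: dist_norm)
  then have "\<bar>2 * of_int k * pi\<bar> < 2 * pi" unfolding norm_of_real by simp
  then have "\<bar>of_int k\<bar> < (1::real)" by (simp add: abs_mult)
  then have "k = 0" by linarith
  then show ?thesis using e by simp
qed

locale univalent_curve = reflected_curve +
  assumes inj: "inj_on g D"
begin

lemma g_regular:
  assumes "z \<in> D" shows "deriv p z + of_nat \<kappa> / z^2 \<noteq> 0"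
proof -
  have "\<kappa> = 0 \<or> z \<noteq> 0" using assms by (simp add: punctured_disc_def)
  then have "deriv g z = deriv p z + of_nat \<kappa> / z^2" by (intro DERIV_imp_deriv g_deriv)
  then show ?thesis using holomorphic_injective_imp_regular[OF g_hol_D open_punctured_disc inj assms] by simp
qed

text \<open>By the open mapping theorem the values near \<open>g w\<close> would all be taken near
  z, but they are also taken at points of the disc near w.\<close>

lemma g_interior_boundary:
  assumes z: "z \<in> D" and w: "norm w = 1"
  shows "g z \<noteq> g w"
proof
  assume eq: "g z = g w"
  have zw: "z \<noteq> w" using z w by (auto simp: punctured_disc_def)
  obtain e where e: "e > 0" "ball z e \<subseteq> D"
    using z open_punctured_disc openE by blast
  \<comment> \<open>The bound by half the distance keeps this ball away from w.\<close>
  define e' where "e' = min e (dist z w / 2)"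
  have e': "e' > 0" "ball z e' \<subseteq> D" using e zw by (auto simp: e'_def)
  have op: "open (g ` ball z e')"
    using open_mapping_thm3[of g "ball z e'"] g_hol_D inj e'
    by (meson holomorphic_on_subset inj_on_subset open_ball)
  have "g w \<in> g ` ball z e'" using eq e' by (metis centre_in_ball imageI)
  moreover have "isCont g w" using g_isCont[of w] w by (cases "w = 0") auto
  ultimately have "\<forall>\<^sub>F v in nhds w. g v \<in> g ` ball z e'"
    using op by (auto simp: isCont_def tendsto_at_iff_tendsto_nhds dest: topological_tendstoD)
  then obtain d where d: "d > 0" "\<And>v. dist v w < d \<Longrightarrow> g v \<in> g ` ball z e'"
    by (auto simp: eventually_nhds_metric)
  define s where "s = min (1/2) (min (d/2) (e'/2))"
  have s: "s > 0" "s \<le> 1/2" "s < d" "s < e'" using d e' by (auto simp: s_def)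
  define v where "v = of_real (1 - s) * w"
  have "norm v = 1 - s" using s w by (simp only: v_def norm_mult norm_of_real) simp
  then have vD: "v \<in> D" using s by (auto simp: punctured_disc_def)
  have dvw: "dist v w = s"
  proof -
    have "v - w = - (of_real s * w)" by (simp add: v_def algebra_simps)
    then show ?thesis using s w by (simp add: dist_norm norm_mult)
  qed
  then obtain u where u: "u \<in> ball z e'" "g v = g u" using d(2)[of v] s by (metis imageE)
  then have "v = u" using inj vD e' by (meson inj_on_def subsetD)
  then have "dist z v < e'" using u by simp
  moreover have "dist z w \<ge> 2 * e'" by (simp add: e'_def)
  moreover have "dist z w \<le> dist z v + dist v w" by (rule dist_triangle)
  ultimately show False using dvw s by linarith
qed

lemma exp_i_D: "Im \<zeta> > 0 \<Longrightarrow> exp (\<i> * \<zeta>) \<in> D"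
  by (auto simp: punctured_disc_def norm_exp_eq_Re)

lemma G_inj: "\<lbrakk>Im \<zeta> > 0; Im \<omega> > 0; G \<zeta> = G \<omega>\<rbrakk> \<Longrightarrow> exp (\<i> * \<zeta>) = exp (\<i> * \<omega>)"
  using inj exp_i_D by (auto simp: G_def inj_on_def)

lemma G_not_constant: "\<not> (\<forall>\<zeta>. G \<zeta> = c)"
proof
  assume "\<forall>\<zeta>. G \<zeta> = c"
  then have "exp (\<i> * \<i>) = exp (\<i> * (2 * \<i>))" by (intro G_inj) auto
  then have "norm (exp (\<i> * \<i>)) = norm (exp (\<i> * (2 * \<i>)))" by simp
  then have "exp (-1::real) = exp (-2)" by (simp add: norm_exp_eq_Re)
  then show False by simp
qed

lemma ex_order:
  obtains n where "0 < n" "(deriv ^^ n) G (of_real t) \<noteq> 0"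
    "\<And>i. 0 < i \<Longrightarrow> i < n \<Longrightarrow> (deriv ^^ i) G (of_real t) = 0"
proof -
  have "\<exists>n. 0 < n \<and> (deriv ^^ n) G (of_real t) \<noteq> 0"
  proof (rule ccontr)
    assume "\<not> ?thesis"
    then have z: "\<And>n. 0 < n \<Longrightarrow> (deriv ^^ n) G (of_real t) = 0" by blast
    then have "G w = G (of_real t)" for w
      using holomorphic_fun_eq_const_on_connected[OF G_hol open_UNIV _ z] by auto
    then show False using G_not_constant by blast
  qed
  then have "\<exists>n. (0 < n \<and> (deriv ^^ n) G (of_real t) \<noteq> 0) \<and> (\<forall>i<n. \<not> (0 < i \<and> (deriv ^^ i) G (of_real t) \<noteq> 0))"
    by (rule exists_least_iff[THEN iffD1])
  then show ?thesis using that by blast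
qed

text \<open>Univalence forbids an opening of more than a full turn, so the order n is at most 2:
  order 1 at regular points, where the domain fills a half plane of directions, and order 2 at
  cusps, where it fills all directions but one.\<close>

lemma boundary_cover:
  obtains n :: nat and \<phi> c where "n = 1 \<or> n = 2" "norm c = 1"
     "n = 1 \<Longrightarrow> f t \<noteq> 0" "n = 1 \<Longrightarrow> c = \<i> * T t" "n = 2 \<Longrightarrow> f t = 0" "n = 2 \<Longrightarrow> deriv F (of_real t) \<noteq> 0"
    "\<And>\<alpha> r. 0 < \<alpha> \<Longrightarrow> \<alpha> < pi \<Longrightarrow> 0 < r \<Longrightarrow>
      \<exists>\<delta>>0. \<forall>\<rho>. 0 < \<rho> \<and> \<rho> < \<delta> \<longrightarrow> (\<exists>\<zeta>\<in>ball (of_real t) r. Im \<zeta> > 0 \<and>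
         G \<zeta> = G (of_real t) + of_real \<rho> * cis (of_nat n * \<alpha>) * c \<and> \<phi> \<zeta> = of_real (root n \<rho>) * cis \<alpha>)"
proof -
  let ?t = "complex_of_real t"
  obtain n where n: "0 < n" "(deriv ^^ n) G ?t \<noteq> 0" "\<And>i. 0 < i \<Longrightarrow> i < n \<Longrightarrow> (deriv ^^ i) G ?t = 0"
    using ex_order by metis
  obtain \<phi> c where c: "norm c = 1" "n = 1 \<Longrightarrow> c = sgn (deriv G ?t)"
    and cov: "\<And>\<alpha> r. 0 < \<alpha> \<Longrightarrow> \<alpha> < pi \<Longrightarrow> 0 < r \<Longrightarrow>
      \<exists>\<delta>>0. \<forall>\<rho>. 0 < \<rho> \<and> \<rho> < \<delta> \<longrightarrow> (\<exists>\<zeta>\<in>ball ?t r. Im \<zeta> > 0 \<and>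
         G \<zeta> = G ?t + of_real \<rho> * cis (of_nat n * \<alpha>) * c \<and> \<phi> \<zeta> = of_real (root n \<rho>) * cis \<alpha>)"
    by (rule half_plane_cover[OF G_hol open_UNIV UNIV_I n(1) n(2) n(3)]) (assumption | rule that)+
  have dG: "deriv G = (\<lambda>\<zeta>. \<i> * exp (\<i> * of_nat N * \<zeta> / 2) * F \<zeta>)"
    using G_deriv DERIV_imp_deriv by blast
  have d2: "(deriv G has_field_derivative \<i> * exp (\<i> * of_nat N * ?t / 2) * (\<i> * of_nat N / 2) * F ?t
       + \<i> * exp (\<i> * of_nat N * ?t / 2) * deriv F ?t) (at ?t)"
  proof -
    have "((\<lambda>\<zeta>. \<i> * exp (\<i> * of_nat N * \<zeta> / 2)) has_field_derivative
        \<i> * (exp (\<i> * of_nat N * ?t / 2) * (\<i> * of_nat N / 2))) (at ?t)"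
      by (auto intro!: derivative_eq_intros) (simp add: complex_eq_iff)
    from DERIV_mult[OF this F_deriv[of ?t]] show ?thesis unfolding dG by (simp add: algebra_simps)
  qed
  have "\<not> n \<ge> 3"
  proof
    assume n3: "n \<ge> 3"
    \<comment> \<open>Chosen so that \<alpha> and pi - \<alpha> differ by 2 pi / n: both rays have
      the same image direction, while the coordinate \<phi> sees cosines of opposite sign.\<close>
    define \<alpha> where "\<alpha> = (pi - 2 * pi / n) / 2"
    have "2 * pi / n < pi" using n3 by (simp add: field_simps)
    moreover have "2 * pi / n > 0" using n3 by simp
    ultimately have \<alpha>: "0 < \<alpha>" "\<alpha> < pi / 2" by (auto simp: \<alpha>_def)
    obtain \<delta>1 where \<delta>1: "\<delta>1 > 0" "\<And>\<rho>. 0 < \<rho> \<and> \<rho> < \<delta>1 \<Longrightarrow> (\<exists>\<zeta>\<in>ball ?t 1. Im \<zeta> > 0 \<and>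
         G \<zeta> = G ?t + of_real \<rho> * cis (of_nat n * \<alpha>) * c \<and> \<phi> \<zeta> = of_real (root n \<rho>) * cis \<alpha>)"
      using cov[of \<alpha> 1] \<alpha> by auto
    obtain \<delta>2 where \<delta>2: "\<delta>2 > 0" "\<And>\<rho>. 0 < \<rho> \<and> \<rho> < \<delta>2 \<Longrightarrow> (\<exists>\<zeta>\<in>ball ?t 1. Im \<zeta> > 0 \<and>
         G \<zeta> = G ?t + of_real \<rho> * cis (of_nat n * (pi - \<alpha>)) * c \<and> \<phi> \<zeta> = of_real (root n \<rho>) * cis (pi - \<alpha>))"
      using cov[of "pi - \<alpha>" 1] \<alpha> by auto
    define \<rho> where "\<rho> = min \<delta>1 \<delta>2 / 2"
    have \<rho>: "0 < \<rho>" "\<rho> < \<delta>1" "\<rho> < \<delta>2" using \<delta>1 \<delta>2 by (auto simp: \<rho>_def)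
    obtain \<zeta>1 where \<zeta>1: "\<zeta>1 \<in> ball ?t 1" "Im \<zeta>1 > 0" "G \<zeta>1 = G ?t + of_real \<rho> * cis (of_nat n * \<alpha>) * c"
        "\<phi> \<zeta>1 = of_real (root n \<rho>) * cis \<alpha>" using \<delta>1(2) \<rho> by blast
    obtain \<zeta>2 where \<zeta>2: "\<zeta>2 \<in> ball ?t 1" "Im \<zeta>2 > 0" "G \<zeta>2 = G ?t + of_real \<rho> * cis (of_nat n * (pi - \<alpha>)) * c"
        "\<phi> \<zeta>2 = of_real (root n \<rho>) * cis (pi - \<alpha>)" using \<delta>2(2) \<rho> by blast
    have "of_nat n * (pi - \<alpha>) = of_nat n * \<alpha> + 2 * pi" using n3 by (simp add: \<alpha>_def field_simps)
    then have "cis (of_nat n * (pi - \<alpha>)) = cis (of_nat n * \<alpha>)" by (metis cis_2pi cis_mult mult.right_neutral)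
    then have "G \<zeta>1 = G \<zeta>2" using \<zeta>1 \<zeta>2 by simp
    then have "exp (\<i> * \<zeta>1) = exp (\<i> * \<zeta>2)" using G_inj \<zeta>1 \<zeta>2 by blast
    moreover have "dist \<zeta>1 \<zeta>2 < 2 * pi"
      using \<zeta>1(1) \<zeta>2(1) dist_triangle2[of \<zeta>1 \<zeta>2 ?t] pi_gt3 by (simp add: dist_commute)
    ultimately have "\<zeta>1 = \<zeta>2" by (rule exp_i_inj_near)
    then have "cis \<alpha> = cis (pi - \<alpha>)" using \<zeta>1 \<zeta>2 \<rho> n by simp
    then have "cos \<alpha> = - cos \<alpha>" by (simp add: complex_eq_iff)
    moreover have "cos \<alpha> > 0" using \<alpha> by (intro cos_gt_zero_pi) auto
    ultimately show False by simp
  qed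
  then have n12: "n = 1 \<or> n = 2" using n(1) by linarith
  show ?thesis
  proof (rule that[of n c \<phi>, OF n12 c(1)])
    show "f t \<noteq> 0" if "n = 1" using n(2) that dG by (auto simp: F_of_real)
    show "c = \<i> * T t" if "n = 1" using c(2) that sgn_deriv_G by simp
    show f0: "f t = 0" if "n = 2" using n(3)[of 1] that by (auto simp: dG F_of_real)
    show "deriv F ?t \<noteq> 0" if "n = 2"
    proof
      assume "deriv F ?t = 0"
      then have "deriv (deriv G) ?t = 0" using DERIV_imp_deriv[OF d2] f0[OF that] by (simp add: F_of_real)
      then show False using n(2) that by (simp add: numeral_2_eq_2)
    qed
  qed (use cov in blast)
qed

lemma simple_zero: "f t = 0 \<Longrightarrow> deriv F (of_real t) \<noteq> 0"
  by (rule boundary_cover[of t]) auto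

lemma exp_i_separate:
  assumes "exp (\<i> * \<zeta>) \<noteq> exp (\<i> * \<omega>)"
  obtains r where "r > 0" "\<And>x y. x \<in> ball \<zeta> r \<Longrightarrow> y \<in> ball \<omega> r \<Longrightarrow> exp (\<i> * x) \<noteq> exp (\<i> * y)"
proof -
  define e where "e = dist (exp (\<i> * \<zeta>)) (exp (\<i> * \<omega>)) / 2"
  have e: "e > 0" using assms by (simp add: e_def)
  have "isCont (\<lambda>x. exp (\<i> * x)) \<zeta>" "isCont (\<lambda>x. exp (\<i> * x)) \<omega>" by (intro continuous_intros)+
  then obtain r1 r2 where r: "r1 > 0" "\<And>x. dist x \<zeta> < r1 \<Longrightarrow> dist (exp (\<i> * x)) (exp (\<i> * \<zeta>)) < e"
     "r2 > 0" "\<And>x. dist x \<omega> < r2 \<Longrightarrow> dist (exp (\<i> * x)) (exp (\<i> * \<omega>)) < e"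
    using e unfolding continuous_at_eps_delta by metis
  show ?thesis
  proof (rule that[of "min r1 r2"])
    fix x y assume "x \<in> ball \<zeta> (min r1 r2)" "y \<in> ball \<omega> (min r1 r2)"
    then have "dist (exp (\<i> * x)) (exp (\<i> * \<zeta>)) < e" "dist (exp (\<i> * y)) (exp (\<i> * \<omega>)) < e"
      using r by (metis dist_commute mem_ball min_less_iff_conj)+
    moreover have "dist (exp (\<i> * \<zeta>)) (exp (\<i> * \<omega>)) = 2 * e" by (simp add: e_def)
    ultimately show "exp (\<i> * x) \<noteq> exp (\<i> * y)"
      by (metis dist_commute dist_triangle_half_l mult_2 field_sum_of_halves less_irrefl mult.commute
         nonzero_mult_div_cancel_right zero_neq_numeral)
  qed (use r in auto)
qed

definition dbl :: "real \<Rightarrow> real \<Rightarrow> bool" where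
  "dbl s t \<longleftrightarrow> G (of_real s) = G (of_real t) \<and> cis s \<noteq> cis t"

lemma dbl_sym: "dbl s t \<Longrightarrow> dbl t s" by (auto simp: dbl_def)

text \<open>The two half discs have disjoint images, so their openings n * pi and m * pi share a
  full turn: both are half planes, and they are opposite.\<close>

lemma dbl_tangent:
  assumes "dbl s t"
  shows "f s \<noteq> 0" "f t \<noteq> 0" "T s = - T t"
proof -
  let ?s = "complex_of_real s" and ?t = "complex_of_real t"
  have ne: "exp (\<i> * ?s) \<noteq> exp (\<i> * ?t)" and eq: "G ?s = G ?t"
    using assms by (auto simp: dbl_def cis_conv_exp)
  obtain r where r: "r > 0" "\<And>x y. x \<in> ball ?s r \<Longrightarrow> y \<in> ball ?t r \<Longrightarrow> exp (\<i> * x) \<noteq> exp (\<i> * y)"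
    using exp_i_separate[OF ne] by blast
  obtain n \<phi> c where n: "n = (1::nat) \<or> n = 2" "norm c = 1"
     "n = 1 \<Longrightarrow> f s \<noteq> 0" "n = 1 \<Longrightarrow> c = \<i> * T s"
    and cov: "\<And>\<alpha> r. 0 < \<alpha> \<Longrightarrow> \<alpha> < pi \<Longrightarrow> 0 < r \<Longrightarrow>
      \<exists>\<delta>>0. \<forall>\<rho>. 0 < \<rho> \<and> \<rho> < \<delta> \<longrightarrow> (\<exists>\<zeta>\<in>ball ?s r. Im \<zeta> > 0 \<and>
         G \<zeta> = G ?s + of_real \<rho> * cis (of_nat n * \<alpha>) * c \<and> \<phi> \<zeta> = of_real (root n \<rho>) * cis \<alpha>)"
    by (rule boundary_cover[of s]) (assumption | rule that)+
  obtain m \<psi> d where m: "m = (1::nat) \<or> m = 2" "norm d = 1"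
     "m = 1 \<Longrightarrow> f t \<noteq> 0" "m = 1 \<Longrightarrow> d = \<i> * T t"
    and cov': "\<And>\<alpha> r. 0 < \<alpha> \<Longrightarrow> \<alpha> < pi \<Longrightarrow> 0 < r \<Longrightarrow>
      \<exists>\<delta>>0. \<forall>\<rho>. 0 < \<rho> \<and> \<rho> < \<delta> \<longrightarrow> (\<exists>\<zeta>\<in>ball ?t r. Im \<zeta> > 0 \<and>
         G \<zeta> = G ?t + of_real \<rho> * cis (of_nat m * \<alpha>) * d \<and> \<psi> \<zeta> = of_real (root m \<rho>) * cis \<alpha>)"
    by (rule boundary_cover[of t]) (assumption | rule that)+
  \<comment> \<open>A direction common to both openings gives a common value on a short ray, at two
    different points of the disc.\<close>
  have clash: False if a: "0 < \<alpha>" "\<alpha> < pi" "0 < \<beta>" "\<beta> < pi" and e: "cis (of_nat n * \<alpha>) * c = cis (of_nat m * \<beta>) * d" for \<alpha> \<beta>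
  proof -
    obtain \<delta>1 where \<delta>1: "\<delta>1 > 0" "\<And>\<rho>. 0 < \<rho> \<and> \<rho> < \<delta>1 \<Longrightarrow> (\<exists>\<zeta>\<in>ball ?s r. Im \<zeta> > 0 \<and>
         G \<zeta> = G ?s + of_real \<rho> * cis (of_nat n * \<alpha>) * c)"
      using cov[of \<alpha> r] a r(1) by blast
    obtain \<delta>2 where \<delta>2: "\<delta>2 > 0" "\<And>\<rho>. 0 < \<rho> \<and> \<rho> < \<delta>2 \<Longrightarrow> (\<exists>\<zeta>\<in>ball ?t r. Im \<zeta> > 0 \<and>
         G \<zeta> = G ?t + of_real \<rho> * cis (of_nat m * \<beta>) * d)"
      using cov'[of \<beta> r] a r(1) by blast
    define \<rho> where "\<rho> = min \<delta>1 \<delta>2 / 2"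
    have \<rho>: "0 < \<rho>" "\<rho> < \<delta>1" "\<rho> < \<delta>2" using \<delta>1 \<delta>2 by (auto simp: \<rho>_def)
    obtain \<zeta>1 where \<zeta>1: "\<zeta>1 \<in> ball ?s r" "Im \<zeta>1 > 0" "G \<zeta>1 = G ?s + of_real \<rho> * cis (of_nat n * \<alpha>) * c"
      using \<delta>1(2) \<rho> by blast
    obtain \<zeta>2 where \<zeta>2: "\<zeta>2 \<in> ball ?t r" "Im \<zeta>2 > 0" "G \<zeta>2 = G ?t + of_real \<rho> * cis (of_nat m * \<beta>) * d"
      using \<delta>2(2) \<rho> by blast
    have "G \<zeta>1 = G \<zeta>2" using \<zeta>1 \<zeta>2 e eq by (simp add: mult.assoc)
    then have "exp (\<i> * \<zeta>1) = exp (\<i> * \<zeta>2)" using G_inj \<zeta>1 \<zeta>2 by blast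
    then show False using r(2) \<zeta>1 \<zeta>2 by blast
  qed
  have sqrt: "\<exists>\<beta>. 0 < \<beta> \<and> \<beta> < pi \<and> cis (2 * \<beta>) = u" if "norm u = 1" "u \<noteq> 1" for u
  proof -
    have u: "u = cis (Arg2pi u)" using Arg2pi_eq[of u] that by (auto simp: cis_conv_exp)
    have "Arg2pi u \<noteq> 0" using u that(2) by (metis cis_zero)
    then show ?thesis using Arg2pi[of u] u by (intro exI[of _ "Arg2pi u / 2"]) (auto simp: less_le)
  qed
  \<comment> \<open>An opening of a full turn misses only the direction d, while the other opening
    contains more than one direction; the angles pi / 2 and pi / 3 provide two of them.\<close>
  have two: "\<exists>\<alpha> \<beta>. 0 < \<alpha> \<and> \<alpha> < pi \<and> 0 < \<beta> \<and> \<beta> < pi \<and> cis (of_nat n * \<alpha>) * c = cis (2 * \<beta>) * d"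
    if n: "n = (1::nat) \<or> n = 2" and "norm c = 1" "norm d = 1" for n c d
  proof -
    have nz: "c \<noteq> 0" "d \<noteq> 0" using that by auto
    have "cis (of_nat n * (pi/2)) \<noteq> cis (of_nat n * (pi/3))"
      using n by (auto simp: complex_eq_iff cos_60 cos_120)
    then have "cis (of_nat n * (pi/2)) * c \<noteq> d \<or> cis (of_nat n * (pi/3)) * c \<noteq> d"
      using nz by (metis mult_right_cancel)
    moreover have "0 < pi / 2" "pi / 2 < pi" "0 < pi / 3" "pi / 3 < pi" by auto
    ultimately obtain \<alpha> where \<alpha>: "0 < \<alpha>" "\<alpha> < pi" "cis (of_nat n * \<alpha>) * c \<noteq> d" by metis
    have "norm (cis (of_nat n * \<alpha>) * c / d) = 1" using that by (simp add: norm_mult norm_divide)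
    moreover have "cis (of_nat n * \<alpha>) * c / d \<noteq> 1" using \<alpha> nz by simp
    ultimately obtain \<beta> where "0 < \<beta>" "\<beta> < pi" "cis (2 * \<beta>) = cis (of_nat n * \<alpha>) * c / d" using sqrt by blast
    then show ?thesis using \<alpha> nz by (intro exI[of _ \<alpha>] exI[of _ \<beta>]) auto
  qed
  have m1: "m = 1"
  proof (rule ccontr)
    assume "m \<noteq> 1" then have "m = 2" using m by auto
    then show False using two[OF n(1,2) m(2)] clash by (metis of_nat_numeral)
  qed
  have n1: "n = 1"
  proof (rule ccontr)
    assume "n \<noteq> 1" then have "n = 2" using n by auto
    then show False using two[OF m(1,2) n(2)] clash by (metis of_nat_numeral)
  qed
  show "f s \<noteq> 0" "f t \<noteq> 0" using n m n1 m1 by auto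
  have nz: "c \<noteq> 0" "d \<noteq> 0" using n m by auto
  have "c = - d"
  proof (rule ccontr)
    assume "c \<noteq> - d"
    \<comment> \<open>The bisector of the two half planes lies in both unless they are
      opposite.\<close>
    define \<beta> where "\<beta> = Arg (d / c)"
    have dc: "d / c = cis \<beta>" using cis_Arg[of "d/c"] nz n m by (simp add: \<beta>_def sgn_eq norm_divide)
    have "\<beta> \<noteq> pi" using \<open>c \<noteq> - d\<close> dc nz by (auto simp: field_simps)
    then have \<beta>: "- pi < \<beta>" "\<beta> < pi" using Arg_bounded[of "d/c"] by (auto simp: \<beta>_def)
    have "cis ((pi + \<beta>)/2) * c = cis ((pi - \<beta>)/2) * d"
    proof -
      have "cis ((pi - \<beta>)/2) * d = cis ((pi - \<beta>)/2) * cis \<beta> * c" using dc nz by (simp add: field_simps)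
      also have "\<dots> = cis ((pi + \<beta>)/2) * c" by (simp add: cis_mult field_simps)
      finally show ?thesis by simp
    qed
    then show False using clash[of "(pi + \<beta>)/2" "(pi - \<beta>)/2"] \<beta> n1 m1 by simp
  qed
  then show "T s = - T t" using n m n1 m1 by (metis mult_minus_right mult_cancel_left complex_i_not_zero)
qed

text \<open>Three outward normals cannot be opposite in pairs.\<close>

lemma no_triple: "\<lbrakk>dbl r s; dbl s t\<rbrakk> \<Longrightarrow> cis r = cis t"
proof (rule ccontr)
  assume a: "dbl r s" "dbl s t" "cis r \<noteq> cis t"
  then have "dbl r t" by (auto simp: dbl_def)
  then have "T r = - T t" "T r = - T s" "T s = - T t" using dbl_tangent a by blast+
  then have "T r = 0" by simp
  then show False using dbl_tangent(1)[OF a(1)] by (simp add: T_def sgn_zero_iff)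
qed

text \<open>Opposite normals make the phases N s / 2 and N t / 2 agree modulo pi.\<close>

lemma dbl_lattice:
  assumes "dbl s t"
  obtains k :: int where "s - t = 2 * pi * k / N"
proof -
  have "cis (real N * s / 2) * of_real (sgn (f s)) = - cis (real N * t / 2) * of_real (sgn (f t))"
    using dbl_tangent(3)[OF assms] by (simp add: T_def)
  then have "cis (- (real N * t / 2)) * (cis (real N * s / 2) * of_real (sgn (f s)))
      = - (cis (- (real N * t / 2)) * cis (real N * t / 2)) * of_real (sgn (f t))"
    by simp
  then have "cis (real N * s / 2 - real N * t / 2) * of_real (sgn (f s)) = - of_real (sgn (f t))"
    by (simp add: cis_mult flip: mult.assoc)
  then have "Im (cis (real N * s / 2 - real N * t / 2) * of_real (sgn (f s))) = Im (- complex_of_real (sgn (f t)))" by metis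
  then have "sin (real N * s / 2 - real N * t / 2) = 0" using dbl_tangent(1)[OF assms] by (simp add: sgn_zero_iff)
  then obtain k :: int where "real N * s / 2 - real N * t / 2 = of_int k * pi" by (auto simp: sin_zero_iff_int2)
  then have "s - t = 2 * pi * k / N" using N_pos by (simp add: field_simps)
  then show ?thesis using that by blast
qed

end

section \<open>The image domain\<close>

lemma log_coordinate:
  fixes t r :: real
  assumes "r > 0"
  obtains r' where "r' > 0" "\<And>z. z \<in> ball (cis t) r' \<Longrightarrow> \<exists>\<zeta>\<in>ball (of_real t) r. exp (\<i> * \<zeta>) = z"
proof -
  define L where "L z = of_real t - \<i> * Ln (z / cis t)" for z
  have "isCont L (cis t)" unfolding L_def by (intro continuous_intros) (auto simp: complex_nonpos_Reals_iff)
  moreover have L0: "L (cis t) = of_real t" by (simp add: L_def)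
  ultimately obtain r1 where r1: "r1 > 0" "\<And>z. dist z (cis t) < r1 \<Longrightarrow> dist (L z) (of_real t) < r"
    using assms unfolding continuous_at_eps_delta by metis
  show ?thesis
  proof (rule that[of "min r1 1"])
    fix z assume z: "z \<in> ball (cis t) (min r1 1)"
    then have "z \<noteq> 0" by (auto simp: dist_norm)
    then have "exp (\<i> * L z) = exp (\<i> * of_real t) * (z / cis t)"
      by (simp add: L_def algebra_simps exp_add)
    also have "\<dots> = z" by (simp add: cis_conv_exp)
    finally show "\<exists>\<zeta>\<in>ball (of_real t) r. exp (\<i> * \<zeta>) = z"
      using r1(2)[of z] z by (intro bexI[of _ "L z"]) (auto simp: dist_commute)
  qed (use r1 in auto)
qed

context reflected_curve
begin

abbreviation \<gamma> :: "real \<Rightarrow> complex" where "\<gamma> t \<equiv> G (of_real t)"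

lemma \<gamma>_eq: "\<gamma> t = g (cis t)" by (simp add: G_def cis_conv_exp)

lemma \<gamma>_cong: "cis s = cis t \<Longrightarrow> \<gamma> s = \<gamma> t" by (simp add: \<gamma>_eq)

lemma \<gamma>_periodic: "\<gamma> (t + 2 * pi * of_int k) = \<gamma> t"
  by (rule \<gamma>_cong) (simp add: cis_mult[symmetric] cis_multiple_2pi)

lemma \<gamma>_cont: "continuous_on S \<gamma>"
  by (intro continuous_at_imp_continuous_on ballI continuous_within_compose3[OF G_isCont] isCont_of_real) auto

lemma g_lower_bound:
  obtains C where "C \<ge> 0" "\<And>z. norm z \<le> 1 \<Longrightarrow> norm (g z) \<ge> of_nat \<kappa> / norm z - C"
proof -
  have "compact (p ` cball 0 1)"
    using p_hol by (intro compact_continuous_image) (auto intro: holomorphic_on_imp_continuous_on holomorphic_on_subset)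
  then obtain C where C: "C > 0" "\<And>z. z \<in> cball 0 1 \<Longrightarrow> norm (p z) \<le> C"
    using compact_imp_bounded[of "p ` cball 0 1"] unfolding bounded_pos by auto
  show ?thesis
  proof (rule that[of C])
    fix z :: complex assume "norm z \<le> 1"
    then have "norm (p z) \<le> C" using C by simp
    moreover have "norm (of_nat \<kappa> / z) \<le> norm (g z) + norm (p z)"
      unfolding g_def using norm_triangle_ineq4[of "p z" "p z - of_nat \<kappa> / z"] by simp
    ultimately show "norm (g z) \<ge> of_nat \<kappa> / norm z - C" by (simp add: norm_divide)
  qed (use C in auto)
qed

text \<open>Compactness fails only at the puncture, and there the pole sends the values to infinity,
  so a convergent sequence of values keeps its preimages away from 0.\<close>

lemma closed_image:
  assumes S: "closed S" "S \<subseteq> cball 0 1"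
  shows "closed (g ` {z\<in>S. \<kappa> = 0 \<or> z \<noteq> 0})"
  unfolding closed_sequential_limits
proof (intro allI impI, elim conjE)
  fix w l assume w: "\<forall>n. w n \<in> g ` {z\<in>S. \<kappa> = 0 \<or> z \<noteq> 0}" and wl: "w \<longlonglongrightarrow> l"
  then have "\<forall>n. \<exists>z. z \<in> S \<and> (\<kappa> = 0 \<or> z \<noteq> 0) \<and> w n = g z" by blast
  then obtain z where z: "\<And>n. z n \<in> S" "\<And>n. \<kappa> = 0 \<or> z n \<noteq> 0" "\<And>n. w n = g (z n)" by metis
  have "compact S" using S compact_cball by (metis compact_eq_bounded_closed bounded_cball bounded_subset)
  then obtain l' r where l': "l' \<in> S" "strict_mono r" "(z \<circ> r) \<longlonglongrightarrow> l'"
    using z(1) by (metis seq_compact_def compact_imp_seq_compact)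
  have wr: "(w \<circ> r) \<longlonglongrightarrow> l" using wl l'(2) by (rule LIMSEQ_subseq_LIMSEQ)
  have ok: "\<kappa> = 0 \<or> l' \<noteq> 0"
  proof (rule ccontr)
    assume "\<not> (\<kappa> = 0 \<or> l' \<noteq> 0)"
    then have k: "\<kappa> = 1" "l' = 0" using kappa by auto
    obtain C where C: "C \<ge> 0" "\<And>z. norm z \<le> 1 \<Longrightarrow> norm (g z) \<ge> of_nat \<kappa> / norm z - C"
      using g_lower_bound by metis
    obtain B where B: "B > 0" "\<And>n. norm ((w \<circ> r) n) \<le> B"
      using convergent_imp_bounded[OF wr] unfolding bounded_pos by auto
    have "1 / norm (z (r n)) \<le> B + C" for n
    proof -
      have "z (r n) \<in> cball 0 1" using z(1) S(2) by blast
      then have "1 / norm (z (r n)) - C \<le> norm (g (z (r n)))" using C(2)[of "z (r n)"] k by simp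
      also have "\<dots> \<le> B" using B(2)[of n] z(3) by simp
      finally show ?thesis by simp
    qed
    then have "norm (z (r n)) \<ge> 1 / (B + C)" for n
      using z(2)[of "r n"] k B(1) C(1) by (simp add: divide_le_eq add_pos_nonneg mult.commute)
    moreover have "(\<lambda>n. norm (z (r n))) \<longlonglongrightarrow> 0" using l'(3) k tendsto_norm_zero by (fastforce simp: o_def)
    ultimately have "1 / (B + C) \<le> 0" using LIMSEQ_le_const by blast
    then show False using B C(1) by (simp add: divide_le_0_iff)
  qed
  have "(\<lambda>n. g (z (r n))) \<longlonglongrightarrow> g l'"
    using l'(3) g_isCont[OF ok] by (auto simp: o_def intro: isCont_tendsto_compose)
  then have "l = g l'" using wr z(3) LIMSEQ_unique by (auto simp: o_def)
  then show "l \<in> g ` {z\<in>S. \<kappa> = 0 \<or> z \<noteq> 0}" using l' ok by blast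
qed

lemma sphere_eq: "sphere 0 1 = cis ` {a..<a + 2 * pi}"
proof (intro equalityI subsetI)
  fix z :: complex assume "z \<in> sphere 0 1"
  then have "z = cis (Arg z)" by (metis cis_Arg_unique cis_Arg norm_zero mem_sphere_0 sgn_eq div_by_1 of_real_1 zero_neq_one)
  moreover define k where "k = \<lfloor>(Arg z - a) / (2 * pi)\<rfloor>"
  have "of_int k \<le> (Arg z - a) / (2 * pi)" "(Arg z - a) / (2 * pi) < of_int k + 1" by (simp_all add: k_def)
  then have "Arg z - 2 * pi * of_int k \<in> {a..<a + 2 * pi}" by (simp add: field_simps)
  moreover have "cis (Arg z - 2 * pi * of_int k) = cis (Arg z)"
    by (simp add: cis_divide[symmetric] cis_multiple_2pi)
  ultimately show "z \<in> cis ` {a..<a + 2 * pi}" by (metis imageI)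
qed auto

end

lemma cis_eq_window:
  assumes "cis s = cis t" "\<bar>s - t\<bar> < 2 * pi" shows "s = t"
proof -
  have "complex_of_real s = complex_of_real t"
    by (rule exp_i_inj_near) (use assms in \<open>auto simp: cis_conv_exp dist_norm simp flip: of_real_diff\<close>)
  then show ?thesis by simp
qed

context univalent_curve
begin

definition \<Omega> where "\<Omega> = g ` D"

lemma open_\<Omega>: "open \<Omega>"
  unfolding \<Omega>_def using open_mapping_thm3[OF g_hol_D open_punctured_disc inj] .

lemma connected_\<Omega>: "connected \<Omega>"
  unfolding \<Omega>_def using connected_punctured_disc g_hol_D
  by (intro connected_continuous_image holomorphic_on_imp_continuous_on)

lemma closure_\<Omega>: "closure \<Omega> = g ` {z\<in>cball 0 1. \<kappa> = 0 \<or> z \<noteq> 0}"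
proof
  show "closure \<Omega> \<subseteq> g ` {z\<in>cball 0 1. \<kappa> = 0 \<or> z \<noteq> 0}"
    using closed_image[of "cball 0 1"] by (intro closure_minimal) (auto simp: \<Omega>_def punctured_disc_def)
  show "g ` {z\<in>cball 0 1. \<kappa> = 0 \<or> z \<noteq> 0} \<subseteq> closure \<Omega>"
  proof clarify
    fix z :: complex assume z: "z \<in> cball 0 1" "\<kappa> = 0 \<or> z \<noteq> 0"
    \<comment> \<open>Radial approach; the first factor is 1 / 2 and not 0, so the puncture is never
      hit.\<close>
    define v where "v n = of_real (1 - inverse (of_nat (Suc (Suc n)))) * z" for n
    have "v \<longlonglongrightarrow> of_real (1 - 0) * z"
      unfolding v_def by (intro tendsto_intros LIMSEQ_Suc[OF LIMSEQ_inverse_real_of_nat])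
    then have "(\<lambda>n. g (v n)) \<longlonglongrightarrow> g z" using g_isCont[OF z(2)] by (auto intro: isCont_tendsto_compose)
    moreover have "g (v n) \<in> \<Omega>" for n
    proof -
      have s: "0 < 1 - inverse (real (Suc (Suc n)))" "1 - inverse (real (Suc (Suc n))) < 1"
        by (auto simp: field_simps)
      have "norm (v n) = (1 - inverse (real (Suc (Suc n)))) * norm z"
        using s unfolding v_def norm_mult norm_of_real by simp
      also have "\<dots> < 1"
      proof -
        have "norm z \<le> 1" using z(1) by simp
        from mult_left_mono[OF this less_imp_le[OF s(1)]] show ?thesis using s(2) by (metis mult_1_right le_less_trans)
      qed
      finally have "norm (v n) < 1" .
      moreover have "v n = 0 \<longleftrightarrow> z = 0" using s unfolding v_def mult_eq_0_iff of_real_eq_0_iff by auto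
      ultimately show ?thesis using z(2) by (auto simp: \<Omega>_def punctured_disc_def)
    qed
    ultimately show "g z \<in> closure \<Omega>" by (meson closure_sequential)
  qed
qed

lemma frontier_\<Omega>_sphere: "frontier \<Omega> = g ` sphere 0 1"
proof -
  have "frontier \<Omega> = g ` {z\<in>cball 0 1. \<kappa> = 0 \<or> z \<noteq> 0} - g ` D"
    using open_\<Omega> by (simp add: frontier_def closure_\<Omega> interior_open) (simp add: \<Omega>_def)
  also have "\<dots> = g ` sphere 0 1"
  proof (intro equalityI subsetI)
    fix w assume "w \<in> g ` {z\<in>cball 0 1. \<kappa> = 0 \<or> z \<noteq> 0} - g ` D"
    then obtain z where "z \<in> cball 0 1" "\<kappa> = 0 \<or> z \<noteq> 0" "w = g z" "z \<notin> D" by blast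
    then show "w \<in> g ` sphere 0 1" by (auto simp: punctured_disc_def)
  next
    fix w assume "w \<in> g ` sphere 0 1"
    then obtain z where z: "norm z = 1" "w = g z" by auto
    then have "w \<notin> g ` D" using g_interior_boundary by fastforce
    then show "w \<in> g ` {z\<in>cball 0 1. \<kappa> = 0 \<or> z \<noteq> 0} - g ` D" using z by auto
  qed
  finally show ?thesis .
qed

lemma frontier_\<Omega>: "frontier \<Omega> = \<gamma> ` {a..<a + 2 * pi}"
  unfolding frontier_\<Omega>_sphere sphere_eq[of a] by (auto simp: \<gamma>_eq image_image)

text \<open>By \<open>dbl_lattice\<close> a double parameter is a zero of G(z + 2 pi k / N) - G(z)
  for one of finitely many k. This entire function is not identically 0, as univalence shows at z =
  i, and a nonzero constant has no zeros.\<close>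

lemma finite_doubles: "finite {t\<in>{a..b}. \<exists>s. dbl s t}"
proof -
  define A where "A k = {z \<in> complex_of_real ` {a..b}. G (z + 2 * pi * of_nat k / of_nat N) - G z = 0}" for k :: nat
  have fin: "finite (A k)" if k: "0 < k" "k < N" for k
  proof (cases "(\<lambda>z::complex. G (z + 2 * pi * of_nat k / of_nat N) - G z) constant_on UNIV")
    case False
    show ?thesis unfolding A_def
    proof (rule holomorphic_compact_finite_zeros[OF _ _ _ _ _ False])
      have "(\<lambda>z. G (z + 2 * pi * of_nat k / of_nat N)) holomorphic_on UNIV"
        using N_pos by (intro holomorphic_on_compose_gen[OF _ G_hol, unfolded o_def] holomorphic_intros) auto
      then show "(\<lambda>z. G (z + 2 * pi * of_nat k / of_nat N) - G z) holomorphic_on UNIV"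
        by (intro holomorphic_on_diff G_hol)
      show "compact (complex_of_real ` {a..b})" by (intro compact_continuous_image continuous_intros) auto
    qed auto
  next
    case True
    then obtain c where c: "\<And>z::complex. G (z + 2 * pi * of_nat k / of_nat N) - G z = c" unfolding constant_on_def by auto
    have "c \<noteq> 0"
    proof
      assume "c = 0"
      then have "G (\<i> + 2 * pi * of_nat k / of_nat N) = G \<i>" using c[of \<i>] by simp
      moreover have "Im (\<i> + 2 * pi * of_nat k / of_nat N) > 0"
      proof -
        have "2 * pi * of_nat k / of_nat N = complex_of_real (2 * pi * real k / real N)" by simp
        then show ?thesis by (simp only: plus_complex.simps Im_complex_of_real) simp
      qed
      ultimately have "exp (\<i> * (\<i> + 2 * pi * of_nat k / of_nat N)) = exp (\<i> * \<i>)" by (metis G_inj imaginary_unit.sel(2) zero_less_one)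
      moreover have "dist (\<i> + 2 * pi * of_nat k / of_nat N) \<i> < 2 * pi"
      proof -
        have "dist (\<i> + 2 * pi * of_nat k / of_nat N) \<i> = norm (complex_of_real (2 * pi * real k / real N))"
          by (simp add: dist_norm)
        also have "\<dots> = 2 * pi * real k / real N" unfolding norm_of_real by simp
        also have "\<dots> < 2 * pi" using k by (simp add: field_simps)
        finally show ?thesis .
      qed
      ultimately have "\<i> + 2 * pi * of_nat k / of_nat N = \<i>" by (rule exp_i_inj_near)
      then show False using k by simp
    qed
    then have "A k = {}" using c by (auto simp: A_def)
    then show ?thesis by simp
  qed
  have "of_real ` {t\<in>{a..b}. \<exists>s. dbl s t} \<subseteq> (\<Union>k\<in>{0<..<N}. A k)"
  proof clarify
    fix t s assume t: "t \<in> {a..b}" and d: "dbl s t"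
    obtain k where k: "s - t = 2 * pi * of_int k / N" using dbl_lattice[OF d] by blast
    define k' where "k' = nat (k mod int N)"
    have k': "int k' = k mod int N" "k' < N" using N_pos by (auto simp: k'_def nat_less_iff)
    have "of_int k = of_nat k' + of_nat N * (of_int (k div int N) :: real)"
    proof -
      have "k = int k' + int N * (k div int N)" using k' by (simp add: mod_mult_div_eq)
      then show ?thesis by (metis of_int_add of_int_mult of_int_of_nat_eq)
    qed
    then have s: "s = t + 2 * pi * of_nat k' / of_nat N + 2 * pi * of_int (k div int N)"
      using k N_pos by (simp add: field_simps)
    then have cs: "cis s = cis (t + 2 * pi * of_nat k' / of_nat N)"
      by (simp add: cis_mult[symmetric] cis_multiple_2pi)
    have "k' \<noteq> 0"
    proof
      assume "k' = 0"
      then have "cis s = cis t" using cs by simp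
      then show False using d by (simp add: dbl_def)
    qed
    have "\<gamma> (t + 2 * pi * of_nat k' / of_nat N) = \<gamma> t" using \<gamma>_cong[OF cs] d by (simp add: dbl_def)
    then have "of_real t \<in> A k'" using t by (simp add: A_def)
    then show "of_real t \<in> (\<Union>k\<in>{0<..<N}. A k)" using \<open>k' \<noteq> 0\<close> k' by auto
  qed
  then have "finite (complex_of_real ` {t\<in>{a..b}. \<exists>s. dbl s t})"
    using fin finite_subset by (metis (no_types, lifting) finite_UN finite_greaterThanLessThan greaterThanLessThan_iff)
  then show ?thesis by (rule finite_imageD) (simp add: inj_on_def)
qed

lemma finite_f_zeros: "finite {t\<in>{a..b}. f t = 0}"
proof -
  have nz: "\<exists>z. F z \<noteq> 0"
  proof (rule ccontr)
    assume "\<not> ?thesis"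
    then have "(G has_field_derivative 0) (at z)" for z using G_deriv[of z] by simp
    then have "G z = G 0" for z
      using has_field_derivative_zero_constant[of UNIV G] by (metis UNIV_I convex_UNIV)
    then show False using G_not_constant by blast
  qed
  have "finite {z\<in>complex_of_real ` {a..b}. F z = 0}"
  proof (cases "F constant_on UNIV")
    case False
    show ?thesis
      by (rule holomorphic_compact_finite_zeros[OF F_hol _ _ _ _ False])
        (auto intro!: compact_continuous_image continuous_intros)
  next
    case True
    then have "{z\<in>complex_of_real ` {a..b}. F z = 0} = {}" using nz by (auto simp: constant_on_def)
    then show ?thesis by (metis finite.emptyI)
  qed
  then have "finite (complex_of_real ` {t\<in>{a..b}. f t = 0})"
    by (rule finite_subset[rotated]) (auto simp: F_of_real)
  then show ?thesis by (rule finite_imageD) (simp add: inj_on_def)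
qed

lemma isolated_singular:
  obtains \<delta> where "\<delta> > 0" "\<And>t. t \<noteq> t0 \<Longrightarrow> \<bar>t - t0\<bar> < \<delta> \<Longrightarrow> f t \<noteq> 0 \<and> (\<forall>s. \<not> dbl s t)"
proof -
  have "finite ({t\<in>{t0-1..t0+1}. f t = 0} \<union> {t\<in>{t0-1..t0+1}. \<exists>s. dbl s t})"
    using finite_f_zeros finite_doubles by simp
  from finite_set_avoid[OF this, of t0] obtain d where d: "d > 0" "\<And>t. t \<in> {t\<in>{t0-1..t0+1}. f t = 0} \<union> {t\<in>{t0-1..t0+1}. \<exists>s. dbl s t} \<Longrightarrow> t \<noteq> t0 \<Longrightarrow> d \<le> dist t0 t"
    by blast
  show ?thesis
  proof (rule that[of "min d 1"])
    fix t assume t: "t \<noteq> t0" "\<bar>t - t0\<bar> < min d 1"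
    then have "t \<in> {t0-1..t0+1}" "dist t0 t < d" by (auto simp: dist_real_def)
    then show "f t \<noteq> 0 \<and> (\<forall>s. \<not> dbl s t)" using d(2)[of t] t by force
  qed (use d in auto)
qed

text \<open>The part of the closed disc away from \<open>cis t\<close> has a closed image, which
  misses \<open>\<gamma> t\<close> because t is not a double parameter. Hence values near
  \<open>\<gamma> t\<close> come only from near \<open>cis t\<close>.\<close>

lemma near_preimage:
  assumes nd: "\<forall>s. \<not> dbl s t" and r: "r > 0"
  obtains \<eta> where "\<eta> > 0" "\<And>z. norm z \<le> 1 \<Longrightarrow> \<kappa> = 0 \<or> z \<noteq> 0 \<Longrightarrow> dist (g z) (\<gamma> t) < \<eta> \<Longrightarrow>
      \<exists>\<zeta>\<in>ball (of_real t) r. Im \<zeta> \<ge> 0 \<and> exp (\<i> * \<zeta>) = z"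
proof -
  obtain r' where r': "r' > 0" "\<And>z. z \<in> ball (cis t) r' \<Longrightarrow> \<exists>\<zeta>\<in>ball (of_real t) r. exp (\<i> * \<zeta>) = z"
    using log_coordinate[OF r] by blast
  define K where "K = g ` {z \<in> cball 0 1 - ball (cis t) r'. \<kappa> = 0 \<or> z \<noteq> 0}"
  have "closed K" unfolding K_def by (intro closed_image closed_Diff) auto
  moreover have "\<gamma> t \<notin> K"
  proof
    assume "\<gamma> t \<in> K"
    then obtain z where z: "norm z \<le> 1" "z \<notin> ball (cis t) r'" "\<kappa> = 0 \<or> z \<noteq> 0" "g (cis t) = g z"
      by (auto simp: K_def \<gamma>_eq)
    have "norm z = 1"
    proof (rule ccontr)
      assume "norm z \<noteq> 1"
      then have "z \<in> D" using z by (auto simp: punctured_disc_def)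
      then show False using g_interior_boundary[of z "cis t"] z by simp
    qed
    then have "z \<in> cis ` {0..<0 + 2 * pi}" using sphere_eq[of 0] by auto
    then obtain s where s: "z = cis s" by blast
    then have "dbl s t" using z r'(1) by (auto simp: dbl_def \<gamma>_eq)
    then show False using nd by blast
  qed
  ultimately obtain \<eta> where \<eta>: "\<eta> > 0" "ball (\<gamma> t) \<eta> \<subseteq> - K" by (metis open_Compl ComplI openE)
  show ?thesis
  proof (rule that[OF \<eta>(1)])
    fix z assume z: "norm z \<le> 1" "\<kappa> = 0 \<or> z \<noteq> 0" "dist (g z) (\<gamma> t) < \<eta>"
    then have "g z \<notin> K" using \<eta>(2) by (auto simp: dist_commute)
    then have "z \<in> ball (cis t) r'" using z by (auto simp: K_def)
    then obtain \<zeta> where \<zeta>: "\<zeta> \<in> ball (of_real t) r" "exp (\<i> * \<zeta>) = z" using r' by blast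
    moreover have "Im \<zeta> \<ge> 0" using \<zeta>(2) z(1) norm_exp_eq_Re[of "\<i> * \<zeta>"] by (cases "Im \<zeta> \<ge> 0") auto
    ultimately show "\<exists>\<zeta>\<in>ball (of_real t) r. Im \<zeta> \<ge> 0 \<and> exp (\<i> * \<zeta>) = z" by blast
  qed
qed

text \<open>G is injective on a full disc around t, so a point just below the real axis has a value
  that no point of the closed unit disc can produce.\<close>

lemma exterior_near_regular:
  assumes nd: "\<forall>s. \<not> dbl s t" and ft: "f t \<noteq> 0" and O: "open V" "\<gamma> t \<in> V"
  shows "\<not> V \<subseteq> closure \<Omega>"
proof
  assume sub: "V \<subseteq> closure \<Omega>"
  let ?t = "complex_of_real t"
  have "deriv G ?t \<noteq> 0" using DERIV_imp_deriv[OF G_deriv, of ?t] ft by (simp add: F_of_real)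
  then obtain r where r: "r > 0" "inj_on G (ball ?t r)"
    using has_complex_derivative_locally_injective[OF G_hol, of ?t] by auto
  obtain \<eta> where \<eta>: "\<eta> > 0" "\<And>z. norm z \<le> 1 \<Longrightarrow> \<kappa> = 0 \<or> z \<noteq> 0 \<Longrightarrow> dist (g z) (\<gamma> t) < \<eta> \<Longrightarrow>
      \<exists>\<zeta>\<in>ball ?t r. Im \<zeta> \<ge> 0 \<and> exp (\<i> * \<zeta>) = z" using near_preimage[OF nd r(1)] by metis
  have "open (V \<inter> ball (\<gamma> t) \<eta>)" "\<gamma> t \<in> V \<inter> ball (\<gamma> t) \<eta>" using O \<eta> by auto
  then obtain e where e: "e > 0" "\<And>x. dist x ?t < e \<Longrightarrow> G x \<in> V \<inter> ball (\<gamma> t) \<eta>"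
    using G_isCont[of ?t] unfolding continuous_at_open eventually_nhds_metric
    by (metis (no_types, lifting) dist_commute mem_ball openE subsetD)
  define \<sigma> where "\<sigma> = min e r / 2"
  have \<sigma>: "\<sigma> > 0" "\<sigma> < e" "\<sigma> < r" using e r by (auto simp: \<sigma>_def)
  define x where "x = ?t - \<i> * of_real \<sigma>"
  have dx: "dist x ?t = \<sigma>" using \<sigma> by (simp add: x_def dist_norm norm_mult)
  then have "G x \<in> V \<inter> ball (\<gamma> t) \<eta>" using e \<sigma> by auto
  then obtain z where z: "norm z \<le> 1" "\<kappa> = 0 \<or> z \<noteq> 0" "G x = g z" "dist (g z) (\<gamma> t) < \<eta>"
    using sub unfolding closure_\<Omega> by (auto simp: dist_commute)
  then obtain \<zeta> where \<zeta>: "\<zeta> \<in> ball ?t r" "Im \<zeta> \<ge> 0" "exp (\<i> * \<zeta>) = z" using \<eta> by blast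
  then have "G \<zeta> = G x" using z by (simp add: G_def)
  then have "\<zeta> = x" using r(2) \<zeta> dx \<sigma> by (auto simp: inj_on_def dist_commute)
  then show False using \<zeta>(2) \<sigma> by (simp add: x_def)
qed

text \<open>Critical and double parameters are isolated, so near every boundary point there are
  regular simple ones, and at those exterior points accumulate.\<close>

lemma interior_closure_\<Omega>: "interior (closure \<Omega>) = \<Omega>"
proof
  show "\<Omega> \<subseteq> interior (closure \<Omega>)" using open_\<Omega> by (simp add: closure_subset interior_maximal)
  show "interior (closure \<Omega>) \<subseteq> \<Omega>"
  proof
    fix w assume w: "w \<in> interior (closure \<Omega>)"
    show "w \<in> \<Omega>"
    proof (rule ccontr)
      assume "w \<notin> \<Omega>"
      then have "w \<in> frontier \<Omega>" using w open_\<Omega> interior_subset by (auto simp: frontier_def interior_open)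
      then obtain t0 where t0: "w = \<gamma> t0" unfolding frontier_\<Omega>[of 0] by auto
      obtain \<delta> where \<delta>: "\<delta> > 0" "\<And>t. t \<noteq> t0 \<Longrightarrow> \<bar>t - t0\<bar> < \<delta> \<Longrightarrow> f t \<noteq> 0 \<and> (\<forall>s. \<not> dbl s t)"
        using isolated_singular by metis
      have "isCont \<gamma> t0" using \<gamma>_cont[of UNIV] by (simp add: continuous_on_eq_continuous_at)
      then obtain e where e: "e > 0" "\<And>t. dist t t0 < e \<Longrightarrow> \<gamma> t \<in> interior (closure \<Omega>)"
        using w t0 open_interior unfolding continuous_at_open
        by (metis (no_types, lifting) dist_commute mem_ball openE subsetD)
      define t where "t = t0 + min \<delta> e / 2"
      have "t \<noteq> t0" "\<bar>t - t0\<bar> < \<delta>" "dist t t0 < e" using \<delta> e by (auto simp: t_def dist_real_def)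
      then have "\<not> interior (closure \<Omega>) \<subseteq> closure \<Omega>"
        using exterior_near_regular[of t "interior (closure \<Omega>)"] \<delta>(2) e(2) by blast
      then show False using interior_subset by blast
    qed
  qed
qed

lemma exterior_point: obtains a where "a \<notin> closure \<Omega>"
proof -
  have "frontier \<Omega> \<noteq> {}" unfolding frontier_\<Omega>[of 0] by auto
  then have "closure \<Omega> \<noteq> UNIV" using interior_closure_\<Omega> by (metis frontier_UNIV frontier_def interior_UNIV closure_UNIV)
  then show ?thesis using that by blast
qed

end

section \<open>Classification of the boundary points\<close>

context univalent_curve
begin

lemma \<gamma>_inj_window:
  assumes "inj_on \<gamma> {t0-\<delta><..<t0+\<delta>}" "\<delta> > 0"
  shows "analytic_arc (\<lambda>\<tau>. \<gamma> (t0 + \<delta> * \<tau>))"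
  unfolding analytic_arc_def
proof (intro conjI exI[of _ UNIV] exI[of _ "\<lambda>\<zeta>. G (of_real t0 + of_real \<delta> * \<zeta>)"])
  show "(\<lambda>\<zeta>. G (of_real t0 + of_real \<delta> * \<zeta>)) holomorphic_on UNIV"
    by (intro holomorphic_on_compose_gen[OF _ G_hol, unfolded o_def] holomorphic_intros) auto
  show "inj_on (\<lambda>\<tau>. \<gamma> (t0 + \<delta> * \<tau>)) {-1<..<1}"
  proof (rule inj_onI)
    fix x y :: real assume xy: "x \<in> {-1<..<1}" "y \<in> {-1<..<1}" "\<gamma> (t0 + \<delta> * x) = \<gamma> (t0 + \<delta> * y)"
    have "t0 + \<delta> * u \<in> {t0-\<delta><..<t0+\<delta>}" if "u \<in> {-1<..<1}" for u
    proof -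
      have "\<delta> * u < \<delta> * 1" "\<delta> * (-1) < \<delta> * u" using that assms(2) by (auto simp only: mult_less_cancel_left_pos) auto
      then show ?thesis by simp
    qed
    then have "t0 + \<delta> * x = t0 + \<delta> * y" using assms(1) xy by (auto simp only: inj_on_def)
    then show "x = y" using assms(2) by simp
  qed
qed auto

lemma vector_derivative_\<gamma>:
  "vector_derivative (\<lambda>\<tau>. \<gamma> (t0 + \<delta> * \<tau>)) (at \<tau>) = of_real \<delta> * (\<i> * exp (\<i> * of_nat N * (of_real (t0 + \<delta> * \<tau>)) / 2) * F (of_real (t0 + \<delta> * \<tau>)))"
proof (rule vector_derivative_at)
  have "((\<lambda>\<zeta>. G (of_real t0 + of_real \<delta> * \<zeta>)) has_field_derivative
     (\<i> * exp (\<i> * of_nat N * (of_real (t0 + \<delta> * \<tau>)) / 2) * F (of_real (t0 + \<delta> * \<tau>))) * of_real \<delta>) (at (of_real \<tau>))"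
  proof -
    have a: "((\<lambda>\<zeta>. of_real t0 + of_real \<delta> * \<zeta>) has_field_derivative of_real \<delta>) (at (complex_of_real \<tau>))"
      by (auto intro!: derivative_eq_intros)
    have b: "(G has_field_derivative \<i> * exp (\<i> * of_nat N * (of_real (t0 + \<delta> * \<tau>)) / 2) * F (of_real (t0 + \<delta> * \<tau>)))
       (at (of_real t0 + of_real \<delta> * complex_of_real \<tau>))"
      using G_deriv[of "of_real (t0 + \<delta> * \<tau>)"] by simp
    show ?thesis using DERIV_chain'[OF a b] .
  qed
  from has_field_derivative_at_within[OF this, of UNIV]
  show "((\<lambda>\<tau>. \<gamma> (t0 + \<delta> * \<tau>)) has_vector_derivative of_real \<delta> * (\<i> * exp (\<i> * of_nat N * (of_real (t0 + \<delta> * \<tau>)) / 2) * F (of_real (t0 + \<delta> * \<tau>)))) (at \<tau>)"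
    using has_vector_derivative_real_field[of "\<lambda>\<zeta>. G (of_real t0 + of_real \<delta> * \<zeta>)"] by (simp add: mult.commute)
qed

lemma vector_derivative_\<gamma>_nonzero:
  "\<delta> \<noteq> 0 \<Longrightarrow> f (t0 + \<delta> * \<tau>) \<noteq> 0 \<Longrightarrow> vector_derivative (\<lambda>\<tau>. \<gamma> (t0 + \<delta> * \<tau>)) (at \<tau>) \<noteq> 0"
  unfolding vector_derivative_\<gamma> F_of_real by simp

lemma window_image:
  assumes "\<delta> > 0"
  shows "(\<lambda>\<tau>. \<gamma> (t0 + \<delta> * \<tau>)) ` {-1<..<1} = \<gamma> ` {t0-\<delta><..<t0+\<delta>}"
proof -
  have "(\<lambda>\<tau>. t0 + \<delta> * \<tau>) ` {-1<..<1} = {t0-\<delta><..<t0+\<delta>}"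
  proof (intro equalityI subsetI)
    fix x assume "x \<in> {t0-\<delta><..<t0+\<delta>}"
    then show "x \<in> (\<lambda>\<tau>. t0 + \<delta> * \<tau>) ` {-1<..<1}"
      using assms by (intro image_eqI[of _ _ "(x - t0) / \<delta>"]) (auto simp: field_simps)
  next
    fix x assume "x \<in> (\<lambda>\<tau>. t0 + \<delta> * \<tau>) ` {-1<..<1}"
    then obtain \<tau> where \<tau>: "x = t0 + \<delta> * \<tau>" "-1 < \<tau>" "\<tau> < 1" by (auto simp only: image_iff greaterThanLessThan_iff)
    have "\<delta> * \<tau> < \<delta> * 1" "\<delta> * (-1) < \<delta> * \<tau>" using \<tau> assms by (auto simp only: mult_less_cancel_left_pos)
    then show "x \<in> {t0-\<delta><..<t0+\<delta>}" using \<tau> by simp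
  qed
  then show ?thesis by (metis image_image)
qed

lemma \<gamma>_eq_cases: "\<gamma> s = \<gamma> t \<Longrightarrow> \<bar>s - t\<bar> < 2 * pi \<Longrightarrow> s = t \<or> dbl s t"
  using cis_eq_window by (auto simp: dbl_def)

text \<open>The complement of J in the closed period is compact, so removing its image from the
  plane leaves an open set in which only the arc over J remains.\<close>

lemma frontier_window:
  assumes J: "open J" "J \<subseteq> {a<..<a + 2 * pi}" and sep: "\<And>t t'. t \<in> J \<Longrightarrow> t' \<in> {a..a + 2 * pi} - J \<Longrightarrow> \<gamma> t \<noteq> \<gamma> t'"
  obtains V where "open V" "frontier \<Omega> \<inter> V = \<gamma> ` J"
proof (rule that[of "- \<gamma> ` ({a..a + 2 * pi} - J)"])
  have "compact ({a..a + 2 * pi} - J)" using J(1) by (intro compact_diff) auto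
  then have "compact (\<gamma> ` ({a..a + 2 * pi} - J))" by (intro compact_continuous_image \<gamma>_cont)
  then show "open (- \<gamma> ` ({a..a + 2 * pi} - J))" by (simp add: compact_imp_closed open_Compl)
  show "frontier \<Omega> \<inter> - \<gamma> ` ({a..a + 2 * pi} - J) = \<gamma> ` J"
  proof (intro equalityI subsetI)
    fix w assume w: "w \<in> frontier \<Omega> \<inter> - \<gamma> ` ({a..a + 2 * pi} - J)"
    then obtain t where t: "t \<in> {a..<a + 2 * pi}" "w = \<gamma> t" unfolding frontier_\<Omega>[of a] by blast
    then have "t \<in> J" using w by force
    then show "w \<in> \<gamma> ` J" using t by blast
  next
    fix w assume "w \<in> \<gamma> ` J"
    then obtain t where t: "t \<in> J" "w = \<gamma> t" by blast
    then have "w \<in> frontier \<Omega>" unfolding frontier_\<Omega>[of a] using J(2) by (intro image_eqI[of _ _ t]) auto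
    moreover have "w \<notin> \<gamma> ` ({a..a + 2 * pi} - J)"
    proof
      assume "w \<in> \<gamma> ` ({a..a + 2 * pi} - J)"
      then obtain t' where "t' \<in> {a..a + 2 * pi} - J" "w = \<gamma> t'" by blast
      then show False using sep[OF t(1)] t(2) by auto
    qed
    ultimately show "w \<in> frontier \<Omega> \<inter> - \<gamma> ` ({a..a + 2 * pi} - J)" by blast
  qed
qed

lemma frontier_nondouble_window:
  assumes J: "open J" "J \<subseteq> {a<..<a + 2 * pi}" and nd: "\<And>t s. t \<in> J \<Longrightarrow> \<not> dbl s t"
  obtains V where "open V" "frontier \<Omega> \<inter> V = \<gamma> ` J"
proof (rule frontier_window[OF J])
  fix t t' assume t: "t \<in> J" "t' \<in> {a..a + 2 * pi} - J"
  then have "\<bar>t' - t\<bar> < 2 * pi" "t' \<noteq> t" using J(2) by (auto simp: subset_iff)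
  then show "\<gamma> t \<noteq> \<gamma> t'" using \<gamma>_eq_cases[of t' t] nd[OF t(1)] by auto
qed (rule that)

lemma frontier_simple:
  assumes nd: "\<forall>s. \<not> dbl s t0"
  obtains \<delta> V where "\<delta> > 0" "\<delta> < pi" "open V" "frontier \<Omega> \<inter> V = \<gamma> ` {t0-\<delta><..<t0+\<delta>}"
    "inj_on \<gamma> {t0-\<delta>..t0+\<delta>}" "\<And>t. t \<noteq> t0 \<Longrightarrow> t \<in> {t0-\<delta>..t0+\<delta>} \<Longrightarrow> f t \<noteq> 0"
proof -
  obtain d where d: "d > 0" "\<And>t. t \<noteq> t0 \<Longrightarrow> \<bar>t - t0\<bar> < d \<Longrightarrow> f t \<noteq> 0 \<and> (\<forall>s. \<not> dbl s t)"
    using isolated_singular by metis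
  define \<delta> where "\<delta> = min d pi / 2"
  have \<delta>: "\<delta> > 0" "\<delta> < pi" "\<delta> < d" using d by (auto simp: \<delta>_def min_def)
  have ok: "f t \<noteq> 0 \<or> t = t0" "\<not> dbl s t" if "t \<in> {t0-\<delta>..t0+\<delta>}" for t s
    using d(2)[of t] nd that \<delta> by (cases "t = t0"; force)+
  obtain V where V: "open V" "frontier \<Omega> \<inter> V = \<gamma> ` {t0-\<delta><..<t0+\<delta>}"
    by (rule frontier_nondouble_window[of "{t0-\<delta><..<t0+\<delta>}" "t0 - pi"]) (use \<delta> ok in \<open>auto simp del: dbl_def\<close>)
  moreover have "inj_on \<gamma> {t0-\<delta>..t0+\<delta>}"
  proof (rule inj_onI)
    fix x y assume xy: "x \<in> {t0-\<delta>..t0+\<delta>}" "y \<in> {t0-\<delta>..t0+\<delta>}" "\<gamma> x = \<gamma> y"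
    then have "\<bar>x - y\<bar> < 2 * pi" using \<delta> by auto
    then show "x = y" using \<gamma>_eq_cases xy ok(2) by blast
  qed
  ultimately show ?thesis using that \<delta> ok(1) by blast
qed

lemma regular_point:
  assumes nd: "\<forall>s. \<not> dbl s t0" and ft: "f t0 \<noteq> 0"
  shows "regular_boundary_point \<Omega> (\<gamma> t0)"
proof -
  obtain \<delta> V where \<delta>: "\<delta> > 0" "\<delta> < pi" "open V" "frontier \<Omega> \<inter> V = \<gamma> ` {t0-\<delta><..<t0+\<delta>}"
    "inj_on \<gamma> {t0-\<delta>..t0+\<delta>}" "\<And>t. t \<noteq> t0 \<Longrightarrow> t \<in> {t0-\<delta>..t0+\<delta>} \<Longrightarrow> f t \<noteq> 0"
    by (rule frontier_simple[OF nd]) (assumption | rule that)+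
  have "\<gamma> t0 \<in> frontier \<Omega> \<inter> V" unfolding \<delta>(4) using \<delta>(1) by simp
  then have inF: "\<gamma> t0 \<in> frontier \<Omega>" "\<gamma> t0 \<in> V" by auto
  have fz: "f t \<noteq> 0" if "t \<in> \<gamma>_dom" "\<gamma>_dom = {t0-\<delta><..<t0+\<delta>}" for t \<gamma>_dom
    using \<delta>(6)[of t] ft that by (cases "t = t0") auto
  have "regular_arc (\<lambda>\<tau>. \<gamma> (t0 + \<delta> * \<tau>))" unfolding regular_arc_def
  proof (intro conjI ballI)
    show "analytic_arc (\<lambda>\<tau>. \<gamma> (t0 + \<delta> * \<tau>))"
      by (rule \<gamma>_inj_window[OF inj_on_subset[OF \<delta>(5)] \<delta>(1)]) auto
    fix \<tau> :: real assume \<tau>: "\<tau> \<in> {-1<..<1}"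
    have "\<delta> * \<tau> < \<delta> * 1" "\<delta> * (-1) < \<delta> * \<tau>" using \<tau> \<delta>(1) by (auto simp only: mult_less_cancel_left_pos) auto
    then show "vector_derivative (\<lambda>\<tau>. \<gamma> (t0 + \<delta> * \<tau>)) (at \<tau>) \<noteq> 0"
      using \<delta>(1) by (intro vector_derivative_\<gamma>_nonzero fz[OF _ refl]) auto
  qed
  then show ?thesis unfolding regular_boundary_point_def
    using inF \<delta>(3) by (intro conjI exI[of _ V] exI[of _ "\<lambda>\<tau>. \<gamma> (t0 + \<delta> * \<tau>)"])
      (simp_all only: window_image[OF \<delta>(1)] \<delta>(4) Int_iff mult_zero_right add_0_right)
qed

lemma deriv2_G: "f t = 0 \<Longrightarrow> (deriv ^^ 2) G (of_real t) \<noteq> 0" "f t = 0 \<Longrightarrow> deriv G (of_real t) = 0"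
proof -
  assume f: "f t = 0"
  have dG: "deriv G = (\<lambda>\<zeta>. \<i> * exp (\<i> * of_nat N * \<zeta> / 2) * F \<zeta>)"
    using G_deriv DERIV_imp_deriv by blast
  show "deriv G (of_real t) = 0" using f by (simp add: dG F_of_real)
  let ?t = "complex_of_real t"
  have "((\<lambda>\<zeta>. \<i> * exp (\<i> * of_nat N * \<zeta> / 2)) has_field_derivative
        deriv (\<lambda>\<zeta>. \<i> * exp (\<i> * of_nat N * \<zeta> / 2)) ?t) (at ?t)"
    by (rule holomorphic_derivI[of _ UNIV]) (auto intro!: holomorphic_intros)
  from DERIV_mult[OF this F_deriv[of ?t]] have "deriv (deriv G) ?t = deriv F ?t * (\<i> * exp (\<i> * of_nat N * ?t / 2))"
    unfolding dG using f by (intro DERIV_imp_deriv) (simp add: F_of_real)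
  then show "(deriv ^^ 2) G ?t \<noteq> 0" using simple_zero[OF f] by (simp add: numeral_2_eq_2)
qed

lemma cusp_not_dbl: "f t = 0 \<Longrightarrow> \<not> dbl s t" using dbl_tangent by blast

text \<open>At a zero of \<open>f\<close> the curve is \<open>\<gamma> t0\<close> plus the square of
  the parameter difference times a nonvanishing factor. It arrives and leaves on the same side, and
  nearby frontier points lie in a cone of half-angle 60 degrees around c.\<close>

lemma cusp_cone:
  assumes ft: "f t0 = 0"
  obtains c \<eta> where "c \<noteq> 0" "\<eta> > 0"
    "\<And>q. q \<in> frontier \<Omega> \<Longrightarrow> dist q (\<gamma> t0) < \<eta> \<Longrightarrow> Re (cnj c * (q - \<gamma> t0)) \<ge> norm c * norm (q - \<gamma> t0) / 2"
proof -
  let ?t = "complex_of_real t0"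
  have "\<And>i. 0 < i \<Longrightarrow> i < 2 \<Longrightarrow> (deriv ^^ i) G ?t = 0"
  proof -
    fix i :: nat assume "0 < i" "i < 2"
    then have "i = 1" by simp
    then show "(deriv ^^ i) G ?t = 0" using deriv2_G(2)[OF ft] by simp
  qed
  then obtain h r where r: "0 < r" and hh: "h holomorphic_on ball ?t r"
    and Geq: "\<And>w. w \<in> ball ?t r \<Longrightarrow> G w - G ?t = (w - ?t)^2 * h w"
    and hnz: "\<And>w. w \<in> ball ?t r \<Longrightarrow> h w \<noteq> 0"
    using holomorphic_factor_order_of_zero[OF G_hol open_UNIV UNIV_I _ deriv2_G(1)[OF ft]] by (metis zero_less_numeral)
  define c where "c = h ?t"
  have c: "c \<noteq> 0" using hnz r by (simp add: c_def)
  have "isCont h ?t" using hh r by (metis centre_in_ball continuous_on_eq_continuous_at holomorphic_on_imp_continuous_on open_ball)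
  then have "isCont (\<lambda>w. Re (cnj c * h w) - norm c * norm (h w) / 2) ?t" by (intro continuous_intros isCont_Re) auto
  moreover have "Re (cnj c * h ?t) - norm c * norm (h ?t) / 2 > 0"
  proof -
    have "cnj c * c = of_real ((norm c)^2)" by (simp add: complex_norm_square mult.commute flip: of_real_power)
    then show ?thesis using c by (simp add: power2_eq_square flip: c_def)
  qed
  ultimately obtain e where e: "e > 0" "\<And>w. dist w ?t < e \<Longrightarrow> Re (cnj c * h w) - norm c * norm (h w) / 2 > 0"
    unfolding continuous_at_eps_delta using r
    by (smt (verit) dist_real_def)
  obtain \<eta> where \<eta>: "\<eta> > 0" "\<And>z. norm z \<le> 1 \<Longrightarrow> \<kappa> = 0 \<or> z \<noteq> 0 \<Longrightarrow> dist (g z) (\<gamma> t0) < \<eta> \<Longrightarrow>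
      \<exists>\<zeta>\<in>ball ?t (min e r). Im \<zeta> \<ge> 0 \<and> exp (\<i> * \<zeta>) = z"
    using near_preimage[of t0 "min e r"] cusp_not_dbl[OF ft] e r by (metis min_less_iff_conj)
  show ?thesis
  proof (rule that[OF c \<eta>(1)])
    fix q assume q: "q \<in> frontier \<Omega>" "dist q (\<gamma> t0) < \<eta>"
    then obtain z where z: "norm z = 1" "q = g z" unfolding frontier_\<Omega>_sphere by auto
    moreover have "z \<noteq> 0" using z by auto
    ultimately obtain \<zeta> where \<zeta>: "\<zeta> \<in> ball ?t (min e r)" "exp (\<i> * \<zeta>) = z" using \<eta>(2)[of z] q by auto
    have "Im \<zeta> = 0" using \<zeta>(2) z(1) norm_exp_eq_Re[of "\<i> * \<zeta>"] by simp
    then obtain \<tau> where \<tau>: "\<zeta> = complex_of_real \<tau>" by (metis complex_is_Real_iff Reals_cases)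
    have "q - \<gamma> t0 = (of_real \<tau> - ?t)^2 * h (of_real \<tau>)"
      using Geq[of \<zeta>] \<zeta> z \<tau> by (simp add: G_def)
    also have "(of_real \<tau> - ?t)^2 = complex_of_real ((\<tau> - t0)^2)" by simp
    finally have qe: "q - \<gamma> t0 = of_real ((\<tau> - t0)^2) * h (of_real \<tau>)" .
    have "Re (cnj c * h (of_real \<tau>)) \<ge> norm c * norm (h (of_real \<tau>)) / 2"
      using e(2)[of \<zeta>] \<zeta> \<tau> by (simp add: dist_commute)
    then have "(\<tau> - t0)^2 * Re (cnj c * h (of_real \<tau>)) \<ge> (\<tau> - t0)^2 * (norm c * norm (h (of_real \<tau>)) / 2)"
      by (rule mult_left_mono) simp
    moreover have "Re (cnj c * (q - \<gamma> t0)) = (\<tau> - t0)^2 * Re (cnj c * h (of_real \<tau>))"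
    proof -
      have "cnj c * (q - \<gamma> t0) = of_real ((\<tau> - t0)^2) * (cnj c * h (of_real \<tau>))" unfolding qe by (simp add: mult_ac)
      then show ?thesis by (simp only: Re_complex_of_real times_complex.simps Im_complex_of_real)
    qed
    moreover have "norm (q - \<gamma> t0) = (\<tau> - t0)^2 * norm (h (of_real \<tau>))"
      unfolding qe norm_mult norm_of_real by simp
    ultimately show "Re (cnj c * (q - \<gamma> t0)) \<ge> norm c * norm (q - \<gamma> t0) / 2" by (simp add: mult_ac)
  qed
qed

text \<open>A path with nonzero velocity v leaves in the opposite directions v and - v, which cannot
  both lie in the cone of \<open>cusp_cone\<close>.\<close>

lemma no_regular_path_through_cusp:
  assumes ft: "f t0 = 0" and d: "(\<beta> has_vector_derivative v) (at t1)" and v: "v \<noteq> 0"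
    and \<beta>: "\<beta> t1 = \<gamma> t0" "t1 \<in> {-1<..<1}" "\<beta> ` {-1<..<1} \<subseteq> frontier \<Omega>"
  shows False
proof -
  obtain c \<eta> where c: "c \<noteq> 0" "\<eta> > 0"
    and cone: "\<And>q. q \<in> frontier \<Omega> \<Longrightarrow> dist q (\<gamma> t0) < \<eta> \<Longrightarrow> Re (cnj c * (q - \<gamma> t0)) \<ge> norm c * norm (q - \<gamma> t0) / 2"
    using cusp_cone[OF ft] by metis
  \<comment> \<open>The cone inequalities bound the sum of the two norms by 4 e h, and the linear
    approximation bounds it below by 2 h (norm v - e); any e below norm v / 3 yields a
    contradiction.\<close>
  define e where "e = norm v / 4"
  have e: "e > 0" using v by (simp add: e_def)
  obtain d1 where d1: "d1 > 0" "\<And>x. \<bar>x - t1\<bar> < d1 \<Longrightarrow> norm (\<beta> x - \<beta> t1 - (x - t1) *\<^sub>R v) \<le> e * \<bar>x - t1\<bar>"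
    using d e unfolding has_vector_derivative_def has_derivative_at_alt by auto
  have "isCont \<beta> t1" using d has_vector_derivative_continuous by blast
  then obtain d2 where d2: "d2 > 0" "\<And>x. \<bar>x - t1\<bar> < d2 \<Longrightarrow> dist (\<beta> x) (\<beta> t1) < \<eta>"
    using c unfolding continuous_at_eps_delta dist_real_def by metis
  define h where "h = min (min d1 d2) (min (1 - t1) (t1 + 1)) / 2"
  have h: "h > 0" "h < d1" "h < d2" "h < 1 - t1" "h < t1 + 1" using d1 d2 \<beta>(2) by (auto simp: h_def)
  define yp where "yp = \<beta> (t1 + h) - \<gamma> t0"
  define ym where "ym = \<beta> (t1 - h) - \<gamma> t0"
  have ep: "norm (yp - h *\<^sub>R v) \<le> e * h" using d1(2)[of "t1 + h"] h \<beta> by (simp add: yp_def)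
  have em: "norm (ym + h *\<^sub>R v) \<le> e * h" using d1(2)[of "t1 - h"] h \<beta> by (simp add: ym_def)
  have "Re (cnj c * yp) \<ge> norm c * norm yp / 2" "Re (cnj c * ym) \<ge> norm c * norm ym / 2"
    unfolding yp_def ym_def using h d2(2)[of "t1 + h"] d2(2)[of "t1 - h"] \<beta> by (intro cone; auto)+
  moreover have "Re (cnj c * yp) + Re (cnj c * ym) \<le> norm c * (2 * (e * h))"
  proof -
    have "Re (cnj c * yp) + Re (cnj c * ym) = Re (cnj c * (yp + ym))" by (simp add: algebra_simps)
    also have "\<dots> \<le> norm (cnj c * (yp + ym))" by (rule complex_Re_le_cmod)
    also have "\<dots> = norm c * norm ((yp - h *\<^sub>R v) + (ym + h *\<^sub>R v))" by (simp add: norm_mult)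
    also have "\<dots> \<le> norm c * (2 * (e * h))"
      using norm_triangle_ineq[of "yp - h *\<^sub>R v" "ym + h *\<^sub>R v"] ep em by (intro mult_left_mono) auto
    finally show ?thesis .
  qed
  ultimately have "norm c * (norm yp + norm ym) \<le> norm c * (4 * (e * h))" by (simp add: algebra_simps)
  then have "norm yp + norm ym \<le> 4 * (e * h)"
    using c(1) by (metis mult_le_cancel_left_pos zero_less_norm_iff)
  moreover have "norm yp \<ge> h * norm v - e * h"
    using ep norm_triangle_ineq2[of "h *\<^sub>R v" "yp"] h by (simp add: norm_minus_commute)
  moreover have "norm ym \<ge> h * norm v - e * h"
    using em norm_triangle_ineq2[of "- (h *\<^sub>R v)" "ym"] h by (simp add: norm_minus_commute add.commute)
  ultimately have "2 * (h * norm v) \<le> 6 * (e * h)" by linarith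
  then have "2 * norm v \<le> 6 * e" using h by simp
  then show False using e v by (simp add: e_def)
qed

lemma analytic_arc_vector_derivative:
  assumes "analytic_arc \<beta>" "t \<in> {-1<..<1}"
  shows "(\<beta> has_vector_derivative vector_derivative \<beta> (at t)) (at t)"
proof -
  obtain S h where S: "open S" "complex_of_real ` {-1<..<1} \<subseteq> S" "h holomorphic_on S"
     "\<forall>t\<in>{-1<..<1}. \<beta> t = h (complex_of_real t)" using assms unfolding analytic_arc_def by blast
  have "(h has_field_derivative deriv h (of_real t)) (at (of_real t))"
    using S assms by (intro holomorphic_derivI[OF S(3,1)]) auto
  then have "((\<lambda>t. h (of_real t)) has_vector_derivative deriv h (of_real t)) (at t)"
    by (intro has_vector_derivative_real_field)
  then have "(\<beta> has_vector_derivative deriv h (of_real t)) (at t)"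
    by (rule has_vector_derivative_transform_within_open[of _ _ _ "{-1<..<1}"]) (use S assms in auto)
  then show ?thesis using vector_derivative_at by fastforce
qed

lemma cusp_point:
  assumes ft: "f t0 = 0"
  shows "boundary_cusp \<Omega> (\<gamma> t0)"
proof -
  have nd: "\<forall>s. \<not> dbl s t0" using cusp_not_dbl[OF ft] by blast
  obtain \<delta> V where \<delta>: "\<delta> > 0" "\<delta> < pi" "open V" "frontier \<Omega> \<inter> V = \<gamma> ` {t0-\<delta><..<t0+\<delta>}"
    "inj_on \<gamma> {t0-\<delta>..t0+\<delta>}" "\<And>t. t \<noteq> t0 \<Longrightarrow> t \<in> {t0-\<delta>..t0+\<delta>} \<Longrightarrow> f t \<noteq> 0"
    by (rule frontier_simple[OF nd]) (assumption | rule that)+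
  have "\<gamma> t0 \<in> frontier \<Omega> \<inter> V" unfolding \<delta>(4) using \<delta>(1) by simp
  then have inF: "\<gamma> t0 \<in> frontier \<Omega>" "\<gamma> t0 \<in> V" by auto
  have nreg: "\<not> regular_boundary_point \<Omega> (\<gamma> t0)"
  proof
    assume "regular_boundary_point \<Omega> (\<gamma> t0)"
    then obtain U \<beta> where \<beta>: "regular_arc \<beta>" "\<beta> 0 = \<gamma> t0" "frontier \<Omega> \<inter> U = \<beta> ` {-1<..<1}"
      unfolding regular_boundary_point_def by blast
    have "(\<beta> has_vector_derivative vector_derivative \<beta> (at 0)) (at 0)"
      using \<beta>(1) by (intro analytic_arc_vector_derivative) (auto simp: regular_arc_def)
    moreover have "vector_derivative \<beta> (at 0) \<noteq> 0" using \<beta>(1) by (auto simp: regular_arc_def)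
    ultimately show False using no_regular_path_through_cusp[OF ft, of \<beta> _ 0] \<beta>(2,3) by auto
  qed
  have der: "vector_derivative (\<lambda>\<tau>. \<gamma> (t0 + \<delta> * \<tau>)) (at \<tau>) \<noteq> 0" if \<tau>: "\<tau> \<in> {-1<..<1} - {0}" for \<tau>
  proof -
    have "\<delta> * \<tau> < \<delta> * 1" "\<delta> * (-1) < \<delta> * \<tau>" using \<tau> \<delta>(1) by (auto simp only: mult_less_cancel_left_pos) auto
    then show ?thesis using \<delta>(1) \<tau> by (intro vector_derivative_\<gamma>_nonzero \<delta>(6)) auto
  qed
  have an: "analytic_arc (\<lambda>\<tau>. \<gamma> (t0 + \<delta> * \<tau>))"
    by (rule \<gamma>_inj_window[OF inj_on_subset[OF \<delta>(5)] \<delta>(1)]) auto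
  show ?thesis unfolding boundary_cusp_def
    using inF \<delta>(3) nreg der an
    by (intro conjI ballI exI[of _ V] exI[of _ "\<lambda>\<tau>. \<gamma> (t0 + \<delta> * \<tau>)"])
      (simp_all only: window_image[OF \<delta>(1)] \<delta>(4) Int_iff mult_zero_right add_0_right not_False_eq_True)
qed

lemma analytic_arc_continuous: "analytic_arc \<beta> \<Longrightarrow> continuous_on {-1<..<1} \<beta>"
  by (intro continuous_at_imp_continuous_on ballI)
    (blast intro: has_vector_derivative_continuous[OF analytic_arc_vector_derivative])

lemma \<gamma>_inverse:
  assumes "inj_on \<gamma> {a..b}"
  obtains \<iota> where "continuous_on (\<gamma> ` {a..b}) \<iota>" "\<And>t. t \<in> {a..b} \<Longrightarrow> \<iota> (\<gamma> t) = t"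
proof (rule that)
  show "continuous_on (\<gamma> ` {a..b}) (the_inv_into {a..b} \<gamma>)"
    by (rule continuous_on_inv[OF \<gamma>_cont compact_Icc]) (simp add: the_inv_into_f_f[OF assms])
qed (simp add: the_inv_into_f_f[OF assms])

text \<open>Near the point both arcs run on the single arc over a window around t0. By
  one-dimensional invariance of domain each contains the image of an open interval around t0, so
  they meet in more than one point.\<close>

lemma nondouble_not_double_point:
  assumes nd: "\<forall>s. \<not> dbl s t0"
  shows "\<not> boundary_double_point \<Omega> (\<gamma> t0)"
proof
  assume "boundary_double_point \<Omega> (\<gamma> t0)"
  then obtain U \<gamma>1 \<gamma>2 where U: "open U" "\<gamma> t0 \<in> U" "regular_arc \<gamma>1" "regular_arc \<gamma>2" "\<gamma>1 0 = \<gamma> t0" "\<gamma>2 0 = \<gamma> t0"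
    "\<gamma>1 ` {-1<..<1} \<inter> \<gamma>2 ` {-1<..<1} = {\<gamma> t0}" "frontier \<Omega> \<inter> U = \<gamma>1 ` {-1<..<1} \<union> \<gamma>2 ` {-1<..<1}"
    unfolding boundary_double_point_def by blast
  obtain \<delta> V where \<delta>: "\<delta> > 0" "\<delta> < pi" "open V" "frontier \<Omega> \<inter> V = \<gamma> ` {t0-\<delta><..<t0+\<delta>}"
    "inj_on \<gamma> {t0-\<delta>..t0+\<delta>}" "\<And>t. t \<noteq> t0 \<Longrightarrow> t \<in> {t0-\<delta>..t0+\<delta>} \<Longrightarrow> f t \<noteq> 0"
    by (rule frontier_simple[OF nd]) (assumption | rule that)+
  obtain \<iota> where \<iota>: "continuous_on (\<gamma> ` {t0-\<delta>..t0+\<delta>}) \<iota>" "\<And>t. t \<in> {t0-\<delta>..t0+\<delta>} \<Longrightarrow> \<iota> (\<gamma> t) = t"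
    using \<gamma>_inverse[OF \<delta>(5)] by metis
  have inV: "\<gamma> t0 \<in> V" using \<delta> by (metis IntD2 greaterThanLessThan_iff imageI less_add_same_cancel1 diff_less_eq)
  have key: "\<exists>J. open J \<and> t0 \<in> J \<and> J \<subseteq> {t0-\<delta><..<t0+\<delta>} \<and> \<gamma> ` J \<subseteq> \<beta> ` {-1<..<1}"
    if \<beta>: "regular_arc \<beta>" "\<beta> 0 = \<gamma> t0" "\<beta> ` {-1<..<1} \<subseteq> frontier \<Omega>" for \<beta>
  proof -
    have cont: "continuous_on {-1<..<1} \<beta>" and inj\<beta>: "inj_on \<beta> {-1<..<1}"
      using \<beta> analytic_arc_continuous by (auto simp: regular_arc_def analytic_arc_def)
    define E where "E = {-1<..<1} \<inter> \<beta> -` V"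
    have oE: "open E" unfolding E_def using cont \<delta>(3) by (simp add: continuous_open_preimage)
    have E0: "0 \<in> E" using inV \<beta> by (simp add: E_def)
    have sub: "\<beta> ` E \<subseteq> \<gamma> ` {t0-\<delta><..<t0+\<delta>}" using \<beta>(3) \<delta>(4) by (auto simp: E_def)
    also have "\<dots> \<subseteq> \<gamma> ` {t0-\<delta>..t0+\<delta>}" by (intro image_mono) auto
    finally have sub': "\<beta> ` E \<subseteq> \<gamma> ` {t0-\<delta>..t0+\<delta>}" .
    have bk: "\<gamma> (\<iota> (\<beta> x)) = \<beta> x" "\<iota> (\<beta> x) \<in> {t0-\<delta><..<t0+\<delta>}" if xE: "x \<in> E" for x
    proof -
      obtain t where t: "t \<in> {t0-\<delta><..<t0+\<delta>}" "\<beta> x = \<gamma> t" using sub xE by blast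
      moreover have "\<iota> (\<gamma> t) = t" using \<iota>(2) t(1) by simp
      ultimately show "\<gamma> (\<iota> (\<beta> x)) = \<beta> x" "\<iota> (\<beta> x) \<in> {t0-\<delta><..<t0+\<delta>}" by simp_all
    qed
    have "continuous_on E (\<lambda>x. \<iota> (\<beta> x))"
      using continuous_on_compose2[OF \<iota>(1) continuous_on_subset[OF cont] sub'] by (auto simp: E_def)
    moreover have "inj_on (\<lambda>x. \<iota> (\<beta> x)) E"
    proof (rule inj_onI)
      fix x y assume "x \<in> E" "y \<in> E" "\<iota> (\<beta> x) = \<iota> (\<beta> y)"
      then have "\<beta> x = \<beta> y" using bk by metis
      then show "x = y" using inj\<beta> \<open>x \<in> E\<close> \<open>y \<in> E\<close> by (auto simp: E_def inj_on_def)
    qed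
    ultimately have "open ((\<lambda>x. \<iota> (\<beta> x)) ` E)" using invariance_of_domain[OF _ oE] by blast
    moreover have "t0 \<in> (\<lambda>x. \<iota> (\<beta> x)) ` E" using E0 \<iota>(2)[of t0] \<beta>(2) \<delta>(1) by (intro image_eqI[of _ _ 0]) auto
    moreover have "\<gamma> ` (\<lambda>x. \<iota> (\<beta> x)) ` E \<subseteq> \<beta> ` {-1<..<1}" using bk by (auto simp: E_def)
    ultimately show ?thesis using bk by (intro exI[of _ "(\<lambda>x. \<iota> (\<beta> x)) ` E"]) blast
  qed
  obtain J1 where J1: "open J1" "t0 \<in> J1" "J1 \<subseteq> {t0-\<delta><..<t0+\<delta>}" "\<gamma> ` J1 \<subseteq> \<gamma>1 ` {-1<..<1}"
    using key[of \<gamma>1] U by blast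
  obtain J2 where J2: "open J2" "t0 \<in> J2" "J2 \<subseteq> {t0-\<delta><..<t0+\<delta>}" "\<gamma> ` J2 \<subseteq> \<gamma>2 ` {-1<..<1}"
    using key[of \<gamma>2] U by blast
  have "open (J1 \<inter> J2)" "t0 \<in> J1 \<inter> J2" using J1 J2 by auto
  then obtain e where e: "e > 0" "ball t0 e \<subseteq> J1 \<inter> J2" using openE by blast
  define t where "t = t0 + e / 2"
  have t: "t \<in> J1" "t \<in> J2" "t \<noteq> t0" using e by (auto simp: t_def subset_iff dist_real_def)
  then have "\<gamma> t \<in> \<gamma>1 ` {-1<..<1} \<inter> \<gamma>2 ` {-1<..<1}" using J1 J2 by blast
  then have "\<gamma> t = \<gamma> t0" using U(7) by blast
  moreover have "t \<in> {t0-\<delta>..t0+\<delta>}" "t0 \<in> {t0-\<delta>..t0+\<delta>}" using J1(3) t(1) \<delta>(1) by fastforce+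
  ultimately show False using inj_onD[OF \<delta>(5)] t(3) by blast
qed

end

section \<open>Double points of the boundary, and why they are not cusps\<close>

context univalent_curve
begin

lemma dbl_rep:
  assumes "dbl s t"
  obtains s' where "t < s'" "s' < t + 2 * pi" "dbl s' t" "cis s' = cis s"
proof -
  have "cis s \<in> sphere 0 1" by simp
  then obtain s' where s': "s' \<in> {t..<t + 2 * pi}" "cis s = cis s'" unfolding sphere_eq[of t] by blast
  then have "dbl s' t" using assms by (auto simp: dbl_def \<gamma>_eq)
  moreover have "s' \<noteq> t" using calculation by (auto simp: dbl_def)
  ultimately show ?thesis using that[of s'] s' by auto
qed

lemma frontier_double:
  assumes d: "dbl s0 t0" "t0 < s0" "s0 < t0 + 2 * pi"
  obtains \<delta>0 where "\<delta>0 > 0"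
    "\<And>\<delta>. 0 < \<delta> \<Longrightarrow> \<delta> \<le> \<delta>0 \<Longrightarrow> \<exists>V. open V \<and> frontier \<Omega> \<inter> V = \<gamma> ` {t0-\<delta><..<t0+\<delta>} \<union> \<gamma> ` {s0-\<delta><..<s0+\<delta>}"
    "\<And>\<delta>. 0 < \<delta> \<Longrightarrow> \<delta> \<le> \<delta>0 \<Longrightarrow> \<gamma> ` {t0-\<delta>..t0+\<delta>} \<inter> \<gamma> ` {s0-\<delta>..s0+\<delta>} = {\<gamma> t0}"
    "\<And>\<delta>. 0 < \<delta> \<Longrightarrow> \<delta> \<le> \<delta>0 \<Longrightarrow> inj_on \<gamma> {t0-\<delta>..t0+\<delta>} \<and> inj_on \<gamma> {s0-\<delta>..s0+\<delta>}"
    "\<And>\<delta> t. 0 < \<delta> \<Longrightarrow> \<delta> \<le> \<delta>0 \<Longrightarrow> t \<in> {t0-\<delta>..t0+\<delta>} \<union> {s0-\<delta>..s0+\<delta>} \<Longrightarrow> f t \<noteq> 0"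
    "\<And>\<delta> t s. 0 < \<delta> \<Longrightarrow> \<delta> \<le> \<delta>0 \<Longrightarrow> t \<in> {t0-\<delta>..t0+\<delta>} \<union> {s0-\<delta>..s0+\<delta>} \<Longrightarrow> t \<noteq> t0 \<Longrightarrow> t \<noteq> s0 \<Longrightarrow> \<not> dbl s t"
    "t0 + \<delta>0 < s0 - \<delta>0" "s0 + \<delta>0 < t0 - \<delta>0 + 2 * pi"
proof -
  obtain d1 where d1: "d1 > 0" "\<And>t. t \<noteq> t0 \<Longrightarrow> \<bar>t - t0\<bar> < d1 \<Longrightarrow> f t \<noteq> 0 \<and> (\<forall>s. \<not> dbl s t)"
    using isolated_singular by metis
  obtain d2 where d2: "d2 > 0" "\<And>t. t \<noteq> s0 \<Longrightarrow> \<bar>t - s0\<bar> < d2 \<Longrightarrow> f t \<noteq> 0 \<and> (\<forall>s. \<not> dbl s t)"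
    using isolated_singular by metis
  define \<eta> where "\<eta> = min (s0 - t0) (t0 + 2 * pi - s0)"
  have \<eta>: "\<eta> > 0" "\<eta> \<le> s0 - t0" "\<eta> \<le> t0 + 2 * pi - s0" using d by (auto simp: \<eta>_def)
  \<comment> \<open>A third of the distance of t0 and s0 on the circle leaves a gap between the two
    windows on both sides.\<close>
  define \<delta>0 where "\<delta>0 = min (min d1 d2) \<eta> / 3"
  have \<delta>0: "\<delta>0 > 0" "\<delta>0 < d1" "\<delta>0 < d2" "3 * \<delta>0 \<le> \<eta>" using d1 d2 \<eta> by (auto simp: \<delta>0_def)
  have gap: "t0 + \<delta>0 < s0 - \<delta>0" "s0 + \<delta>0 < t0 - \<delta>0 + 2 * pi" using \<delta>0 \<eta> by auto
  show ?thesis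
  proof (rule that[OF \<delta>0(1) _ _ _ _ _ gap])
    fix \<delta> assume \<delta>: "0 < \<delta>" "\<delta> \<le> \<delta>0"
    show fz: "f t \<noteq> 0" if "t \<in> {t0-\<delta>..t0+\<delta>} \<union> {s0-\<delta>..s0+\<delta>}" for t
      using that dbl_tangent(1,2)[OF d(1)] d1(2)[of t] d2(2)[of t] \<delta> \<delta>0
      by (cases "t = t0"; cases "t = s0") (auto simp: abs_less_iff)
    show nd: "\<not> dbl s t" if "t \<in> {t0-\<delta>..t0+\<delta>} \<union> {s0-\<delta>..s0+\<delta>}" "t \<noteq> t0" "t \<noteq> s0" for t s
      using that d1(2)[of t] d2(2)[of t] \<delta> \<delta>0 by (auto simp: abs_less_iff)
    have only: "u = s0" if "dbl u t0" "\<bar>u - s0\<bar> < 2 * pi" for u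
    proof -
      have "cis u = cis s0" using no_triple[OF that(1) dbl_sym[OF d(1)]] .
      then show ?thesis using cis_eq_window that(2) by blast
    qed
    have only': "u = t0" if "dbl u s0" "\<bar>u - t0\<bar> < 2 * pi" for u
    proof -
      have "cis u = cis t0" using no_triple[OF that(1) d(1)] .
      then show ?thesis using cis_eq_window that(2) by blast
    qed
    show inj2: "inj_on \<gamma> {t0-\<delta>..t0+\<delta>} \<and> inj_on \<gamma> {s0-\<delta>..s0+\<delta>}"
    proof (intro conjI inj_onI)
      fix x y assume xy: "x \<in> {t0-\<delta>..t0+\<delta>}" "y \<in> {t0-\<delta>..t0+\<delta>}" "\<gamma> x = \<gamma> y"
      show "x = y"
      proof (rule ccontr)
        assume ne: "x \<noteq> y"
        have "\<bar>x - y\<bar> < 2 * pi" using xy \<delta> \<delta>0 \<eta> gap by auto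
        then have db: "dbl x y" "dbl y x" using \<gamma>_eq_cases[OF xy(3)] ne dbl_sym by auto
        then have "x = t0" "y = t0" using nd[of x y] nd[of y x] xy gap \<delta> by auto
        then show False using ne by simp
      qed
    next
      fix x y assume xy: "x \<in> {s0-\<delta>..s0+\<delta>}" "y \<in> {s0-\<delta>..s0+\<delta>}" "\<gamma> x = \<gamma> y"
      show "x = y"
      proof (rule ccontr)
        assume ne: "x \<noteq> y"
        have "\<bar>x - y\<bar> < 2 * pi" using xy \<delta> \<delta>0 \<eta> gap by auto
        then have db: "dbl x y" "dbl y x" using \<gamma>_eq_cases[OF xy(3)] ne dbl_sym by auto
        then have "x = s0" "y = s0" using nd[of x y] nd[of y x] xy gap \<delta> by auto
        then show False using ne by simp
      qed
    qed
    show "\<gamma> ` {t0-\<delta>..t0+\<delta>} \<inter> \<gamma> ` {s0-\<delta>..s0+\<delta>} = {\<gamma> t0}"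
    proof (intro equalityI subsetI)
      fix w assume "w \<in> \<gamma> ` {t0-\<delta>..t0+\<delta>} \<inter> \<gamma> ` {s0-\<delta>..s0+\<delta>}"
      then obtain x y where xy: "x \<in> {t0-\<delta>..t0+\<delta>}" "y \<in> {s0-\<delta>..s0+\<delta>}" "w = \<gamma> x" "\<gamma> x = \<gamma> y" by blast
      have "\<bar>x - y\<bar> < 2 * pi" "x \<noteq> y" using xy \<delta> gap by (auto simp: abs_less_iff)
      then have "dbl y x" using \<gamma>_eq_cases[OF xy(4)] dbl_sym by auto
      then have "x = t0" using nd[of x y] xy gap \<delta> by auto
      then show "w \<in> {\<gamma> t0}" using xy by simp
    next
      fix w assume "w \<in> {\<gamma> t0}"
      moreover have "\<gamma> t0 = \<gamma> s0" using d by (simp add: dbl_def)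
      ultimately have "w = \<gamma> t0" "w = \<gamma> s0" by auto
      then show "w \<in> \<gamma> ` {t0-\<delta>..t0+\<delta>} \<inter> \<gamma> ` {s0-\<delta>..s0+\<delta>}"
        using \<delta> by (intro IntI image_eqI[of _ \<gamma> t0] image_eqI[of _ \<gamma> s0]) auto
    qed
    \<comment> \<open>The midpoint of the arc left free by the windows, so that one period starting
      there contains both.\<close>
    define a where "a = t0 - \<delta> - (t0 - \<delta> + 2 * pi - (s0 + \<delta>)) / 2"
    have a: "a < t0 - \<delta>" "s0 + \<delta> < a + 2 * pi" using gap \<delta> by (auto simp: a_def field_simps)
    have "\<exists>V. open V \<and> frontier \<Omega> \<inter> V = \<gamma> ` ({t0-\<delta><..<t0+\<delta>} \<union> {s0-\<delta><..<s0+\<delta>})"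
    proof (rule frontier_window[of "{t0-\<delta><..<t0+\<delta>} \<union> {s0-\<delta><..<s0+\<delta>}" a])
      show "{t0-\<delta><..<t0+\<delta>} \<union> {s0-\<delta><..<s0+\<delta>} \<subseteq> {a<..<a + 2 * pi}" using a gap \<delta> by auto
      fix t t' assume t: "t \<in> {t0-\<delta><..<t0+\<delta>} \<union> {s0-\<delta><..<s0+\<delta>}"
        and t': "t' \<in> {a..a + 2 * pi} - ({t0-\<delta><..<t0+\<delta>} \<union> {s0-\<delta><..<s0+\<delta>})"
      show "\<gamma> t \<noteq> \<gamma> t'"
      proof
        assume eq: "\<gamma> t = \<gamma> t'"
        have ne: "t \<noteq> t'" using t t' by auto
        have "\<bar>t - t'\<bar> < 2 * pi" using t t' a gap \<delta> by auto
        then have db: "dbl t' t" using \<gamma>_eq_cases[OF eq] ne dbl_sym by auto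
        moreover have "t \<in> {t0-\<delta>..t0+\<delta>} \<union> {s0-\<delta>..s0+\<delta>}" using t by auto
        ultimately have "t = t0 \<or> t = s0" using nd[of t t'] by blast
        then show False
        proof
          assume "t = t0"
          then have "t' = s0" using only[of t'] db t' a gap \<delta> d by auto
          then show False using t' \<delta> by auto
        next
          assume "t = s0"
          then have "t' = t0" using only'[of t'] db t' a gap \<delta> d by auto
          then show False using t' \<delta> by auto
        qed
      qed
    qed auto
    then show "\<exists>V. open V \<and> frontier \<Omega> \<inter> V = \<gamma> ` {t0-\<delta><..<t0+\<delta>} \<union> \<gamma> ` {s0-\<delta><..<s0+\<delta>}"
      by (simp only: image_Un)
  qed
qed

lemma double_point:
  assumes "dbl s t0"
  shows "boundary_double_point \<Omega> (\<gamma> t0)"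
proof -
  obtain s0 where d: "t0 < s0" "s0 < t0 + 2 * pi" "dbl s0 t0" using dbl_rep[OF assms] by metis
  obtain \<delta> where \<delta>: "\<delta> > 0"
    "\<And>e. 0 < e \<Longrightarrow> e \<le> \<delta> \<Longrightarrow> \<exists>V. open V \<and> frontier \<Omega> \<inter> V = \<gamma> ` {t0-e<..<t0+e} \<union> \<gamma> ` {s0-e<..<s0+e}"
    "\<And>e. 0 < e \<Longrightarrow> e \<le> \<delta> \<Longrightarrow> \<gamma> ` {t0-e..t0+e} \<inter> \<gamma> ` {s0-e..s0+e} = {\<gamma> t0}"
    "\<And>e. 0 < e \<Longrightarrow> e \<le> \<delta> \<Longrightarrow> inj_on \<gamma> {t0-e..t0+e} \<and> inj_on \<gamma> {s0-e..s0+e}"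
    "\<And>e t. 0 < e \<Longrightarrow> e \<le> \<delta> \<Longrightarrow> t \<in> {t0-e..t0+e} \<union> {s0-e..s0+e} \<Longrightarrow> f t \<noteq> 0"
    by (rule frontier_double[OF d(3,1,2)]) (assumption | rule that)+
  obtain V where V: "open V" "frontier \<Omega> \<inter> V = \<gamma> ` {t0-\<delta><..<t0+\<delta>} \<union> \<gamma> ` {s0-\<delta><..<s0+\<delta>}" using \<delta>(1,2) by blast
  have st: "\<gamma> s0 = \<gamma> t0" using d by (simp add: dbl_def)
  have reg: "regular_arc (\<lambda>\<tau>. \<gamma> (u + \<delta> * \<tau>))" if u: "u = t0 \<or> u = s0" for u
    unfolding regular_arc_def
  proof (intro conjI ballI)
    have "inj_on \<gamma> {u-\<delta>..u+\<delta>}" using \<delta>(4)[OF \<delta>(1) order_refl] u by auto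
    then show "analytic_arc (\<lambda>\<tau>. \<gamma> (u + \<delta> * \<tau>))"
      by (intro \<gamma>_inj_window \<delta>(1)) (erule inj_on_subset, auto)
    fix \<tau> :: real assume \<tau>: "\<tau> \<in> {-1<..<1}"
    have "\<delta> * \<tau> < \<delta> * 1" "\<delta> * (-1) < \<delta> * \<tau>" using \<tau> \<delta>(1) by (auto simp only: mult_less_cancel_left_pos) auto
    then show "vector_derivative (\<lambda>\<tau>. \<gamma> (u + \<delta> * \<tau>)) (at \<tau>) \<noteq> 0"
      using \<delta>(1) u by (intro vector_derivative_\<gamma>_nonzero \<delta>(5)[OF \<delta>(1) order_refl]) auto
  qed
  have "\<gamma> t0 \<in> frontier \<Omega> \<inter> V" unfolding V(2) using \<delta>(1) by simp
  then have inF: "\<gamma> t0 \<in> frontier \<Omega>" "\<gamma> t0 \<in> V" by auto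
  have int: "\<gamma> ` {t0-\<delta><..<t0+\<delta>} \<inter> \<gamma> ` {s0-\<delta><..<s0+\<delta>} = {\<gamma> t0}"
  proof
    have "\<gamma> ` {t0-\<delta><..<t0+\<delta>} \<inter> \<gamma> ` {s0-\<delta><..<s0+\<delta>} \<subseteq> \<gamma> ` {t0-\<delta>..t0+\<delta>} \<inter> \<gamma> ` {s0-\<delta>..s0+\<delta>}"
      by (intro Int_mono image_mono) auto
    then show "\<gamma> ` {t0-\<delta><..<t0+\<delta>} \<inter> \<gamma> ` {s0-\<delta><..<s0+\<delta>} \<subseteq> {\<gamma> t0}" using \<delta>(3)[OF \<delta>(1) order_refl] by simp
    have "\<gamma> t0 \<in> \<gamma> ` {t0-\<delta><..<t0+\<delta>}" "\<gamma> s0 \<in> \<gamma> ` {s0-\<delta><..<s0+\<delta>}" using \<delta>(1) by auto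
    then show "{\<gamma> t0} \<subseteq> \<gamma> ` {t0-\<delta><..<t0+\<delta>} \<inter> \<gamma> ` {s0-\<delta><..<s0+\<delta>}" using st by simp
  qed
  show ?thesis unfolding boundary_double_point_def
    using inF V(1) reg[of t0] reg[of s0] int st
    by (intro conjI exI[of _ V] exI[of _ "\<lambda>\<tau>. \<gamma> (t0 + \<delta> * \<tau>)"] exI[of _ "\<lambda>\<tau>. \<gamma> (s0 + \<delta> * \<tau>)"])
      (simp_all only: window_image[OF \<delta>(1)] V(2) mult_zero_right add_0_right simp_thms)
qed

text \<open>The interval without 0 has only four ends: at 1, at -1, and at 0 from the right and from
  the left. Each of the four disjoint sets runs into one of them, no two into the same one, so by
  counting the ends at 1 and at -1 are both taken. The sets will be the parameter sets of the four
  branches at a double point.\<close>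

lemma four_intervals:
  fixes T :: "nat \<Rightarrow> real set"
  assumes conn: "\<And>j. j < 4 \<Longrightarrow> connected (T j)" and dis: "\<And>i j. i < 4 \<Longrightarrow> j < 4 \<Longrightarrow> i \<noteq> j \<Longrightarrow> T i \<inter> T j = {}"
    and sub: "\<And>j. j < 4 \<Longrightarrow> T j \<subseteq> {-1<..<1} - {0}"
    and lim: "\<And>j. j < 4 \<Longrightarrow> \<exists>x e. (\<forall>n. x n \<in> T j) \<and> x \<longlonglongrightarrow> e \<and> e \<in> {-1,0,1}"
  shows "\<exists>j<4. \<exists>m<1. {m<..<1} \<subseteq> T j" "\<exists>j<4. \<exists>m>-1. {-1<..<m} \<subseteq> T j"
proof -
  define slot where "slot k = (\<lambda>m::real. if k = (0::nat) then {m<..<1} else if k = 1 then {-1<..<m}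
      else if k = 2 then {0<..<m} else {m<..<0})" for k
  define ok where "ok k m \<longleftrightarrow> (if k = (0::nat) then m < 1 else if k = 1 then m > (-1::real) else if k = 2 then m > 0 else m < 0)" for k m
  have ex: "\<exists>k<4. \<exists>m. ok k m \<and> slot k m \<subseteq> T j" if j: "j < 4" for j
  proof -
    obtain x e where x: "\<And>n. x n \<in> T j" "x \<longlonglongrightarrow> e" "e \<in> {-1,0,1}" using lim[OF j] by blast
    have btw: "u \<in> T j" if "a \<in> T j" "b \<in> T j" "a \<le> u" "u \<le> b" for a b u
      using conn[OF j] that by (meson connectedD_interval)
    define m where "m = x 0"
    have m: "m \<in> T j" "m < 1" "m > -1" "m \<noteq> 0" using x(1)[of 0] sub[OF j] by (auto simp: m_def)
    have up: "\<exists>n. x n > u" if "u < e" for u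
      using order_tendstoD(1)[OF x(2) that] by (auto simp: eventually_sequentially)
    have down: "\<exists>n. x n < u" if "u > e" for u
      using order_tendstoD(2)[OF x(2) that] by (auto simp: eventually_sequentially)
    consider "e = 1" | "e = -1" | "e = 0" "m > 0" | "e = 0" "m < 0" using x(3) m(4) by (cases m "0::real" rule: linorder_cases) auto
    then show ?thesis
    proof cases
      case 1
      have "u \<in> T j" if u: "u \<in> {m<..<1}" for u
        using up[of u] 1 u btw[OF m(1) x(1)] by (auto intro: less_imp_le)
      then show ?thesis using m by (intro exI[of _ 0] exI[of _ m] conjI) (auto simp: slot_def ok_def)
    next
      case 2
      have "u \<in> T j" if u: "u \<in> {-1<..<m}" for u
        using down[of u] 2 u btw[OF x(1) m(1)] by (auto intro: less_imp_le)
      then show ?thesis using m by (intro exI[of _ 1] exI[of _ m] conjI) (auto simp: slot_def ok_def)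
    next
      case 3
      have "u \<in> T j" if u: "u \<in> {0<..<m}" for u
        using down[of u] 3 u btw[OF x(1) m(1)] by (auto intro: less_imp_le)
      then show ?thesis using 3 by (intro exI[of _ 2] exI[of _ m] conjI) (auto simp: slot_def ok_def)
    next
      case 4
      have "u \<in> T j" if u: "u \<in> {m<..<0}" for u
        using up[of u] 4 u btw[OF m(1) x(1)] by (auto intro: less_imp_le)
      then show ?thesis using 4 by (intro exI[of _ 3] exI[of _ m] conjI) (auto simp: slot_def ok_def)
    qed
  qed
  then obtain K where K: "\<And>j. j < 4 \<Longrightarrow> K j < (4::nat) \<and> (\<exists>m. ok (K j) m \<and> slot (K j) m \<subseteq> T j)" by metis
  have meet: "slot k m \<inter> slot k m' \<noteq> {}" if "ok k m" "ok k m'" for k m m'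
  proof -
    have "max m m' / 2 + 1/2 \<in> slot k m \<inter> slot k m'" if "k = 0"
      using that \<open>ok k m\<close> \<open>ok k m'\<close> by (auto simp: slot_def ok_def max_def)
    moreover have "min m m' / 2 - 1/2 \<in> slot k m \<inter> slot k m'" if "k = 1"
      using that \<open>ok k m\<close> \<open>ok k m'\<close> by (auto simp: slot_def ok_def min_def)
    moreover have "min m m' / 2 \<in> slot k m \<inter> slot k m'" if "k = 2"
      using that \<open>ok k m\<close> \<open>ok k m'\<close> by (auto simp: slot_def ok_def min_def)
    moreover have "max m m' / 2 \<in> slot k m \<inter> slot k m'" if "k \<noteq> 0" "k \<noteq> 1" "k \<noteq> 2"
      using that \<open>ok k m\<close> \<open>ok k m'\<close> by (auto simp: slot_def ok_def max_def)
    ultimately show ?thesis by blast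
  qed
  have "inj_on K {..<4}"
  proof (rule inj_onI)
    fix i j assume ij: "i \<in> {..<4}" "j \<in> {..<4}" "K i = K j"
    obtain m where m: "ok (K i) m" "slot (K i) m \<subseteq> T i" using K[of i] ij by auto
    obtain m' where m': "ok (K i) m'" "slot (K i) m' \<subseteq> T j" using K[of j] ij by auto
    have "T i \<inter> T j \<noteq> {}" using meet[OF m(1) m'(1)] m m' by blast
    then show "i = j" using dis ij by auto
  qed
  moreover have "K ` {..<4} \<subseteq> {..<4}" using K by auto
  ultimately have surj: "K ` {..<4} = {..<4}" by (intro endo_inj_surj) auto
  have "0 \<in> K ` {..<4}" "1 \<in> K ` {..<4}" unfolding surj by auto
  then obtain j0 j1 where j: "j0 < 4" "K j0 = 0" "j1 < 4" "K j1 = 1" by auto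
  show "\<exists>j<4. \<exists>m<1. {m<..<1} \<subseteq> T j" using K[of j0] j by (auto simp: slot_def ok_def)
  show "\<exists>j<4. \<exists>m>-1. {-1<..<m} \<subseteq> T j" using K[of j1] j by (auto simp: slot_def ok_def)
qed

text \<open>The obstacle is the figure-eight, where one arc passes the double point at parameter 0
  and returns to it at both ends. By \<open>four_intervals\<close> the branches fill both ends of
  the parameter interval, so the arc has a compact image and is the whole frontier. Then it also
  runs through the cusp at t1 with nonzero velocity, which is impossible.\<close>

lemma double_not_cusp:
  assumes db: "dbl s t0" and cusp: "f t1 = 0"
  shows "\<not> boundary_cusp \<Omega> (\<gamma> t0)"
proof
  assume "boundary_cusp \<Omega> (\<gamma> t0)"
  then obtain U \<beta> where U: "open U" "\<gamma> t0 \<in> U" "analytic_arc \<beta>" "\<beta> 0 = \<gamma> t0"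
    "\<forall>t\<in>{-1<..<1} - {0}. vector_derivative \<beta> (at t) \<noteq> 0" "frontier \<Omega> \<inter> U = \<beta> ` {-1<..<1}"
    unfolding boundary_cusp_def by blast
  have cont\<beta>: "continuous_on {-1<..<1} \<beta>" by (rule analytic_arc_continuous[OF U(3)])
  have inj\<beta>: "inj_on \<beta> {-1<..<1}" using U(3) by (simp add: analytic_arc_def)
  obtain s0 where d: "t0 < s0" "s0 < t0 + 2 * pi" "dbl s0 t0" using dbl_rep[OF db] by metis
  have st: "\<gamma> s0 = \<gamma> t0" using d by (simp add: dbl_def)
  obtain \<delta>0 where \<delta>0: "\<delta>0 > 0"
    "\<And>e. 0 < e \<Longrightarrow> e \<le> \<delta>0 \<Longrightarrow> \<exists>V. open V \<and> frontier \<Omega> \<inter> V = \<gamma> ` {t0-e<..<t0+e} \<union> \<gamma> ` {s0-e<..<s0+e}"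
    "\<And>e. 0 < e \<Longrightarrow> e \<le> \<delta>0 \<Longrightarrow> \<gamma> ` {t0-e..t0+e} \<inter> \<gamma> ` {s0-e..s0+e} = {\<gamma> t0}"
    "\<And>e. 0 < e \<Longrightarrow> e \<le> \<delta>0 \<Longrightarrow> inj_on \<gamma> {t0-e..t0+e} \<and> inj_on \<gamma> {s0-e..s0+e}"
    "\<And>e t. 0 < e \<Longrightarrow> e \<le> \<delta>0 \<Longrightarrow> t \<in> {t0-e..t0+e} \<union> {s0-e..s0+e} \<Longrightarrow> f t \<noteq> 0"
    "\<And>e t s. 0 < e \<Longrightarrow> e \<le> \<delta>0 \<Longrightarrow> t \<in> {t0-e..t0+e} \<union> {s0-e..s0+e} \<Longrightarrow> t \<noteq> t0 \<Longrightarrow> t \<noteq> s0 \<Longrightarrow> \<not> dbl s t"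
    "t0 + \<delta>0 < s0 - \<delta>0" "s0 + \<delta>0 < t0 - \<delta>0 + 2 * pi"
    by (rule frontier_double[OF d(3,1,2)]) (assumption | rule that)+
  have "\<exists>e>0. \<forall>x. \<bar>x - t0\<bar> < e \<longrightarrow> \<gamma> x \<in> U" "\<exists>e>0. \<forall>x. \<bar>x - s0\<bar> < e \<longrightarrow> \<gamma> x \<in> U"
  proof -
    have "open (\<gamma> -` U)" using U(1) \<gamma>_cont[of UNIV] by (simp add: continuous_on_open_vimage)
    moreover have "t0 \<in> \<gamma> -` U" "s0 \<in> \<gamma> -` U" using U(2) st by auto
    ultimately show "\<exists>e>0. \<forall>x. \<bar>x - t0\<bar> < e \<longrightarrow> \<gamma> x \<in> U" "\<exists>e>0. \<forall>x. \<bar>x - s0\<bar> < e \<longrightarrow> \<gamma> x \<in> U"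
      unfolding open_dist dist_real_def by blast+
  qed
  then obtain e1 e2 where e: "e1 > 0" "\<And>x. \<bar>x - t0\<bar> < e1 \<Longrightarrow> \<gamma> x \<in> U" "e2 > 0" "\<And>x. \<bar>x - s0\<bar> < e2 \<Longrightarrow> \<gamma> x \<in> U" by blast
  define \<delta> where "\<delta> = min \<delta>0 (min e1 e2 / 2)"
  have \<delta>: "0 < \<delta>" "\<delta> \<le> \<delta>0" "\<delta> < e1" "\<delta> < e2" using \<delta>0(1) e by (auto simp: \<delta>_def min_def)
  have gap: "t0 + \<delta> < s0 - \<delta>" "s0 + \<delta> < t0 - \<delta> + 2 * pi" using \<delta>0(7,8) \<delta> by auto
  \<comment> \<open>The parameters of the four branches of the frontier at the double point, without
    the point itself.\<close>
  define J where "J j = (if j = 0 then {t0<..<t0+\<delta>} else if j = 1 then {t0-\<delta><..<t0}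
     else if j = 2 then {s0<..<s0+\<delta>} else {s0-\<delta><..<s0})" for j :: nat
  define Q where "Q = \<gamma> ` {t0-\<delta>..t0+\<delta>} \<union> \<gamma> ` {s0-\<delta>..s0+\<delta>}"
  have Jcl: "J j \<subseteq> {t0-\<delta>..t0+\<delta>} \<or> J j \<subseteq> {s0-\<delta>..s0+\<delta>}" for j by (auto simp: J_def)
  have JQ: "\<gamma> ` J j \<subseteq> Q" for j using Jcl[of j] unfolding Q_def by blast
  have frQ: "Q \<subseteq> frontier \<Omega> \<inter> U"
  proof -
    have "\<gamma> x \<in> frontier \<Omega>" for x unfolding frontier_\<Omega>_sphere by (simp add: \<gamma>_eq)
    moreover have "\<gamma> x \<in> U" if "x \<in> {t0-\<delta>..t0+\<delta>} \<union> {s0-\<delta>..s0+\<delta>}" for x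
      using e(2)[of x] e(4)[of x] that \<delta> by (auto simp: abs_less_iff)
    ultimately show ?thesis by (auto simp: Q_def)
  qed
  have oJ: "open (J j)" and cJ: "connected (J j)" for j by (auto simp: J_def)
  have injQ: "x = y" if "x \<in> {t0-\<delta>..t0+\<delta>} \<union> {s0-\<delta>..s0+\<delta>}" "y \<in> {t0-\<delta>..t0+\<delta>} \<union> {s0-\<delta>..s0+\<delta>}" "\<gamma> x = \<gamma> y" "x \<noteq> t0" "x \<noteq> s0" for x y
  proof -
    have "\<bar>x - y\<bar> < 2 * pi" using that gap \<delta> by auto
    then show ?thesis using \<gamma>_eq_cases[OF that(3)] \<delta>0(6)[OF \<delta>(1,2) that(1)] that dbl_sym by blast
  qed
  have Jn: "t \<noteq> t0" "t \<noteq> s0" "t \<in> {t0-\<delta>..t0+\<delta>} \<union> {s0-\<delta>..s0+\<delta>}" if "t \<in> J j" for t j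
    using that gap \<delta>(1) by (auto simp: J_def split: if_splits)
  define T where "T j = {\<tau>\<in>{-1<..<1}. \<beta> \<tau> \<in> \<gamma> ` J j}" for j
  have facts: "connected (T j) \<and> (\<exists>x e. (\<forall>n. x n \<in> T j) \<and> x \<longlonglongrightarrow> e \<and> e \<in> {-1,0,1}) \<and> T j \<subseteq> {-1<..<1} - {0}" for j
  proof -
    have nd: "\<not> dbl u t" if "t \<in> J j" for t u using \<delta>0(6)[OF \<delta>(1,2)] Jn[OF that] by blast
    define a where "a = (if j < 2 then t0 - pi else s0 - pi)"
    have "J j \<subseteq> {a<..<a + 2 * pi}" using gap \<delta>(1) by (auto simp: J_def a_def)
    then obtain V where V: "open V" "frontier \<Omega> \<inter> V = \<gamma> ` J j"
      using frontier_nondouble_window[OF oJ _ nd] by blast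
    have \<beta>F: "\<beta> \<tau> \<in> frontier \<Omega>" if "\<tau> \<in> {-1<..<1}" for \<tau> using U(6) that by blast
    have TV: "T j = {-1<..<1} \<inter> \<beta> -` V" using V(2) \<beta>F by (auto simp: T_def)
    have oT: "open (T j)" unfolding TV using cont\<beta> V(1) by (simp add: continuous_open_preimage)
    obtain lo hi where lh: "J j \<subseteq> {lo..hi}" "inj_on \<gamma> {lo..hi}"
      using Jcl[of j] \<delta>0(4)[OF \<delta>(1,2)] by blast
    obtain \<iota> where \<iota>: "continuous_on (\<gamma> ` {lo..hi}) \<iota>" "\<And>t. t \<in> {lo..hi} \<Longrightarrow> \<iota> (\<gamma> t) = t"
      using \<gamma>_inverse[OF lh(2)] by metis
    have sub: "\<beta> ` T j \<subseteq> \<gamma> ` {lo..hi}" using lh(1) by (auto simp: T_def)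
    \<comment> \<open>In the coordinate \<iota> the arc maps T j bijectively onto the interval J j.
      By invariance of domain this is a homeomorphism, so T j is connected.\<close>
    have im: "(\<lambda>x. \<iota> (\<beta> x)) ` T j = J j"
    proof (intro equalityI subsetI)
      fix y assume "y \<in> (\<lambda>x. \<iota> (\<beta> x)) ` T j"
      then show "y \<in> J j" using \<iota>(2) lh(1) by (auto simp: T_def)
    next
      fix y assume y: "y \<in> J j"
      then have "\<gamma> y \<in> \<beta> ` {-1<..<1}" using JQ[of j] frQ U(6) by blast
      then obtain x where "x \<in> {-1<..<1}" "\<beta> x = \<gamma> y" by (metis imageE)
      then show "y \<in> (\<lambda>x. \<iota> (\<beta> x)) ` T j" using y \<iota>(2)[of y] lh(1) by (intro image_eqI[of _ _ x]) (auto simp: T_def)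
    qed
    have "continuous_on (T j) (\<lambda>x. \<iota> (\<beta> x))"
    proof -
      have "T j \<subseteq> {-1<..<1}" by (auto simp: T_def)
      then show ?thesis using continuous_on_compose2[OF \<iota>(1) continuous_on_subset[OF cont\<beta>] sub] by blast
    qed
    moreover have "inj_on (\<lambda>x. \<iota> (\<beta> x)) (T j)"
    proof (rule inj_onI)
      fix x y assume xy: "x \<in> T j" "y \<in> T j" "\<iota> (\<beta> x) = \<iota> (\<beta> y)"
      then obtain u v where "u \<in> J j" "\<beta> x = \<gamma> u" "v \<in> J j" "\<beta> y = \<gamma> v" by (auto simp: T_def)
      then have "\<beta> x = \<beta> y" using xy(3) \<iota>(2) lh(1) by (metis subsetD)
      then show "x = y" using inj\<beta> xy by (auto simp: T_def inj_on_def)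
    qed
    ultimately obtain h where h: "homeomorphism (T j) ((\<lambda>x. \<iota> (\<beta> x)) ` T j) (\<lambda>x. \<iota> (\<beta> x)) h"
      using invariance_of_domain_homeomorphism[OF oT, of "\<lambda>x. \<iota> (\<beta> x)"] by auto
    then have "T j = h ` J j" "continuous_on (J j) h" unfolding homeomorphism_def im by auto
    then have conn: "connected (T j)" using connected_continuous_image[OF _ cJ] by metis
    have T0: "T j \<subseteq> {-1<..<1} - {0}"
    proof -
      have "\<gamma> t0 \<notin> \<gamma> ` J j"
      proof
        assume "\<gamma> t0 \<in> \<gamma> ` J j"
        then obtain t where t: "t \<in> J j" "\<gamma> t = \<gamma> t0" by auto
        then have "t = t0" using injQ[of t t0] Jn[OF t(1)] \<delta>(1) by auto
        then show False using Jn[OF t(1)] by simp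
      qed
      then have "0 \<notin> T j" using U(4) by (simp add: T_def)
      then show ?thesis by (auto simp: T_def)
    qed
    \<comment> \<open>A sequence on the branch that runs into the double point; the corresponding
      parameters of the arc can accumulate only at 0 or at the two ends.\<close>
    obtain y where y: "\<And>n. y n \<in> J j" "y \<longlonglongrightarrow> t0 \<or> y \<longlonglongrightarrow> s0"
    proof -
      have l: "(\<lambda>n. c + d * inverse (real (Suc (Suc n)))) \<longlonglongrightarrow> c" for c d :: real
      proof -
        have "(\<lambda>n. c + d * inverse (real (Suc (Suc n)))) \<longlonglongrightarrow> c + d * 0"
          by (intro tendsto_intros LIMSEQ_Suc[OF LIMSEQ_inverse_real_of_nat])
        then show ?thesis by simp
      qed
      define c where "c = (if j < 2 then t0 else s0)"
      define dd where "dd = (if even j \<and> j < 3 then \<delta> else - \<delta>)"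
      have i: "0 < \<delta> * inverse (real (Suc (Suc n)))" "\<delta> * inverse (real (Suc (Suc n))) < \<delta>" for n
      proof -
        have "0 < inverse (real (Suc (Suc n)))" "inverse (real (Suc (Suc n))) < 1" by (auto simp: inverse_less_1_iff)
        then show "0 < \<delta> * inverse (real (Suc (Suc n)))" "\<delta> * inverse (real (Suc (Suc n))) < \<delta>"
          using \<delta>(1) by (metis mult_pos_pos, metis mult.right_neutral mult_less_cancel_left_pos)
      qed
      have "c + dd * inverse (real (Suc (Suc n))) \<in> J j" for n
        using i[of n] by (auto simp: J_def c_def dd_def)
      then show ?thesis using l[of c dd] that[of "\<lambda>n. c + dd * inverse (real (Suc (Suc n)))"]
        by (auto simp: c_def split: if_splits)
    qed
    have "\<forall>n. \<exists>x. x \<in> T j \<and> \<beta> x = \<gamma> (y n)"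
    proof
      fix n
      have "y n \<in> (\<lambda>x. \<iota> (\<beta> x)) ` T j" using y(1) im by simp
      then obtain x where x: "x \<in> T j" "y n = \<iota> (\<beta> x)" by blast
      then obtain u where "u \<in> J j" "\<beta> x = \<gamma> u" by (auto simp: T_def)
      then have "\<beta> x = \<gamma> (y n)" using x \<iota>(2)[of u] lh(1) by auto
      then show "\<exists>x. x \<in> T j \<and> \<beta> x = \<gamma> (y n)" using x by blast
    qed
    then obtain x where x: "\<And>n. x n \<in> T j" "\<And>n. \<beta> (x n) = \<gamma> (y n)" by metis
    have "x n \<in> {-1..1}" for n using x(1)[of n] by (auto simp: T_def)
    then obtain l r where l: "l \<in> {-1..1}" "strict_mono r" "(x \<circ> r) \<longlonglongrightarrow> l"
      using compact_Icc[of "-1::real" 1] by (metis seq_compact_def compact_imp_seq_compact)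
    have "(\<lambda>n. \<gamma> (y n)) \<longlonglongrightarrow> \<gamma> t0"
    proof -
      have "isCont \<gamma> t" for t using \<gamma>_cont[of UNIV] by (simp add: continuous_on_eq_continuous_at)
      then show ?thesis using y(2) st isCont_tendsto_compose[of t0 \<gamma> y] isCont_tendsto_compose[of s0 \<gamma> y] by auto
    qed
    then have lim: "(\<lambda>n. \<beta> (x (r n))) \<longlonglongrightarrow> \<gamma> t0"
      using LIMSEQ_subseq_LIMSEQ[OF _ l(2)] x(2) by (fastforce simp: o_def)
    have "l \<in> {-1,0,1}"
    proof (rule ccontr)
      assume nl: "l \<notin> {-1,0,1}"
      then have l1: "l \<in> {-1<..<1}" using l(1) by auto
      then have "isCont \<beta> l" using cont\<beta> by (simp add: continuous_on_eq_continuous_at)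
      then have "(\<lambda>n. \<beta> (x (r n))) \<longlonglongrightarrow> \<beta> l" using l(3) isCont_tendsto_compose[of l \<beta> "x \<circ> r"] by (simp add: o_def)
      then have "\<beta> l = \<beta> 0" using lim LIMSEQ_unique U(4) by metis
      then have "l = 0" using inj\<beta> l1 by (auto simp: inj_on_def)
      then show False using nl by simp
    qed
    then show ?thesis using conn T0 l x(1) by (intro conjI exI[of _ "x \<circ> r"] exI[of _ l]) auto
  qed
  have dis: "T i \<inter> T j = {}" if ij: "i < 4" "j < 4" "i \<noteq> j" for i j
  proof (rule ccontr)
    assume "T i \<inter> T j \<noteq> {}"
    then obtain x where "\<beta> x \<in> \<gamma> ` J i" "\<beta> x \<in> \<gamma> ` J j" by (auto simp: T_def)
    moreover from this(1) obtain u where "u \<in> J i" "\<beta> x = \<gamma> u" by blast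
    moreover from calculation(2) obtain v where "v \<in> J j" "\<beta> x = \<gamma> v" by blast
    ultimately have uv: "u \<in> J i" "v \<in> J j" "\<gamma> u = \<gamma> v" by auto
    then have "u = v" using injQ Jn by blast
    moreover have "J i \<inter> J j = {}" using ij gap \<delta>(1) by (auto simp: J_def)
    ultimately show False using uv by blast
  qed
  obtain j0 m0 where j0: "m0 < 1" "{m0<..<1} \<subseteq> T j0" using four_intervals(1)[of T] facts dis by blast
  obtain j1 m1 where j1: "m1 > -1" "{-1<..<m1} \<subseteq> T j1" using four_intervals(2)[of T] facts dis by blast
  \<comment> \<open>Beyond these bounds the arc stays on the branches, which are contained in the
    compact set Q.\<close>
  define lo hi where "lo = min 0 ((m1 - 1) / 2)" and "hi = max 0 ((m0 + 1) / 2)"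
  have lh: "-1 < lo" "lo \<le> 0" "hi < 1" "hi \<ge> 0" using j0 j1 by (auto simp: lo_def hi_def)
  have cover: "\<beta> ` {-1<..<1} = \<beta> ` {lo..hi} \<union> Q"
  proof
    show "\<beta> ` {-1<..<1} \<subseteq> \<beta> ` {lo..hi} \<union> Q"
    proof
      fix w assume "w \<in> \<beta> ` {-1<..<1}"
      then obtain x where x: "x \<in> {-1<..<1}" "w = \<beta> x" by blast
      consider "x \<in> {lo..hi}" | "x < lo" | "x > hi" by fastforce
      then show "w \<in> \<beta> ` {lo..hi} \<union> Q"
      proof cases
        case 2
        then have "x < m1" using j1 by (auto simp: lo_def min_def split: if_splits)
        then have "x \<in> T j1" using j1 x by auto
        then show ?thesis using JQ[of j1] x by (auto simp: T_def)
      next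
        case 3
        then have "x > m0" using j0 by (auto simp: hi_def max_def split: if_splits)
        then have "x \<in> T j0" using j0 x by auto
        then show ?thesis using JQ[of j0] x by (auto simp: T_def)
      qed (use x in auto)
    qed
    have "\<beta> ` {lo..hi} \<subseteq> \<beta> ` {-1<..<1}" using lh by (intro image_mono) auto
    then show "\<beta> ` {lo..hi} \<union> Q \<subseteq> \<beta> ` {-1<..<1}" using frQ U(6) by blast
  qed
  have "compact (\<beta> ` {lo..hi} \<union> Q)" unfolding Q_def
    using cont\<beta> lh by (intro compact_Un compact_continuous_image \<gamma>_cont continuous_on_subset[OF cont\<beta>]) auto
  then have "closed (\<beta> ` {-1<..<1})" unfolding cover by (rule compact_imp_closed)
  have "isCont g z" if "z \<in> sphere 0 1" for z using g_isCont[of z] that by (cases "z = 0") auto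
  then have "connected (frontier \<Omega>)" unfolding frontier_\<Omega>_sphere
    by (intro connected_continuous_image connected_sphere continuous_at_imp_continuous_on) auto
  \<comment> \<open>The image of the arc is closed and also relatively open in the frontier, being
    cut out by U; the frontier is connected.\<close>
  have allF: "frontier \<Omega> \<subseteq> \<beta> ` {-1<..<1}"
  proof (rule ccontr)
    assume ns: "\<not> frontier \<Omega> \<subseteq> \<beta> ` {-1<..<1}"
    have "\<gamma> t0 \<in> frontier \<Omega> \<inter> U" using U(2) frQ \<delta>(1) unfolding Q_def by auto
    then show False
      using connectedD[OF \<open>connected (frontier \<Omega>)\<close> U(1) open_Compl[OF \<open>closed (\<beta> ` {-1<..<1})\<close>]] U(6) ns by blast
  qed
  have "\<gamma> t1 \<in> frontier \<Omega>" unfolding frontier_\<Omega>_sphere by (simp add: \<gamma>_eq)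
  then obtain \<tau> where \<tau>: "\<tau> \<in> {-1<..<1}" "\<beta> \<tau> = \<gamma> t1" using allF by (metis imageE subsetD)
  have "\<tau> \<noteq> 0"
  proof
    assume "\<tau> = 0"
    then have eq: "\<gamma> t1 = \<gamma> t0" using \<tau> U(4) by simp
    show False
    proof (cases "cis t1 = cis t0")
      case True
      then show False using cusp dbl_tangent(2)[OF d(3)] by (simp add: f_zero_iff)
    next
      case False
      then have "dbl t1 t0" using eq by (simp add: dbl_def)
      then show False using cusp dbl_tangent by blast
    qed
  qed
  then have "vector_derivative \<beta> (at \<tau>) \<noteq> 0" using U(5) \<tau> by auto
  then show False
    using no_regular_path_through_cusp[OF cusp analytic_arc_vector_derivative[OF U(3) \<tau>(1)] _ \<tau>(2,1)] U(6) by blast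
qed

text \<open>One genuine cusp is enough for the local definitions to tell all boundary points apart;
  it enters through \<open>double_not_cusp\<close>.\<close>

lemma boundary_classification:
  assumes cusp: "f t1 = 0"
  shows "{z. boundary_cusp \<Omega> z} = \<gamma> ` {t\<in>{0..<2 * pi}. f t = 0}"
    and "{z. boundary_double_point \<Omega> z} = \<gamma> ` {t\<in>{0..<2 * pi}. \<exists>s. dbl s t}"
proof -
  have F: "z \<in> frontier \<Omega> \<Longrightarrow> \<exists>t\<in>{0..<2 * pi}. z = \<gamma> t" for z using frontier_\<Omega>[of 0] by auto
  show "{z. boundary_cusp \<Omega> z} = \<gamma> ` {t\<in>{0..<2 * pi}. f t = 0}"
  proof (intro equalityI subsetI)
    fix z assume "z \<in> {z. boundary_cusp \<Omega> z}"
    then have z: "boundary_cusp \<Omega> z" by simp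
    then have "z \<in> frontier \<Omega>" by (simp add: boundary_cusp_def)
    then obtain t where t: "t \<in> {0..<2 * pi}" "z = \<gamma> t" using F by blast
    have "f t = 0"
    proof (rule ccontr)
      assume ft: "f t \<noteq> 0"
      show False
      proof (cases "\<exists>s. dbl s t")
        case True then show False using double_not_cusp[OF _ cusp] z t by blast
      next
        case False then show False using regular_point[OF _ ft] z t by (auto simp: boundary_cusp_def)
      qed
    qed
    then show "z \<in> \<gamma> ` {t\<in>{0..<2 * pi}. f t = 0}" using t by auto
  qed (use cusp_point in auto)
  show "{z. boundary_double_point \<Omega> z} = \<gamma> ` {t\<in>{0..<2 * pi}. \<exists>s. dbl s t}"
  proof (intro equalityI subsetI)
    fix z assume "z \<in> {z. boundary_double_point \<Omega> z}"
    then have z: "boundary_double_point \<Omega> z" by simp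
    then have "z \<in> frontier \<Omega>" by (simp add: boundary_double_point_def)
    then obtain t where t: "t \<in> {0..<2 * pi}" "z = \<gamma> t" using F by blast
    then have "\<exists>s. dbl s t" using nondouble_not_double_point z by blast
    then show "z \<in> \<gamma> ` {t\<in>{0..<2 * pi}. \<exists>s. dbl s t}" using t by auto
  qed (use double_point in auto)
qed

end

section \<open>Counting tangency chords\<close>

text \<open>The image of the chord is a Jordan curve, because q identifies only its end points. Each
  side of the chord is convex and therefore goes into one component. That the two sides go into
  different ones is seen at the midpoint of the chord, where the image of a small disc is open and
  meets both components.\<close>

lemma chord_separation:
  fixes q :: "complex \<Rightarrow> complex"
  assumes cont: "continuous_on (cball 0 1) q" and hol: "q holomorphic_on ball 0 1" and inj: "inj_on q (ball 0 1)"
    and bd: "\<And>z w. norm z < 1 \<Longrightarrow> norm w = 1 \<Longrightarrow> q z \<noteq> q w"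
    and uv: "norm u = 1" "norm v = 1" "u \<noteq> v" "q u = q v"
    and only: "\<And>w. norm w = 1 \<Longrightarrow> q w = q u \<Longrightarrow> w = u \<or> w = v"
    and x: "norm x \<le> 1" "Im ((x - u) / (v - u)) < 0" and y: "norm y \<le> 1" "Im ((y - u) / (v - u)) > 0"
  shows "(q x \<in> inside (q ` closed_segment u v) \<and> q y \<in> outside (q ` closed_segment u v)) \<or>
         (q x \<in> outside (q ` closed_segment u v) \<and> q y \<in> inside (q ` closed_segment u v))"
proof -
  define C where "C = q ` closed_segment u v"
  define Xp where "Xp = {z\<in>cball 0 1. Im ((z - u) / (v - u)) > 0}"
  define Xm where "Xm = {z\<in>cball 0 1. Im ((z - u) / (v - u)) < 0}"
  have seg: "norm z < 1" if "z \<in> open_segment u v" for z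
    using dist_decreases_open_segment[OF that, of 0] uv by simp
  have segc: "closed_segment u v \<subseteq> cball 0 1"
    using uv by (intro closed_segment_subset) auto
  have onseg: "Im ((z - u) / (v - u)) = 0" if zc: "z \<in> closed_segment u v" for z
  proof -
    obtain s where s: "z = (1 - s) *\<^sub>R u + s *\<^sub>R v" using zc unfolding closed_segment_def by blast
    have "z - u = s *\<^sub>R (v - u)" unfolding s by (simp add: algebra_simps)
    then have "(z - u) / (v - u) = of_real s" using uv by (simp add: scaleR_conv_of_real)
    then show ?thesis by simp
  qed
  define c where "c = q \<circ> linepath u v"
  have pc: "path c" unfolding c_def
    using segc by (intro path_continuous_image continuous_on_subset[OF cont]) auto
  have pimg: "path_image c = C" by (simp add: c_def C_def path_image_compose)
  have lp: "linepath u v s \<in> open_segment u v" if "0 < s" "s < 1" for s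
    using that uv by (auto simp: linepath_def in_segment)
  have "simple_path c"
    unfolding simple_path_def loop_free_def
  proof (intro conjI pc ballI impI)
    fix a b :: real assume ab: "a \<in> {0..1}" "b \<in> {0..1}" "c a = c b"
    have endp: "linepath u v s = u \<or> linepath u v s = v" if "s = 0 \<or> s = 1" for s using that by (auto simp: linepath_def)
    consider "0 < a \<and> a < 1" "0 < b \<and> b < 1" | "a = 0 \<or> a = 1" "0 < b \<and> b < 1" | "0 < a \<and> a < 1" "b = 0 \<or> b = 1"
      | "a = 0 \<or> a = 1" "b = 0 \<or> b = 1" using ab by fastforce
    then show "a = b \<or> a = 0 \<and> b = 1 \<or> a = 1 \<and> b = 0"
    proof cases
      case 1
      then have "linepath u v a = linepath u v b"
        using ab(3) inj seg[OF lp] by (auto simp: c_def inj_on_def)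
      then show ?thesis using inj_on_linepath[OF uv(3)] ab by (auto simp: inj_on_def)
    next
      case 2
      then show ?thesis using bd[OF seg[OF lp, of b], of u] bd[OF seg[OF lp, of b], of v] ab(3) endp[of a] uv by (auto simp: c_def)
    next
      case 3
      then show ?thesis using bd[OF seg[OF lp, of a], of u] bd[OF seg[OF lp, of a], of v] ab(3) endp[of b] uv by (auto simp: c_def)
    qed auto
  qed
  moreover have "pathfinish c = pathstart c" using uv by (simp add: c_def pathstart_def pathfinish_def linepath_def)
  ultimately have J: "open (inside C)" "open (outside C)" "frontier (inside C) = C" "frontier (outside C) = C"
       "inside C \<inter> outside C = {}" "inside C \<union> outside C = - C"
    using Jordan_inside_outside[of c] by (auto simp: pimg)
  have dis: "q z \<notin> C" if z: "norm z \<le> 1" "Im ((z - u) / (v - u)) \<noteq> 0" for z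
  proof
    assume "q z \<in> C"
    then obtain w where w: "w \<in> closed_segment u v" "q z = q w" by (auto simp: C_def)
    have zw: "z \<noteq> w" "z \<noteq> u" "z \<noteq> v" using onseg[OF w(1)] z uv by auto
    have w': "w \<in> open_segment u v \<or> w = u \<or> w = v" using w(1) by (auto simp: open_segment_def)
    show False
    proof (cases "norm z < 1")
      case True
      then have "w \<noteq> u" "w \<noteq> v" using bd w(2) uv by metis+
      then have "norm w < 1" using w' seg by blast
      then show False using inj True w(2) zw by (auto simp: inj_on_def)
    next
      case False
      then have nz: "norm z = 1" using z by simp
      then have "\<not> norm w < 1" using bd[of w z] w(2) by auto
      then have "w = u \<or> w = v" using w' seg by blast
      then have "q z = q u" using w(2) uv by auto
      then show False using only[OF nz] zw by blast
    qed
  qed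
  have lin: "Im ((((1 - s) *\<^sub>R a + s *\<^sub>R b) - u) / (v - u)) = (1 - s) * Im ((a - u) / (v - u)) + s * Im ((b - u) / (v - u))" for a b s
  proof -
    have "((1 - s) *\<^sub>R a + s *\<^sub>R b) - u = (1 - s) *\<^sub>R (a - u) + s *\<^sub>R (b - u)" by (simp add: algebra_simps)
    then have "(((1 - s) *\<^sub>R a + s *\<^sub>R b) - u) / (v - u) = (1 - s) *\<^sub>R ((a - u) / (v - u)) + s *\<^sub>R ((b - u) / (v - u))"
      by (simp add: add_divide_distrib scaleR_conv_of_real)
    then show ?thesis by simp
  qed
  have "convex Xp" "convex Xm" unfolding Xp_def Xm_def convex_alt
  proof (safe)
    fix a b :: complex and s :: real assume a: "a \<in> cball 0 1" "b \<in> cball 0 1" "0 \<le> s" "s \<le> 1"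
    then show "(1 - s) *\<^sub>R a + s *\<^sub>R b \<in> cball 0 1" "(1 - s) *\<^sub>R a + s *\<^sub>R b \<in> cball 0 1"
      using convexD_alt[OF convex_cball] by blast+
    show "Im ((((1 - s) *\<^sub>R a + s *\<^sub>R b) - u) / (v - u)) > 0" if "Im ((a - u) / (v - u)) > 0" "Im ((b - u) / (v - u)) > 0"
      unfolding lin using that a by (cases "s = 0") (auto intro!: add_nonneg_pos)
    show "Im ((((1 - s) *\<^sub>R a + s *\<^sub>R b) - u) / (v - u)) < 0" if "Im ((a - u) / (v - u)) < 0" "Im ((b - u) / (v - u)) < 0"
    proof (cases "s = 0")
      case False
      then have "s * Im ((b - u) / (v - u)) < 0" "(1 - s) * Im ((a - u) / (v - u)) \<le> 0"
        using that a by (auto simp: mult_less_0_iff mult_le_0_iff)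
      then show ?thesis unfolding lin by simp
    qed (use that lin in simp)
  qed
  have side: "q ` X \<subseteq> inside C \<or> q ` X \<subseteq> outside C" if X: "convex X" "X \<subseteq> cball 0 1" "\<And>z. z \<in> X \<Longrightarrow> Im ((z - u) / (v - u)) \<noteq> 0" for X
  proof -
    have "connected (q ` X)"
      using X by (intro connected_continuous_image continuous_on_subset[OF cont] convex_connected)
    moreover have "q ` X \<subseteq> inside C \<union> outside C" unfolding J(6) using X dis by auto
    ultimately show ?thesis using connectedD[of "q ` X" "inside C" "outside C"] J(1,2,5) by blast
  qed
  have sp: "q ` Xp \<subseteq> inside C \<or> q ` Xp \<subseteq> outside C" by (rule side[OF \<open>convex Xp\<close>]) (auto simp: Xp_def)
  have sm: "q ` Xm \<subseteq> inside C \<or> q ` Xm \<subseteq> outside C" by (rule side[OF \<open>convex Xm\<close>]) (auto simp: Xm_def)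
  define m where "m = midpoint u v"
  have mo: "m \<in> open_segment u v" using uv by (simp add: m_def)
  then have mb: "norm m < 1" by (rule seg)
  \<comment> \<open>Small enough for the disc around the midpoint to stay in the unit disc and to
    meet the line through u and v only inside the chord.\<close>
  define e where "e = min (1 - norm m) (norm (v - u) / 2)"
  have e: "e > 0" using mb uv by (simp add: e_def)
  have be: "ball m e \<subseteq> ball 0 1"
  proof
    fix z assume "z \<in> ball m e"
    then have "norm (z - m) < 1 - norm m" by (simp add: e_def dist_norm norm_minus_commute)
    then show "z \<in> ball 0 1" using norm_triangle_ineq[of "z - m" m] by simp
  qed
  have ob: "open (q ` ball m e)"
    by (rule open_mapping_thm3[OF holomorphic_on_subset[OF hol be] open_ball inj_on_subset[OF inj be]])
  have mC: "q m \<in> C" using mo by (auto simp: C_def open_segment_def)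
  have meet: "\<exists>z\<in>Xp \<union> Xm. q z \<in> S" if S: "open S" "frontier S = C" "S \<inter> C = {}" for S
  proof -
    have "q m \<in> closure S" using mC S(2) by (auto simp: frontier_def)
    moreover have "q m \<in> q ` ball m e" using e by simp
    ultimately have "q ` ball m e \<inter> S \<noteq> {}" using open_Int_closure_eq_empty[OF ob, of S] by blast
    then obtain z where z: "z \<in> ball m e" "q z \<in> S" by blast
    have "Im ((z - u) / (v - u)) \<noteq> 0"
    proof
      assume im: "Im ((z - u) / (v - u)) = 0"
      define s where "s = Re ((z - u) / (v - u))"
      have "(z - u) / (v - u) = of_real s" using im by (simp add: s_def complex_eq_iff)
      then have zs: "z = u + of_real s * (v - u)" using uv by (simp add: field_simps)
      have "z - m = of_real (s - 1/2) * (v - u)"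
        unfolding zs m_def midpoint_def by (simp add: scaleR_conv_of_real algebra_simps) (simp add: field_simps)
      then have "norm (z - m) = \<bar>s - 1/2\<bar> * norm (v - u)" by (simp only: norm_mult norm_of_real)
      moreover have "norm (z - m) < norm (v - u) / 2"
        using z(1) by (simp add: e_def dist_norm norm_minus_commute)
      ultimately have "\<bar>s - 1/2\<bar> * norm (v - u) < norm (v - u) / 2" by simp
      then have "\<bar>s - 1/2\<bar> < 1/2" using uv by (simp add: field_simps)
      then have "0 \<le> s" "s \<le> 1" by linarith+
      moreover have "z = (1 - s) *\<^sub>R u + s *\<^sub>R v" unfolding zs by (simp add: scaleR_conv_of_real algebra_simps)
      ultimately have "z \<in> closed_segment u v" by (auto simp: in_segment)
      then show False using z S(3) by (auto simp: C_def)
    qed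
    moreover have "z \<in> cball 0 1" using z(1) be by fastforce
    ultimately show ?thesis using z(2) by (auto simp: Xp_def Xm_def intro!: bexI[of _ z])
  qed
  have "inside C \<inter> C = {}" "outside C \<inter> C = {}" using J(6) by blast+
  then obtain z1 z2 where z: "z1 \<in> Xp \<union> Xm" "q z1 \<in> inside C" "z2 \<in> Xp \<union> Xm" "q z2 \<in> outside C"
    using meet[OF J(1,3)] meet[OF J(2,4)] by blast
  have "x \<in> Xm" "y \<in> Xp" using x y by (auto simp: Xm_def Xp_def)
  then show ?thesis unfolding C_def[symmetric] using sp sm z J(5) by blast
qed

lemma cis_chord_ratio:
  assumes "t < s" "s < t + 2 * pi"
  shows "Im ((cis x - cis t) / (cis s - cis t)) = sin ((x - t) / 2) * sin ((x - s) / 2) / sin ((s - t) / 2)"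
proof -
  have d: "cis a - cis b = 2 * \<i> * of_real (sin ((a - b) / 2)) * cis ((a + b) / 2)" for a b
  proof -
    have "sin ((b - a) / 2) = - sin ((a - b) / 2)" by (metis minus_diff_eq minus_divide_left sin_minus)
    then show ?thesis by (simp add: complex_eq_iff cos_diff_cos sin_diff_sin)
  qed
  have nz: "sin ((s - t) / 2) > 0" using assms by (intro sin_gt_zero) auto
  have "(cis x - cis t) / (cis s - cis t) = of_real (sin ((x - t) / 2) / sin ((s - t) / 2)) * (cis ((x + t) / 2) / cis ((s + t) / 2))"
    unfolding d[of x t] d[of s t] using nz by (simp add: field_simps)
  also have "cis ((x + t) / 2) / cis ((s + t) / 2) = cis ((x - s) / 2)" by (simp add: cis_divide diff_divide_distrib add_divide_distrib)
  finally show ?thesis by (simp add: field_simps)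
qed

lemma cis_chord_side:
  assumes "t < s" "s < t + 2 * pi"
  shows "t < x \<Longrightarrow> x < s \<Longrightarrow> Im ((cis x - cis t) / (cis s - cis t)) < 0"
    "s < x \<Longrightarrow> x < t + 2 * pi \<Longrightarrow> Im ((cis x - cis t) / (cis s - cis t)) > 0"
proof -
  have nz: "sin ((s - t) / 2) > 0" using assms by (intro sin_gt_zero) auto
  show "Im ((cis x - cis t) / (cis s - cis t)) < 0" if "t < x" "x < s"
  proof -
    have "sin ((x - t) / 2) > 0" "sin ((s - x) / 2) > 0" using that assms by (intro sin_gt_zero; simp)+
    moreover have "sin ((x - s) / 2) = - sin ((s - x) / 2)" by (metis minus_diff_eq minus_divide_left sin_minus)
    ultimately show ?thesis unfolding cis_chord_ratio[OF assms] using nz by (simp add: divide_less_0_iff)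
  qed
  show "Im ((cis x - cis t) / (cis s - cis t)) > 0" if "s < x" "x < t + 2 * pi"
  proof -
    have "sin ((x - t) / 2) > 0" "sin ((x - s) / 2) > 0" using that assms by (intro sin_gt_zero; simp)+
    then show ?thesis unfolding cis_chord_ratio[OF assms] using nz by simp
  qed
qed

section \<open>Each tangency separates the boundary\<close>

context univalent_curve
begin

text \<open>In the unbounded case the domain is brought back to the plane by w -> 1 / (w - a) with
  an exterior point a. The composition is holomorphic at the puncture with value 0, so the Jordan
  curve argument covers both cases; the same chart later gives simple connectedness.\<close>

lemma disc_chart:
  obtains q where "continuous_on (cball 0 1) q" "q holomorphic_on ball 0 1" "inj_on q (ball 0 1)"
    "\<And>z w. norm z < 1 \<Longrightarrow> norm w = 1 \<Longrightarrow> q z \<noteq> q w" "\<And>z w. norm z = 1 \<Longrightarrow> norm w = 1 \<Longrightarrow> q z = q w \<longleftrightarrow> g z = g w"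
    "\<kappa> = 0 \<Longrightarrow> q = g" "\<kappa> = 1 \<Longrightarrow> \<exists>a. a \<notin> \<Omega> \<and> q ` ball 0 1 = insert 0 ((\<lambda>w. inverse (w - a)) ` \<Omega>)"
proof (cases "\<kappa> = 0")
  case True
  have D: "D = ball 0 1" using True by (auto simp: punctured_disc_def)
  show ?thesis
  proof (rule that[of g])
    show "continuous_on (cball 0 1) g" using g_isCont True by (intro continuous_at_imp_continuous_on) auto
    show "g holomorphic_on ball 0 1" "inj_on g (ball 0 1)" using g_hol_D inj D by auto
    show "g z \<noteq> g w" if "norm z < 1" "norm w = 1" for z w using g_interior_boundary D that by auto
  qed (use True in auto)
next
  case False
  then have k: "\<kappa> = 1" using kappa by simp
  have gk: "g z = p z - 1 / z" for z unfolding g_def using k by simp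
  obtain a where a: "a \<notin> closure \<Omega>" using exterior_point by blast
  \<comment> \<open>This is 1 / (g z - a) with the pole of g cleared.\<close>
  define q where "q z = z / (z * (p z - a) - 1)" for z
  have ga: "g z \<noteq> a" if "norm z \<le> 1" "z \<noteq> 0" for z using a that by (auto simp: closure_\<Omega>)
  have nz: "z * (p z - a) - 1 \<noteq> 0" if "norm z \<le> 1" for z
  proof (cases "z = 0")
    case False
    have "z * (p z - a) - 1 = z * (g z - a)" unfolding gk using False by (simp add: field_simps)
    then show ?thesis using ga[OF that False] False by simp
  qed simp
  have qg: "q z = 1 / (g z - a)" if "z \<noteq> 0" for z
  proof -
    have "z * (p z - a) - 1 = z * (g z - a)" unfolding gk using that by (simp add: field_simps)
    then show ?thesis using that by (simp add: q_def)
  qed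
  have q0: "q z = 0 \<longleftrightarrow> z = 0" if "norm z \<le> 1" for z using nz[OF that] by (simp add: q_def)
  have qeq: "q z = q w \<longleftrightarrow> g z = g w" if "norm z \<le> 1" "norm w \<le> 1" "z \<noteq> 0" "w \<noteq> 0" for z w
    using that ga[of z] ga[of w] by (simp add: qg divide_eq_eq)
  show ?thesis
  proof (rule that[of q])
    have "continuous_on (cball 0 1) p" using p_hol holomorphic_on_imp_continuous_on continuous_on_subset by blast
    then show "continuous_on (cball 0 1) q" unfolding q_def using nz by (intro continuous_intros) auto
    have "p holomorphic_on ball 0 1" using p_hol holomorphic_on_subset by blast
    then show "q holomorphic_on ball 0 1" unfolding q_def using nz by (intro holomorphic_intros) auto
    show "inj_on q (ball 0 1)"
    proof (rule inj_onI)
      fix z w assume zw: "z \<in> ball 0 1" "w \<in> ball 0 1" "q z = q w"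
      show "z = w"
      proof (cases "z = 0 \<or> w = 0")
        case True then show ?thesis using q0[of z] q0[of w] zw by auto
      next
        case False
        then have "g z = g w" using qeq[of z w] zw by auto
        then show ?thesis using inj zw False by (auto simp: inj_on_def punctured_disc_def)
      qed
    qed
    show "q z \<noteq> q w" if "norm z < 1" "norm w = 1" for z w
    proof (cases "z = 0")
      case True then show ?thesis using q0[of z] q0[of w] that by auto
    next
      case False
      then have "g z \<noteq> g w" using that by (intro g_interior_boundary) (auto simp: punctured_disc_def)
      then show ?thesis using qeq[of z w] that False by fastforce
    qed
    show "q z = q w \<longleftrightarrow> g z = g w" if "norm z = 1" "norm w = 1" for z w using that by (intro qeq) auto
    have "q ` ball 0 1 = insert 0 ((\<lambda>w. inverse (w - a)) ` \<Omega>)"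
    proof -
      have "ball 0 1 = insert 0 D" using k by (auto simp: punctured_disc_def)
      then have "q ` ball 0 1 = insert (q 0) (q ` D)" by simp
      moreover have "q ` D = (\<lambda>z. inverse (g z - a)) ` D"
        by (rule image_cong) (use k in \<open>auto simp: punctured_disc_def qg inverse_eq_divide\<close>)
      ultimately show ?thesis by (simp add: q_def \<Omega>_def image_image)
    qed
    moreover have "a \<notin> \<Omega>" using a closure_subset[of \<Omega>] by blast
    ultimately show "\<exists>a. a \<notin> \<Omega> \<and> q ` ball 0 1 = insert 0 ((\<lambda>w. inverse (w - a)) ` \<Omega>)" by blast
  qed (use False in auto)
qed

text \<open>The first claim makes tangency chords non-crossing. The second, for bounded domains,
  puts the separation into a form that supporting lines can contradict: one of the two points is
  enclosed by a curve in the closure of the domain.\<close>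

lemma dbl_separation:
  assumes d: "dbl s t" "t < s" "s < t + 2 * pi" and x: "t < x" "x < s" and y: "s < y" "y < t + 2 * pi"
  shows "\<gamma> x \<noteq> \<gamma> y" "\<kappa> = 0 \<Longrightarrow> \<exists>C. closed C \<and> C \<subseteq> closure \<Omega> \<and> (\<gamma> x \<in> inside C \<or> \<gamma> y \<in> inside C)"
proof -
  obtain q where q: "continuous_on (cball 0 1) q" "q holomorphic_on ball 0 1" "inj_on q (ball 0 1)"
    "\<And>z w. norm z < 1 \<Longrightarrow> norm w = 1 \<Longrightarrow> q z \<noteq> q w"
    and qe: "\<And>z w. norm z = 1 \<Longrightarrow> norm w = 1 \<Longrightarrow> q z = q w \<longleftrightarrow> g z = g w" and q0: "\<kappa> = 0 \<Longrightarrow> q = g"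
    by (rule disc_chart) (assumption | rule that)+
  let ?C = "q ` closed_segment (cis t) (cis s)"
  have only: "w = cis t \<or> w = cis s" if w: "norm w = 1" "q w = q (cis t)" for w
  proof -
    have "w \<in> cis ` {0..<0 + 2 * pi}" using w(1) sphere_eq[of 0] by auto
    then obtain r where r: "w = cis r" by blast
    have "\<gamma> r = \<gamma> t" using w(2) qe[of w "cis t"] r by (simp add: \<gamma>_eq)
    then have "cis r = cis t \<or> dbl r t" by (auto simp: dbl_def)
    then show ?thesis using no_triple[OF _ dbl_sym[OF d(1)], of r] r by auto
  qed
  have sep: "(q (cis x) \<in> inside ?C \<and> q (cis y) \<in> outside ?C) \<or> (q (cis x) \<in> outside ?C \<and> q (cis y) \<in> inside ?C)"
  proof (rule chord_separation[OF q])
    show "cis t \<noteq> cis s" "q (cis t) = q (cis s)" using d(1) qe[of "cis t" "cis s"] by (auto simp: dbl_def \<gamma>_eq)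
    show "Im ((cis x - cis t) / (cis s - cis t)) < 0" "Im ((cis y - cis t) / (cis s - cis t)) > 0"
      using cis_chord_side[OF d(2,3)] x y by auto
  qed (use only in auto)
  have "q (cis x) \<noteq> q (cis y)" using sep inside_Int_outside[of ?C] by (metis IntI empty_iff)
  then show "\<gamma> x \<noteq> \<gamma> y" using qe[of "cis x" "cis y"] by (simp add: \<gamma>_eq)
  show "\<exists>C. closed C \<and> C \<subseteq> closure \<Omega> \<and> (\<gamma> x \<in> inside C \<or> \<gamma> y \<in> inside C)" if k: "\<kappa> = 0"
  proof (intro exI[of _ ?C] conjI)
    show "closed ?C"
      by (intro compact_imp_closed compact_continuous_image continuous_on_subset[OF q(1)] compact_segment closed_segment_subset) auto
    have "closed_segment (cis t) (cis s) \<subseteq> cball 0 1" by (intro closed_segment_subset) auto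
    then show "?C \<subseteq> closure \<Omega>" unfolding closure_\<Omega> q0[OF k] using k by blast
    show "\<gamma> x \<in> inside ?C \<or> \<gamma> y \<in> inside ?C" using sep q0[OF k] by (auto simp: \<gamma>_eq)
  qed
qed

end

section \<open>Cosets of a lattice against a laminar family of intervals\<close>

lemma card_lattice_interval:
  fixes a u \<rho> :: real and k :: nat
  assumes u: "u > 0" and gen: "\<And>j::int. \<rho> + u * real_of_int j \<noteq> a"
  shows "finite {j::int. a < \<rho> + u * real_of_int j \<and> \<rho> + u * real_of_int j < a + u * k}" "card {j::int. a < \<rho> + u * real_of_int j \<and> \<rho> + u * real_of_int j < a + u * k} = k"
proof -
  define x where "x = (a - \<rho>) / u"
  have gen': "real_of_int j \<noteq> x" for j
  proof
    assume "real_of_int j = x"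
    then have "\<rho> + u * real_of_int j = a" using u by (simp add: x_def field_simps)
    then show False using gen by blast
  qed
  have "{j::int. a < \<rho> + u * real_of_int j \<and> \<rho> + u * real_of_int j < a + u * k} = {\<lfloor>x\<rfloor> + 1..\<lfloor>x\<rfloor> + int k}"
  proof (rule set_eqI)
    fix j :: int
    have "a < \<rho> + u * real_of_int j \<longleftrightarrow> x < j" using u by (simp add: x_def field_simps)
    moreover have "\<rho> + u * real_of_int j < a + u * k \<longleftrightarrow> real_of_int (j - int k) < x" using u by (simp add: x_def field_simps)
    moreover have "x < j \<longleftrightarrow> \<lfloor>x\<rfloor> + 1 \<le> j" by linarith
    moreover have "real_of_int (j - int k) < x \<longleftrightarrow> j - int k \<le> \<lfloor>x\<rfloor>" using gen'[of "j - int k"] by linarith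
    ultimately show "j \<in> {j::int. a < \<rho> + u * real_of_int j \<and> \<rho> + u * real_of_int j < a + u * k} \<longleftrightarrow> j \<in> {\<lfloor>x\<rfloor> + 1..\<lfloor>x\<rfloor> + int k}" by auto
  qed
  then show "finite {j::int. a < \<rho> + u * real_of_int j \<and> \<rho> + u * real_of_int j < a + u * k}"
    "card {j::int. a < \<rho> + u * real_of_int j \<and> \<rho> + u * real_of_int j < a + u * k} = k" by auto
qed

definition covered :: "real \<Rightarrow> real \<Rightarrow> (real \<times> real) set \<Rightarrow> int set" where
  "covered \<rho> u X = {j. \<exists>(a, b)\<in>X. a < \<rho> + u * real_of_int j \<and> \<rho> + u * real_of_int j < b}"

lemma generic_point:
  fixes l h u :: real
  assumes "l < h" "countable X"
  obtains \<rho> where "l < \<rho>" "\<rho> < h" "\<And>x j. x \<in> X \<Longrightarrow> \<rho> + u * of_int j \<noteq> x"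
proof -
  have "countable ((\<lambda>(x, j::int). x - u * real_of_int j) ` (X \<times> UNIV))" using assms by auto
  moreover have "uncountable {l<..<h}" using assms by (simp add: uncountable_open_interval)
  ultimately have "\<not> {l<..<h} \<subseteq> (\<lambda>(x, j::int). x - u * real_of_int j) ` (X \<times> UNIV)" using countable_subset by blast
  then obtain \<rho> where r: "\<rho> \<in> {l<..<h}" "\<rho> \<notin> (\<lambda>(x, j::int). x - u * real_of_int j) ` (X \<times> UNIV)" by blast
  show ?thesis
  proof (rule that[of \<rho>])
    fix x j assume "x \<in> X"
    then show "\<rho> + u * of_int j \<noteq> x" using r(2) by (auto simp: image_iff)
  qed (use r in auto)
qed

text \<open>Take a longest interval, of length k u. By maximality every other one lies inside it or
  off it, and each generic coset has exactly k points in it. Since the count M of the nested family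
  is the same for all generic \<rho>, it may be computed with \<rho> just right of the left end:
  that point lies in the interval but in no nested one, so k exceeds M. Hence every interval
  accounts for at least one new point.\<close>

lemma laminar_count:
  fixes X :: "(real \<times> real) set" and u :: real
  assumes u: "u > 0" and fin: "finite X" and len: "\<And>a b. (a, b) \<in> X \<Longrightarrow> \<exists>k>0. b = a + u * real k"
    and lam: "\<And>a b a' b'. (a, b) \<in> X \<Longrightarrow> (a', b') \<in> X \<Longrightarrow> (a, b) \<noteq> (a', b') \<Longrightarrow>
        b < a' \<or> b' < a \<or> (a < a' \<and> b' < b) \<or> (a' < a \<and> b < b')"
  shows "\<exists>M\<ge>card X. \<forall>\<rho>. (\<forall>(a, b)\<in>X. \<forall>j::int. \<rho> + u * real_of_int j \<noteq> a) \<longrightarrow> finite (covered \<rho> u X) \<and> card (covered \<rho> u X) = M"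
  using fin len lam
proof (induction "card X" arbitrary: X rule: less_induct)
  case less
  show ?case
  proof (cases "X = {}")
    case True
    then show ?thesis by (intro exI[of _ 0]) (auto simp: covered_def)
  next
    case False
    define len where "len J = snd J - fst J" for J :: "real \<times> real"
    have "Max (len ` X) \<in> len ` X" using less.prems(1) False by (intro Max_in) auto
    then obtain I where I': "I \<in> X" "len I = Max (len ` X)" by fastforce
    have "len J \<le> len I" if "J \<in> X" for J unfolding I'(2) using less.prems(1) that by (intro Max_ge) auto
    then have I: "I \<in> X" "\<And>J. J \<in> X \<Longrightarrow> snd J - fst J \<le> snd I - fst I" using I' by (auto simp: len_def)
    obtain a b where ab: "I = (a, b)" by fastforce
    have abX: "(a, b) \<in> X" using I ab by simp
    obtain k where k: "k > 0" "b = a + u * real k" using less.prems(2)[OF abX] by blast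
    have ab_lt: "a < b" using k u by simp
    define A where "A = {(a', b')\<in>X. a < a' \<and> b' < b}"
    define B where "B = {(a', b')\<in>X. b < a' \<or> b' < a}"
    have AX: "A \<subseteq> X" and BX: "B \<subseteq> X" by (auto simp: A_def B_def)
    have finA: "finite A" "finite B" using AX BX less.prems(1) finite_subset by blast+
    have Xeq: "X = insert (a, b) (A \<union> B)"
    proof (intro equalityI subsetI)
      fix J assume J: "J \<in> X"
      obtain a' b' where J': "J = (a', b')" by fastforce
      have "b' - a' \<le> b - a" using I(2)[OF J] J' ab by simp
      then show "J \<in> insert (a, b) (A \<union> B)"
        using less.prems(3)[OF abX, of a' b'] J J' by (auto simp: A_def B_def)
    qed (use abX AX BX in auto)
    have nA: "(a, b) \<notin> A" and nB: "(a, b) \<notin> B" using ab_lt by (auto simp: A_def B_def)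
    have pos: "a' < b'" if "(a', b') \<in> X" for a' b' using less.prems(2)[OF that] u by auto
    have AB: "A \<inter> B = {}"
    proof (rule ccontr)
      assume "A \<inter> B \<noteq> {}"
      then obtain a' b' where "(a', b') \<in> X" "a < a'" "b' < b" "b < a' \<or> b' < a" by (auto simp: A_def B_def)
      then show False using pos[of a' b'] by auto
    qed
    have cX: "card X = card A + card B + 1"
      using finA nA nB AB by (subst Xeq) (simp add: card_Un_disjoint)
    have "card A < card X" "card B < card X" using cX by auto
    have IHA: "\<exists>M\<ge>card A. \<forall>\<rho>. (\<forall>(a, b)\<in>A. \<forall>j::int. \<rho> + u * real_of_int j \<noteq> a) \<longrightarrow> finite (covered \<rho> u A) \<and> card (covered \<rho> u A) = M"
    proof (rule less.hyps[OF \<open>card A < card X\<close> finA(1)])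
      show "\<exists>k>0. b = a + u * real k" if "(a, b) \<in> A" for a b using that AX less.prems(2) by blast
      show "b < a' \<or> b' < a \<or> (a < a' \<and> b' < b) \<or> (a' < a \<and> b < b')" if "(a, b) \<in> A" "(a', b') \<in> A" "(a, b) \<noteq> (a', b')" for a b a' b'
        using that AX less.prems(3)[of a b a' b'] by blast
    qed
    have IHB: "\<exists>M\<ge>card B. \<forall>\<rho>. (\<forall>(a, b)\<in>B. \<forall>j::int. \<rho> + u * real_of_int j \<noteq> a) \<longrightarrow> finite (covered \<rho> u B) \<and> card (covered \<rho> u B) = M"
    proof (rule less.hyps[OF \<open>card B < card X\<close> finA(2)])
      show "\<exists>k>0. b = a + u * real k" if "(a, b) \<in> B" for a b using that BX less.prems(2) by blast
      show "b < a' \<or> b' < a \<or> (a < a' \<and> b' < b) \<or> (a' < a \<and> b < b')" if "(a, b) \<in> B" "(a', b') \<in> B" "(a, b) \<noteq> (a', b')" for a b a' b'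
        using that BX less.prems(3)[of a b a' b'] by blast
    qed
    obtain MA where MA: "MA \<ge> card A" "\<And>\<rho>. (\<forall>(a, b)\<in>A. \<forall>j::int. \<rho> + u * real_of_int j \<noteq> a) \<Longrightarrow> finite (covered \<rho> u A) \<and> card (covered \<rho> u A) = MA"
      using IHA by blast
    obtain MB where MB: "MB \<ge> card B" "\<And>\<rho>. (\<forall>(a, b)\<in>B. \<forall>j::int. \<rho> + u * real_of_int j \<noteq> a) \<Longrightarrow> finite (covered \<rho> u B) \<and> card (covered \<rho> u B) = MB"
      using IHB by blast
    define II where "II \<rho> = {j::int. a < \<rho> + u * real_of_int j \<and> \<rho> + u * real_of_int j < a + u * k}" for \<rho>
    have covA: "covered \<rho> u A \<subseteq> II \<rho>" for \<rho> using k(2) by (auto simp: covered_def II_def A_def)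
    have kA: "k \<ge> card A + 1"
    proof -
      \<comment> \<open>The first left end of a nested interval, or the right end b when nothing is
        nested.\<close>
      define m where "m = Min (insert b (fst ` A))"
      have m: "m \<le> b" "\<And>a' b'. (a', b') \<in> A \<Longrightarrow> m \<le> a'" using finA by (auto simp: m_def intro!: Min_le image_eqI[of _ fst "(_, _)"])
      have "m \<in> insert b (fst ` A)" unfolding m_def using finA by (intro Min_in) auto
      then have am: "a < m" using ab_lt by (auto simp: A_def)
      obtain \<rho> where \<rho>: "a < \<rho>" "\<rho> < m" "\<And>x j. x \<in> insert a (fst ` A) \<Longrightarrow> \<rho> + u * of_int j \<noteq> x"
        using generic_point[OF am, of "insert a (fst ` A)" u] finA by (auto simp: countable_finite)
      have fc: "finite (II \<rho>)" "card (II \<rho>) = k"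
        unfolding II_def by (rule card_lattice_interval[OF u], use \<rho>(3) in blast)+
      have "\<forall>(a, b)\<in>A. \<forall>j::int. \<rho> + u * real_of_int j \<noteq> a"
      proof -
        have "\<rho> + u * real_of_int j \<noteq> a'" if "(a', b') \<in> A" for a' b' j
          by (rule \<rho>(3)) (use that in force)
        then show ?thesis by blast
      qed
      then have cA: "finite (covered \<rho> u A)" "card (covered \<rho> u A) = MA" using MA(2) by auto
      have "covered \<rho> u A \<subseteq> II \<rho> - {0}"
      proof -
        have "0 \<notin> covered \<rho> u A" using m(2) \<rho>(2) by (fastforce simp: covered_def)
        then show ?thesis using covA by blast
      qed
      moreover have "0 \<in> II \<rho>" using \<rho> m(1) k(2) by (auto simp: II_def)
      ultimately have "MA \<le> k - 1" using cA fc card_mono[of "II \<rho> - {0}" "covered \<rho> u A"] by simp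
      then show ?thesis using MA(1) k(1) by linarith
    qed
    show ?thesis
    proof (intro exI[of _ "k + MB"] conjI allI impI)
      show "k + MB \<ge> card X" using kA MB(1) cX by simp
      fix \<rho> assume gen: "\<forall>(a, b)\<in>X. \<forall>j::int. \<rho> + u * real_of_int j \<noteq> a"
      have fc: "finite (II \<rho>)" "card (II \<rho>) = k"
        unfolding II_def by (rule card_lattice_interval[OF u], use gen abX in blast)+
      have cB: "finite (covered \<rho> u B)" "card (covered \<rho> u B) = MB" using MB(2)[of \<rho>] gen BX by blast+
      have eq: "covered \<rho> u X = II \<rho> \<union> covered \<rho> u B"
      proof -
        have "covered \<rho> u X = II \<rho> \<union> covered \<rho> u A \<union> covered \<rho> u B"
          by (subst Xeq) (auto simp: covered_def II_def k(2))
        then show ?thesis using covA by blast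
      qed
      have disj: "II \<rho> \<inter> covered \<rho> u B = {}"
      proof (rule ccontr)
        assume "II \<rho> \<inter> covered \<rho> u B \<noteq> {}"
        then obtain j a' b' where "a < \<rho> + u * of_int j" "\<rho> + u * of_int j < b" "(a', b') \<in> B" "a' < \<rho> + u * of_int j" "\<rho> + u * of_int j < b'"
          by (auto simp: II_def covered_def k(2))
        then show False by (auto simp: B_def)
      qed
      show "finite (covered \<rho> u X)" using eq fc cB by simp
      show "card (covered \<rho> u X) = k + MB" unfolding eq using fc cB disj by (simp add: card_Un_disjoint)
    qed
  qed
qed

section \<open>Upper bounds for the number of tangencies\<close>

context univalent_curve
begin

abbreviation un :: real where "un \<equiv> 2 * pi / N"

lemma un_pos: "un > 0" using N_pos by simp

definition chords :: "real \<Rightarrow> (real \<times> real) set" where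
  "chords a = {(t, s). a < t \<and> t < s \<and> s < a + 2 * pi \<and> dbl s t}"

lemma finite_chords: "finite (chords a)"
proof -
  have "chords a \<subseteq> {t\<in>{a..a + 2 * pi}. \<exists>s. dbl s t} \<times> {t\<in>{a..a + 2 * pi}. \<exists>s. dbl s t}"
    using dbl_sym by (fastforce simp: chords_def)
  then show ?thesis by (rule finite_subset) (intro finite_cartesian_product finite_doubles)
qed

lemma chords_length:
  assumes "(t, s) \<in> chords a" shows "\<exists>k>0. s = t + un * real k"
proof -
  have d: "dbl s t" "t < s" using assms by (auto simp: chords_def)
  obtain k :: int where k: "s - t = 2 * pi * k / N" using dbl_lattice[OF d(1)] by blast
  then have "2 * pi * of_int k / N > 0" using d by simp
  then have "k > 0" using N_pos by (simp add: zero_less_divide_iff zero_less_mult_iff)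
  then show ?thesis using k by (intro exI[of _ "nat k"]) (simp add: algebra_simps)
qed

lemma chords_endpoints:
  assumes "(t, s) \<in> chords a" "(t', s') \<in> chords a" "(t, s) \<noteq> (t', s')"
  shows "t \<noteq> t'" "t \<noteq> s'" "s \<noteq> t'" "s \<noteq> s'"
proof -
  have d: "dbl s t" "dbl s' t'" and r: "a < t" "t < s" "s < a + 2 * pi" "a < t'" "t' < s'" "s' < a + 2 * pi"
    using assms by (auto simp: chords_def)
  have w: "cis x = cis y \<Longrightarrow> x = y" if "a < x" "x < a + 2 * pi" "a < y" "y < a + 2 * pi" for x y
    using cis_eq_window[of x y] that by auto
  show "t \<noteq> t'"
  proof
    assume "t = t'"
    then have "cis s = cis s'" using no_triple[OF d(1) dbl_sym[OF d(2)[folded \<open>t = t'\<close>]]] by simp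
    then show False using w[of s s'] r assms(3) \<open>t = t'\<close> by auto
  qed
  show "t \<noteq> s'"
  proof
    assume e: "t = s'"
    then have "cis s = cis t'" using no_triple[OF d(1)] d(2) by blast
    then show False using w[of s t'] r e by auto
  qed
  show "s \<noteq> t'"
  proof
    assume e: "s = t'"
    then have "cis s' = cis t" using no_triple[OF d(2)] d(1) by blast
    then show False using w[of s' t] r e by auto
  qed
  show "s \<noteq> s'"
  proof
    assume e: "s = s'"
    then have "cis t = cis t'" using no_triple[OF dbl_sym[OF d(1)]] d(2) by blast
    then show False using w[of t t'] r assms(3) e by auto
  qed
qed

lemma chords_laminar:
  assumes "(t, s) \<in> chords a" "(t', s') \<in> chords a" "(t, s) \<noteq> (t', s')"
  shows "s < t' \<or> s' < t \<or> (t < t' \<and> s' < s) \<or> (t' < t \<and> s < s')"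
proof (rule ccontr)
  assume n: "\<not> ?thesis"
  note ne = chords_endpoints[OF assms]
  have d: "dbl s t" "dbl s' t'" and r: "a < t" "t < s" "s < a + 2 * pi" "a < t'" "t' < s'" "s' < a + 2 * pi"
    using assms by (auto simp: chords_def)
  have "(t < t' \<and> t' < s \<and> s < s') \<or> (t' < t \<and> t < s' \<and> s' < s)" using n ne by auto
  then show False
  proof
    assume c: "t < t' \<and> t' < s \<and> s < s'"
    then show False using dbl_separation(1)[OF d(1), of t' s'] r d(2) by (auto simp: dbl_def)
  next
    assume c: "t' < t \<and> t < s' \<and> s' < s"
    then show False using dbl_separation(1)[OF d(2), of t s] r d(1) by (auto simp: dbl_def)
  qed
qed

lemma chords_count:
  obtains M where "M \<ge> card (chords a)"
    "\<And>\<rho>. (\<And>t s j. (t, s) \<in> chords a \<Longrightarrow> \<rho> + un * of_int j \<noteq> t) \<Longrightarrow> card (covered \<rho> un (chords a)) = M"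
proof -
  have "\<exists>M\<ge>card (chords a). \<forall>\<rho>. (\<forall>(t, s)\<in>chords a. \<forall>j::int. \<rho> + un * real_of_int j \<noteq> t) \<longrightarrow>
      finite (covered \<rho> un (chords a)) \<and> card (covered \<rho> un (chords a)) = M"
    by (rule laminar_count[OF un_pos finite_chords chords_length chords_laminar])
  then obtain M where "M \<ge> card (chords a)" "\<forall>\<rho>. (\<forall>(t, s)\<in>chords a. \<forall>j::int. \<rho> + un * real_of_int j \<noteq> t) \<longrightarrow>
      finite (covered \<rho> un (chords a)) \<and> card (covered \<rho> un (chords a)) = M" by blast
  then show ?thesis using that[of M] by blast
qed

text \<open>One period contains exactly N points of a generic coset, and those in L are lost for the
  chords.\<close>

lemma chords_bound_outside:
  assumes gen: "\<And>t s j. (t, s) \<in> chords a \<Longrightarrow> \<rho> + un * of_int j \<noteq> t" and gen_a: "\<And>j. \<rho> + un * of_int j \<noteq> a"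
    and L: "finite L" "\<And>j. j \<in> L \<Longrightarrow> a < \<rho> + un * of_int j \<and> \<rho> + un * of_int j < a + 2 * pi"
    "\<And>j t s. j \<in> L \<Longrightarrow> (t, s) \<in> chords a \<Longrightarrow> \<not> (t < \<rho> + un * of_int j \<and> \<rho> + un * of_int j < s)"
  shows "card (chords a) + card L \<le> N"
proof -
  obtain M where M: "M \<ge> card (chords a)"
    "\<And>\<rho>. (\<And>t s j. (t, s) \<in> chords a \<Longrightarrow> \<rho> + un * of_int j \<noteq> t) \<Longrightarrow> card (covered \<rho> un (chords a)) = M"
    using chords_count by metis
  have cM: "card (covered \<rho> un (chords a)) = M" using M(2) gen by blast
  define II where "II = {j::int. a < \<rho> + un * real_of_int j \<and> \<rho> + un * real_of_int j < a + un * N}"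
  have "finite II" "card II = N" unfolding II_def by (rule card_lattice_interval[OF un_pos gen_a])+
  moreover have "un * N = 2 * pi" using N_pos by simp
  then have "covered \<rho> un (chords a) \<union> L \<subseteq> II"
    using L(2) by (auto simp: II_def covered_def chords_def)
  moreover have "covered \<rho> un (chords a) \<inter> L = {}" using L(3) by (fastforce simp: covered_def)
  ultimately have "card (covered \<rho> un (chords a)) + card L \<le> N"
    using L(1) card_mono[of II "covered \<rho> un (chords a) \<union> L"]
    by (metis (no_types, lifting) card_Un_disjoint finite_Un finite_subset)
  then show ?thesis using M(1) cM by linarith
qed

text \<open>A coset point between a and the beginning of the first chord is covered by none.\<close>

lemma chords_bound: "card (chords a) + 1 \<le> N"
proof -
  \<comment> \<open>The value a + \<open>un\<close> caps the minimum when there is no chord and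
    keeps \<rho> inside the period.\<close>
  define m where "m = Min (insert (a + un) (fst ` chords a))"
  have fin: "finite (fst ` chords a)" using finite_chords by simp
  have m: "m \<le> a + un" "\<And>t s. (t, s) \<in> chords a \<Longrightarrow> m \<le> t"
    using fin by (auto simp: m_def intro!: Min_le image_eqI[of _ fst "(_, _)"])
  have "m \<in> insert (a + un) (fst ` chords a)" unfolding m_def using fin by (intro Min_in) auto
  then have am: "a < m" using un_pos by (auto simp: chords_def)
  obtain \<rho> where \<rho>: "a < \<rho>" "\<rho> < m" "\<And>x j. x \<in> insert a (fst ` chords a) \<Longrightarrow> \<rho> + un * of_int j \<noteq> x"
    using generic_point[OF am, of "insert a (fst ` chords a)" un] fin by (auto simp: countable_finite)
  have "un \<le> 2 * pi" using N_pos by (simp add: field_simps)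
  have "card (chords a) + card {0::int} \<le> N"
  proof (rule chords_bound_outside[of a \<rho>])
    show "\<rho> + un * of_int j \<noteq> t" if "(t, s) \<in> chords a" for t s j
    proof -
      have "t \<in> insert a (fst ` chords a)" using that by force
      then show ?thesis by (rule \<rho>(3))
    qed
    show "\<rho> + un * of_int j \<noteq> a" for j by (rule \<rho>(3)) simp
    show "a < \<rho> + un * of_int j \<and> \<rho> + un * of_int j < a + 2 * pi" if "j \<in> {0}" for j :: int
      using that \<rho> m(1) \<open>un \<le> 2 * pi\<close> by auto
    show "\<not> (t < \<rho> + un * of_int j \<and> \<rho> + un * of_int j < s)" if "j \<in> {0}" "(t, s) \<in> chords a" for t s and j :: int
      using that \<rho>(2) m(2)[OF that(2)] by auto
  qed simp
  then show ?thesis by simp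
qed

text \<open>Since a is not a double parameter, every double point has exactly two parameters
  strictly inside the period, that is, one chord.\<close>

lemma card_double_points:
  assumes nd: "\<forall>s. \<not> dbl s a"
  shows "card (\<gamma> ` {t\<in>{0..<2 * pi}. \<exists>s. dbl s t}) = card (chords a)"
proof -
  have nda: "\<not> dbl a s" for s using nd dbl_sym[of a s] by blast
  have "inj_on (\<lambda>(t, s). \<gamma> t) (chords a)"
  proof (rule inj_onI, clarify)
    fix t s t' s' assume c: "(t, s) \<in> chords a" "(t', s') \<in> chords a" "\<gamma> t = \<gamma> t'"
    show "t = t' \<and> s = s'"
    proof (rule ccontr)
      assume n: "\<not> ?thesis"
      then have "(t, s) \<noteq> (t', s')" by blast
      note ne = chords_endpoints(1,3)[OF c(1,2) this]
      have r: "a < t" "t < s" "s < a + 2 * pi" "a < t'" "t' < s'" "s' < a + 2 * pi" "dbl s t"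
        using c by (auto simp: chords_def)
      then have "dbl t t'" using \<gamma>_eq_cases[OF c(3)] ne by auto
      then have "cis s = cis t'" by (rule no_triple[OF r(7)])
      moreover have "\<bar>s - t'\<bar> < 2 * pi" using r by linarith
      ultimately show False using cis_eq_window[of s t'] ne by blast
    qed
  qed
  moreover have "(\<lambda>(t, s). \<gamma> t) ` chords a = \<gamma> ` {t\<in>{0..<2 * pi}. \<exists>s. dbl s t}"
  proof (intro equalityI subsetI)
    fix w assume "w \<in> (\<lambda>(t, s). \<gamma> t) ` chords a"
    then obtain t s where ts: "dbl s t" "w = \<gamma> t" by (auto simp: chords_def)
    have "cis t \<in> sphere 0 1" by simp
    then obtain t' where t': "t' \<in> {0..<0 + 2 * pi}" "cis t = cis t'" unfolding sphere_eq[of 0] by blast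
    then have "dbl s t'" "w = \<gamma> t'" using ts by (auto simp: dbl_def \<gamma>_eq)
    then show "w \<in> \<gamma> ` {t\<in>{0..<2 * pi}. \<exists>s. dbl s t}" using t' by auto
  next
    fix w assume "w \<in> \<gamma> ` {t\<in>{0..<2 * pi}. \<exists>s. dbl s t}"
    then obtain t s where ts: "dbl s t" "w = \<gamma> t" by auto
    have "cis t \<in> sphere 0 1" "cis s \<in> sphere 0 1" by auto
    then obtain t' s' where t': "t' \<in> {a..<a + 2 * pi}" "cis t = cis t'" "s' \<in> {a..<a + 2 * pi}" "cis s = cis s'"
      unfolding sphere_eq[of a] by blast
    then have d: "dbl s' t'" "w = \<gamma> t'" "w = \<gamma> s'" using ts by (auto simp: dbl_def \<gamma>_eq)
    have ne: "t' \<noteq> a" "s' \<noteq> a" "t' \<noteq> s'"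
    proof -
      show "t' \<noteq> a" using d(1) nd by blast
      show "s' \<noteq> a" using d(1) nda by blast
      show "t' \<noteq> s'" using d(1) by (auto simp: dbl_def)
    qed
    then have "(t', s') \<in> chords a \<or> (s', t') \<in> chords a" using t' d(1) dbl_sym by (auto simp: chords_def)
    then show "w \<in> (\<lambda>(t, s). \<gamma> t) ` chords a" using d by (auto intro: rev_image_eqI)
  qed
  ultimately show ?thesis by (metis card_image)
qed

text \<open>A point of the closure that is extreme in direction u lies on the boundary. It is no
  cusp, since there the domain fills all directions but one, and at a regular point the half plane
  of directions forces the normal to be u.\<close>

lemma support_point:
  assumes k: "\<kappa> = 0" and u: "norm u = 1"
  obtains t where "t \<in> {a..<a + 2 * pi}" "T t = u" "\<And>z. z \<in> closure \<Omega> \<Longrightarrow> Re (cnj u * z) \<le> Re (cnj u * \<gamma> t)"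
proof -
  have "closure \<Omega> = g ` cball 0 1" using closure_\<Omega> k by auto
  moreover have "compact (g ` cball 0 1)"
    using g_isCont k by (intro compact_continuous_image continuous_at_imp_continuous_on) auto
  ultimately have comp: "compact (closure \<Omega>)" by simp
  have "closure \<Omega> \<noteq> {}" using frontier_\<Omega>[of 0] by (auto simp: frontier_def)
  moreover have "continuous_on (closure \<Omega>) (\<lambda>z. Re (cnj u * z))" by (intro continuous_intros)
  ultimately obtain w where w: "w \<in> closure \<Omega>" "\<And>z. z \<in> closure \<Omega> \<Longrightarrow> Re (cnj u * z) \<le> Re (cnj u * w)"
    using continuous_attains_sup[OF comp] by metis
  have uu: "cnj u * u = 1" using u complex_norm_square[of u] by (simp add: mult.commute)
  have "w \<notin> \<Omega>"
  proof
    assume "w \<in> \<Omega>"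
    then obtain e where e: "e > 0" "ball w e \<subseteq> \<Omega>" using open_\<Omega> openE by blast
    define z where "z = w + of_real (e / 2) * u"
    have "dist w z < e" using e u by (simp add: z_def dist_norm norm_mult)
    then have "z \<in> closure \<Omega>" using e closure_subset by fastforce
    then have "Re (cnj u * z) \<le> Re (cnj u * w)" by (rule w(2))
    moreover have "cnj u * z = cnj u * w + of_real (e / 2) * (cnj u * u)" by (simp add: z_def algebra_simps)
    ultimately show False using e by (simp add: uu)
  qed
  then have "w \<in> frontier \<Omega>" using w(1) open_\<Omega> by (simp add: frontier_def interior_open)
  then obtain t where t: "t \<in> {a..<a + 2 * pi}" "w = \<gamma> t" unfolding frontier_\<Omega>[of a] by blast
  obtain n :: nat and \<phi> c where n: "n = 1 \<or> n = 2" "norm c = 1" "n = 1 \<Longrightarrow> c = \<i> * T t"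
    and cov: "\<And>\<alpha> r. 0 < \<alpha> \<Longrightarrow> \<alpha> < pi \<Longrightarrow> 0 < r \<Longrightarrow>
      \<exists>\<delta>>0. \<forall>\<rho>. 0 < \<rho> \<and> \<rho> < \<delta> \<longrightarrow> (\<exists>\<zeta>\<in>ball (of_real t) r. Im \<zeta> > 0 \<and>
         G \<zeta> = G (of_real t) + of_real \<rho> * cis (of_nat n * \<alpha>) * c \<and> \<phi> \<zeta> = of_real (root n \<rho>) * cis \<alpha>)"
    by (rule boundary_cover[of t]) (assumption | rule that)+
  have dir: "Re (cnj u * (cis (of_nat n * \<alpha>) * c)) \<le> 0" if \<alpha>: "0 < \<alpha>" "\<alpha> < pi" for \<alpha>
  proof -
    obtain \<delta> where \<delta>: "\<delta> > 0" "\<And>\<rho>. 0 < \<rho> \<and> \<rho> < \<delta> \<Longrightarrow> (\<exists>\<zeta>\<in>ball (of_real t) 1. Im \<zeta> > 0 \<and>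
         G \<zeta> = G (of_real t) + of_real \<rho> * cis (of_nat n * \<alpha>) * c)" using cov[OF \<alpha>, of 1] by (meson zero_less_one)
    obtain \<zeta> where \<zeta>: "Im \<zeta> > 0" "G \<zeta> = \<gamma> t + of_real (\<delta>/2) * cis (of_nat n * \<alpha>) * c" using \<delta>(2)[of "\<delta>/2"] \<delta>(1) by auto
    have "G \<zeta> \<in> \<Omega>" using exp_i_D[OF \<zeta>(1)] by (auto simp: G_def \<Omega>_def)
    then have "Re (cnj u * G \<zeta>) \<le> Re (cnj u * \<gamma> t)" using w(2) t closure_subset by auto
    moreover have "cnj u * G \<zeta> = cnj u * \<gamma> t + of_real (\<delta>/2) * (cnj u * (cis (of_nat n * \<alpha>) * c))"
      unfolding \<zeta>(2) by (simp add: algebra_simps)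
    ultimately have "(\<delta>/2) * Re (cnj u * (cis (of_nat n * \<alpha>) * c)) \<le> 0"
      by (simp only: plus_complex.simps Re_complex_of_real times_complex.simps(1)[of "of_real _"] Im_complex_of_real)
    then show ?thesis using \<delta>(1) by (simp add: mult_le_0_iff)
  qed
  define v where "v = cnj u * c"
  have vn: "norm v = 1" using n(2) u by (simp add: v_def norm_mult)
  have dir': "Re (cis (of_nat n * \<alpha>) * v) \<le> 0" if "0 < \<alpha>" "\<alpha> < pi" for \<alpha>
    using dir[OF that] by (simp add: v_def mult_ac)
  have "n = 1"
  proof (rule ccontr)
    assume "n \<noteq> 1"
    then have n2: "n = 2" using n by auto
    \<comment> \<open>At a cusp the directions pi / 2, 3 pi / 2, pi / 4 and pi already force v =
      0.\<close>
    have d1: "Re (cis (2 * (pi/4)) * v) \<le> 0" "Re (cis (2 * (3 * pi/4)) * v) \<le> 0" "Re (cis (2 * (pi/8)) * v) \<le> 0"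
      "Re (cis (2 * (pi/2)) * v) \<le> 0"
      using dir'[of "pi/4"] dir'[of "3 * pi/4"] dir'[of "pi/8"] dir'[of "pi/2"] n2 by (auto simp del: times_complex.simps)
    have e: "2 * (pi/4) = pi/2" "2 * (3 * pi/4) = pi + pi/2" "2 * (pi/8) = pi/4" "2 * (pi/2) = pi" by auto
    have c3: "cis (pi + pi/2) = - \<i>" by (simp only: cis_mult[symmetric] cis_pi cis_pi_half) simp
    have "Im v \<ge> 0" "Im v \<le> 0" "Re v \<ge> 0" using d1(1,2,4) unfolding e c3 by (auto simp: cis.ctr)
    moreover have "(cos (pi/4)) * Re v - sin (pi/4) * Im v \<le> 0" using d1(3) unfolding e by simp
    ultimately have "Re v = 0" "Im v = 0"
      by (auto simp: cos_45 sin_45 mult_le_0_iff)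
    then show False using vn by (simp add: complex_eq_iff cmod_def)
  qed
  then have n1: "n = 1" .
  \<comment> \<open>The inequality extends to the closed range by continuity; at 0, pi and pi / 2 it
    leaves only v = i.\<close>
  have v: "cos \<alpha> * Re v - sin \<alpha> * Im v \<le> 0" if "\<alpha> \<in> {0..pi}" for \<alpha>
  proof (rule continuous_le_on_closure[of "{0<..<pi}" "\<lambda>\<alpha>. cos \<alpha> * Re v - sin \<alpha> * Im v" \<alpha> 0])
    show "continuous_on (closure {0<..<pi}) (\<lambda>\<alpha>. cos \<alpha> * Re v - sin \<alpha> * Im v)" by (intro continuous_intros)
    show "\<alpha> \<in> closure {0<..<pi}" using that by simp
    show "cos \<beta> * Re v - sin \<beta> * Im v \<le> 0" if "\<beta> \<in> {0<..<pi}" for \<beta> using dir'[of \<beta>] that n1 by simp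
  qed
  have "Re v \<le> 0" "Re v \<ge> 0" "Im v \<ge> 0" using v[of 0] v[of pi] v[of "pi/2"] by auto
  then have "v = \<i>" using vn by (auto simp: complex_eq_iff cmod_def)
  then have "u * v = \<i> * u" by simp
  moreover have "u * v = c" using uu by (simp add: v_def mult_ac)
  ultimately have "T t = u" using n(3)[OF n1] by (metis complex_i_not_zero mult_cancel_left)
  then show ?thesis using that t w(2) by blast
qed

lemma T_lattice:
  assumes "T t = cis (real N * \<rho> / 2) \<or> T t = - cis (real N * \<rho> / 2)"
  obtains j :: int where "t = \<rho> + un * of_int j"
proof -
  have ft: "f t \<noteq> 0" using assms by (auto simp: T_def)
  have "cis (- (real N * \<rho> / 2)) * T t = 1 \<or> cis (- (real N * \<rho> / 2)) * T t = - 1" using assms by (auto simp: cis_mult)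
  moreover have "cis (- (real N * \<rho> / 2)) * T t = cis (real N * t / 2 - real N * \<rho> / 2) * of_real (sgn (f t))"
    by (simp add: T_def cis_mult flip: mult.assoc)
  ultimately have "cis (real N * t / 2 - real N * \<rho> / 2) * of_real (sgn (f t)) \<in> {1, -1}" by auto
  then have "Im (cis (real N * t / 2 - real N * \<rho> / 2) * of_real (sgn (f t))) \<in> Im ` {1, -1}" by (rule imageI)
  then have "Im (cis (real N * t / 2 - real N * \<rho> / 2) * of_real (sgn (f t))) = 0" by simp
  then have "sin (real N * t / 2 - real N * \<rho> / 2) = 0" using ft by (simp add: sgn_zero_iff)
  then obtain k :: int where "real N * t / 2 - real N * \<rho> / 2 = of_int k * pi" by (auto simp: sin_zero_iff_int2)
  then have "t = \<rho> + un * of_int k" using N_pos by (simp add: field_simps)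
  then show ?thesis using that by blast
qed

text \<open>The half plane bounded by the supporting line is convex and contains C, hence also
  everything that C encloses. But a neighbourhood of an enclosed w is enclosed too and reaches
  beyond the line.\<close>

lemma support_not_inside:
  assumes C: "closed C" "C \<subseteq> closure \<Omega>" and u: "norm u = 1" and sup: "\<And>z. z \<in> closure \<Omega> \<Longrightarrow> Re (cnj u * z) \<le> Re (cnj u * w)"
  shows "w \<notin> inside C"
proof
  assume w: "w \<in> inside C"
  obtain e where e: "e > 0" "ball w e \<subseteq> inside C" using w open_inside[OF C(1)] openE by blast
  define H where "H = {z. Re (cnj u * z) \<le> Re (cnj u * w)}"
  have "H = {z. inner u z \<le> Re (cnj u * w)}" by (auto simp: H_def inner_complex_def)
  then have "convex H" by (simp add: convex_halfspace_le)
  moreover have "C \<subseteq> H" using C(2) sup by (auto simp: H_def)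
  ultimately have "inside C \<subseteq> H" using outside_subset_convex[of H C] inside_Int_outside[of C] by blast
  moreover define z where "z = w + of_real (e / 2) * u"
  have "dist w z < e" using e u by (simp add: z_def dist_norm norm_mult)
  ultimately have "z \<in> H" using e by auto
  moreover have uu: "cnj u * u = 1" using u complex_norm_square[of u] by (simp add: mult.commute)
  have eq: "cnj u * z = cnj u * w + of_real (e / 2) * (cnj u * u)" by (simp add: z_def algebra_simps)
  have "Re (cnj u * z) = Re (cnj u * w) + e / 2" unfolding eq uu by simp
  ultimately show False using e(1) unfolding H_def mem_Collect_eq by linarith
qed

text \<open>Three points of one coset lie outside all chords. Two are supporting points with normals
  u and - u: the base a is itself a supporting point, and a chord separating two supporting points
  would enclose one of them. The third is x, just left of a longest chord; it is not one of the
  supporting points, because beyond the tangent at t the twin arc brings points of the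
  domain.\<close>

lemma chords_bound_bounded:
  assumes k: "\<kappa> = 0" and ex: "dbl s1 t1"
  obtains a where "\<forall>s. \<not> dbl s a" "card (chords a) + 3 \<le> N"
proof -
  define BD where "BD = {t. \<exists>s. dbl s t}"
  have cBD: "countable BD"
  proof -
    have "BD \<subseteq> (\<Union>n::nat. {t\<in>{- real n..real n}. \<exists>s. dbl s t})"
    proof
      fix t assume "t \<in> BD"
      moreover obtain n :: nat where "\<bar>t\<bar> \<le> real n" using real_arch_simple by blast
      ultimately have "t \<in> {t\<in>{- real n..real n}. \<exists>s. dbl s t}" by (auto simp: BD_def)
      then show "t \<in> (\<Union>n::nat. {t\<in>{- real n..real n}. \<exists>s. dbl s t})" by blast
    qed
    moreover have "countable (\<Union>n::nat. {t\<in>{- real n..real n}. \<exists>s. dbl s t})"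
      using countable_finite[OF finite_doubles] by (intro countable_UN) auto
    ultimately show ?thesis using countable_subset by blast
  qed
  \<comment> \<open>A generic normal direction makes the base point a supporting point that is not a
    double parameter.\<close>
  obtain \<rho>0 where \<rho>0: "\<And>x j. x \<in> BD \<Longrightarrow> \<rho>0 + un * of_int j \<noteq> x" using generic_point[OF zero_less_one cBD, of un] by metis
  obtain a where a: "T a = cis (real N * \<rho>0 / 2)" "\<And>z. z \<in> closure \<Omega> \<Longrightarrow> Re (cnj (cis (real N * \<rho>0 / 2)) * z) \<le> Re (cnj (cis (real N * \<rho>0 / 2)) * \<gamma> a)"
    using support_point[OF k, of "cis (real N * \<rho>0 / 2)" 0] by (metis norm_cis)
  have nda: "\<forall>s. \<not> dbl s a"
  proof -
    obtain j :: int where "a = \<rho>0 + un * of_int j" using T_lattice a(1) by metis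
    then have "a \<notin> BD" using \<rho>0 by metis
    then show ?thesis by (auto simp: BD_def)
  qed
  have outer: "\<not> (t < x \<and> x < s)" if "(t, s) \<in> chords a" "norm u = 1" "\<And>z. z \<in> closure \<Omega> \<Longrightarrow> Re (cnj u * z) \<le> Re (cnj u * \<gamma> x)" for t s x u
  proof
    assume x: "t < x \<and> x < s"
    have r: "a < t" "t < s" "s < a + 2 * pi" "dbl s t" using that(1) by (auto simp: chords_def)
    have ga: "\<gamma> (a + 2 * pi) = \<gamma> a" using \<gamma>_periodic[of a 1] by simp
    obtain C where C: "closed C" "C \<subseteq> closure \<Omega>" "\<gamma> x \<in> inside C \<or> \<gamma> (a + 2 * pi) \<in> inside C"
      using dbl_separation(2)[OF r(4), of x "a + 2 * pi"] r x k by auto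
    have "\<gamma> x \<notin> inside C" by (rule support_not_inside[OF C(1,2) that(2,3)])
    moreover have "\<gamma> a \<notin> inside C" by (rule support_not_inside[OF C(1,2) _ a(2)]) auto
    ultimately show False using C(3) ga by simp
  qed
  have ne: "chords a \<noteq> {}"
  proof
    assume "chords a = {}"
    then have "card (\<gamma> ` {t\<in>{0..<2 * pi}. \<exists>s. dbl s t}) = 0" using card_double_points[OF nda] by simp
    moreover have "finite {t\<in>{0..<2 * pi}. \<exists>s. dbl s t}"
      by (rule finite_subset[OF _ finite_doubles[of 0 "2 * pi"]]) auto
    ultimately have e: "{t\<in>{0..<2 * pi}. \<exists>s. dbl s t} = {}" by simp
    have "cis t1 \<in> sphere 0 1" by simp
    then obtain t' where t': "t' \<in> {0..<0 + 2 * pi}" "cis t1 = cis t'" unfolding sphere_eq[of 0] by blast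
    then have "dbl s1 t'" using ex by (auto simp: dbl_def \<gamma>_eq)
    then show False using e t' by auto
  qed
  define len where "len J = snd J - fst J" for J :: "real \<times> real"
  have "Max (len ` chords a) \<in> len ` chords a" using finite_chords ne by (intro Max_in) auto
  then obtain I where I': "I \<in> chords a" "len I = Max (len ` chords a)" by fastforce
  obtain t s where ts: "I = (t, s)" by fastforce
  have tsc: "(t, s) \<in> chords a" using I' ts by simp
  have mx: "s' - t' \<le> s - t" if "(t', s') \<in> chords a" for t' s'
  proof -
    have "len (t', s') \<le> len I" unfolding I'(2) using finite_chords that by (intro Max_ge) auto
    then show ?thesis by (simp add: len_def ts)
  qed
  have r: "a < t" "t < s" "s < a + 2 * pi" "dbl s t" using tsc by (auto simp: chords_def)
  \<comment> \<open>The sheet of the domain at s lies on the outer side of the tangent at t; by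
    continuity z0 is also beyond the tangents at parameters near t.\<close>
  obtain z0 where z0: "z0 \<in> \<Omega>" "Re (cnj (T t) * (z0 - \<gamma> t)) > 0"
  proof -
    obtain n :: nat and \<phi> c where n: "n = 1 \<or> n = 2" "n = 1 \<Longrightarrow> c = \<i> * T s" "n = 2 \<Longrightarrow> f s = 0"
      and cov: "\<And>\<alpha> r. 0 < \<alpha> \<Longrightarrow> \<alpha> < pi \<Longrightarrow> 0 < r \<Longrightarrow>
        \<exists>\<delta>>0. \<forall>\<rho>. 0 < \<rho> \<and> \<rho> < \<delta> \<longrightarrow> (\<exists>\<zeta>\<in>ball (of_real s) r. Im \<zeta> > 0 \<and>
           G \<zeta> = G (of_real s) + of_real \<rho> * cis (of_nat n * \<alpha>) * c \<and> \<phi> \<zeta> = of_real (root n \<rho>) * cis \<alpha>)"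
      by (rule boundary_cover[of s]) (assumption | rule that)+
    have n1: "n = 1" using n dbl_tangent(1)[OF r(4)] by auto
    obtain \<delta> where \<delta>: "\<delta> > 0" "\<And>\<rho>. 0 < \<rho> \<and> \<rho> < \<delta> \<Longrightarrow> (\<exists>\<zeta>\<in>ball (of_real s) 1. Im \<zeta> > 0 \<and>
         G \<zeta> = \<gamma> s + of_real \<rho> * cis (of_nat n * (pi/2)) * c)"
    proof -
      have "0 < pi/2" "pi/2 < pi" by auto
      from cov[OF this, of 1] show ?thesis using that by (meson zero_less_one)
    qed
    obtain \<zeta> where \<zeta>: "Im \<zeta> > 0" "G \<zeta> = \<gamma> s + of_real (\<delta>/2) * cis (of_nat n * (pi/2)) * c" using \<delta>(2)[of "\<delta>/2"] \<delta>(1) by auto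
    have st: "\<gamma> s = \<gamma> t" "T s = - T t" using r(4) dbl_tangent by (auto simp: dbl_def)
    have nT: "norm (T t) = 1" using dbl_tangent(2)[OF r(4)] by (simp add: T_def norm_mult abs_sgn_eq)
    have TT: "cnj (T t) * T t = 1" using nT complex_norm_square[of "T t"] by (simp add: mult.commute)
    have "G \<zeta> - \<gamma> t = of_real (\<delta>/2) * T t" unfolding \<zeta>(2) using n1 n(2) st
      by (simp add: mult.assoc)
    then have "cnj (T t) * (G \<zeta> - \<gamma> t) = of_real (\<delta>/2) * (cnj (T t) * T t)" by (simp add: mult_ac)
    then have eq: "cnj (T t) * (G \<zeta> - \<gamma> t) = of_real (\<delta>/2)" by (simp only: TT mult_1_right)
    have "Re (cnj (T t) * (G \<zeta> - \<gamma> t)) > 0" unfolding eq using \<delta>(1) by simp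
    moreover have "G \<zeta> \<in> \<Omega>" using exp_i_D[OF \<zeta>(1)] by (auto simp: G_def \<Omega>_def)
    ultimately show ?thesis using that by blast
  qed
  obtain e where e: "e > 0" "\<And>x. \<bar>x - t\<bar> < e \<Longrightarrow> f x \<noteq> 0 \<and> Re (cnj (T x) * (z0 - \<gamma> x)) > 0"
  proof -
    have cf: "isCont f t" unfolding f_def by (intro isCont_Re continuous_within_compose3[OF F_isCont] isCont_of_real) auto
    have ft: "f t \<noteq> 0" using dbl_tangent(2)[OF r(4)] .
    have "\<exists>d>0. \<forall>x. \<bar>x - t\<bar> < d \<longrightarrow> sgn (f x) = sgn (f t)"
    proof -
      obtain d where d: "d > 0" "\<And>x. dist x t < d \<Longrightarrow> dist (f x) (f t) < \<bar>f t\<bar>"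
        using cf ft unfolding continuous_at_eps_delta by (metis zero_less_abs_iff)
      have "sgn (f x) = sgn (f t)" if "\<bar>x - t\<bar> < d" for x
        using d(2)[of x] that by (auto simp: dist_real_def sgn_if split: if_splits)
      then show ?thesis using d(1) by blast
    qed
    then obtain d1 where d1: "d1 > 0" "\<And>x. \<bar>x - t\<bar> < d1 \<Longrightarrow> sgn (f x) = sgn (f t)" by blast
    define h where "h x = Re (cnj (cis (real N * x / 2) * of_real (sgn (f t))) * (z0 - \<gamma> x))" for x
    have "isCont \<gamma> t" using \<gamma>_cont[of UNIV] by (simp add: continuous_on_eq_continuous_at)
    then have "isCont h t" unfolding h_def cis_conv_exp
      by (intro isCont_Re continuous_intros isCont_cnj) auto
    moreover have "h t > 0" using z0(2) by (simp add: h_def T_def)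
    ultimately obtain d2 where d2': "d2 > 0" "\<And>x. dist x t < d2 \<Longrightarrow> dist (h x) (h t) < h t"
      unfolding continuous_at_eps_delta by blast
    have d2: "d2 > 0" "h x > 0" if "\<bar>x - t\<bar> < d2" for x
      using d2'(2)[of x] d2'(1) that by (auto simp: dist_real_def)
    show ?thesis
    proof (rule that[of "min d1 d2"])
      fix x assume x: "\<bar>x - t\<bar> < min d1 d2"
      then have sg: "sgn (f x) = sgn (f t)" using d1(2)[of x] by simp
      then have "T x = cis (real N * x / 2) * of_real (sgn (f t))" by (simp add: T_def)
      then have "Re (cnj (T x) * (z0 - \<gamma> x)) = h x" by (simp only: h_def)
      moreover have "h x > 0" using d2(2)[of x] x by simp
      moreover have "f x \<noteq> 0" using sg ft by (metis sgn_zero_iff)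
      ultimately show "f x \<noteq> 0 \<and> Re (cnj (T x) * (z0 - \<gamma> x)) > 0" by simp
    qed (use d1 d2' in auto)
  qed
  \<comment> \<open>All chord ends to the left of t, together with a. As x is taken to the right of
    them, a chord over x would have to contain the longest chord.\<close>
  define E where "E = {y \<in> insert a (fst ` chords a \<union> snd ` chords a). y < t}"
  have finE: "finite E" "E \<noteq> {}" using finite_chords r by (auto simp: E_def)
  define lo where "lo = max (t - e) (Max E)"
  have "lo < t" using finE e Max_in[OF finE] by (auto simp: lo_def E_def)
  have loE: "y \<le> lo" if "y \<in> E" for y using Max_ge[OF finE(1) that] by (simp add: lo_def)
  obtain x where x: "lo < x" "x < t" "\<And>y j. y \<in> insert a BD \<Longrightarrow> x + un * of_int j \<noteq> y"
    using generic_point[OF \<open>lo < t\<close>, of "insert a BD" un] cBD by (metis countable_insert)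
  have xa: "a < x" "x < a + 2 * pi" using x r loE[of a] by (auto simp: E_def)
  have xout: "\<not> (t' < x \<and> x < s')" if c: "(t', s') \<in> chords a" for t' s'
  proof
    assume xx: "t' < x \<and> x < s'"
    then have "(t', s') \<noteq> (t, s)" using x by auto
    then have lam: "s' < t \<or> s < t' \<or> (t' < t \<and> s < s') \<or> (t < t' \<and> s' < s)" using chords_laminar[OF c tsc] by blast
    have "\<not> s' < t"
    proof
      assume "s' < t"
      then have "s' \<in> E" using c by (force simp: E_def)
      then show False using loE x xx by fastforce
    qed
    then show False using lam xx x r mx[OF c] by auto
  qed
  have fx: "f x \<noteq> 0" "Re (cnj (T x) * (z0 - \<gamma> x)) > 0" using e(2)[of x] x by (auto simp: lo_def)
  define u where "u = cis (real N * x / 2)"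
  have Tx: "T x = u \<or> T x = - u" using fx(1) by (auto simp: T_def u_def sgn_if)
  obtain tp where tp: "tp \<in> {a..<a + 2 * pi}" "T tp = u" "\<And>z. z \<in> closure \<Omega> \<Longrightarrow> Re (cnj u * z) \<le> Re (cnj u * \<gamma> tp)"
    using support_point[OF k, of u a] by (metis norm_cis u_def)
  obtain tm where tm: "tm \<in> {a..<a + 2 * pi}" "T tm = - u" "\<And>z. z \<in> closure \<Omega> \<Longrightarrow> Re (cnj (-u) * z) \<le> Re (cnj (-u) * \<gamma> tm)"
    using support_point[OF k, of "-u" a] by (metis norm_cis u_def norm_minus_cancel)
  have z0c: "z0 \<in> closure \<Omega>" using z0 closure_subset by blast
  have xp: "x \<noteq> tp"
  proof
    assume e: "x = tp"
    then have "Re (cnj (T x) * z0) \<le> Re (cnj (T x) * \<gamma> x)" using tp(3)[OF z0c] tp(2) by simp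
    then show False using fx(2) by (simp add: algebra_simps)
  qed
  have xm: "x \<noteq> tm"
  proof
    assume e: "x = tm"
    then have "Re (cnj (T x) * z0) \<le> Re (cnj (T x) * \<gamma> x)" using tm(3)[OF z0c] tm(2) by (simp only:)
    then show False using fx(2) by (simp add: algebra_simps)
  qed
  have u0: "u \<noteq> 0" by (simp add: u_def)
  have pm: "tp \<noteq> tm" using tp(2) tm(2) u0 by auto
  obtain jp :: int where jp: "tp = x + un * of_int jp" using T_lattice[of tp x] tp(2) u_def by metis
  obtain jm :: int where jm: "tm = x + un * of_int jm" using T_lattice[of tm x] tm(2) u_def by metis
  have "card {0, jp, jm} = 3"
    using xp xm pm jp jm by auto
  moreover have "card (chords a) + card {0, jp, jm} \<le> N"
  proof (rule chords_bound_outside[of a x])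
    show "x + un * of_int j \<noteq> t'" if "(t', s') \<in> chords a" for t' s' j
    proof (rule x(3))
      show "t' \<in> insert a BD" using that by (auto simp: BD_def chords_def)
    qed
    show na: "x + un * of_int j \<noteq> a" for j by (rule x(3)) simp
    have inw: "a < y \<and> y < a + 2 * pi" if "y = x + un * of_int j" "y \<in> {a..<a + 2 * pi}" for y j
      using that na[of j] by auto
    show "a < x + un * of_int j \<and> x + un * of_int j < a + 2 * pi" if "j \<in> {0, jp, jm}" for j
      using that xa inw[OF jp tp(1)] inw[OF jm tm(1)] jp jm by auto
    show "\<not> (t' < x + un * of_int j \<and> x + un * of_int j < s')" if "j \<in> {0, jp, jm}" "(t', s') \<in> chords a" for t' s' j
    proof -
      have "\<not> (t' < tp \<and> tp < s')" by (rule outer[OF that(2) _ tp(3)]) (simp add: u_def)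
      moreover have "\<not> (t' < tm \<and> tm < s')" by (rule outer[OF that(2) _ tm(3)]) (simp add: u_def)
      ultimately show ?thesis using that(1) xout[OF that(2)] jp jm by auto
    qed
  qed simp
  ultimately have "card (chords a) + 3 \<le> N" by simp
  then show ?thesis using that nda by blast
qed

end

section \<open>Perturbation at double points\<close>

lemma positive_nbhd2:
  fixes R :: "'a::metric_space \<times> 'b::metric_space \<Rightarrow> real"
  assumes "continuous_on UNIV R" "R (a, b) > 0"
  obtains r where "r > 0" "\<And>x y. dist x a < r \<Longrightarrow> dist y b < r \<Longrightarrow> R (x, y) > 0"
proof -
  have "open {x. 0 < R x}" by (intro open_Collect_less continuous_on_const assms)
  moreover have "(a, b) \<in> {x. 0 < R x}" using assms by simp
  ultimately obtain A B where AB: "open A" "open B" "(a, b) \<in> A \<times> B" "A \<times> B \<subseteq> {x. 0 < R x}"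
    using open_prod_elim by metis
  obtain r1 where r1: "r1 > 0" "ball a r1 \<subseteq> A" using AB(1,3) open_contains_ball by (metis mem_Sigma_iff)
  obtain r2 where r2: "r2 > 0" "ball b r2 \<subseteq> B" using AB(2,3) open_contains_ball by (metis mem_Sigma_iff)
  show ?thesis
  proof (rule that[of "min r1 r2"])
    fix x y assume "dist x a < min r1 r2" "dist y b < min r1 r2"
    then have "x \<in> A" "y \<in> B" using r1 r2 by (auto simp: dist_commute)
    then show "R (x, y) > 0" using AB by auto
  qed (use r1 r2 in auto)
qed

lemma positive_nbhd3:
  fixes R :: "'a::metric_space \<times> 'b::metric_space \<times> 'c::metric_space \<Rightarrow> real"
  assumes "continuous_on UNIV R" "R (a, b, c) > 0"
  obtains r where "r > 0" "\<And>x y z. dist x a < r \<Longrightarrow> dist y b < r \<Longrightarrow> dist z c < r \<Longrightarrow> R (x, y, z) > 0"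
proof -
  obtain r where r: "r > 0" "\<And>x y. dist x a < r \<Longrightarrow> dist y (b, c) < r \<Longrightarrow> R (x, y) > 0"
    using positive_nbhd2[OF assms] by metis
  show ?thesis
  proof (rule that[of "r / 2"])
    fix x y z assume a: "dist x a < r / 2" "dist y b < r / 2" "dist z c < r / 2"
    have "dist (y, z) (b, c) \<le> dist y b + dist z c"
      by (simp add: dist_Pair_Pair sqrt_sum_squares_le_sum)
    then show "R (x, y, z) > 0" using a r(1) by (intro r(2)) linarith+
  qed (use r in auto)
qed

text \<open>The Noshiro-Warschawski criterion, for a half plane rotated by a.\<close>

lemma injective_positive_derivative:
  fixes P Q :: "complex \<Rightarrow> complex"
  assumes S: "convex S" and d: "\<And>\<zeta>. \<zeta> \<in> S \<Longrightarrow> (P has_field_derivative Q \<zeta>) (at \<zeta>)"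
    and pos: "\<And>\<zeta>. \<zeta> \<in> S \<Longrightarrow> Re (a * Q \<zeta>) > 0"
  shows "inj_on P S"
proof (rule inj_onI, rule ccontr)
  fix z w assume zw: "z \<in> S" "w \<in> S" "P z = P w" "z \<noteq> w"
  define l where "l s = w + of_real s * (z - w)" for s :: real
  have lS: "l s \<in> S" if "0 \<le> s" "s \<le> 1" for s
    using convexD_alt[OF S zw(2,1) that] by (simp add: l_def scaleR_conv_of_real algebra_simps)
  define \<phi> where "\<phi> s = Re (a * (P (l s) / (z - w)))" for s
  have "(\<phi> has_real_derivative Re (a * Q (l s))) (at s)" if "0 \<le> s" "s \<le> 1" for s
  proof -
    have "((\<lambda>s. P (w + s * (z - w))) has_field_derivative Q (l s) * (z - w)) (at (of_real s))"
      by (rule DERIV_chain'[where g = P]) (use d[OF lS[OF that]] in \<open>auto intro!: derivative_eq_intros simp: l_def\<close>)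
    then have "((\<lambda>s. P (w + s * (z - w)) / (z - w)) has_field_derivative Q (l s)) (at (of_real s))"
      using zw(4) by (auto dest: DERIV_cdivide[of _ _ _ _ "z - w"])
    from DERIV_cmult[OF this, of a]
    have "((\<lambda>s. a * (P (w + s * (z - w)) / (z - w))) has_field_derivative a * Q (l s)) (at (of_real s))" .
    from has_vector_derivative_real_field[OF this]
    have "((\<lambda>s. a * (P (l s) / (z - w))) has_vector_derivative a * Q (l s)) (at s)" by (simp add: l_def)
    then show ?thesis unfolding \<phi>_def has_real_derivative_iff_has_vector_derivative
      by (rule bounded_linear.has_vector_derivative[OF bounded_linear_Re])
  qed
  then obtain s where "0 < s" "s < 1" "\<phi> 1 - \<phi> 0 = (1 - 0) * Re (a * Q (l s))"
    using MVT2[of 0 1 \<phi> "\<lambda>s. Re (a * Q (l s))"] by auto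
  moreover have "\<phi> 1 = \<phi> 0" using zw(3) by (simp add: \<phi>_def l_def)
  ultimately show False using pos[OF lS, of s] by simp
qed

text \<open>Together with \<open>real_axis_increase\<close> this compares a point of the upper half
  disc with the centre along a piece of the real axis followed by a vertical segment.\<close>

lemma vertical_increase:
  fixes P Q :: "complex \<Rightarrow> complex"
  assumes d: "\<And>\<zeta>. \<zeta> \<in> ball (of_real t) r \<Longrightarrow> (P has_field_derivative Q \<zeta>) (at \<zeta>)"
    and pos: "\<And>\<zeta>. \<zeta> \<in> ball (of_real t) r \<Longrightarrow> Re (Q \<zeta>) > 0"
    and \<zeta>: "\<zeta> \<in> ball (of_real t) r" "Im \<zeta> > 0"
  shows "Im (P \<zeta>) > Im (P (of_real (Re \<zeta>)))"
proof -
  define l where "l s = of_real (Re \<zeta>) + \<i> * of_real s" for s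
  have lb: "l s \<in> ball (of_real t) r" if "0 \<le> s" "s \<le> Im \<zeta>" for s
  proof -
    have "norm (l s - of_real t) \<le> norm (\<zeta> - of_real t)"
      using that by (simp add: l_def cmod_def power_mono)
    then show ?thesis using \<zeta>(1) by (simp add: dist_norm norm_minus_commute)
  qed
  have "((\<lambda>s. Im (P (l s))) has_real_derivative Re (Q (l s))) (at s)" if "0 \<le> s" "s \<le> Im \<zeta>" for s
  proof -
    have "((\<lambda>s. P (of_real (Re \<zeta>) + \<i> * s)) has_field_derivative Q (l s) * \<i>) (at (of_real s))"
      by (rule DERIV_chain'[where g = P]) (use d[OF lb[OF that]] in \<open>auto intro!: derivative_eq_intros simp: l_def\<close>)
    from has_vector_derivative_real_field[OF this]
    have "((\<lambda>s. P (l s)) has_vector_derivative Q (l s) * \<i>) (at s)" by (simp add: l_def)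
    from bounded_linear.has_vector_derivative[OF bounded_linear_Im this] show ?thesis
      unfolding has_real_derivative_iff_has_vector_derivative by simp
  qed
  then obtain s where "0 < s" "s < Im \<zeta>" "Im (P (l (Im \<zeta>))) - Im (P (l 0)) = (Im \<zeta> - 0) * Re (Q (l s))"
    using MVT2[of 0 "Im \<zeta>" "\<lambda>s. Im (P (l s))" "\<lambda>s. Re (Q (l s))"] \<zeta>(2) by auto
  moreover have "l (Im \<zeta>) = \<zeta>" "l 0 = of_real (Re \<zeta>)" by (auto simp: l_def complex_eq_iff)
  ultimately show ?thesis using pos[OF lb, of s] \<zeta>(2) by (smt (verit) mult_pos_pos)
qed

lemma real_axis_increase:
  fixes P Q :: "complex \<Rightarrow> complex"
  assumes d: "\<And>\<zeta>. \<zeta> \<in> ball (of_real t) r \<Longrightarrow> (P has_field_derivative Q \<zeta>) (at \<zeta>)"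
    and sg: "\<And>\<tau>. \<bar>\<tau> - t\<bar> < r \<Longrightarrow> Im (Q (of_real \<tau>)) * (\<tau> - t) \<ge> 0" and \<tau>: "\<bar>\<tau> - t\<bar> < r"
  shows "Im (P (of_real \<tau>)) \<ge> Im (P (of_real t))"
proof -
  have der: "((\<lambda>s. Im (P (of_real s))) has_real_derivative Im (Q (of_real s))) (at s)" if "\<bar>s - t\<bar> < r" for s
  proof -
    have "of_real s \<in> ball (complex_of_real t) r" using that by (simp add: dist_norm norm_minus_commute flip: of_real_diff)
    from bounded_linear.has_vector_derivative[OF bounded_linear_Im has_vector_derivative_real_field[OF d[OF this]]] show ?thesis
      unfolding has_real_derivative_iff_has_vector_derivative by simp
  qed
  show ?thesis
  proof (cases \<tau> t rule: linorder_cases)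
    case less
    then obtain s where s: "\<tau> < s" "s < t" "Im (P (of_real t)) - Im (P (of_real \<tau>)) = (t - \<tau>) * Im (Q (of_real s))"
      using MVT2[of \<tau> t "\<lambda>s. Im (P (of_real s))" "\<lambda>s. Im (Q (of_real s))"] der \<tau> by auto
    have "Im (Q (of_real s)) * (s - t) \<ge> 0" using sg s \<tau> by auto
    then have "Im (Q (of_real s)) \<le> 0" using s by (simp add: zero_le_mult_iff)
    then show ?thesis using s less by (smt (verit) mult_nonneg_nonpos)
  next
    case greater
    then obtain s where s: "t < s" "s < \<tau>" "Im (P (of_real \<tau>)) - Im (P (of_real t)) = (\<tau> - t) * Im (Q (of_real s))"
      using MVT2[of t \<tau> "\<lambda>s. Im (P (of_real s))" "\<lambda>s. Im (Q (of_real s))"] der \<tau> by auto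
    have "Im (Q (of_real s)) * (s - t) \<ge> 0" using sg s \<tau> by auto
    then have "Im (Q (of_real s)) \<ge> 0" using s by (simp add: zero_le_mult_iff)
    then show ?thesis using s greater by (smt (verit) mult_nonneg_nonneg)
  qed auto
qed

text \<open>The direction h satisfies the same reality condition as g, without a pole, so every g +
  \<epsilon> h keeps the tangent directions prescribed by t, up to sign.\<close>

locale perturbed_curve = univalent_curve +
  fixes h :: "complex \<Rightarrow> complex"
  assumes h_hol: "h holomorphic_on UNIV"
    and h_real: "\<And>t::real. Im (exp (- (\<i> * N * t / 2)) * (exp (\<i> * t) * deriv h (exp (\<i> * t)))) = 0"
begin

definition H :: "complex \<Rightarrow> complex" where "H \<zeta> = exp (- (\<i> * N * \<zeta> / 2)) * (exp (\<i> * \<zeta>) * deriv h (exp (\<i> * \<zeta>)))"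
definition ge :: "real \<Rightarrow> complex \<Rightarrow> complex" where "ge \<epsilon> z = g z + of_real \<epsilon> * h z"
definition Ge :: "real \<Rightarrow> complex \<Rightarrow> complex" where "Ge \<epsilon> \<zeta> = ge \<epsilon> (exp (\<i> * \<zeta>))"
definition Fe :: "real \<Rightarrow> complex \<Rightarrow> complex" where "Fe \<epsilon> \<zeta> = F \<zeta> + of_real \<epsilon> * H \<zeta>"
definition fe :: "real \<Rightarrow> real \<Rightarrow> real" where "fe \<epsilon> t = Re (Fe \<epsilon> (of_real t))"

lemma h_deriv: "(h has_field_derivative deriv h z) (at z)"
  using h_hol holomorphic_derivI by blast

lemma H_hol: "H holomorphic_on UNIV"
proof -
  have "deriv h holomorphic_on UNIV" using h_hol holomorphic_deriv by blast
  then have "(\<lambda>\<zeta>. deriv h (exp (\<i> * \<zeta>))) holomorphic_on UNIV"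
    using holomorphic_on_compose_gen[of "\<lambda>\<zeta>. exp (\<i> * \<zeta>)" UNIV "deriv h" UNIV]
    by (auto simp: o_def intro!: holomorphic_intros)
  then show ?thesis unfolding H_def by (intro holomorphic_intros) auto
qed

lemma Fe_of_real: "Fe \<epsilon> (of_real t) = of_real (fe \<epsilon> t)"
  using h_real[of t] by (simp add: fe_def Fe_def F_of_real H_def complex_eq_iff)

lemma fe_0: "fe 0 t = f t" by (simp add: fe_def Fe_def f_def)

lemma Ge_deriv: "(Ge \<epsilon> has_field_derivative \<i> * exp (\<i> * of_nat N * \<zeta> / 2) * Fe \<epsilon> \<zeta>) (at \<zeta>)"
proof -
  have "((\<lambda>\<zeta>. h (exp (\<i> * \<zeta>))) has_field_derivative deriv h (exp (\<i> * \<zeta>)) * (exp (\<i> * \<zeta>) * \<i>)) (at \<zeta>)"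
    by (auto intro!: derivative_eq_intros DERIV_chain'[OF _ h_deriv])
  from DERIV_add[OF G_deriv DERIV_cmult[OF this, of "of_real \<epsilon>"]]
  have "((\<lambda>\<zeta>. G \<zeta> + of_real \<epsilon> * h (exp (\<i> * \<zeta>))) has_field_derivative
     \<i> * exp (\<i> * of_nat N * \<zeta> / 2) * F \<zeta> + of_real \<epsilon> * (deriv h (exp (\<i> * \<zeta>)) * (exp (\<i> * \<zeta>) * \<i>))) (at \<zeta>)" .
  moreover have "\<i> * exp (\<i> * of_nat N * \<zeta> / 2) * Fe \<epsilon> \<zeta> = \<i> * exp (\<i> * of_nat N * \<zeta> / 2) * F \<zeta> + of_real \<epsilon> * (deriv h (exp (\<i> * \<zeta>)) * (exp (\<i> * \<zeta>) * \<i>))"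
  proof -
    have "\<i> * exp (\<i> * of_nat N * \<zeta> / 2) * Fe \<epsilon> \<zeta> = \<i> * exp (\<i> * of_nat N * \<zeta> / 2) * F \<zeta> +
        of_real \<epsilon> * ((exp (\<i> * of_nat N * \<zeta> / 2) * exp (- (\<i> * of_nat N * \<zeta> / 2))) * (deriv h (exp (\<i> * \<zeta>)) * (exp (\<i> * \<zeta>) * \<i>)))"
      by (simp add: Fe_def H_def algebra_simps)
    also have "exp (\<i> * of_nat N * \<zeta> / 2) * exp (- (\<i> * of_nat N * \<zeta> / 2)) = 1" by (simp flip: exp_add)
    finally show ?thesis by simp
  qed
  moreover have "Ge \<epsilon> = (\<lambda>\<zeta>. G \<zeta> + of_real \<epsilon> * h (exp (\<i> * \<zeta>)))" by (auto simp: Ge_def ge_def G_def)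
  ultimately show ?thesis by (simp only:)
qed

lemma cont_F: "continuous_on UNIV F" "continuous_on UNIV H" "continuous_on UNIV (deriv F)" "continuous_on UNIV (deriv H)"
  using F_hol H_hol holomorphic_deriv[OF F_hol] holomorphic_deriv[OF H_hol] holomorphic_on_imp_continuous_on by blast+

text \<open>The tangent turns at the constant rate N / 2 in the parameter, so near a regular
  parameter the domain is locally convex and the half disc is mapped strictly to the inner side of
  the tangent at t, uniformly in \<epsilon>. The normal \<open>T t\<close> is that of the
  unperturbed curve, because the perturbation does not turn it.\<close>

lemma half_plane_uniform:
  assumes ft: "f t \<noteq> 0"
  obtains r where "r > 0" "\<And>\<epsilon> \<zeta>. \<bar>\<epsilon>\<bar> < r \<Longrightarrow> \<zeta> \<in> ball (of_real t) r \<Longrightarrow> Im \<zeta> > 0 \<Longrightarrow> Re (cnj (T t) * (Ge \<epsilon> \<zeta> - Ge \<epsilon> (of_real t))) < 0"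
proof -
  let ?t = "complex_of_real t"
  define Q where "Q \<epsilon> \<zeta> = cnj (T t) * exp (\<i> * of_nat N * \<zeta> / 2) * Fe \<epsilon> \<zeta>" for \<epsilon> \<zeta>
  have TT: "cnj (T t) = cis (- (real N * t / 2)) * of_real (sgn (f t))" by (simp add: T_def cis_cnj)
  have Qr: "Q \<epsilon> (of_real \<tau>) = cis (real N * (\<tau> - t) / 2) * of_real (sgn (f t) * fe \<epsilon> \<tau>)" for \<epsilon> \<tau>
  proof -
    have "exp (\<i> * of_nat N * of_real \<tau> / 2) = cis (real N * \<tau> / 2)" by (simp add: cis_conv_exp mult.assoc)
    then have "Q \<epsilon> (of_real \<tau>) = (cis (- (real N * t / 2)) * cis (real N * \<tau> / 2)) * of_real (sgn (f t) * fe \<epsilon> \<tau>)"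
      by (simp add: Q_def TT Fe_of_real mult_ac)
    also have "cis (- (real N * t / 2)) * cis (real N * \<tau> / 2) = cis (real N * (\<tau> - t) / 2)"
      by (simp add: cis_mult right_diff_distrib diff_divide_distrib)
    finally show ?thesis .
  qed
  have "continuous_on UNIV (\<lambda>x. Re (Q (snd x) (fst x)))" unfolding Q_def Fe_def
    by (intro continuous_intros continuous_on_compose2[OF cont_F(1)] continuous_on_compose2[OF cont_F(2)]) auto
  moreover have "Re (Q (snd (?t, 0::real)) (fst (?t, 0::real))) > 0"
    using Qr[of 0 t] ft by (simp add: fe_0 sgn_mult_self_eq) (simp add: sgn_if)
  ultimately obtain r where r: "r > 0" "\<And>x y. dist x ?t < r \<Longrightarrow> dist y 0 < r \<Longrightarrow> Re (Q y x) > 0"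
    using positive_nbhd2[of "\<lambda>x. Re (Q (snd x) (fst x))" ?t 0] by auto
  \<comment> \<open>Keeps the turning of the tangent on this window below a right angle.\<close>
  define r' where "r' = min r (pi / (2 * real N))"
  have r': "r' > 0" "r' \<le> r" "real N * r' \<le> pi / 2" using r N_pos by (auto simp: r'_def field_simps min_def)
  show ?thesis
  proof (rule that[OF r'(1)])
    fix \<epsilon> \<zeta> assume \<epsilon>: "\<bar>\<epsilon>\<bar> < r'" and \<zeta>: "\<zeta> \<in> ball ?t r'" "Im \<zeta> > 0"
    define P where "P \<zeta> = cnj (T t) * Ge \<epsilon> \<zeta> / \<i>" for \<zeta>
    have dP: "(P has_field_derivative Q \<epsilon> \<zeta>) (at \<zeta>)" for \<zeta>
    proof -
      have "(P has_field_derivative (cnj (T t) * (\<i> * exp (\<i> * of_nat N * \<zeta> / 2) * Fe \<epsilon> \<zeta>)) / \<i>) (at \<zeta>)"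
        unfolding P_def by (intro DERIV_cdivide DERIV_cmult Ge_deriv)
      then show ?thesis by (simp add: Q_def mult_ac)
    qed
    have pos: "Re (Q \<epsilon> \<omega>) > 0" if "\<omega> \<in> ball ?t r'" for \<omega>
      using that \<epsilon> r' by (intro r(2)) (auto simp: dist_commute)
    have sg: "Im (Q \<epsilon> (of_real \<tau>)) * (\<tau> - t) \<ge> 0" if \<tau>: "\<bar>\<tau> - t\<bar> < r'" for \<tau>
    proof -
      define \<theta> where "\<theta> = real N * (\<tau> - t) / 2"
      define v where "v = sgn (f t) * fe \<epsilon> \<tau>"
      have "\<bar>\<theta>\<bar> < pi / 2"
      proof -
        have "real N * \<bar>\<tau> - t\<bar> < real N * r'" using \<tau> N_pos by simp
        then have "real N * \<bar>\<tau> - t\<bar> < pi" using r'(3) pi_gt_zero by linarith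
        then show ?thesis by (simp add: \<theta>_def abs_mult)
      qed
      then have c: "cos \<theta> > 0" by (intro cos_gt_zero_pi) auto
      have "of_real \<tau> \<in> ball ?t r'" using \<tau> by (simp add: dist_norm norm_minus_commute flip: of_real_diff)
      from pos[OF this] have "cos \<theta> * v > 0" by (simp add: Qr \<theta>_def v_def)
      then have v: "v > 0" using c by (simp add: zero_less_mult_iff)
      have "sin \<theta> * (\<tau> - t) \<ge> 0"
      proof (cases "\<tau> \<ge> t")
        case True
        then have "0 \<le> \<theta>" by (simp add: \<theta>_def)
        moreover have "\<theta> \<le> pi" using \<open>\<bar>\<theta>\<bar> < pi / 2\<close> pi_gt_zero by linarith
        ultimately have "sin \<theta> \<ge> 0" by (rule sin_ge_zero)
        then show ?thesis using True by simp
      next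
        case False
        then have "0 \<le> - \<theta>" by (simp add: \<theta>_def mult_nonneg_nonpos)
        moreover have "- \<theta> \<le> pi" using \<open>\<bar>\<theta>\<bar> < pi / 2\<close> pi_gt_zero by linarith
        ultimately have "sin (- \<theta>) \<ge> 0" by (rule sin_ge_zero)
        then show ?thesis using False by (simp add: zero_le_mult_iff)
      qed
      then have "v * (sin \<theta> * (\<tau> - t)) \<ge> 0" using v by simp
      then show ?thesis by (simp add: Qr \<theta>_def v_def mult_ac)
    qed
    have Re: "\<bar>Re \<zeta> - t\<bar> < r'" using \<zeta>(1) abs_Re_le_cmod[of "\<zeta> - ?t"] by (simp add: dist_norm norm_minus_commute)
    have "Im (P \<zeta>) > Im (P (of_real (Re \<zeta>)))" by (rule vertical_increase[OF dP pos \<zeta>])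
    moreover have "Im (P (of_real (Re \<zeta>))) \<ge> Im (P ?t)" by (rule real_axis_increase[OF dP sg Re])
    ultimately have "Im (P \<zeta> - P ?t) > 0" by simp
    moreover have "P \<zeta> - P ?t = (cnj (T t) * (Ge \<epsilon> \<zeta> - Ge \<epsilon> ?t)) / \<i>" by (simp add: P_def field_simps)
    moreover have "Im (w / \<i>) = - Re w" for w by (simp add: Im_divide)
    ultimately show "Re (cnj (T t) * (Ge \<epsilon> \<zeta> - Ge \<epsilon> ?t)) < 0" by (simp only:)
  qed
qed

lemma deriv_Fe: "(Fe \<epsilon> has_field_derivative deriv F \<zeta> + of_real \<epsilon> * deriv H \<zeta>) (at \<zeta>)"
  unfolding Fe_def using F_deriv holomorphic_derivI[OF H_hol open_UNIV UNIV_I]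
  by (intro DERIV_add DERIV_cmult) auto

lemma deriv_fe: "(fe \<epsilon> has_real_derivative Re (deriv F (of_real t) + of_real \<epsilon> * deriv H (of_real t))) (at t)"
proof -
  from bounded_linear.has_vector_derivative[OF bounded_linear_Re has_vector_derivative_real_field[OF deriv_Fe[of \<epsilon> "of_real t"]]]
  show ?thesis unfolding fe_def has_real_derivative_iff_has_vector_derivative .
qed

text \<open>The perturbed real factor has a simple zero c near t. Relative to the phase at c, the
  derivative of \<open>Ge \<epsilon>\<close> takes values in one half plane over the upper half
  disc: on the real axis the sine of the phase and the real factor change sign together at c, and
  above it the imaginary part of their product increases. Then the Noshiro-Warschawski criterion
  applies.\<close>

lemma cusp_uniform:
  assumes ft: "f t = 0"
  obtains r where "r > 0" "\<And>\<epsilon>. \<bar>\<epsilon>\<bar> < r \<Longrightarrow> inj_on (Ge \<epsilon>) (ball (of_real t) r \<inter> {\<zeta>. Im \<zeta> > 0})"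
proof -
  let ?t = "complex_of_real t"
  define d0 where "d0 = Re (deriv F ?t)"
  have d0: "d0 \<noteq> 0"
  proof -
    have "((\<lambda>s. F (of_real s)) has_vector_derivative deriv F ?t) (at t)"
      by (rule has_vector_derivative_real_field[OF F_deriv])
    from bounded_linear.has_vector_derivative[OF bounded_linear_Im this]
    have "((\<lambda>s. 0) has_vector_derivative Im (deriv F ?t)) (at t)" by (simp add: F_of_real)
    then have "Im (deriv F ?t) = 0" using vector_derivative_unique_at[OF _ has_vector_derivative_const] by blast
    then show ?thesis using simple_zero[OF ft] by (auto simp: d0_def complex_eq_iff)
  qed
  define \<sigma> where "\<sigma> = sgn d0"
  have \<sigma>: "\<sigma> * d0 > 0" "\<sigma> * \<sigma> = 1" using d0 by (auto simp: \<sigma>_def sgn_if)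
  define E where "E c \<zeta> = exp (\<i> * of_nat N * (\<zeta> - of_real c) / 2)" for c :: real and \<zeta>
  \<comment> \<open>The real part of the derivative of Q below, with the position c of the perturbed
    zero as a third variable; its positivity at (t, 0, t) persists nearby.\<close>
  define R where "R = (\<lambda>(\<zeta>, \<epsilon>::real, c). Re (E c \<zeta> * of_real \<sigma> * (deriv F \<zeta> + of_real \<epsilon> * deriv H \<zeta> + \<i> * of_nat N / 2 * Fe \<epsilon> \<zeta>)))"
  have Req: "R = (\<lambda>x. Re (exp (\<i> * of_nat N * (fst x - of_real (snd (snd x))) / 2) * of_real \<sigma> *
      (deriv F (fst x) + of_real (fst (snd x)) * deriv H (fst x) + \<i> * of_nat N / 2 * (F (fst x) + of_real (fst (snd x)) * H (fst x)))))"
    by (auto simp: R_def E_def Fe_def split: prod.splits)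
  have contR: "continuous_on UNIV R" unfolding Req
    by (intro continuous_intros continuous_on_compose2[OF cont_F(1)] continuous_on_compose2[OF cont_F(2)]
      continuous_on_compose2[OF cont_F(3)] continuous_on_compose2[OF cont_F(4)]) auto
  have R0: "R (?t, 0, t) > 0" using \<sigma> ft by (simp add: R_def E_def Fe_of_real fe_0 d0_def)
  obtain r0 where r0: "r0 > 0" "\<And>x y z. dist x ?t < r0 \<Longrightarrow> dist y 0 < r0 \<Longrightarrow> dist z t < r0 \<Longrightarrow> R (x, y, z) > 0"
    using positive_nbhd3[OF contR R0] by metis
  \<comment> \<open>The zero c and the real part of a point of the disc are at most 2 r1 apart,
    which keeps the phase \<theta> within the range where its sine has its sign.\<close>
  define r1 where "r1 = min r0 (pi / real N) / 2"
  have r1: "r1 > 0" "r1 < r0" "2 * (real N * r1) \<le> pi"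
  proof -
    show "r1 > 0" using r0(1) N_pos by (simp add: r1_def)
    show "r1 < r0" using r0(1) by (simp add: r1_def min_def)
    have "2 * r1 \<le> pi / real N" by (simp add: r1_def)
    then show "2 * (real N * r1) \<le> pi" using N_pos by (simp add: field_simps)
  qed
  have inc: "\<sigma> * Re (deriv F (of_real \<tau>) + of_real \<epsilon> * deriv H (of_real \<tau>)) > 0" if "\<bar>\<tau> - t\<bar> < r0" "\<bar>\<epsilon>\<bar> < r0" for \<tau> \<epsilon>
  proof -
    have "dist (complex_of_real \<tau>) ?t < r0" using that by (simp add: dist_norm flip: of_real_diff)
    then have "R (of_real \<tau>, \<epsilon>, \<tau>) > 0" using that by (intro r0(2)) (auto simp: dist_real_def)
    then show ?thesis by (simp add: R_def E_def Fe_of_real)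
  qed
  have mono: "\<sigma> * fe \<epsilon> a < \<sigma> * fe \<epsilon> b" if "a < b" "\<bar>a - t\<bar> < r0" "\<bar>b - t\<bar> < r0" "\<bar>\<epsilon>\<bar> < r0" for a b \<epsilon>
  proof (rule DERIV_pos_imp_increasing[OF that(1)])
    fix x assume "a \<le> x" "x \<le> b"
    then have "\<bar>x - t\<bar> < r0" using that by auto
    then show "\<exists>y. ((\<lambda>x. \<sigma> * fe \<epsilon> x) has_real_derivative y) (at x) \<and> 0 < y"
      using inc[of x \<epsilon>] that(4) DERIV_cmult[OF deriv_fe] by blast
  qed
  have sgn1: "\<sigma> * fe 0 (t - r1) < 0" "\<sigma> * fe 0 (t + r1) > 0"
    using mono[of "t - r1" t 0] mono[of t "t + r1" 0] r1 r0 ft by (auto simp: fe_0)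
  have cfe: "isCont (\<lambda>\<epsilon>. \<sigma> * fe \<epsilon> a) 0" for a unfolding fe_def Fe_def by (intro continuous_intros isCont_Re)
  obtain e1 where e1: "e1 > 0" "\<And>\<epsilon>. \<bar>\<epsilon>\<bar> < e1 \<Longrightarrow> \<sigma> * fe \<epsilon> (t - r1) < 0"
  proof -
    obtain e where e: "e > 0" "\<And>\<epsilon>. dist \<epsilon> 0 < e \<Longrightarrow> dist (\<sigma> * fe \<epsilon> (t - r1)) (\<sigma> * fe 0 (t - r1)) < - (\<sigma> * fe 0 (t - r1))"
      using cfe[of "t - r1"] sgn1(1) unfolding continuous_at_eps_delta by (metis neg_0_less_iff_less)
    have "\<sigma> * fe \<epsilon> (t - r1) < 0" if "\<bar>\<epsilon>\<bar> < e" for \<epsilon> using e(2)[of \<epsilon>] that by (auto simp: dist_real_def)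
    then show ?thesis using that e(1) by blast
  qed
  obtain e2 where e2: "e2 > 0" "\<And>\<epsilon>. \<bar>\<epsilon>\<bar> < e2 \<Longrightarrow> \<sigma> * fe \<epsilon> (t + r1) > 0"
  proof -
    obtain e where e: "e > 0" "\<And>\<epsilon>. dist \<epsilon> 0 < e \<Longrightarrow> dist (\<sigma> * fe \<epsilon> (t + r1)) (\<sigma> * fe 0 (t + r1)) < \<sigma> * fe 0 (t + r1)"
      using cfe[of "t + r1"] sgn1(2) unfolding continuous_at_eps_delta by metis
    have "\<sigma> * fe \<epsilon> (t + r1) > 0" if "\<bar>\<epsilon>\<bar> < e" for \<epsilon> using e(2)[of \<epsilon>] that by (auto simp: dist_real_def)
    then show ?thesis using that e(1) by blast
  qed
  define r where "r = min r1 (min e1 e2)"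
  have r: "r > 0" "r \<le> r1" "r \<le> e1" "r \<le> e2" using r1 e1 e2 by (auto simp: r_def)
  show ?thesis
  proof (rule that[OF r(1)])
    fix \<epsilon> assume \<epsilon>: "\<bar>\<epsilon>\<bar> < r"
    have "\<exists>c. t - r1 \<le> c \<and> c \<le> t + r1 \<and> \<sigma> * fe \<epsilon> c = 0"
    proof (rule IVT)
      show "\<sigma> * fe \<epsilon> (t - r1) \<le> 0" "0 \<le> \<sigma> * fe \<epsilon> (t + r1)" using e1(2)[of \<epsilon>] e2(2)[of \<epsilon>] \<epsilon> r by auto
      show "\<forall>x. t - r1 \<le> x \<and> x \<le> t + r1 \<longrightarrow> isCont (\<lambda>c. \<sigma> * fe \<epsilon> c) x"
        using DERIV_isCont[OF DERIV_cmult[OF deriv_fe]] by blast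
    qed (use r1 in auto)
    then obtain c where c': "t - r1 \<le> c" "c \<le> t + r1" "\<sigma> * fe \<epsilon> c = 0" by blast
    then have c: "\<bar>c - t\<bar> \<le> r1" "fe \<epsilon> c = 0" using \<sigma> by auto
    define Q where "Q \<zeta> = E c \<zeta> * of_real \<sigma> * Fe \<epsilon> \<zeta>" for \<zeta>
    have Er: "E c (of_real \<tau>) = cis (real N * (\<tau> - c) / 2)" for \<tau>
      by (simp add: E_def cis_conv_exp mult.assoc)
    have dQ: "(Q has_field_derivative E c \<zeta> * of_real \<sigma> * (deriv F \<zeta> + of_real \<epsilon> * deriv H \<zeta> + \<i> * of_nat N / 2 * Fe \<epsilon> \<zeta>)) (at \<zeta>)" for \<zeta>
    proof -
      have "(E c has_field_derivative E c \<zeta> * (\<i> * of_nat N / 2)) (at \<zeta>)" unfolding E_def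
        by (rule derivative_eq_intros refl | simp)+
      from DERIV_mult[OF DERIV_cmult_right[OF this, of "of_real \<sigma>"] deriv_Fe] show ?thesis
        unfolding Q_def by (simp add: algebra_simps)
    qed
    have pos: "Re (E c \<zeta> * of_real \<sigma> * (deriv F \<zeta> + of_real \<epsilon> * deriv H \<zeta> + \<i> * of_nat N / 2 * Fe \<epsilon> \<zeta>)) > 0"
      if "\<zeta> \<in> ball ?t r" for \<zeta>
      using r0(2)[of \<zeta> \<epsilon> c] that \<epsilon> r r1 c by (auto simp: R_def dist_commute dist_real_def)
    have ImQ: "Im (Q \<zeta>) > 0" if \<zeta>: "\<zeta> \<in> ball ?t r" "Im \<zeta> > 0" for \<zeta>
    proof -
      have Re: "\<bar>Re \<zeta> - t\<bar> < r" using \<zeta>(1) abs_Re_le_cmod[of "\<zeta> - ?t"] by (simp add: dist_norm norm_minus_commute)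
      define \<theta> where "\<theta> = real N * (Re \<zeta> - c) / 2"
      have "\<bar>Re \<zeta> - c\<bar> \<le> 2 * r1" using Re c r by linarith
      then have "real N * \<bar>Re \<zeta> - c\<bar> \<le> real N * (2 * r1)" by (intro mult_left_mono) auto
      also have "\<dots> = 2 * (real N * r1)" by simp
      finally have "real N * \<bar>Re \<zeta> - c\<bar> \<le> pi * 2" using r1(3) pi_gt_zero by linarith
      then have \<theta>: "\<bar>\<theta>\<bar> \<le> pi" by (simp add: \<theta>_def abs_mult)
      have "sin \<theta> * (\<sigma> * fe \<epsilon> (Re \<zeta>)) \<ge> 0"
      proof (cases "Re \<zeta>" c rule: linorder_cases)
        case less
        then have "\<sigma> * fe \<epsilon> (Re \<zeta>) < \<sigma> * fe \<epsilon> c" using Re c r r1 \<epsilon> by (intro mono) auto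
        moreover have "\<theta> \<le> 0" using less by (simp add: \<theta>_def mult_nonneg_nonpos)
        then have "sin (- \<theta>) \<ge> 0" using \<theta> by (intro sin_ge_zero) auto
        ultimately show ?thesis using c(2) by (simp add: zero_le_mult_iff)
      next
        case greater
        then have "\<sigma> * fe \<epsilon> c < \<sigma> * fe \<epsilon> (Re \<zeta>)" using Re c r r1 \<epsilon> by (intro mono) auto
        moreover have "0 \<le> \<theta>" using greater by (simp add: \<theta>_def)
        then have "sin \<theta> \<ge> 0" using \<theta> by (intro sin_ge_zero) auto
        ultimately show ?thesis using c(2) by simp
      qed (simp add: c \<theta>_def)
      then have "Im (Q (of_real (Re \<zeta>))) \<ge> 0" by (simp add: Q_def Er Fe_of_real \<theta>_def mult_ac)
      moreover have "Im (Q \<zeta>) > Im (Q (of_real (Re \<zeta>)))" by (rule vertical_increase[OF dQ pos \<zeta>])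
      ultimately show ?thesis by simp
    qed
    show "inj_on (Ge \<epsilon>) (ball ?t r \<inter> {\<zeta>. Im \<zeta> > 0})"
    \<comment> \<open>The constant turns the derivative of \<open>Ge \<epsilon>\<close> into - i Q,
      whose real part is the imaginary part of Q.\<close>
    proof (rule injective_positive_derivative[where a = "- (cis (- (real N * c / 2)) * of_real \<sigma>)"])
      show "convex (ball ?t r \<inter> {\<zeta>. Im \<zeta> > 0})"
        by (intro convex_Int convex_ball convex_halfspace_Im_gt)
      fix \<zeta> assume \<zeta>: "\<zeta> \<in> ball ?t r \<inter> {\<zeta>. Im \<zeta> > 0}"
      show "(Ge \<epsilon> has_field_derivative \<i> * exp (\<i> * of_nat N * \<zeta> / 2) * Fe \<epsilon> \<zeta>) (at \<zeta>)" by (rule Ge_deriv)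
      have "E c \<zeta> = cis (- (real N * c / 2)) * exp (\<i> * of_nat N * \<zeta> / 2)"
        by (simp add: E_def cis_conv_exp flip: exp_add) (simp add: algebra_simps diff_divide_distrib)
      then have eq: "- (cis (- (real N * c / 2)) * of_real \<sigma>) * (\<i> * exp (\<i> * of_nat N * \<zeta> / 2) * Fe \<epsilon> \<zeta>) = - \<i> * Q \<zeta>"
        by (simp add: Q_def mult_ac)
      show "0 < Re (- (cis (- (real N * c / 2)) * of_real \<sigma>) * (\<i> * exp (\<i> * of_nat N * \<zeta> / 2) * Fe \<epsilon> \<zeta>))"
        unfolding eq using ImQ[of \<zeta>] \<zeta> by simp
    qed
  qed
qed

end

section \<open>Local injectivity, uniformly in the perturbation\<close>

context perturbed_curve
begin

lemma ge_deriv: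
  assumes "\<kappa> = 0 \<or> z \<noteq> 0"
  shows "(ge \<epsilon> has_field_derivative deriv p z + of_nat \<kappa> / z^2 + of_real \<epsilon> * deriv h z) (at z)"
  unfolding ge_def by (intro DERIV_add DERIV_cmult g_deriv[OF assms] h_deriv)

text \<open>Injectivity near the pair (z, w), uniformly in small \<epsilon>; for z = w it is
  injectivity near one point. The centres z and w may be boundary points or the puncture, so that
  the pairs to be checked form a compact set.\<close>

definition good :: "complex \<Rightarrow> complex \<Rightarrow> bool" where
  "good z w \<longleftrightarrow> (\<exists>r>0. \<forall>z' w' \<epsilon>. z' \<in> D \<longrightarrow> w' \<in> D \<longrightarrow> dist z' z < r \<longrightarrow> dist w' w < r \<longrightarrow> \<bar>\<epsilon>\<bar> < r \<longrightarrow> z' \<noteq> w' \<longrightarrow> ge \<epsilon> z' \<noteq> ge \<epsilon> w')"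

lemma good_sym: "good z w \<Longrightarrow> good w z"
  unfolding good_def by metis

lemma good_separated:
  assumes z: "\<kappa> = 0 \<or> z \<noteq> 0" and w: "\<kappa> = 0 \<or> w \<noteq> 0" and ne: "g z \<noteq> g w"
  shows "good z w"
proof -
  define e where "e = dist (g z) (g w) / 4"
  have e: "e > 0" using ne by (simp add: e_def)
  have ch: "isCont h x" for x using h_deriv DERIV_isCont by blast
  have near: "\<exists>r>0. \<forall>x' \<epsilon>. dist x' x < r \<longrightarrow> \<bar>\<epsilon>\<bar> < r \<longrightarrow> dist (ge \<epsilon> x') (g x) < e * 2" if x: "\<kappa> = 0 \<or> x \<noteq> 0" for x
  proof -
    obtain r1 where r1: "r1 > 0" "\<And>x'. dist x' x < r1 \<Longrightarrow> dist (g x') (g x) < e"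
      using g_isCont[OF x] e unfolding continuous_at_eps_delta by metis
    obtain r2 where r2: "r2 > 0" "\<And>x'. dist x' x < r2 \<Longrightarrow> dist (h x') (h x) < 1"
      using ch[of x] unfolding continuous_at_eps_delta by (metis zero_less_one)
    define B where "B = norm (h x) + 1"
    have B: "B > 0" by (simp add: B_def add_nonneg_pos)
    define r where "r = min (min r1 r2) (e / B)"
    have r: "r > 0" using r1 r2 e B by (simp add: r_def)
    have "dist (ge \<epsilon> x') (g x) < e * 2" if "dist x' x < r" "\<bar>\<epsilon>\<bar> < r" for x' \<epsilon>
    proof -
      have "norm (h x') \<le> B" using r2(2)[of x'] that norm_triangle_sub[of "h x'" "h x"] by (simp add: B_def r_def dist_norm)
      then have "\<bar>\<epsilon>\<bar> * norm (h x') \<le> \<bar>\<epsilon>\<bar> * B" by (intro mult_left_mono) auto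
      also have "\<dots> \<le> e" using that(2) B by (simp add: r_def field_simps)
      finally have "norm (of_real \<epsilon> * h x') \<le> e" by (simp add: norm_mult)
      moreover have "norm (g x' - g x) < e" using r1(2)[of x'] that by (simp add: r_def dist_norm)
      moreover have eq: "ge \<epsilon> x' - g x = (g x' - g x) + of_real \<epsilon> * h x'" by (simp add: ge_def)
      ultimately show ?thesis unfolding dist_norm eq
        using norm_triangle_ineq[of "g x' - g x" "of_real \<epsilon> * h x'"] by linarith
    qed
    then show ?thesis using r by blast
  qed
  obtain r1 where r1: "r1 > 0" "\<And>x' \<epsilon>. dist x' z < r1 \<Longrightarrow> \<bar>\<epsilon>\<bar> < r1 \<Longrightarrow> dist (ge \<epsilon> x') (g z) < e * 2" using near[OF z] by blast
  obtain r2 where r2: "r2 > 0" "\<And>x' \<epsilon>. dist x' w < r2 \<Longrightarrow> \<bar>\<epsilon>\<bar> < r2 \<Longrightarrow> dist (ge \<epsilon> x') (g w) < e * 2" using near[OF w] by blast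
  have "ge \<epsilon> z' \<noteq> ge \<epsilon> w'" if "dist z' z < min r1 r2" "dist w' w < min r1 r2" "\<bar>\<epsilon>\<bar> < min r1 r2" for z' w' \<epsilon>
  proof
    assume eq: "ge \<epsilon> z' = ge \<epsilon> w'"
    have "dist (g z) (g w) \<le> dist (ge \<epsilon> z') (g z) + dist (ge \<epsilon> w') (g w)"
      using eq by (metis dist_commute dist_triangle)
    also have "\<dots> < e * 2 + e * 2" using r1(2)[of z' \<epsilon>] r2(2)[of w' \<epsilon>] that by (intro add_strict_mono) auto
    finally show False by (simp add: e_def)
  qed
  then show ?thesis unfolding good_def using r1 r2 by (intro exI[of _ "min r1 r2"]) auto
qed

text \<open>Moving the point and perturbing the map each change the derivative by at most a quarter
  of norm c, so it stays in the half plane around c.\<close>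

lemma good_regular:
  assumes z: "\<kappa> = 0 \<or> z \<noteq> 0" and nz: "deriv p z + of_nat \<kappa> / z^2 \<noteq> 0"
  shows "good z z"
proof -
  define c where "c = deriv p z + of_nat \<kappa> / z^2"
  define S where "S = {z::complex. \<kappa> = 0 \<or> z \<noteq> 0}"
  have oS: "open S" unfolding S_def by (cases "\<kappa> = 0") (auto simp: Collect_neg_eq intro: open_Compl)
  define dg where "dg z = deriv p z + of_nat \<kappa> / z^2" for z
  have cp: "isCont (deriv p) x" "isCont (deriv h) x" for x
    using holomorphic_deriv[OF p_hol open_UNIV] holomorphic_deriv[OF h_hol open_UNIV]
    by (auto intro: continuous_on_interior[OF holomorphic_on_imp_continuous_on])
  have "isCont dg z"
  proof (cases "\<kappa> = 0")
    case True
    then have "dg = deriv p" by (auto simp: dg_def)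
    then show ?thesis using cp by simp
  next
    case False
    then show ?thesis using z cp unfolding dg_def by (intro continuous_intros) auto
  qed
  moreover have c2: "norm c / 4 > 0" using nz by (simp add: c_def)
  ultimately obtain r1 where r1: "r1 > 0" "\<And>x. dist x z < r1 \<Longrightarrow> dist (dg x) (dg z) < norm c / 4"
    unfolding continuous_at_eps_delta by metis
  obtain r2 where r2: "r2 > 0" "\<And>x. dist x z < r2 \<Longrightarrow> dist (deriv h x) (deriv h z) < 1"
    using cp(2)[of z] unfolding continuous_at_eps_delta by (metis zero_less_one)
  obtain r3 where r3: "r3 > 0" "ball z r3 \<subseteq> S" using oS z openE by (auto simp: S_def)
  define B where "B = norm (deriv h z) + 1"
  have B: "B > 0" by (simp add: B_def add_nonneg_pos)
  define r where "r = min (min r1 r2) (min r3 (norm c / 4 / B))"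
  have r: "r > 0" using r1 r2 r3 c2 B by (simp add: r_def)
  have "inj_on (ge \<epsilon>) (ball z r)" if \<epsilon>: "\<bar>\<epsilon>\<bar> < r" for \<epsilon>
  proof (rule injective_positive_derivative[where a = "cnj c"])
    fix x assume x: "x \<in> ball z r"
    then have "x \<in> S" using r3(2) by (auto simp: r_def)
    then have "\<kappa> = 0 \<or> x \<noteq> 0" by (simp add: S_def)
    then show "(ge \<epsilon> has_field_derivative dg x + of_real \<epsilon> * deriv h x) (at x)" unfolding dg_def by (rule ge_deriv)
    have "norm (deriv h x) \<le> B"
      using r2(2)[of x] x norm_triangle_sub[of "deriv h x" "deriv h z"] by (simp add: B_def r_def dist_norm norm_minus_commute)
    then have "\<bar>\<epsilon>\<bar> * norm (deriv h x) \<le> \<bar>\<epsilon>\<bar> * B" by (intro mult_left_mono) auto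
    also have "\<dots> \<le> norm c / 4" using \<epsilon> B by (simp add: r_def field_simps)
    finally have "norm (of_real \<epsilon> * deriv h x) \<le> norm c / 4" by (simp add: norm_mult)
    moreover have "norm (dg x - c) < norm c / 4" using r1(2)[of x] x by (simp add: r_def dist_norm norm_minus_commute dg_def c_def)
    moreover define v where "v = dg x + of_real \<epsilon> * deriv h x - c"
    have "v = (dg x - c) + of_real \<epsilon> * deriv h x" by (simp add: v_def)
    then have "norm v \<le> norm (dg x - c) + norm (of_real \<epsilon> * deriv h x)" by (simp only: norm_triangle_ineq)
    ultimately have "norm v < norm c" using c2 by linarith
    then have "norm (cnj c * v) < norm c * norm c" using c2 by (simp add: norm_mult)
    then have "Re (cnj c * v) > - (norm c * norm c)" using abs_Re_le_cmod[of "cnj c * v"] by linarith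
    moreover have cc: "cnj c * c = of_real (norm c * norm c)" using complex_norm_square[of c] by (simp add: mult.commute power2_eq_square)
    moreover have "cnj c * (dg x + of_real \<epsilon> * deriv h x) = cnj c * c + cnj c * v" by (simp add: v_def algebra_simps)
    ultimately show "Re (cnj c * (dg x + of_real \<epsilon> * deriv h x)) > 0" by simp
  qed simp
  then show ?thesis unfolding good_def using r by (intro exI[of _ r]) (auto simp: inj_on_def dist_commute)
qed

lemma upper_log_coordinate:
  assumes "r > 0"
  obtains r' where "r' > 0" "\<And>z. z \<in> D \<Longrightarrow> dist z (cis t) < r' \<Longrightarrow> \<exists>\<zeta>\<in>ball (of_real t) r. Im \<zeta> > 0 \<and> exp (\<i> * \<zeta>) = z"
proof -
  obtain r' where r': "r' > 0" "\<And>z. z \<in> ball (cis t) r' \<Longrightarrow> \<exists>\<zeta>\<in>ball (of_real t) r. exp (\<i> * \<zeta>) = z"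
    using log_coordinate[OF assms] by blast
  show ?thesis
  proof (rule that[OF r'(1)])
    fix z assume z: "z \<in> D" "dist z (cis t) < r'"
    then obtain \<zeta> where \<zeta>: "\<zeta> \<in> ball (of_real t) r" "exp (\<i> * \<zeta>) = z" using r'(2)[of z] by (auto simp: dist_commute)
    have "norm z < 1" using z by (simp add: punctured_disc_def)
    then have "Im \<zeta> > 0" using \<zeta>(2) norm_exp_eq_Re[of "\<i> * \<zeta>"] by simp
    then show "\<exists>\<zeta>\<in>ball (of_real t) r. Im \<zeta> > 0 \<and> exp (\<i> * \<zeta>) = z" using \<zeta> by blast
  qed
qed

lemma good_cusp:
  assumes "f t = 0" shows "good (cis t) (cis t)"
proof -
  obtain r where r: "r > 0" "\<And>\<epsilon>. \<bar>\<epsilon>\<bar> < r \<Longrightarrow> inj_on (Ge \<epsilon>) (ball (of_real t) r \<inter> {\<zeta>. Im \<zeta> > 0})"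
    using cusp_uniform[OF assms] by metis
  obtain r' where r': "r' > 0" "\<And>z. z \<in> D \<Longrightarrow> dist z (cis t) < r' \<Longrightarrow> \<exists>\<zeta>\<in>ball (of_real t) r. Im \<zeta> > 0 \<and> exp (\<i> * \<zeta>) = z"
    using upper_log_coordinate[OF r(1)] by metis
  have "ge \<epsilon> z \<noteq> ge \<epsilon> w" if zw: "z \<in> D" "w \<in> D" "dist z (cis t) < min r r'" "dist w (cis t) < min r r'" "\<bar>\<epsilon>\<bar> < min r r'" "z \<noteq> w" for z w \<epsilon>
  proof
    assume eq: "ge \<epsilon> z = ge \<epsilon> w"
    obtain \<zeta> where \<zeta>: "\<zeta> \<in> ball (of_real t) r" "Im \<zeta> > 0" "exp (\<i> * \<zeta>) = z" using r'(2)[of z] zw by auto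
    obtain \<omega> where \<omega>: "\<omega> \<in> ball (of_real t) r" "Im \<omega> > 0" "exp (\<i> * \<omega>) = w" using r'(2)[of w] zw by auto
    have "Ge \<epsilon> \<zeta> = Ge \<epsilon> \<omega>" using eq \<zeta> \<omega> by (simp add: Ge_def)
    then have "\<zeta> = \<omega>" using r(2)[of \<epsilon>] zw \<zeta> \<omega> by (auto simp: inj_on_def)
    then show False using \<zeta> \<omega> zw by simp
  qed
  then show ?thesis unfolding good_def using r r' by (intro exI[of _ "min r r'"]) auto
qed

text \<open>The two images lie on opposite sides of parallel tangent lines. The condition
  \<open>tang\<close> says that the perturbation moves both lines by the same amount along the
  normal, so the lines still coincide.\<close>

lemma good_double:
  assumes d: "dbl s t" and tang: "Re (cnj (T t) * (h (cis s) - h (cis t))) = 0"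
  shows "good (cis s) (cis t)"
proof -
  obtain r1 where r1: "r1 > 0" "\<And>\<epsilon> \<zeta>. \<bar>\<epsilon>\<bar> < r1 \<Longrightarrow> \<zeta> \<in> ball (of_real s) r1 \<Longrightarrow> Im \<zeta> > 0 \<Longrightarrow> Re (cnj (T s) * (Ge \<epsilon> \<zeta> - Ge \<epsilon> (of_real s))) < 0"
    using half_plane_uniform[OF dbl_tangent(1)[OF d]] by metis
  obtain r2 where r2: "r2 > 0" "\<And>\<epsilon> \<zeta>. \<bar>\<epsilon>\<bar> < r2 \<Longrightarrow> \<zeta> \<in> ball (of_real t) r2 \<Longrightarrow> Im \<zeta> > 0 \<Longrightarrow> Re (cnj (T t) * (Ge \<epsilon> \<zeta> - Ge \<epsilon> (of_real t))) < 0"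
    using half_plane_uniform[OF dbl_tangent(2)[OF d]] by metis
  obtain r1' where r1': "r1' > 0" "\<And>z. z \<in> D \<Longrightarrow> dist z (cis s) < r1' \<Longrightarrow> \<exists>\<zeta>\<in>ball (of_real s) r1. Im \<zeta> > 0 \<and> exp (\<i> * \<zeta>) = z"
    using upper_log_coordinate[OF r1(1)] by metis
  obtain r2' where r2': "r2' > 0" "\<And>z. z \<in> D \<Longrightarrow> dist z (cis t) < r2' \<Longrightarrow> \<exists>\<zeta>\<in>ball (of_real t) r2. Im \<zeta> > 0 \<and> exp (\<i> * \<zeta>) = z"
    using upper_log_coordinate[OF r2(1)] by metis
  define r where "r = min (min r1 r2) (min r1' r2')"
  have "ge \<epsilon> z \<noteq> ge \<epsilon> w" if zw: "z \<in> D" "w \<in> D" "dist z (cis s) < r" "dist w (cis t) < r" "\<bar>\<epsilon>\<bar> < r" for z w \<epsilon>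
  proof
    assume eq: "ge \<epsilon> z = ge \<epsilon> w"
    obtain \<zeta> where \<zeta>: "\<zeta> \<in> ball (of_real s) r1" "Im \<zeta> > 0" "exp (\<i> * \<zeta>) = z" using r1'(2)[of z] zw by (auto simp: r_def)
    obtain \<omega> where \<omega>: "\<omega> \<in> ball (of_real t) r2" "Im \<omega> > 0" "exp (\<i> * \<omega>) = w" using r2'(2)[of w] zw by (auto simp: r_def)
    have e: "Ge \<epsilon> \<zeta> = Ge \<epsilon> \<omega>" using eq \<zeta> \<omega> by (simp add: Ge_def)
    have "Re (cnj (T s) * (Ge \<epsilon> \<zeta> - Ge \<epsilon> (of_real s))) < 0" using r1(2)[of \<epsilon> \<zeta>] \<zeta> zw by (simp add: r_def)
    then have a: "Re (cnj (T t) * (Ge \<epsilon> \<zeta> - Ge \<epsilon> (of_real s))) > 0"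
      unfolding dbl_tangent(3)[OF d] by (simp only: complex_cnj_minus mult_minus_left uminus_complex.simps(1))
    have b: "Re (cnj (T t) * (Ge \<epsilon> \<omega> - Ge \<epsilon> (of_real t))) < 0" using r2(2)[of \<epsilon> \<omega>] \<omega> zw by (simp add: r_def)
    have "Ge \<epsilon> (of_real s) - Ge \<epsilon> (of_real t) = of_real \<epsilon> * (h (cis s) - h (cis t))"
      using d by (simp add: Ge_def ge_def dbl_def G_def cis_conv_exp algebra_simps)
    then have "cnj (T t) * (Ge \<epsilon> (of_real s) - Ge \<epsilon> (of_real t)) = of_real \<epsilon> * (cnj (T t) * (h (cis s) - h (cis t)))" by (simp add: mult_ac)
    moreover have "Re (of_real \<epsilon> * x) = \<epsilon> * Re x" for x by simp
    ultimately have c: "Re (cnj (T t) * (Ge \<epsilon> (of_real s) - Ge \<epsilon> (of_real t))) = 0" using tang by (simp only: mult_zero_right)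
    have "cnj (T t) * (Ge \<epsilon> \<omega> - Ge \<epsilon> (of_real t)) = cnj (T t) * (Ge \<epsilon> \<zeta> - Ge \<epsilon> (of_real s)) + cnj (T t) * (Ge \<epsilon> (of_real s) - Ge \<epsilon> (of_real t))"
      unfolding e by (simp add: algebra_simps)
    then show False using a b c by (simp only: plus_complex.simps)
  qed
  moreover have "r > 0" using r1 r2 r1' r2' by (simp add: r_def)
  ultimately show ?thesis unfolding good_def by (intro exI[of _ r]) auto
qed

text \<open>The regular part has Lipschitz constant L, while 1 / z - 1 / w has size norm (z - w) /
  (norm z * norm w), which is larger near the pole.\<close>

lemma good_zero_zero:
  assumes k: "\<kappa> = 1" shows "good 0 0"
proof -
  define q where "q \<epsilon> z = p z + of_real \<epsilon> * h z" for \<epsilon> :: real and z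
  have dq: "(q \<epsilon> has_field_derivative deriv p z + of_real \<epsilon> * deriv h z) (at z)" for \<epsilon> z
    unfolding q_def by (intro DERIV_add DERIV_cmult p_deriv h_deriv)
  have "compact (deriv p ` cball 0 1)" "compact (deriv h ` cball 0 1)"
    using holomorphic_deriv[OF p_hol open_UNIV] holomorphic_deriv[OF h_hol open_UNIV]
    by (auto intro!: compact_continuous_image intro: holomorphic_on_imp_continuous_on holomorphic_on_subset)
  then obtain B1 B2 where B: "B1 > 0" "\<And>z. norm z \<le> 1 \<Longrightarrow> norm (deriv p z) \<le> B1" "B2 > 0" "\<And>z. norm z \<le> 1 \<Longrightarrow> norm (deriv h z) \<le> B2"
    using compact_imp_bounded[of "deriv p ` cball 0 1"] compact_imp_bounded[of "deriv h ` cball 0 1"] unfolding bounded_pos by auto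
  define L where "L = B1 + B2"
  have L: "L > 0" using B by (simp add: L_def)
  define r where "r = min 1 (1 / L)"
  have r: "r > 0" "r \<le> 1" "r * L \<le> 1" using L by (auto simp: r_def field_simps min_def)
  have "ge \<epsilon> z \<noteq> ge \<epsilon> w" if zw: "z \<in> D" "w \<in> D" "norm z < r" "norm w < r" "\<bar>\<epsilon>\<bar> < r" "z \<noteq> w" for z w \<epsilon>
  proof
    assume eq: "ge \<epsilon> z = ge \<epsilon> w"
    have nz: "z \<noteq> 0" "w \<noteq> 0" using zw k by (auto simp: punctured_disc_def)
    have gq: "ge \<epsilon> x = q \<epsilon> x - 1 / x" for x unfolding ge_def g_def q_def using k by simp
    have "norm (q \<epsilon> z - q \<epsilon> w) \<le> L * norm (z - w)"
    proof (rule field_differentiable_bound[of "cball 0 1" "q \<epsilon>" "\<lambda>z. deriv p z + of_real \<epsilon> * deriv h z" L])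
      fix x :: complex assume x: "x \<in> cball 0 1"
      show "(q \<epsilon> has_field_derivative deriv p x + of_real \<epsilon> * deriv h x) (at x within cball 0 1)"
        using dq has_field_derivative_at_within by blast
      have "\<bar>\<epsilon>\<bar> * norm (deriv h x) \<le> 1 * B2" using B(4)[of x] x zw(5) r(2) by (intro mult_mono) auto
      then show "norm (deriv p x + of_real \<epsilon> * deriv h x) \<le> L"
        using B(2)[of x] x norm_triangle_ineq[of "deriv p x" "of_real \<epsilon> * deriv h x"] by (simp add: L_def norm_mult)
    qed (use zw r in auto)
    moreover have "q \<epsilon> z - q \<epsilon> w = (w - z) / (z * w)"
    proof -
      have "q \<epsilon> z - q \<epsilon> w = 1 / z - 1 / w" using eq by (simp add: gq algebra_simps)
      also have "\<dots> = (w - z) / (z * w)" using nz by (simp add: field_simps)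
      finally show ?thesis .
    qed
    ultimately have "norm (z - w) / (norm z * norm w) \<le> L * norm (z - w)" by (simp add: norm_divide norm_mult norm_minus_commute)
    then have "1 \<le> L * (norm z * norm w)" using nz zw(6) by (simp add: field_simps)
    moreover have "norm z * norm w < r * 1" using zw r nz by (intro mult_strict_mono) auto
    then have "L * (norm z * norm w) < L * r" using L by simp
    ultimately show False using r by (simp add: mult.commute)
  qed
  then show ?thesis unfolding good_def using r by (intro exI[of _ r]) auto
qed

lemma good_zero_other:
  assumes k: "\<kappa> = 1" and w: "w \<noteq> 0" "norm w \<le> 1" shows "good 0 w"
proof -
  have "compact (p ` cball 0 1)" "compact (h ` cball 0 1)"
    using p_hol h_hol
    by (auto intro!: compact_continuous_image intro: holomorphic_on_imp_continuous_on holomorphic_on_subset)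
  then obtain B1 B2 where B: "B1 > 0" "\<And>z. norm z \<le> 1 \<Longrightarrow> norm (p z) \<le> B1" "B2 > 0" "\<And>z. norm z \<le> 1 \<Longrightarrow> norm (h z) \<le> B2"
    using compact_imp_bounded[of "p ` cball 0 1"] compact_imp_bounded[of "h ` cball 0 1"] unfolding bounded_pos by auto
  define L where "L = B1 + B2"
  have L: "L > 0" using B by (simp add: L_def)
  \<comment> \<open>Equal values would bound 1 / z' by two values of the regular part plus 1 / w',
    where norm w' is at least norm w / 2.\<close>
  define M where "M = 2 * L + 2 / norm w"
  have M: "M > 0" using L w by (simp add: M_def add_pos_nonneg)
  define r where "r = min (min 1 (norm w / 2)) (1 / M)"
  have r: "r > 0" "r \<le> 1" "r \<le> norm w / 2" using w M by (auto simp: r_def)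
  have "r \<le> 1 / M" by (simp add: r_def)
  then have r4: "r * M \<le> 1" using M by (simp add: field_simps)
  have q: "norm (p x + of_real \<epsilon> * h x) \<le> L" if "norm x \<le> 1" "\<bar>\<epsilon>\<bar> < r" for x \<epsilon>
  proof -
    have "\<bar>\<epsilon>\<bar> * norm (h x) \<le> 1 * B2" using B(4)[of x] that r(2) by (intro mult_mono) auto
    then show ?thesis using B(2)[of x] that norm_triangle_ineq[of "p x" "of_real \<epsilon> * h x"] by (simp add: L_def norm_mult)
  qed
  have "ge \<epsilon> z' \<noteq> ge \<epsilon> w'" if zw: "z' \<in> D" "w' \<in> D" "norm z' < r" "dist w' w < r" "\<bar>\<epsilon>\<bar> < r" for z' w' \<epsilon>
  proof
    assume eq: "ge \<epsilon> z' = ge \<epsilon> w'"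
    have nz: "z' \<noteq> 0" "w' \<noteq> 0" "norm z' \<le> 1" "norm w' \<le> 1" using zw k by (auto simp: punctured_disc_def)
    have gq: "ge \<epsilon> x = (p x + of_real \<epsilon> * h x) - 1 / x" for x unfolding ge_def g_def using k by simp
    have "norm w \<le> norm w' + dist w' w" using norm_triangle_sub[of w w'] by (simp add: dist_norm norm_minus_commute)
    then have w': "norm w' \<ge> norm w / 2" using zw(4) r(3) by simp
    have "1 / z' = (p z' + of_real \<epsilon> * h z') - (p w' + of_real \<epsilon> * h w') + 1 / w'"
      using eq by (simp add: gq algebra_simps)
    then have "norm (1 / z') \<le> norm (p z' + of_real \<epsilon> * h z') + norm (p w' + of_real \<epsilon> * h w') + norm (1 / w')"
      by (metis (no_types, lifting) add_right_mono norm_triangle_ineq norm_triangle_ineq4 order_trans)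
    also have "\<dots> \<le> L + L + 2 / norm w"
    proof -
      have "norm (1 / w') \<le> 2 / norm w" using w' w nz by (simp add: norm_divide field_simps)
      then show ?thesis using q[of z' \<epsilon>] q[of w' \<epsilon>] nz zw(5) by simp
    qed
    finally have "1 / norm z' \<le> M" by (simp add: M_def norm_divide)
    then have "1 \<le> M * norm z'" using nz by (simp add: field_simps)
    also have "\<dots> < M * r" using M zw(3) by simp
    finally show False using r4 by (simp add: mult.commute)
  qed
  then show ?thesis unfolding good_def using r by (intro exI[of _ r]) auto
qed

text \<open>A pair with equal values consists of a regular point twice, of a cusp twice, or of the
  two points of a tangency; pairs with the puncture are treated by the pole.\<close>

lemma good_all:
  assumes tang: "\<And>s t. dbl s t \<Longrightarrow> Re (cnj (T t) * (h (cis s) - h (cis t))) = 0"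
    and zw: "norm z \<le> 1" "norm w \<le> 1"
  shows "good z w"
proof (cases "\<kappa> = 0 \<or> (z \<noteq> 0 \<and> w \<noteq> 0)")
  case False
  then have "\<kappa> = 1" using kappa by auto
  then show ?thesis using False good_zero_zero good_zero_other good_sym zw by (cases "z = 0"; cases "w = 0") auto
next
  case True
  then have nz: "\<kappa> = 0 \<or> z \<noteq> 0" "\<kappa> = 0 \<or> w \<noteq> 0" by auto
  have circle: "\<exists>t. x = cis t" if "norm x = 1" for x
  proof -
    have "x \<in> cis ` {0..<0 + 2 * pi}" using that sphere_eq[of 0] by auto
    then show ?thesis by blast
  qed
  show ?thesis
  proof (cases "g z = g w")
    case False then show ?thesis using good_separated nz by blast
  next
    case eq: True
    show ?thesis
    proof (cases "z = w")
      case True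
      show ?thesis
      proof (cases "deriv p z + of_nat \<kappa> / z^2 = 0")
        case False then show ?thesis using good_regular nz True by blast
      next
        case crit: True
        have "norm z = 1"
        proof (rule ccontr)
          assume "norm z \<noteq> 1"
          then have "z \<in> D" using zw nz by (auto simp: punctured_disc_def)
          then show False using g_regular crit by blast
        qed
        then obtain t where "z = cis t" using circle by blast
        then show ?thesis using good_cusp[of t] f_zero_iff[of t] crit True by simp
      qed
    next
      case ne: False
      have b: "norm x = 1" if "norm x \<le> 1" "\<kappa> = 0 \<or> x \<noteq> 0" "norm y \<le> 1" "\<kappa> = 0 \<or> y \<noteq> 0" "g x = g y" "x \<noteq> y" for x y
      proof (rule ccontr)
        assume "norm x \<noteq> 1"
        then have x: "x \<in> D" using that by (auto simp: punctured_disc_def)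
        show False
        proof (cases "norm y = 1")
          case True then show False using g_interior_boundary[OF x] that by blast
        next
          case False
          then have "y \<in> D" using that by (auto simp: punctured_disc_def)
          then show False using inj x that by (auto simp: inj_on_def)
        qed
      qed
      obtain s t where st: "z = cis s" "w = cis t"
        using circle b[of z w] b[of w z] zw nz eq ne by metis
      then have "dbl s t" using eq ne by (simp add: dbl_def \<gamma>_eq)
      then show ?thesis using good_double tang st by blast
    qed
  qed
qed

text \<open>If univalence failed for arbitrarily small \<epsilon>, the colliding pairs would
  accumulate in the compact square of the closed disc, at a pair that is not
  \<open>good\<close>.\<close>

lemma perturbation:
  assumes tang: "\<And>s t. dbl s t \<Longrightarrow> Re (cnj (T t) * (h (cis s) - h (cis t))) = 0"
  obtains \<epsilon>0 where "\<epsilon>0 > 0" "\<And>\<epsilon>. \<bar>\<epsilon>\<bar> < \<epsilon>0 \<Longrightarrow> inj_on (ge \<epsilon>) D"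
proof -
  have "\<exists>\<epsilon>0>0. \<forall>\<epsilon>. \<bar>\<epsilon>\<bar> < \<epsilon>0 \<longrightarrow> inj_on (ge \<epsilon>) D"
  proof (rule ccontr)
    assume "\<not> ?thesis"
    then have "\<forall>n::nat. \<exists>\<epsilon>. \<bar>\<epsilon>\<bar> < inverse (real (Suc n)) \<and> \<not> inj_on (ge \<epsilon>) D"
      by (metis inverse_positive_iff_positive of_nat_0_less_iff zero_less_Suc)
    then have "\<forall>n::nat. \<exists>\<epsilon> z w. \<bar>\<epsilon>\<bar> < inverse (real (Suc n)) \<and> z \<in> D \<and> w \<in> D \<and> z \<noteq> w \<and> ge \<epsilon> z = ge \<epsilon> w"
      unfolding inj_on_def by metis
    then obtain \<epsilon> z w where s: "\<And>n::nat. \<bar>\<epsilon> n\<bar> < inverse (real (Suc n))" "\<And>n. z n \<in> D" "\<And>n. w n \<in> D"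
      "\<And>n. z n \<noteq> w n" "\<And>n. ge (\<epsilon> n) (z n) = ge (\<epsilon> n) (w n)" by metis
    have "(z n, w n) \<in> cball 0 1 \<times> cball 0 1" for n using s(2,3)[of n] by (auto simp: punctured_disc_def)
    moreover have "compact (cball (0::complex) 1 \<times> cball (0::complex) 1)" by (intro compact_Times compact_cball)
    ultimately obtain l r where l: "l \<in> cball 0 1 \<times> cball 0 1" "strict_mono (r :: nat \<Rightarrow> nat)" "((\<lambda>n. (z n, w n)) \<circ> r) \<longlonglongrightarrow> l"
      using compact_imp_seq_compact[unfolded seq_compact_def] by (metis (no_types, lifting))
    obtain z0 w0 where l0: "l = (z0, w0)" by fastforce
    have lz: "(\<lambda>n. z (r n)) \<longlonglongrightarrow> z0" and lw: "(\<lambda>n. w (r n)) \<longlonglongrightarrow> w0"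
      using tendsto_fst[OF l(3)] tendsto_snd[OF l(3)] l0 by (auto simp: o_def)
    have "good z0 w0" using l(1) l0 by (intro good_all[OF tang]) auto
    then obtain \<rho> where \<rho>: "\<rho> > 0" "\<And>z' w' \<epsilon>. z' \<in> D \<Longrightarrow> w' \<in> D \<Longrightarrow> dist z' z0 < \<rho> \<Longrightarrow> dist w' w0 < \<rho> \<Longrightarrow> \<bar>\<epsilon>\<bar> < \<rho> \<Longrightarrow> z' \<noteq> w' \<Longrightarrow> ge \<epsilon> z' \<noteq> ge \<epsilon> w'"
      unfolding good_def by blast
    have "\<forall>\<^sub>F n in sequentially. dist (z (r n)) z0 < \<rho> \<and> dist (w (r n)) w0 < \<rho> \<and> \<bar>\<epsilon> (r n)\<bar> < \<rho>"
    proof (intro eventually_conj)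
      show "\<forall>\<^sub>F n in sequentially. dist (z (r n)) z0 < \<rho>" "\<forall>\<^sub>F n in sequentially. dist (w (r n)) w0 < \<rho>"
        using tendstoD[OF lz \<rho>(1)] tendstoD[OF lw \<rho>(1)] by auto
      have "(\<lambda>n. inverse (real (Suc n))) \<longlonglongrightarrow> 0" by (rule LIMSEQ_inverse_real_of_nat)
      from order_tendstoD(2)[OF LIMSEQ_subseq_LIMSEQ[OF this l(2)] \<rho>(1)]
      show "\<forall>\<^sub>F n in sequentially. \<bar>\<epsilon> (r n)\<bar> < \<rho>"
        by (rule eventually_mono) (use s(1) in \<open>force simp: o_def intro: less_trans\<close>)
    qed
    then obtain n where "dist (z (r n)) z0 < \<rho>" "dist (w (r n)) w0 < \<rho>" "\<bar>\<epsilon> (r n)\<bar> < \<rho>"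
      using eventually_happens'[OF sequentially_bot] by blast
    then show False using \<rho>(2)[of "z (r n)" "w (r n)" "\<epsilon> (r n)"] s by blast
  qed
  then show ?thesis using that by blast
qed

end

section \<open>The polynomial family\<close>

text \<open>P is the product of the factors 1 - z / \<zeta> over its zeros, all with norm \<zeta> at
  least 1, and each factor at most doubles the coefficient bound.\<close>

lemma coeff_bound_zero_free_disc:
  fixes P :: "complex poly"
  assumes "poly P 0 = 1" "\<And>z. norm z < 1 \<Longrightarrow> poly P z \<noteq> 0"
  shows "norm (coeff P i) \<le> 2 ^ degree P"
  using assms
proof (induction "degree P" arbitrary: P i)
  case 0
  then obtain c where c: "P = [:c:]" by (metis degree_eq_zeroE)
  then show ?case using 0 by (cases i) auto
next
  case (Suc n)
  have "\<not> constant (poly P)" using Suc.hyps(2) by (simp add: constant_degree)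
  then obtain \<zeta> where \<zeta>: "poly P \<zeta> = 0" using fundamental_theorem_of_algebra by blast
  then have n\<zeta>: "norm \<zeta> \<ge> 1" using Suc.prems(2)[of \<zeta>] by force
  then have \<zeta>0: "\<zeta> \<noteq> 0" by auto
  obtain Q where Q: "P = [:- \<zeta>, 1:] * Q" using \<zeta> by (metis dvdE poly_eq_0_iff_dvd)
  define R where "R = smult (- \<zeta>) Q"
  have PR: "P = [:1, - 1 / \<zeta>:] * R" using \<zeta>0 by (simp add: Q R_def smult_add_right)
  have P0: "P \<noteq> 0" using Suc.hyps(2) by auto
  then have R0: "R \<noteq> 0" using PR by auto
  have dR: "degree R = n"
  proof -
    have "degree P = degree [:1, - 1 / \<zeta>:] + degree R" unfolding PR using \<zeta>0 R0 by (intro degree_mult_eq) auto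
    then show ?thesis using Suc.hyps(2) \<zeta>0 by simp
  qed
  have R1: "poly R 0 = 1" using Suc.prems(1) PR by simp
  have Rz: "poly R z \<noteq> 0" if "norm z < 1" for z using Suc.prems(2)[OF that] PR by auto
  have IH: "norm (coeff R i) \<le> 2 ^ n" for i using Suc.hyps(1)[of R i] dR R1 Rz by simp
  have "coeff P i = coeff R i + (if i = 0 then 0 else - 1 / \<zeta> * coeff R (i - 1))"
    unfolding PR by (cases i) (auto simp: coeff_pCons)
  also have "norm \<dots> \<le> 2 ^ n + 2 ^ n"
  proof (rule order_trans[OF norm_triangle_ineq add_mono[OF IH]])
    have "norm (1 / \<zeta>) \<le> 1" using n\<zeta> \<zeta>0 by (simp add: norm_divide divide_le_eq)
    then have "norm (1 / \<zeta>) * norm (coeff R (i - 1)) \<le> 1 * 2 ^ n" using IH by (intro mult_mono) auto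
    then show "norm (if i = 0 then 0 else - 1 / \<zeta> * coeff R (i - 1)) \<le> 2 ^ n" by (simp add: norm_mult norm_divide)
  qed
  finally show ?case using Suc.hyps(2) by (simp flip: Suc.hyps(2))
qed

lemma card_roots_simple:
  fixes P :: "complex poly"
  assumes "P \<noteq> 0" "\<And>z. poly P z = 0 \<Longrightarrow> poly (pderiv P) z \<noteq> 0"
  shows "card {z. poly P z = 0} = degree P"
proof -
  have "rsquarefree P" using assms(2) by (auto simp: rsquarefree_roots)
  then have ord: "order z P = 0 \<or> order z P = 1" for z by (auto simp: rsquarefree_def)
  have fin: "finite {z. poly P z = 0}" using assms(1) poly_roots_finite by blast
  have "proots P = mset_set {z. poly P z = 0}"
  proof (rule multiset_eqI)
    fix z
    have "count (proots P) z = order z P" using assms(1) by simp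
    then show "count (proots P) z = count (mset_set {z. poly P z = 0}) z"
      using ord[of z] assms(1) fin order_root[of P z] by (cases "poly P z = 0") auto
  qed
  then show ?thesis using size_proots_complex[of P] by simp
qed

text \<open>Gaussian elimination: an unknown k0 with nonzero coefficient in the new equation is
  expressed by the others.\<close>

lemma underdetermined_system:
  fixes A :: "'j \<Rightarrow> 'k \<Rightarrow> real"
  assumes "finite J" "finite K" "card J < card K"
  shows "\<exists>y. (\<exists>k\<in>K. y k \<noteq> 0) \<and> (\<forall>k. k \<notin> K \<longrightarrow> y k = 0) \<and> (\<forall>j\<in>J. (\<Sum>k\<in>K. A j k * y k) = 0)"
  using assms
proof (induction J arbitrary: K A rule: finite_induct)
  case empty
  then obtain k0 where "k0 \<in> K" by fastforce
  then show ?case by (intro exI[of _ "\<lambda>k. if k = k0 then 1 else 0"]) auto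
next
  case (insert j J)
  show ?case
  proof (cases "\<forall>k\<in>K. A j k = 0")
    case True
    then show ?thesis using insert.IH[OF insert.prems(1), of A] insert.prems insert.hyps by auto
  next
    case False
    then obtain k0 where k0: "k0 \<in> K" "A j k0 \<noteq> 0" by blast
    define K' where "K' = K - {k0}"
    have K': "finite K'" "card J < card K'" "K = insert k0 K'" "k0 \<notin> K'" using insert k0 by (auto simp: K'_def)
    obtain y where y: "\<exists>k\<in>K'. y k \<noteq> 0" "\<forall>k. k \<notin> K' \<longrightarrow> y k = 0" "\<forall>i\<in>J. (\<Sum>k\<in>K'. (A i k - A i k0 * A j k / A j k0) * y k) = 0"
      using insert.IH[OF K'(1,2), of "\<lambda>i k. A i k - A i k0 * A j k / A j k0"] by blast
    define z where "z = y(k0 := - (\<Sum>k\<in>K'. A j k * y k) / A j k0)"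
    have sz: "(\<Sum>k\<in>K. A i k * z k) = A i k0 * z k0 + (\<Sum>k\<in>K'. A i k * y k)" for i
    proof -
      have "(\<Sum>k\<in>K. A i k * z k) = A i k0 * z k0 + (\<Sum>k\<in>K'. A i k * z k)" using K' by simp
      also have "(\<Sum>k\<in>K'. A i k * z k) = (\<Sum>k\<in>K'. A i k * y k)" using K'(4) by (intro sum.cong) (auto simp: z_def)
      finally show ?thesis .
    qed
    have "(\<Sum>k\<in>K. A i k * z k) = 0" if "i \<in> insert j J" for i
    proof (cases "i = j")
      case True then show ?thesis using sz[of j] k0(2) by (simp add: z_def)
    next
      case False
      then have "(\<Sum>k\<in>K'. (A i k - A i k0 * A j k / A j k0) * y k) = 0" using y(3) that by blast
      then have "(\<Sum>k\<in>K'. A i k * y k) = A i k0 / A j k0 * (\<Sum>k\<in>K'. A j k * y k)"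
        by (simp add: left_diff_distrib sum_subtractf sum_distrib_left mult.assoc)
      then show ?thesis using sz[of i] by (simp add: z_def)
    qed
    moreover have "\<exists>k\<in>K. z k \<noteq> 0" using y(1) K' by (auto simp: z_def)
    moreover have "\<forall>k. k \<notin> K \<longrightarrow> z k = 0" using y(2) K' by (auto simp: z_def)
    ultimately show ?thesis by blast
  qed
qed

lemma bounded_sequences_subseq:
  fixes X :: "nat \<Rightarrow> 'k \<Rightarrow> real"
  assumes "finite K" "\<And>n k. k \<in> K \<Longrightarrow> \<bar>X n k\<bar> \<le> B"
  shows "\<exists>r l. strict_mono (r :: nat \<Rightarrow> nat) \<and> (\<forall>k\<in>K. (\<lambda>n. X (r n) k) \<longlonglongrightarrow> l k)"
  using assms
proof (induction K rule: finite_induct)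
  case empty
  then show ?case by (intro exI[of _ id]) (auto simp: strict_mono_def)
next
  case (insert k K)
  then obtain r l where r: "strict_mono (r :: nat \<Rightarrow> nat)" "\<forall>k\<in>K. (\<lambda>n. X (r n) k) \<longlonglongrightarrow> l k" by auto
  have "X (r n) k \<in> {-B..B}" for n using insert.prems[of k "r n"] by (simp add: abs_le_iff)
  then obtain a r' where a: "strict_mono (r' :: nat \<Rightarrow> nat)" "((\<lambda>n. X (r n) k) \<circ> r') \<longlonglongrightarrow> a"
    using compact_imp_seq_compact[OF compact_Icc[of "-B" B], unfolded seq_compact_def]
    by (metis (no_types, lifting))
  have "(\<lambda>n. X ((r \<circ> r') n) j) \<longlonglongrightarrow> (l(k := a)) j" if "j \<in> insert k K" for j
  proof (cases "j = k")
    case True then show ?thesis using a by (simp add: o_def)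
  next
    case False
    then have "(\<lambda>n. X (r n) j) \<longlonglongrightarrow> l j" using that r by auto
    from LIMSEQ_subseq_LIMSEQ[OF this a(1)] show ?thesis using False by (simp add: o_def)
  qed
  then show ?case using strict_mono_o[OF r(1) a(1)] by blast
qed

text \<open>For g(z) = px z - \<kappa> / z the function z g'(z) is z^(1 - 2\<kappa>) + z^d plus a middle part that is
  self-reciprocal of weight freq \<kappa> d, which makes the tangent direction of the boundary curve explicit.\<close>

definition freq :: "nat \<Rightarrow> nat \<Rightarrow> nat" where "freq \<kappa> d = d + 1 - 2 * \<kappa>"
text \<open>The exponents of the free terms. The reflection k -> \<open>freq\<close> - k maps this
  set to itself, while it exchanges the fixed exponent d with 1 or, in the unbounded case, with
  -1.\<close>

definition idx :: "nat \<Rightarrow> nat \<Rightarrow> nat set" where "idx \<kappa> d = {2 - \<kappa>..d - 1 - \<kappa>}"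
text \<open>The general solution of the symmetry b(M - k) = conjugate of b(k), with one real
  parameter per index: x k enters with 1 + i at k and with 1 - i at M - k. At a middle index k = M -
  k the two contributions add up to a real coefficient, so no case distinction is needed.\<close>

definition bc :: "nat \<Rightarrow> (nat \<Rightarrow> real) \<Rightarrow> nat \<Rightarrow> complex" where
  "bc M x k = Complex (x k + x (M - k)) (x k - x (M - k))"
definition hx :: "nat \<Rightarrow> nat \<Rightarrow> (nat \<Rightarrow> real) \<Rightarrow> complex \<Rightarrow> complex" where
  "hx \<kappa> d x z = (\<Sum>k\<in>idx \<kappa> d. bc (freq \<kappa> d) x k / of_nat k * z ^ k)"
definition px :: "nat \<Rightarrow> nat \<Rightarrow> (nat \<Rightarrow> real) \<Rightarrow> complex \<Rightarrow> complex" where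
  "px \<kappa> d x z = of_nat (1 - \<kappa>) * z + z ^ d / of_nat d + hx \<kappa> d x z"
text \<open>The polynomial z^(2 \<kappa>) g'(z); its zeros are the critical points of g.\<close>

definition Px :: "nat \<Rightarrow> nat \<Rightarrow> (nat \<Rightarrow> real) \<Rightarrow> complex poly" where
  "Px \<kappa> d x = 1 + monom 1 (d + 2 * \<kappa> - 1) + (\<Sum>k\<in>idx \<kappa> d. monom (bc (freq \<kappa> d) x k) (k + 2 * \<kappa> - 1))"

locale family =
  fixes \<kappa> d :: nat
  assumes k1: "\<kappa> \<le> 1" and d2: "d \<ge> 2"
begin

abbreviation "N \<equiv> freq \<kappa> d"
abbreviation "K \<equiv> idx \<kappa> d"

lemma N_pos': "N > 0" using k1 d2 by (simp add: freq_def)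
lemma card_K: "card K = d - 2" using k1 d2 by (cases \<kappa>) (auto simp: idx_def)
lemma finite_K: "finite K" by (simp add: idx_def)
lemma K_pos: "k \<in> K \<Longrightarrow> k > 0" using k1 by (auto simp: idx_def)
lemma K_le: "k \<in> K \<Longrightarrow> k \<le> N" using k1 d2 by (cases \<kappa>) (auto simp: idx_def freq_def)
lemma K_refl: "k \<in> K \<Longrightarrow> N - k \<in> K" using k1 d2 by (cases \<kappa>) (auto simp: idx_def freq_def)

lemma bc_refl: "k \<in> K \<Longrightarrow> bc N x (N - k) = cnj (bc N x k)"
  using K_le[of k] by (simp add: bc_def complex_eq_iff)

lemma K_reindex: "(\<Sum>k\<in>K. u (N - k)) = (\<Sum>k\<in>K. u k)"
  by (rule sum.reindex_bij_witness[of _ "\<lambda>k. N - k" "\<lambda>k. N - k"]) (use K_refl K_le in auto)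

lemma hx_deriv: "(hx \<kappa> d x has_field_derivative (\<Sum>k\<in>K. bc N x k * z ^ (k - 1))) (at z)"
proof -
  have "((\<lambda>z. \<Sum>k\<in>K. bc N x k / of_nat k * z ^ k) has_field_derivative (\<Sum>k\<in>K. bc N x k / of_nat k * (of_nat k * z ^ (k - 1)))) (at z)"
    by (intro DERIV_sum DERIV_cmult) (auto intro!: derivative_eq_intros)
  moreover have "(\<Sum>k\<in>K. bc N x k / of_nat k * (of_nat k * z ^ (k - 1))) = (\<Sum>k\<in>K. bc N x k * z ^ (k - 1))"
    using K_pos by (intro sum.cong) auto
  ultimately show ?thesis unfolding hx_def[abs_def] by simp
qed

lemma px_deriv: "(px \<kappa> d x has_field_derivative of_nat (1 - \<kappa>) + z ^ (d - 1) + (\<Sum>k\<in>K. bc N x k * z ^ (k - 1))) (at z)"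
proof -
  have "((\<lambda>z. z ^ d / of_nat d) has_field_derivative z ^ (d - 1)) (at z)"
    using d2 by (auto intro!: derivative_eq_intros)
  moreover have "((\<lambda>z. of_nat (1 - \<kappa>) * z) has_field_derivative of_nat (1 - \<kappa>)) (at z)"
    by (auto intro!: derivative_eq_intros)
  ultimately show ?thesis unfolding px_def[abs_def] by (intro DERIV_add hx_deriv)
qed

lemma hol: "hx \<kappa> d x holomorphic_on UNIV" "px \<kappa> d x holomorphic_on UNIV"
  unfolding holomorphic_on_open[OF open_UNIV] using hx_deriv px_deriv by blast+

lemma deriv_hx: "z * deriv (hx \<kappa> d x) z = (\<Sum>k\<in>K. bc N x k * z ^ k)"
proof -
  have "z * (\<Sum>k\<in>K. bc N x k * z ^ (k - 1)) = (\<Sum>k\<in>K. bc N x k * z ^ k)"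
    unfolding sum_distrib_left
  proof (rule sum.cong[OF refl])
    fix k assume "k \<in> K"
    then have "k = Suc (k - 1)" using K_pos[of k] by simp
    then show "z * (bc N x k * z ^ (k - 1)) = bc N x k * z ^ k" by (metis mult.left_commute power_Suc)
  qed
  then show ?thesis using DERIV_imp_deriv[OF hx_deriv] by simp
qed

text \<open>After multiplication by the phase, conjugation exchanges the terms k and N - k, so the
  sum is real.\<close>

lemma hx_real: "Im (exp (- (\<i> * of_nat N * of_real t / 2)) * (exp (\<i> * of_real t) * deriv (hx \<kappa> d x) (exp (\<i> * of_real t)))) = 0"
proof -
  define S where "S = exp (- (\<i> * of_nat N * of_real t / 2)) * (\<Sum>k\<in>K. bc N x k * exp (\<i> * of_real t) ^ k)"
  define u where "u k = bc N x k * cis ((real k - real N / 2) * t)" for k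
  have Su: "S = (\<Sum>k\<in>K. u k)"
    unfolding S_def sum_distrib_left
  proof (rule sum.cong[OF refl])
    fix k
    have "exp (- (\<i> * of_nat N * of_real t / 2)) * exp (\<i> * of_real t) ^ k = cis ((real k - real N / 2) * t)"
      by (simp add: cis_conv_exp exp_of_nat_mult[symmetric] exp_add[symmetric] algebra_simps)
    then show "exp (- (\<i> * of_nat N * of_real t / 2)) * (bc N x k * exp (\<i> * of_real t) ^ k) = u k"
      by (simp add: u_def mult_ac)
  qed
  have "cnj S = (\<Sum>k\<in>K. u (N - k))" unfolding Su cnj_sum
  proof (rule sum.cong[OF refl])
    fix k assume k: "k \<in> K"
    have "real (N - k) - real N / 2 = - (real k - real N / 2)" using K_le[OF k] by (simp add: of_nat_diff)
    then have "(real (N - k) - real N / 2) * t = - ((real k - real N / 2) * t)" by (metis mult_minus_left)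
    then show "cnj (u k) = u (N - k)" unfolding u_def bc_refl[OF k] by (simp only: complex_cnj_mult cis_cnj)
  qed
  then have "cnj S = S" using K_reindex[of u] Su by simp
  then have "Im S = 0" by (metis Reals_cnj_iff complex_is_Real_iff)
  then show ?thesis by (simp add: S_def deriv_hx)
qed

lemma px_real: "Im (exp (- (\<i> * of_nat N * of_real t / 2)) * (exp (\<i> * of_real t) * deriv (px \<kappa> d x) (exp (\<i> * of_real t)) + of_nat \<kappa> * exp (- (\<i> * of_real t)))) = 0"
proof -
  let ?z = "exp (\<i> * of_real t)" and ?E = "exp (- (\<i> * of_nat N * of_real t / 2))"
  have "deriv (px \<kappa> d x) ?z = of_nat (1 - \<kappa>) + ?z ^ (d - 1) + deriv (hx \<kappa> d x) ?z"
    using DERIV_imp_deriv[OF px_deriv] DERIV_imp_deriv[OF hx_deriv] by simp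
  then have "?z * deriv (px \<kappa> d x) ?z + of_nat \<kappa> * exp (- (\<i> * of_real t)) =
      (of_nat (1 - \<kappa>) * ?z + ?z ^ d + of_nat \<kappa> * exp (- (\<i> * of_real t))) + ?z * deriv (hx \<kappa> d x) ?z"
    using d2 by (simp add: algebra_simps flip: power_Suc)
  moreover have "Im (?E * (of_nat (1 - \<kappa>) * ?z + ?z ^ d + of_nat \<kappa> * exp (- (\<i> * of_real t)))) = 0"
  proof -
    \<comment> \<open>The two fixed terms become conjugate phases, so their sum is 2 cos
      \<theta>.\<close>
    define \<theta> where "\<theta> = (real d - 1 + 2 * real \<kappa>) / 2 * t"
    have zd: "?z ^ d = exp (\<i> * (of_nat d * of_real t))" by (simp add: exp_of_nat_mult[symmetric] mult_ac)
    have rN: "real N = real d + 1 - 2 * real \<kappa>" using k1 d2 by (cases \<kappa>) (auto simp: freq_def of_nat_diff)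
    have cN: "complex_of_nat N = of_real (real d + 1 - 2 * real \<kappa>)" using rN by (metis of_real_of_nat_eq)
    have a: "?E * ?z ^ d = cis \<theta>" unfolding zd cis_conv_exp exp_add[symmetric] \<theta>_def cN
      by (rule arg_cong[where f = exp]) (simp add: field_simps)
    have b: "?E * (of_nat (1 - \<kappa>) * ?z + of_nat \<kappa> * exp (- (\<i> * of_real t))) = cis (- \<theta>)"
    proof (cases "\<kappa> = 0")
      case True
      have "?E * ?z = cis (- \<theta>)" unfolding cis_conv_exp exp_add[symmetric] \<theta>_def cN
        by (rule arg_cong[where f = exp]) (simp add: True field_simps)
      then show ?thesis using True by simp
    next
      case False
      then have k: "\<kappa> = 1" using k1 by simp
      have "?E * exp (- (\<i> * of_real t)) = cis (- \<theta>)" unfolding cis_conv_exp exp_add[symmetric] \<theta>_def cN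
        by (rule arg_cong[where f = exp]) (simp add: k field_simps)
      then show ?thesis using k by simp
    qed
    have "?E * (of_nat (1 - \<kappa>) * ?z + ?z ^ d + of_nat \<kappa> * exp (- (\<i> * of_real t))) = cis \<theta> + cis (- \<theta>)"
      using a b by (simp add: algebra_simps)
    then show ?thesis by simp
  qed
  ultimately show ?thesis using hx_real[of t x] by (simp only: distrib_left[of ?E] plus_complex.simps)
qed

lemma reflected: "reflected_curve \<kappa> N (px \<kappa> d x)"
  by unfold_locales (use k1 N_pos' hol px_real in auto)

abbreviation "gx x \<equiv> reflected_curve.g \<kappa> (px \<kappa> d x)"
abbreviation "fx x \<equiv> reflected_curve.f \<kappa> N (px \<kappa> d x)"
abbreviation "\<gamma>x x \<equiv> (\<lambda>t::real. reflected_curve.G \<kappa> (px \<kappa> d x) (of_real t))"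

lemma poly_Px: "\<kappa> = 0 \<or> z \<noteq> 0 \<Longrightarrow> poly (Px \<kappa> d x) z = z ^ (2 * \<kappa>) * (deriv (px \<kappa> d x) z + of_nat \<kappa> / z^2)"
proof -
  assume z: "\<kappa> = 0 \<or> z \<noteq> 0"
  have dp: "deriv (px \<kappa> d x) z = of_nat (1 - \<kappa>) + z ^ (d - 1) + (\<Sum>k\<in>K. bc N x k * z ^ (k - 1))"
    by (rule DERIV_imp_deriv[OF px_deriv])
  have P: "poly (Px \<kappa> d x) z = 1 + z ^ (d + 2 * \<kappa> - 1) + (\<Sum>k\<in>K. bc N x k * z ^ (k + 2 * \<kappa> - 1))"
    by (simp add: Px_def poly_sum poly_monom)
  show ?thesis
  proof (cases "\<kappa> = 0")
    case True then show ?thesis unfolding P dp by simp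
  next
    case False
    then have k: "\<kappa> = 1" using k1 by simp
    have e: "(\<Sum>k\<in>K. bc N x k * z ^ (k + 2 * \<kappa> - 1)) = z^2 * (\<Sum>k\<in>K. bc N x k * z ^ (k - 1))"
      unfolding sum_distrib_left
    proof (rule sum.cong[OF refl])
      fix j assume "j \<in> K"
      then have "j + 2 * \<kappa> - 1 = 2 + (j - 1)" using K_pos[of j] k by simp
      then have "z ^ (j + 2 * \<kappa> - 1) = z^2 * z ^ (j - 1)" by (metis power_add)
      then show "bc N x j * z ^ (j + 2 * \<kappa> - 1) = z^2 * (bc N x j * z ^ (j - 1))" by simp
    qed
    have "z ^ (d + 2 * \<kappa> - 1) = z^2 * z ^ (d - 1)"
      using d2 k by (simp flip: power_add)
    then show ?thesis unfolding P dp e using z k by (simp add: distrib_left)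
  qed
qed

lemma Px_coeff: "coeff (Px \<kappa> d x) 0 = 1" "j \<in> K \<Longrightarrow> coeff (Px \<kappa> d x) (j + 2 * \<kappa> - 1) = bc N x j"
  "degree (Px \<kappa> d x) = d + 2 * \<kappa> - 1"
proof -
  have K: "0 < k + 2 * \<kappa> - 1" "k + 2 * \<kappa> - 1 < d + 2 * \<kappa> - 1" if "k \<in> K" for k using that k1 d2 by (cases \<kappa>; auto simp: idx_def)+
  show "coeff (Px \<kappa> d x) 0 = 1"
  proof -
    have "(\<Sum>k\<in>K. coeff (monom (bc N x k) (k + 2 * \<kappa> - 1)) 0) = 0"
      using K by (intro sum.neutral ballI) (force simp: coeff_monom)
    then show ?thesis using d2 by (simp add: Px_def coeff_sum coeff_monom)
  qed
  show "coeff (Px \<kappa> d x) (j + 2 * \<kappa> - 1) = bc N x j" if j: "j \<in> K"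
  proof -
    have "(\<Sum>k\<in>K. coeff (monom (bc N x k) (k + 2 * \<kappa> - 1)) (j + 2 * \<kappa> - 1)) = (\<Sum>k\<in>K. if k = j then bc N x k else 0)"
    proof (rule sum.cong[OF refl])
      fix k assume "k \<in> K"
      then have "k + 2 * \<kappa> - 1 = j + 2 * \<kappa> - 1 \<longleftrightarrow> k = j" using K_pos[of k] K_pos[OF j] by auto
      then show "coeff (monom (bc N x k) (k + 2 * \<kappa> - 1)) (j + 2 * \<kappa> - 1) = (if k = j then bc N x k else 0)" by (simp add: coeff_monom)
    qed
    also have "\<dots> = bc N x j" using j finite_K by simp
    finally show ?thesis using K[OF j] by (simp add: Px_def coeff_sum coeff_monom)
  qed
  have n0: "0 < d + 2 * \<kappa> - 1" using d2 by simp
  show "degree (Px \<kappa> d x) = d + 2 * \<kappa> - 1"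
  proof (rule antisym)
    show "degree (Px \<kappa> d x) \<le> d + 2 * \<kappa> - 1" unfolding Px_def
      using K n0 by (intro degree_add_le degree_sum_le degree_monom_le order_trans[OF degree_monom_le]) (auto intro: less_imp_le finite_K)
    have "(\<Sum>k\<in>K. coeff (monom (bc N x k) (k + 2 * \<kappa> - 1)) (d + 2 * \<kappa> - 1)) = 0"
      using K by (intro sum.neutral ballI) (force simp: coeff_monom)
    then have "coeff (Px \<kappa> d x) (d + 2 * \<kappa> - 1) = 1" using n0 by (simp add: Px_def coeff_sum coeff_monom)
    then show "d + 2 * \<kappa> - 1 \<le> degree (Px \<kappa> d x)" by (intro le_degree) auto
  qed
qed

text \<open>The coefficients read backwards are the conjugates; this makes the zeros symmetric in
  the unit circle.\<close>

lemma Px_reflect: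
  assumes z: "z \<noteq> 0"
  shows "poly (Px \<kappa> d x) z = z ^ (d + 2 * \<kappa> - 1) * cnj (poly (Px \<kappa> d x) (1 / cnj z))"
proof -
  define n where "n = d + 2 * \<kappa> - 1"
  have P: "poly (Px \<kappa> d x) w = 1 + w ^ n + (\<Sum>k\<in>K. bc N x k * w ^ (k + 2 * \<kappa> - 1))" for w
    by (simp add: Px_def poly_sum poly_monom n_def)
  have "z ^ n * cnj (poly (Px \<kappa> d x) (1 / cnj z)) = z ^ n + 1 + (\<Sum>k\<in>K. z ^ n * (cnj (bc N x k) * (1 / z) ^ (k + 2 * \<kappa> - 1)))"
    unfolding P using z by (simp add: distrib_left sum_distrib_left power_divide)
  also have "(\<Sum>k\<in>K. z ^ n * (cnj (bc N x k) * (1 / z) ^ (k + 2 * \<kappa> - 1))) = (\<Sum>k\<in>K. bc N x (N - k) * z ^ (N - k + 2 * \<kappa> - 1))"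
  proof (rule sum.cong[OF refl])
    fix k assume k: "k \<in> K"
    have le: "k + 2 * \<kappa> - 1 \<le> n" "N - k + 2 * \<kappa> - 1 = n - (k + 2 * \<kappa> - 1)" using k k1 d2 by (cases \<kappa>; auto simp: idx_def n_def freq_def)+
    have "z ^ n * (1 / z) ^ (k + 2 * \<kappa> - 1) = z ^ (n - (k + 2 * \<kappa> - 1))"
      using le(1) z by (simp add: power_divide power_diff)
    then show "z ^ n * (cnj (bc N x k) * (1 / z) ^ (k + 2 * \<kappa> - 1)) = bc N x (N - k) * z ^ (N - k + 2 * \<kappa> - 1)"
      unfolding bc_refl[OF k] le(2) by (simp add: mult_ac)
  qed
  also have "\<dots> = (\<Sum>k\<in>K. bc N x k * z ^ (k + 2 * \<kappa> - 1))" by (rule K_reindex[of "\<lambda>k. bc N x k * z ^ (k + 2 * \<kappa> - 1)"])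
  finally show ?thesis unfolding n_def[symmetric] P by simp
qed

end

context univalent_curve
begin

text \<open>For odd N the phase cis (N t / 2) changes sign under t -> t + 2 pi, and so does
  \<open>f\<close>. The direction of the derivative of G shows that the two signs cancel.\<close>

lemma T_cong: "cis s = cis t \<Longrightarrow> T s = T t"
proof -
  assume c: "cis s = cis t"
  have e: "deriv G (of_real u) = \<i> * (cis u * deriv p (cis u) + of_nat \<kappa> / cis u)" for u
  proof -
    have "\<i> * exp (\<i> * of_nat N * of_real u / 2) * F (of_real u) = \<i> * (exp (\<i> * of_nat N * of_real u / 2) * exp (- (\<i> * of_nat N * of_real u / 2))) *
        (exp (\<i> * of_real u) * deriv p (exp (\<i> * of_real u)) + of_nat \<kappa> * exp (- (\<i> * of_real u)))"
      by (simp add: F_def mult.assoc)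
    also have "exp (\<i> * of_nat N * of_real u / 2) * exp (- (\<i> * of_nat N * of_real u / 2)) = 1" by (simp flip: exp_add)
    finally have "deriv G (of_real u) = \<i> * 1 * (exp (\<i> * of_real u) * deriv p (exp (\<i> * of_real u)) + of_nat \<kappa> * exp (- (\<i> * of_real u)))"
      unfolding DERIV_imp_deriv[OF G_deriv] .
    then show ?thesis by (simp only: cis_conv_exp exp_minus divide_inverse mult_1_right)
  qed
  have "\<i> * T s = \<i> * T t" unfolding sgn_deriv_G[symmetric] e c ..
  then show ?thesis by simp
qed

text \<open>The condition is symmetric in s and t because the normals are opposite, so one
  representative of each tangency suffices.\<close>

lemma chords_tangent_all:
  assumes nd: "\<forall>s. \<not> dbl s a" and ch: "\<And>t s. (t, s) \<in> chords a \<Longrightarrow> Re (cnj (T t) * (u (cis s) - u (cis t))) = 0"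
    and d: "dbl s t"
  shows "Re (cnj (T t) * (u (cis s) - u (cis t))) = 0"
proof -
  have nda: "\<not> dbl a s" for s using nd dbl_sym[of a s] by blast
  have "cis t \<in> sphere 0 1" "cis s \<in> sphere 0 1" by auto
  then obtain t' s' where t': "t' \<in> {a..<a + 2 * pi}" "cis t = cis t'" "s' \<in> {a..<a + 2 * pi}" "cis s = cis s'"
    unfolding sphere_eq[of a] by blast
  then have d': "dbl s' t'" using d by (auto simp: dbl_def \<gamma>_eq)
  have ne: "t' \<noteq> a" "s' \<noteq> a" "t' \<noteq> s'"
  proof -
    show "t' \<noteq> a" using d' nd by blast
    show "s' \<noteq> a" using d' nda by blast
    show "t' \<noteq> s'" using d' by (auto simp: dbl_def)
  qed
  have "(t', s') \<in> chords a \<or> (s', t') \<in> chords a"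
    using t'(1,3) ne d' dbl_sym[OF d']
    by (metis (no_types, lifting) atLeastLessThan_iff case_prodI chords_def linorder_neqE_linordered_idom mem_Collect_eq order_le_imp_less_or_eq)
  then have "Re (cnj (T t') * (u (cis s') - u (cis t'))) = 0"
  proof
    assume "(s', t') \<in> chords a"
    then have "Re (cnj (T s') * (u (cis t') - u (cis s'))) = 0" by (rule ch)
    moreover have "cnj (T s') * (u (cis t') - u (cis s')) = cnj (T t') * (u (cis s') - u (cis t'))"
      unfolding dbl_tangent(3)[OF d'] by (simp add: algebra_simps)
    ultimately show ?thesis by simp
  qed (rule ch)
  then show ?thesis by (simp only: T_cong[OF t'(2)] t'(2,4))
qed

end

section \<open>The set of univalent parameters and a point of maximal norm\<close>

context family
begin

definition U :: "(nat \<Rightarrow> real) set" where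
  "U = {x. (\<forall>k. k \<notin> K \<longrightarrow> x k = 0) \<and> inj_on (gx x) (punctured_disc \<kappa>)}"

lemma U_univalent: "x \<in> U \<Longrightarrow> univalent_curve \<kappa> N (px \<kappa> d x)"
  using reflected[of x] by (simp add: U_def univalent_curve_def univalent_curve_axioms_def)

lemma hx_0: "hx \<kappa> d (\<lambda>_. 0) z = 0" by (simp add: hx_def bc_def complex_eq_iff)

text \<open>The map z + z^d / d has derivative 1 + z^(d - 1), of positive real part. For z^d / d - 1
  / z the pole term outweighs the power, which is 1-Lipschitz on the disc. The maximum below is thus
  over a nonempty set.\<close>

lemma zero_in_U: "(\<lambda>_. 0) \<in> U"
proof -
  let ?g = "gx (\<lambda>_. 0)"
  have g: "?g z = of_nat (1 - \<kappa>) * z + z ^ d / of_nat d - of_nat \<kappa> / z" for z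
    by (simp add: reflected_curve.g_def[OF reflected] px_def hx_0)
  have "inj_on ?g (punctured_disc \<kappa>)"
  proof (cases "\<kappa> = 0")
    case True
    have D: "punctured_disc \<kappa> = ball 0 1" using True by (auto simp: punctured_disc_def)
    show ?thesis unfolding D
    proof (rule injective_positive_derivative[where a = 1])
      fix z :: complex assume z: "z \<in> ball 0 1"
      have "((\<lambda>z. of_nat (1 - \<kappa>) * z + z ^ d / of_nat d - of_nat \<kappa> / z) has_field_derivative 1 + z ^ (d - 1)) (at z)"
        using True d2 by (auto intro!: derivative_eq_intros)
      then show "(?g has_field_derivative 1 + z ^ (d - 1)) (at z)" using g by presburger
      have "norm (z ^ (d - 1)) < 1" using z d2 by (simp add: norm_power power_less_one_iff)
      then have "Re (z ^ (d - 1)) > - 1" using abs_Re_le_cmod[of "z ^ (d - 1)"] by linarith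
      then show "Re (1 * (1 + z ^ (d - 1))) > 0" by simp
    qed simp
  next
    case False
    then have k: "\<kappa> = 1" using k1 by simp
    show ?thesis
    proof (rule inj_onI, rule ccontr)
      fix z w assume zw: "z \<in> punctured_disc \<kappa>" "w \<in> punctured_disc \<kappa>" "?g z = ?g w" "z \<noteq> w"
      have nz: "z \<noteq> 0" "w \<noteq> 0" "norm z < 1" "norm w < 1" using zw k by (auto simp: punctured_disc_def)
      have "z ^ d / of_nat d - w ^ d / of_nat d = 1 / z - 1 / w" using zw(3) unfolding g by (simp add: k algebra_simps)
      also have "1 / z - 1 / w = (w - z) / (z * w)" using nz by (simp add: field_simps)
      finally have "(z ^ d - w ^ d) / of_nat d = (w - z) / (z * w)" by (simp only: diff_divide_distrib[of "z ^ d"])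
      then have "norm ((z ^ d - w ^ d) / of_nat d) = norm (z - w) / (norm z * norm w)"
        by (simp only: norm_divide norm_mult norm_minus_commute[of w z])
      moreover have "norm (z ^ d - w ^ d) \<le> of_nat d * norm (z - w)"
        using nz by (intro norm_power_diff) auto
      then have "norm (z ^ d - w ^ d) / norm (of_nat d :: complex) \<le> norm (z - w)" using d2 by (simp add: field_simps)
      ultimately have "norm (z - w) / (norm z * norm w) \<le> norm (z - w)" by (simp only: norm_divide)
      then have "1 \<le> norm z * norm w" using nz zw(4) by (simp add: field_simps)
      moreover have "norm z * norm w < 1 * 1" using nz by (intro mult_strict_mono) auto
      ultimately show False by simp
    qed
  qed
  then show ?thesis by (simp add: U_def)
qed

lemma Px_no_zero: "x \<in> U \<Longrightarrow> norm z < 1 \<Longrightarrow> poly (Px \<kappa> d x) z \<noteq> 0"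
proof (cases "z = 0")
  case True then show ?thesis using Px_coeff(1) by (simp add: poly_0_coeff_0)
next
  case False
  assume x: "x \<in> U" and z: "norm z < 1"
  interpret C: univalent_curve \<kappa> N "px \<kappa> d x" by (rule U_univalent[OF x])
  have "z \<in> punctured_disc \<kappa>" using z False by (simp add: punctured_disc_def)
  then show ?thesis using poly_Px[of z x] C.g_regular[of z] False by simp
qed

text \<open>A univalent map has no critical point in the disc, so \<open>Px\<close> is zero-free
  there with constant term 1, and its coefficients are bounded.\<close>

lemma U_bounded:
  assumes "x \<in> U" shows "\<bar>x k\<bar> \<le> 2 ^ (d + 2 * \<kappa> - 1)"
proof (cases "k \<in> K")
  case True
  have "norm (coeff (Px \<kappa> d x) (k + 2 * \<kappa> - 1)) \<le> 2 ^ degree (Px \<kappa> d x)"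
    using Px_no_zero[OF assms] Px_coeff(1) by (intro coeff_bound_zero_free_disc) (auto simp: poly_0_coeff_0)
  then have b: "norm (bc N x k) \<le> 2 ^ (d + 2 * \<kappa> - 1)" using Px_coeff(2)[OF True] Px_coeff(3) by simp
  have "2 * x k = Re (bc N x k) + Im (bc N x k)" by (simp add: bc_def)
  then have "\<bar>2 * x k\<bar> \<le> 2 * norm (bc N x k)" using abs_Re_le_cmod[of "bc N x k"] abs_Im_le_cmod[of "bc N x k"] by linarith
  then show ?thesis using b by simp
next
  case False then show ?thesis using assms by (simp add: U_def)
qed

lemma hx_linear: "hx \<kappa> d (\<lambda>k. a * x k + b * y k) z = of_real a * hx \<kappa> d x z + of_real b * hx \<kappa> d y z"
proof -
  have "bc N (\<lambda>k. a * x k + b * y k) k = of_real a * bc N x k + of_real b * bc N y k" for k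
    by (simp add: bc_def complex_eq_iff algebra_simps)
  then show ?thesis by (simp add: hx_def sum_distrib_left sum.distrib add_divide_distrib algebra_simps)
qed

lemma hx_bound:
  assumes "norm z \<le> 1" "\<And>k. \<bar>y k\<bar> \<le> e" shows "norm (hx \<kappa> d y z) \<le> of_nat (card K) * (4 * e)"
  unfolding hx_def
proof (rule sum_norm_bound)
  fix k assume k: "k \<in> K"
  have e0: "e \<ge> 0" using assms(2)[of 0] by linarith
  have "norm (bc N y k) \<le> \<bar>Re (bc N y k)\<bar> + \<bar>Im (bc N y k)\<bar>" by (rule cmod_le)
  also have "\<dots> \<le> 4 * e" using assms(2)[of k] assms(2)[of "N - k"] by (simp add: bc_def)
  finally have b: "norm (bc N y k) \<le> 4 * e" .
  have "norm (bc N y k / of_nat k * z ^ k) = norm (bc N y k) / of_nat k * norm z ^ k" by (simp add: norm_mult norm_divide norm_power)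
  also have "\<dots> \<le> 4 * e * 1"
  proof (rule mult_mono)
    have "norm (bc N y k) / real k \<le> norm (bc N y k) / 1" using K_pos[OF k] by (intro divide_left_mono) auto
    then show "norm (bc N y k) / real k \<le> 4 * e" using b by simp
    show "norm z ^ k \<le> 1" using assms(1) by (simp add: power_le_one)
  qed (use e0 in auto)
  finally show "norm (bc N y k / of_nat k * z ^ k) \<le> 4 * e" by simp
qed

text \<open>Hurwitz's theorem; the limit map is not constant because \<open>Px\<close> has constant
  term 1 for every parameter.\<close>

lemma U_closed:
  assumes xn: "\<And>n. xn n \<in> U" and lim: "\<And>k. k \<in> K \<Longrightarrow> (\<lambda>n. xn n k) \<longlonglongrightarrow> x k" and x0: "\<And>k. k \<notin> K \<Longrightarrow> x k = 0"
  shows "x \<in> U"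
proof -
  have diff: "gx (xn n) z - gx x z = hx \<kappa> d (\<lambda>k. 1 * xn n k + (-1) * x k) z" for n z
    unfolding hx_linear by (simp add: reflected_curve.g_def[OF reflected] px_def)
  have "inj_on (gx x) (punctured_disc \<kappa>)"
  proof (rule Hurwitz_injective[OF open_punctured_disc connected_punctured_disc, of "\<lambda>n. gx (xn n)"])
    show "gx (xn n) holomorphic_on punctured_disc \<kappa>" for n by (rule reflected_curve.g_hol_D[OF reflected])
    show "gx x holomorphic_on punctured_disc \<kappa>" by (rule reflected_curve.g_hol_D[OF reflected])
    show "inj_on (gx (xn n)) (punctured_disc \<kappa>)" for n using xn[of n] by (simp add: U_def)
    show "\<not> gx x constant_on punctured_disc \<kappa>"
    proof
      assume "gx x constant_on punctured_disc \<kappa>"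
      then obtain c where c: "\<And>z. z \<in> punctured_disc \<kappa> \<Longrightarrow> gx x z = c" by (auto simp: constant_on_def)
      have z0: "poly (Px \<kappa> d x) z = 0" if z: "z \<in> punctured_disc \<kappa>" for z
      proof -
        have nz: "\<kappa> = 0 \<or> z \<noteq> 0" using z by (auto simp: punctured_disc_def)
        have "((\<lambda>_. c) has_field_derivative deriv (px \<kappa> d x) z + of_nat \<kappa> / z^2) (at z)"
          by (rule has_field_derivative_transform_within_open[OF reflected_curve.g_deriv[OF reflected nz] open_punctured_disc z]) (use c in auto)
        then have "deriv (px \<kappa> d x) z + of_nat \<kappa> / z^2 = 0" using DERIV_unique DERIV_const by blast
        then show ?thesis using poly_Px[OF nz] by simp
      qed
      have "infinite (punctured_disc \<kappa>)"
      proof -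
        have "(1/2::complex) \<in> punctured_disc \<kappa>" by (simp add: punctured_disc_def)
        then show ?thesis using open_punctured_disc by (metis finite_imp_not_open empty_iff)
      qed
      moreover have "punctured_disc \<kappa> \<subseteq> {z. poly (Px \<kappa> d x) z = 0}" using z0 by blast
      moreover have "Px \<kappa> d x \<noteq> 0" using Px_coeff(1)[of x] by auto
      ultimately show False using poly_roots_finite finite_subset by blast
    qed
    fix C :: "complex set" assume C: "compact C" "C \<subseteq> punctured_disc \<kappa>"
    show "uniform_limit C (\<lambda>n. gx (xn n)) (gx x) sequentially"
      unfolding uniform_limit_iff
    proof (intro allI impI)
      fix e :: real assume e: "e > 0"
      \<comment> \<open>The bound of \<open>hx_bound\<close> costs a factor 4 * card K; the summand
        1 covers the empty index set of d = 2.\<close>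
      define e' where "e' = e / (4 * of_nat (card K) + 1) / 2"
      have e': "e' > 0" using e by (simp add: e'_def)
      have "\<forall>k\<in>K. \<forall>\<^sub>F n in sequentially. \<bar>xn n k - x k\<bar> < e'"
        using lim tendstoD[OF _ e'] by (fastforce simp: dist_real_def)
      then have "\<forall>\<^sub>F n in sequentially. \<forall>k\<in>K. \<bar>xn n k - x k\<bar> < e'"
        using finite_K by (simp add: eventually_ball_finite)
      then show "\<forall>\<^sub>F n in sequentially. \<forall>z\<in>C. dist (gx (xn n) z) (gx x z) < e"
      proof (rule eventually_mono, intro ballI)
        fix n z assume n: "\<forall>k\<in>K. \<bar>xn n k - x k\<bar> < e'" and z: "z \<in> C"
        have "\<bar>1 * xn n k + (-1) * x k\<bar> \<le> e'" for k
          using n xn[of n] x0[of k] e' by (cases "k \<in> K") (force simp: U_def)+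
        moreover have "norm z \<le> 1" using z C by (auto simp: punctured_disc_def)
        ultimately have "norm (gx (xn n) z - gx x z) \<le> of_nat (card K) * (4 * e')"
          unfolding diff by (intro hx_bound)
        also have "\<dots> < e"
        proof -
          have "of_nat (card K) * (4 * e') = e * (4 * of_nat (card K) / (4 * of_nat (card K) + 1) / 2)" by (simp add: e'_def)
          also have "\<dots> < e * 1" using e by (intro mult_strict_left_mono) (auto simp: field_simps)
          finally show ?thesis by simp
        qed
        finally show "dist (gx (xn n) z) (gx x z) < e" by (simp add: dist_norm)
      qed
    qed
  qed
  then show ?thesis using x0 by (simp add: U_def)
qed

lemma maximizer:
  obtains x where "x \<in> U" "\<And>y. y \<in> U \<Longrightarrow> (\<Sum>k\<in>K. (y k)^2) \<le> (\<Sum>k\<in>K. (x k)^2)"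
proof -
  define q where "q x = (\<Sum>k\<in>K. (x k)^2)" for x :: "nat \<Rightarrow> real"
  define B :: real where "B = 2 ^ (d + 2 * \<kappa> - 1)"
  have bd: "q y \<le> of_nat (card K) * B^2" if "y \<in> U" for y
    unfolding q_def by (rule sum_bounded_above) (use U_bounded[OF that] in \<open>auto simp: B_def abs_le_square_iff[symmetric]\<close>)
  define s where "s = Sup (q ` U)"
  have bdd: "bdd_above (q ` U)" using bd by (intro bdd_aboveI2)
  have ne: "q ` U \<noteq> {}" using zero_in_U by blast
  have "\<exists>y\<in>U. q y > s - inverse (real (Suc n))" for n
  proof -
    have "s - inverse (real (Suc n)) < s" by simp
    then show ?thesis unfolding s_def using less_cSup_iff[OF ne bdd] by blast
  qed
  then obtain xn where xn: "\<And>n. xn n \<in> U" "\<And>n. q (xn n) > s - inverse (real (Suc n))" by metis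
  obtain r l where r: "strict_mono (r :: nat \<Rightarrow> nat)" "\<forall>k\<in>K. (\<lambda>n. xn (r n) k) \<longlonglongrightarrow> l k"
    using bounded_sequences_subseq[OF finite_K, of xn B] U_bounded[OF xn(1)] by (auto simp: B_def)
  define x where "x k = (if k \<in> K then l k else 0)" for k
  have xU: "x \<in> U" by (rule U_closed[of "\<lambda>n. xn (r n)"]) (use xn r in \<open>auto simp: x_def\<close>)
  have l1: "(\<lambda>n. q (xn (r n))) \<longlonglongrightarrow> q x" unfolding q_def using r by (intro tendsto_sum tendsto_power) (auto simp: x_def)
  have l2: "(\<lambda>n. s - inverse (real (Suc (r n)))) \<longlonglongrightarrow> s - 0"
    using LIMSEQ_subseq_LIMSEQ[OF LIMSEQ_inverse_real_of_nat r(1)] by (intro tendsto_intros) (simp add: o_def)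
  have "s - 0 \<le> q x" by (rule LIMSEQ_le[OF l2 l1]) (use xn(2) less_imp_le in blast)
  moreover have "q y \<le> s" if "y \<in> U" for y unfolding s_def using that bdd by (intro cSup_upper) auto
  ultimately show ?thesis using that xU unfolding q_def by force
qed

text \<open>The function that multiplies the parameter x j in \<open>hx\<close>: the parameter
  occurs at the exponent j and at its mirror image.\<close>

definition Hj :: "nat \<Rightarrow> complex \<Rightarrow> complex" where
  "Hj j z = Complex 1 1 / of_nat j * z ^ j + Complex 1 (-1) / of_nat (N - j) * z ^ (N - j)"

lemma hx_basis: "hx \<kappa> d y z = (\<Sum>j\<in>K. of_real (y j) * Hj j z)"
proof -
  have "hx \<kappa> d y z = (\<Sum>k\<in>K. of_real (y k) * (Complex 1 1 / of_nat k * z ^ k)) + (\<Sum>k\<in>K. of_real (y (N - k)) * (Complex 1 (-1) / of_nat k * z ^ k))"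
  proof -
    have "bc N y k = of_real (y k) * Complex 1 1 + of_real (y (N - k)) * Complex 1 (-1)" for k
      by (simp add: bc_def complex_eq_iff)
    then show ?thesis by (simp add: hx_def sum.distrib[symmetric] algebra_simps add_divide_distrib)
  qed
  also have "(\<Sum>k\<in>K. of_real (y (N - k)) * (Complex 1 (-1) / of_nat k * z ^ k)) = (\<Sum>k\<in>K. of_real (y k) * (Complex 1 (-1) / of_nat (N - k) * z ^ (N - k)))"
  proof -
    have "(\<Sum>k\<in>K. of_real (y k) * (Complex 1 (-1) / of_nat (N - k) * z ^ (N - k))) =
        (\<Sum>k\<in>K. of_real (y (N - (N - k))) * (Complex 1 (-1) / of_nat (N - k) * z ^ (N - k)))"
      using K_le by (intro sum.cong) auto
    also have "\<dots> = (\<Sum>k\<in>K. of_real (y (N - k)) * (Complex 1 (-1) / of_nat k * z ^ k))"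
      by (rule K_reindex[of "\<lambda>k. of_real (y (N - k)) * (Complex 1 (-1) / of_nat k * z ^ k)"])
    finally show ?thesis ..
  qed
  finally show ?thesis by (simp add: Hj_def sum.distrib[symmetric] distrib_left)
qed

text \<open>No zero of \<open>Px\<close> lies in the disc by univalence, hence none outside the
  circle by reflection, and \<open>simple_zero\<close> makes all of them simple. So the degree
  counts them, and no two give the same boundary point because a cusp is not a double point.\<close>

lemma cusp_count:
  assumes x: "x \<in> U"
  shows "card (\<gamma>x x ` {t\<in>{0..<2 * pi}. fx x t = 0}) = d + 2 * \<kappa> - 1" "\<exists>t. fx x t = 0"
proof -
  interpret C: univalent_curve \<kappa> N "px \<kappa> d x" by (rule U_univalent[OF x])
  define Z where "Z = {z. poly (Px \<kappa> d x) z = 0}"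
  have P0: "Px \<kappa> d x \<noteq> 0" using Px_coeff(1)[of x] by auto
  have iff: "C.f t = 0 \<longleftrightarrow> cis t \<in> Z" for t
    using C.f_zero_iff[of t] poly_Px[of "cis t" x] by (simp add: Z_def)
  have sph: "norm z = 1" if z: "z \<in> Z" for z
  proof (rule ccontr)
    assume n: "norm z \<noteq> 1"
    have "\<not> norm z < 1" using Px_no_zero[OF x, of z] z by (auto simp: Z_def)
    then have g1: "norm z > 1" using n by simp
    then have "norm (1 / cnj z) < 1" "z \<noteq> 0" by (auto simp: norm_divide divide_less_eq)
    then show False using Px_reflect[of z x] Px_no_zero[OF x, of "1 / cnj z"] z by (simp add: Z_def)
  qed
  have simple: "poly (pderiv (Px \<kappa> d x)) z \<noteq> 0" if z: "poly (Px \<kappa> d x) z = 0" for z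
  proof
    assume d0: "poly (pderiv (Px \<kappa> d x)) z = 0"
    have "norm z = 1" using sph z by (simp add: Z_def)
    then have "z \<in> cis ` {0..<0 + 2 * pi}" using C.sphere_eq[of 0] by auto
    then obtain t where t: "z = cis t" by blast
    then have ft: "C.f t = 0" using iff z by (simp add: Z_def)
    \<comment> \<open>A zero-free factor between F and \<open>Px\<close>, so that a multiple zero of
      \<open>Px\<close> would be one of F.\<close>
    define u where "u \<zeta> = exp (- (\<i> * of_nat N * \<zeta> / 2)) * exp (\<i> * \<zeta>) / exp (\<i> * \<zeta>) ^ (2 * \<kappa>)" for \<zeta>
    have Fu: "C.F = (\<lambda>\<zeta>. u \<zeta> * poly (Px \<kappa> d x) (exp (\<i> * \<zeta>)))"
    proof
      fix \<zeta>
      have "poly (Px \<kappa> d x) (exp (\<i> * \<zeta>)) = exp (\<i> * \<zeta>) ^ (2 * \<kappa>) * (deriv (px \<kappa> d x) (exp (\<i> * \<zeta>)) + of_nat \<kappa> / (exp (\<i> * \<zeta>))^2)"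
        by (rule poly_Px) simp
      then have "u \<zeta> * poly (Px \<kappa> d x) (exp (\<i> * \<zeta>)) = exp (- (\<i> * of_nat N * \<zeta> / 2)) * (exp (\<i> * \<zeta>) * (deriv (px \<kappa> d x) (exp (\<i> * \<zeta>)) + of_nat \<kappa> / (exp (\<i> * \<zeta>))^2))"
        by (simp add: u_def)
      also have "exp (\<i> * \<zeta>) * (deriv (px \<kappa> d x) (exp (\<i> * \<zeta>)) + of_nat \<kappa> / (exp (\<i> * \<zeta>))^2) = exp (\<i> * \<zeta>) * deriv (px \<kappa> d x) (exp (\<i> * \<zeta>)) + of_nat \<kappa> * exp (- (\<i> * \<zeta>))"
        by (simp add: exp_minus field_simps power2_eq_square)
      finally show "C.F \<zeta> = u \<zeta> * poly (Px \<kappa> d x) (exp (\<i> * \<zeta>))" by (simp add: C.F_def)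
    qed
    have zt: "exp (\<i> * of_real t) = z" using t by (simp add: cis_conv_exp)
    have du: "(u has_field_derivative deriv u (of_real t)) (at (of_real t))"
    proof (rule holomorphic_derivI[of _ UNIV])
      show "u holomorphic_on UNIV" unfolding u_def by (intro holomorphic_intros) auto
    qed auto
    have "((\<lambda>\<zeta>. poly (Px \<kappa> d x) (exp (\<i> * \<zeta>))) has_field_derivative poly (pderiv (Px \<kappa> d x)) (exp (\<i> * of_real t)) * (exp (\<i> * of_real t) * \<i>)) (at (of_real t))"
      by (rule DERIV_chain'[OF _ poly_DERIV]) (auto intro!: derivative_eq_intros)
    from DERIV_mult[OF du this] have "deriv C.F (of_real t) = 0"
      unfolding Fu zt d0 z by (intro DERIV_imp_deriv) simp
    then show False using C.simple_zero[OF ft] by blast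
  qed
  have cZ: "card Z = d + 2 * \<kappa> - 1" unfolding Z_def using card_roots_simple[OF P0 simple] Px_coeff(3) by simp
  have Zc: "Z = cis ` {t\<in>{0..<2 * pi}. C.f t = 0}"
  proof (intro equalityI subsetI)
    fix z assume z: "z \<in> Z"
    then have "z \<in> cis ` {0..<0 + 2 * pi}" using C.sphere_eq[of 0] sph by auto
    then show "z \<in> cis ` {t\<in>{0..<2 * pi}. C.f t = 0}" using iff z by auto
  qed (use iff in auto)
  have "inj_on cis {t\<in>{0..<2 * pi}. C.f t = 0}"
  proof (rule inj_onI)
    fix s t assume "s \<in> {t\<in>{0..<2 * pi}. C.f t = 0}" "t \<in> {t\<in>{0..<2 * pi}. C.f t = 0}" "cis s = cis t"
    then show "s = t" by (intro cis_eq_window) auto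
  qed
  then have c1: "card {t\<in>{0..<2 * pi}. C.f t = 0} = d + 2 * \<kappa> - 1" using cZ Zc by (simp add: card_image)
  have "inj_on C.\<gamma> {t\<in>{0..<2 * pi}. C.f t = 0}"
  proof (rule inj_onI)
    fix s t assume st: "s \<in> {t\<in>{0..<2 * pi}. C.f t = 0}" "t \<in> {t\<in>{0..<2 * pi}. C.f t = 0}" "C.\<gamma> s = C.\<gamma> t"
    then have "\<bar>s - t\<bar> < 2 * pi" by auto
    then show "s = t" using C.\<gamma>_eq_cases[OF st(3)] C.cusp_not_dbl st(2) by blast
  qed
  then show "card (C.\<gamma> ` {t\<in>{0..<2 * pi}. C.f t = 0}) = d + 2 * \<kappa> - 1" using c1 by (simp add: card_image)
  have "{t\<in>{0..<2 * pi}. C.f t = 0} \<noteq> {}"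
  proof
    assume e: "{t\<in>{0..<2 * pi}. C.f t = 0} = {}"
    show False using c1 d2 unfolding e by simp
  qed
  then show "\<exists>t. C.f t = 0" by blast
qed

lemma maximizer_chords:
  assumes x: "x \<in> U" and mx: "\<And>y. y \<in> U \<Longrightarrow> (\<Sum>k\<in>K. (y k)^2) \<le> (\<Sum>k\<in>K. (x k)^2)"
    and nd: "\<forall>s. \<not> univalent_curve.dbl \<kappa> (px \<kappa> d x) s a"
  shows "card (univalent_curve.chords \<kappa> (px \<kappa> d x) a) \<ge> d - 2"
proof (rule ccontr)
  interpret C: univalent_curve \<kappa> N "px \<kappa> d x" by (rule U_univalent[OF x])
  assume "\<not> ?thesis"
  then have less: "card (C.chords a) < card K" using card_K by simp
  define A where "A = (\<lambda>(t, s) j. Re (cnj (C.T t) * (Hj j (cis s) - Hj j (cis t))))"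
  obtain y where y: "\<exists>k\<in>K. y k \<noteq> 0" "\<forall>k. k \<notin> K \<longrightarrow> y k = 0" "\<forall>c\<in>C.chords a. (\<Sum>k\<in>K. A c k * y k) = 0"
    using underdetermined_system[OF C.finite_chords finite_K less, of A] by blast
  interpret Q: perturbed_curve \<kappa> N "px \<kappa> d x" "hx \<kappa> d y"
    by unfold_locales (use hol hx_real in auto)
  have ch: "Re (cnj (C.T t) * (hx \<kappa> d y (cis s) - hx \<kappa> d y (cis t))) = 0" if c: "(t, s) \<in> C.chords a" for t s
  proof -
    have "cnj (C.T t) * (hx \<kappa> d y (cis s) - hx \<kappa> d y (cis t)) = (\<Sum>k\<in>K. of_real (y k) * (cnj (C.T t) * (Hj k (cis s) - Hj k (cis t))))"
      by (simp add: hx_basis sum_distrib_left flip: sum_subtractf) (intro sum.cong refl, simp add: algebra_simps)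
    then have "Re (cnj (C.T t) * (hx \<kappa> d y (cis s) - hx \<kappa> d y (cis t))) = (\<Sum>k\<in>K. y k * Re (cnj (C.T t) * (Hj k (cis s) - Hj k (cis t))))"
      by (simp only: Re_sum) simp
    also have "\<dots> = (\<Sum>k\<in>K. A (t, s) k * y k)" by (simp add: A_def mult.commute)
    finally show ?thesis using y(3) c by simp
  qed
  have tang: "Re (cnj (C.T t) * (hx \<kappa> d y (cis s) - hx \<kappa> d y (cis t))) = 0" if "C.dbl s t" for s t
    by (rule C.chords_tangent_all[OF nd ch that])
  obtain \<epsilon>0 where \<epsilon>0: "\<epsilon>0 > 0" "\<And>\<epsilon>. \<bar>\<epsilon>\<bar> < \<epsilon>0 \<Longrightarrow> inj_on (Q.ge \<epsilon>) (punctured_disc \<kappa>)"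
    using Q.perturbation[OF tang] by metis
  have inU: "(\<lambda>k. 1 * x k + \<epsilon> * y k) \<in> U" if "\<bar>\<epsilon>\<bar> < \<epsilon>0" for \<epsilon>
  proof -
    have "gx (\<lambda>k. 1 * x k + \<epsilon> * y k) = Q.ge \<epsilon>"
      unfolding fun_eq_iff reflected_curve.g_def[OF reflected] px_def hx_linear Q.ge_def by simp
    then show ?thesis using \<epsilon>0(2)[OF that] x y(2) by (simp add: U_def)
  qed
  define q where "q z = (\<Sum>k\<in>K. (z k)^2)" for z :: "nat \<Rightarrow> real"
  define \<epsilon> where "\<epsilon> = \<epsilon>0 / 2"
  have "q (\<lambda>k. 1 * x k + \<epsilon> * y k) \<le> q x" "q (\<lambda>k. 1 * x k + (- \<epsilon>) * y k) \<le> q x"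
    unfolding q_def using \<epsilon>0(1) by (intro mx inU; simp add: \<epsilon>_def)+
  \<comment> \<open>The parallelogram identity: the two values cannot both be at most q x.\<close>
  moreover have "q (\<lambda>k. 1 * x k + \<epsilon> * y k) + q (\<lambda>k. 1 * x k + (- \<epsilon>) * y k) = 2 * q x + 2 * \<epsilon>^2 * q y"
    by (simp add: q_def sum_distrib_left flip: sum.distrib) (intro sum.cong refl, simp add: power2_eq_square algebra_simps)
  moreover have "q y > 0"
  proof -
    obtain k where "k \<in> K" "y k \<noteq> 0" using y(1) by blast
    then show ?thesis unfolding q_def using finite_K by (intro sum_pos2[of K k]) auto
  qed
  then have "2 * \<epsilon>^2 * q y > 0" using \<epsilon>0(1) by (simp add: \<epsilon>_def)
  ultimately show False by linarith
qed

text \<open>N is d + 1 or d - 1, so both upper bounds are d - 2. The number of double points does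
  not depend on the base point, which may therefore differ between the upper and the lower
  estimate.\<close>

theorem extremal_curve:
  obtains x where "x \<in> U"
    "card (\<gamma>x x ` {t\<in>{0..<2 * pi}. \<exists>s. univalent_curve.dbl \<kappa> (px \<kappa> d x) s t}) = d - 2"
proof -
  obtain x where x: "x \<in> U" and mx: "\<And>y. y \<in> U \<Longrightarrow> (\<Sum>k\<in>K. (y k)^2) \<le> (\<Sum>k\<in>K. (x k)^2)" using maximizer by metis
  interpret C: univalent_curve \<kappa> N "px \<kappa> d x" by (rule U_univalent[OF x])
  have lower: "card (C.\<gamma> ` {t\<in>{0..<2 * pi}. \<exists>s. C.dbl s t}) \<ge> d - 2" if "\<forall>s. \<not> C.dbl s a" for a
    using maximizer_chords[OF x mx that] C.card_double_points[OF that] by simp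
  obtain \<delta> where \<delta>: "\<delta> > 0" "\<And>t. t \<noteq> 0 \<Longrightarrow> \<bar>t - 0\<bar> < \<delta> \<Longrightarrow> C.f t \<noteq> 0 \<and> (\<forall>s. \<not> C.dbl s t)"
    using C.isolated_singular by metis
  then have nd: "\<forall>s. \<not> C.dbl s (\<delta>/2)" by auto
  have upper: "card (C.\<gamma> ` {t\<in>{0..<2 * pi}. \<exists>s. C.dbl s t}) \<le> d - 2"
  proof (cases "\<kappa> = 1")
    case True
    have "card (C.chords (\<delta>/2)) + 1 \<le> N" by (rule C.chords_bound)
    then show ?thesis using C.card_double_points[OF nd] True d2 by (simp add: freq_def)
  next
    case False
    then have k: "\<kappa> = 0" using k1 by simp
    show ?thesis
    proof (cases "\<exists>s t. C.dbl s t")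
      case True
      then obtain s t where "C.dbl s t" by blast
      then obtain a where a: "\<forall>s. \<not> C.dbl s a" "card (C.chords a) + 3 \<le> N"
        using C.chords_bound_bounded[OF k] by metis
      then show ?thesis using C.card_double_points[OF a(1)] k by (simp add: freq_def)
    next
      case False then show ?thesis by simp
    qed
  qed
  show ?thesis using that[OF x] upper lower[OF nd] by simp
qed

end

section \<open>Polar change of variables\<close>

text \<open>The Jacobian formula is applied on real^2. Identifications with the complex plane and
  with pairs of reals that match the standard bases preserve boxes and their content, hence
  integrals.\<close>

lemma has_integral_basis_isomorphism:
  fixes \<phi> :: "'a::euclidean_space \<Rightarrow> 'b::euclidean_space" and f :: "'b \<Rightarrow> 'c::banach"
  assumes lin: "linear \<phi>" and inv: "\<And>x. \<psi> (\<phi> x) = x" "\<And>y. \<phi> (\<psi> y) = y"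
    and bas: "\<phi> ` Basis = Basis" and inn: "\<And>x b. b \<in> Basis \<Longrightarrow> \<phi> x \<bullet> \<phi> b = x \<bullet> b"
    and f: "(f has_integral I) S" "bounded S"
  shows "((\<lambda>x. f (\<phi> x)) has_integral I) (\<psi> ` S)"
proof -
  have bas': "\<psi> b \<in> Basis \<and> \<phi> (\<psi> b) = b" if "b \<in> Basis" for b
    using that bas inv by (metis imageE)
  have cb: "\<phi> x \<in> cbox (\<phi> u) (\<phi> v) \<longleftrightarrow> x \<in> cbox u v" for x u v
  proof -
    have "\<phi> x \<in> cbox (\<phi> u) (\<phi> v) \<longleftrightarrow> (\<forall>b\<in>Basis. \<phi> u \<bullet> \<phi> b \<le> \<phi> x \<bullet> \<phi> b \<and> \<phi> x \<bullet> \<phi> b \<le> \<phi> v \<bullet> \<phi> b)"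
      unfolding mem_box bas[symmetric] by blast
    then show ?thesis by (simp add: inn mem_box)
  qed
  have img: "\<phi> ` cbox u v = cbox (\<phi> u) (\<phi> v)" for u v
  proof (intro equalityI subsetI)
    fix y assume "y \<in> cbox (\<phi> u) (\<phi> v)"
    then have "\<psi> y \<in> cbox u v" using cb[of "\<psi> y" u v] inv by simp
    then show "y \<in> \<phi> ` cbox u v" using inv by (metis imageI)
  qed (use cb in auto)
  have img': "\<psi> ` cbox u v = cbox (\<psi> u) (\<psi> v)" for u v
  proof -
    have "cbox u v = \<phi> ` cbox (\<psi> u) (\<psi> v)" by (simp add: img inv)
    then show ?thesis by (simp add: image_image inv)
  qed
  have inj\<phi>: "inj_on \<phi> Basis" using inv by (metis inj_on_inverseI)
  have cont: "measure lborel (\<phi> ` cbox u v) = measure lborel (cbox u v)" for u v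
  proof -
    have e: "cbox (\<phi> u) (\<phi> v) = {} \<longleftrightarrow> cbox u v = {}" using img[of u v] by (metis image_is_empty)
    have "(\<Prod>i\<in>Basis. \<phi> v \<bullet> i - \<phi> u \<bullet> i) = (\<Prod>i\<in>Basis. v \<bullet> i - u \<bullet> i)"
      unfolding bas[symmetric] using inj\<phi> by (simp add: prod.reindex inn)
    then show ?thesis unfolding img content_cbox_if using e by simp
  qed
  obtain a where a: "S \<subseteq> cbox (-a) a" using bounded_subset_cbox_symmetric[OF f(2)] by metis
  have "((\<lambda>x. if x \<in> S then f x else 0) has_integral I) (cbox (-a) a)"
    using f(1) a by (simp add: has_integral_restrict)
  moreover have "continuous (at x) \<phi>" for x
    using linear_continuous_at linear_conv_bounded_linear lin by blast
  ultimately have "((\<lambda>x. if \<phi> x \<in> S then f (\<phi> x) else 0) has_integral (1 / 1) *\<^sub>R I) (\<psi> ` cbox (-a) a)"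
    by (intro has_integral_twiddle[where f = "\<lambda>x. if x \<in> S then f x else 0"]) (use inv img img' cont in \<open>auto simp: img img'\<close>)
  moreover have "\<phi> x \<in> S \<longleftrightarrow> x \<in> \<psi> ` S" for x using inv by (metis imageE imageI)
  ultimately have "((\<lambda>x. if x \<in> \<psi> ` S then f (\<phi> x) else 0) has_integral I) (\<psi> ` cbox (-a) a)" by simp
  then show ?thesis using a by (subst (asm) has_integral_restrict) auto
qed

definition v2c :: "real^2 \<Rightarrow> complex" where "v2c x = Complex (x $ 1) (x $ 2)"
definition c2v :: "complex \<Rightarrow> real^2" where "c2v z = vector [Re z, Im z]"
definition v2p :: "real^2 \<Rightarrow> real \<times> real" where "v2p x = (x $ 1, x $ 2)"
definition p2v :: "real \<times> real \<Rightarrow> real^2" where "p2v x = vector [fst x, snd x]"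

lemma v2c_c2v [simp]: "v2c (c2v z) = z" by (simp add: v2c_def c2v_def)
lemma c2v_v2c [simp]: "c2v (v2c x) = x" by (simp add: v2c_def c2v_def vec_eq_iff forall_2)
lemma v2p_p2v [simp]: "v2p (p2v z) = z" by (simp add: v2p_def p2v_def)
lemma p2v_v2p [simp]: "p2v (v2p x) = x" by (simp add: v2p_def p2v_def vec_eq_iff forall_2)

lemma Basis_real2: "(Basis :: (real^2) set) = {axis 1 1, axis 2 1}"
  by (auto simp: Basis_vec_def UNIV_2)

lemma linear_v2c: "linear v2c" by (rule linearI) (auto simp: v2c_def complex_eq_iff)
lemma linear_c2v: "linear c2v" by (rule linearI) (auto simp: c2v_def vec_eq_iff forall_2)
lemma linear_v2p: "linear v2p" by (rule linearI) (auto simp: v2p_def)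
lemma linear_p2v: "linear p2v" by (rule linearI) (auto simp: p2v_def vec_eq_iff forall_2)

lemma v2p_axis: "v2p (axis 1 1) = (1, 0)" "v2p (axis 2 1) = (0, 1)" by (auto simp: v2p_def axis_def)

lemma has_integral_c2v:
  fixes f :: "real^2 \<Rightarrow> 'c::banach"
  assumes "(f has_integral I) S" "bounded S"
  shows "((\<lambda>z. f (c2v z)) has_integral I) (v2c ` S)"
proof (rule has_integral_basis_isomorphism[OF linear_c2v _ _ _ _ assms])
  show "c2v ` Basis = Basis" by (auto simp: Basis_complex_def Basis_real2 c2v_def axis_def vec_eq_iff forall_2)
  show "c2v x \<bullet> c2v b = x \<bullet> b" for x b by (simp add: c2v_def inner_vec_def sum_2 inner_complex_def)
qed auto

lemma has_integral_v2p:
  fixes f :: "real \<times> real \<Rightarrow> 'c::banach"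
  assumes "(f has_integral I) S" "bounded S"
  shows "((\<lambda>z. f (v2p z)) has_integral I) (p2v ` S)"
proof (rule has_integral_basis_isomorphism[OF linear_v2p _ _ _ _ assms])
  show "v2p ` Basis = Basis" by (auto simp: Basis_prod_def Basis_real2 v2p_axis)
  show "v2p x \<bullet> v2p b = x \<bullet> b" for x b by (simp add: v2p_def inner_vec_def sum_2)
qed auto

text \<open>The map (r, t) -> g (r cis t) has Jacobian determinant r * norm (g')^2. It is used on an
  open rectangle, whose polar image misses only a slit along the positive axis; the image of the
  slit under g is negligible.\<close>

lemma polar_change_of_variables:
  fixes g f :: "complex \<Rightarrow> complex"
  assumes r: "0 < r1" "r1 < r2"
    and der: "\<And>z. r1 \<le> norm z \<Longrightarrow> norm z \<le> r2 \<Longrightarrow> (g has_field_derivative g' z) (at z)"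
    and contg': "continuous_on {z. r1 \<le> norm z \<and> norm z \<le> r2} g'"
    and inj: "inj_on g {z. r1 < norm z \<and> norm z < r2}"
    and f: "continuous_on (g ` {z. r1 \<le> norm z \<and> norm z \<le> r2}) f"
  shows "(f has_integral integral {r1..r2} (\<lambda>r. integral {0..2 * pi} (\<lambda>t. of_real (r * (norm (g' (of_real r * cis t)))^2) * f (g (of_real r * cis t)))))
     (g ` {z. r1 < norm z \<and> norm z < r2})"
proof -
  define \<Theta> where "\<Theta> = (\<lambda>(r, t). of_real (r * (norm (g' (of_real r * cis t)))^2) * f (g (of_real r * cis t)))"
  define I where "I = integral {r1..r2} (\<lambda>r. integral {0..2 * pi} (\<lambda>t. \<Theta> (r, t)))"
  define A where "A = {z::complex. r1 \<le> norm z \<and> norm z \<le> r2}"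
  have nrm: "norm (of_real r * cis t) = \<bar>r\<bar>" for r t by (simp add: norm_mult)
  have contg: "continuous_on A g" using der by (intro continuous_at_imp_continuous_on) (auto simp: A_def dest: DERIV_isCont)
  define B where "B = cbox (r1, 0) (r2, 2 * pi)"
  have pol: "(\<lambda>x. of_real (fst x) * cis (snd x)) ` B \<subseteq> A" using r by (auto simp: B_def A_def nrm cbox_Pair_eq)
  have cpol: "continuous_on B (\<lambda>x. of_real (fst x) * cis (snd x))" unfolding cis_conv_exp by (intro continuous_intros)
  have cont\<Theta>: "continuous_on B \<Theta>"
  proof -
    have 1: "continuous_on B (\<lambda>x. g' (of_real (fst x) * cis (snd x)))"
      using continuous_on_compose2[OF contg'[folded A_def] cpol pol] .
    have "continuous_on B (\<lambda>x. g (of_real (fst x) * cis (snd x)))"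
      using continuous_on_compose2[OF contg cpol pol] .
    then have 2: "continuous_on B (\<lambda>x. f (g (of_real (fst x) * cis (snd x))))"
      by (rule continuous_on_compose2[OF f[folded A_def]]) (use pol in auto)
    show ?thesis unfolding \<Theta>_def case_prod_beta by (intro continuous_intros 1 2)
  qed
  have IB: "(\<Theta> has_integral I) B"
  proof -
    have "\<Theta> integrable_on B" using cont\<Theta> unfolding B_def by (rule integrable_continuous)
    moreover have "integral B \<Theta> = I"
      unfolding B_def I_def using integral_prod_continuous[OF cont\<Theta>[unfolded B_def]] by simp
    ultimately show ?thesis by (simp add: has_integral_integrable_integral)
  qed
  define S where "S = p2v ` box (r1, 0) (r2, 2 * pi)"
  have Smem: "x \<in> S \<longleftrightarrow> r1 < x $ 1 \<and> x $ 1 < r2 \<and> 0 < x $ 2 \<and> x $ 2 < 2 * pi" for x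
  proof -
    have "x \<in> S \<longleftrightarrow> v2p x \<in> box (r1, 0) (r2, 2 * pi)"
    proof
      assume "x \<in> S"
      then show "v2p x \<in> box (r1, 0) (r2, 2 * pi)" unfolding S_def by auto
    next
      assume "v2p x \<in> box (r1, 0) (r2, 2 * pi)"
      then show "x \<in> S" unfolding S_def by (rule image_eqI[rotated]) simp
    qed
    then show ?thesis by (auto simp: v2p_def mem_box Basis_prod_def ball_Un)
  qed
  have bS: "bounded S" unfolding S_def
    using bounded_linear_image[OF bounded_box] linear_p2v linear_conv_bounded_linear by blast
  have IS: "((\<lambda>x. \<Theta> (v2p x)) has_integral I) S"
    unfolding S_def using IB unfolding B_def has_integral_open_interval[symmetric]
    by (intro has_integral_v2p) auto
  define P where "P x = of_real (x $ 1) * cis (x $ 2)" for x :: "real^2"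
  define h where "h x = c2v (g (P x))" for x
  define h' where "h' x y = c2v (g' (P x) * (of_real (y $ 1) * cis (x $ 2) + of_real (x $ 1) * (of_real (y $ 2) * (\<i> * cis (x $ 2)))))" for x y :: "real^2"
  have PA: "P x \<in> A" if "x \<in> S" for x using that r by (auto simp: P_def A_def nrm Smem)
  have dP: "(P has_derivative (\<lambda>y. of_real (y $ 1) * cis (x $ 2) + of_real (x $ 1) * (of_real (y $ 2) * (\<i> * cis (x $ 2))))) (at x)" for x
  proof -
    have l1: "((\<lambda>y::real^2. \<i> * of_real (y $ 2)) has_derivative (\<lambda>y. \<i> * of_real (y $ 2))) (at x)"
      by (intro bounded_linear_imp_has_derivative linear_conv_bounded_linear[THEN iffD1] linearI)
        (auto simp: complex_eq_iff)
    have l2: "((\<lambda>y::real^2. complex_of_real (y $ 1)) has_derivative (\<lambda>y. of_real (y $ 1))) (at x)"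
      by (intro bounded_linear_imp_has_derivative linear_conv_bounded_linear[THEN iffD1] linearI)
        (auto simp: complex_eq_iff)
    have c: "((\<lambda>x. cis (x $ 2)) has_derivative (\<lambda>y. of_real (y $ 2) * (\<i> * cis (x $ 2)))) (at x)"
      using has_derivative_compose[OF l1 has_field_derivative_imp_has_derivative[OF DERIV_exp]]
      by (simp add: cis_conv_exp mult_ac)
    show ?thesis unfolding P_def
      using has_derivative_mult[OF l2 c] by (simp add: algebra_simps)
  qed
  have dh: "(h has_derivative h' x) (at x within S)" if x: "x \<in> S" for x
  proof -
    have "(g has_derivative (*) (g' (P x))) (at (P x))" using der[of "P x"] PA[OF x] by (simp add: A_def has_field_derivative_def)
    from has_derivative_compose[OF dP this]
    have "((\<lambda>x. g (P x)) has_derivative (\<lambda>y. g' (P x) * (of_real (y $ 1) * cis (x $ 2) + of_real (x $ 1) * (of_real (y $ 2) * (\<i> * cis (x $ 2)))))) (at x)" .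
    from bounded_linear.has_derivative[OF linear_conv_bounded_linear[THEN iffD1, OF linear_c2v] this]
    show ?thesis unfolding h_def h'_def by (rule has_derivative_at_withinI)
  qed
  have Pinj: "inj_on P S"
  proof (rule inj_onI)
    fix x y assume xy: "x \<in> S" "y \<in> S" "P x = P y"
    have "norm (P x) = norm (P y)" using xy by simp
    then have 1: "x $ 1 = y $ 1" using xy r by (auto simp: P_def nrm Smem)
    then have "cis (x $ 2) = cis (y $ 2)" using xy r by (auto simp: P_def Smem)
    then have "exp (\<i> * of_real (x $ 2)) = exp (\<i> * of_real (y $ 2))" by (simp add: cis_conv_exp)
    then obtain k :: int where k: "\<i> * of_real (x $ 2) = \<i> * of_real (y $ 2) + of_int (2 * k) * pi * \<i>" by (auto simp: exp_eq)
    then have "Im (\<i> * of_real (x $ 2)) = Im (\<i> * of_real (y $ 2) + of_int (2 * k) * pi * \<i>)" by simp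
    then have e: "x $ 2 = y $ 2 + 2 * of_int k * pi" by simp
    have "\<bar>x $ 2 - y $ 2\<bar> < 2 * pi" using xy by (auto simp: Smem)
    then have "\<bar>2 * of_int k * pi\<bar> < 2 * pi" using e by simp
    then have "\<bar>of_int k\<bar> < (1::real)" by (simp add: abs_mult)
    then have "k = 0" by linarith
    then show "x = y" using 1 e by (simp add: vec_eq_iff forall_2)
  qed
  have PS: "P ` S = {z. r1 < norm z \<and> norm z < r2} - {z. Im z = 0 \<and> Re z \<ge> 0}"
  proof (intro equalityI subsetI)
    fix z assume "z \<in> P ` S"
    then obtain x where x: "x \<in> S" "z = P x" by blast
    have "z \<notin> {z. Im z = 0 \<and> Re z \<ge> 0}"
    proof
      assume "z \<in> {z. Im z = 0 \<and> Re z \<ge> 0}"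
      then have "x $ 1 * sin (x $ 2) = 0" "x $ 1 * cos (x $ 2) \<ge> 0" using x by (auto simp: P_def)
      then have s: "sin (x $ 2) = 0" "cos (x $ 2) \<ge> 0" using x r by (auto simp: Smem zero_le_mult_iff)
      then have "cos (x $ 2) = 1" using sin_cos_squared_add[of "x $ 2"] by (simp add: power2_eq_1_iff)
      then obtain n :: int where n: "x $ 2 = of_int n * 2 * pi" using cos_one_2pi_int by blast
      have "0 < of_int n * (2 * pi)" "of_int n * (2 * pi) < 1 * (2 * pi)" using x n by (auto simp: Smem mult.assoc)
      then have "0 < n" "real_of_int n < 1" by (auto simp: zero_less_mult_iff)
      then show False by linarith
    qed
    then show "z \<in> {z. r1 < norm z \<and> norm z < r2} - {z. Im z = 0 \<and> Re z \<ge> 0}" using x r by (auto simp: P_def nrm Smem)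
  next
    fix z assume z: "z \<in> {z. r1 < norm z \<and> norm z < r2} - {z. Im z = 0 \<and> Re z \<ge> 0}"
    define x :: "real^2" where "x = vector [norm z, Arg2pi z]"
    have "z = of_real (norm z) * cis (Arg2pi z)" using Arg2pi_eq[of z] by (simp add: cis_conv_exp)
    then have zP: "z = P x" by (simp add: P_def x_def)
    have "Arg2pi z \<noteq> 0" using z Arg2pi_eq_0[of z] by (auto simp: complex_is_Real_iff)
    then have "x \<in> S" using z Arg2pi[of z] by (auto simp: Smem x_def less_le)
    then show "z \<in> P ` S" using zP by blast
  qed
  have hinj: "inj_on h S"
  proof (rule inj_onI)
    fix x y assume xy: "x \<in> S" "y \<in> S" "h x = h y"
    then have "g (P x) = g (P y)" by (metis h_def v2c_c2v)
    moreover have "P x \<in> P ` S" "P y \<in> P ` S" using xy by auto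
    ultimately have "P x = P y" using inj unfolding PS by (auto simp: inj_on_def)
    then show "x = y" using Pinj xy by (auto simp: inj_on_def)
  qed
  have det: "\<bar>det (matrix (h' x))\<bar> = x $ 1 * (norm (g' (P x)))^2" if x: "x \<in> S" for x
  proof -
    define w where "w = g' (P x) * cis (x $ 2)"
    have c1: "h' x (axis 1 1) = c2v w" by (simp add: h'_def w_def axis_def)
    have c2: "h' x (axis 2 1) = c2v (of_real (x $ 1) * (\<i> * w))" by (simp add: h'_def w_def axis_def mult_ac)
    have "det (matrix (h' x)) = x $ 1 * ((Re w)^2 + (Im w)^2)"
      unfolding det_2 matrix_def by (simp add: c1 c2) (simp add: c2v_def power2_eq_square algebra_simps)
    also have "(Re w)^2 + (Im w)^2 = (norm w)^2" by (simp add: cmod_power2)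
    also have "norm w = norm (g' (P x))" by (simp add: w_def norm_mult)
    finally show ?thesis using x r by (simp add: Smem abs_mult)
  qed
  define f2 where "f2 y = c2v (f (v2c y))" for y
  have Seb: "S \<in> sets lebesgue"
  proof -
    have "S = box (vector [r1, 0]) (vector [r2, 2 * pi])" by (auto simp: Smem mem_box_cart forall_2)
    then show ?thesis by simp
  qed
  have eqn: "\<bar>det (matrix (h' x))\<bar> *\<^sub>R f2 (h x) = c2v (\<Theta> (v2p x))" if "x \<in> S" for x
  proof -
    have "\<Theta> (v2p x) = (x $ 1 * (norm (g' (P x)))^2) *\<^sub>R f (g (P x))"
      by (simp add: \<Theta>_def v2p_def P_def scaleR_conv_of_real)
    then show ?thesis unfolding det[OF that] f2_def h_def using linear_cmul[OF linear_c2v] by simp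
  qed
  have abs: "(\<lambda>x. c2v (\<Theta> (v2p x))) absolutely_integrable_on S"
  proof -
    have "continuous_on (cbox (vector [r1, 0]) (vector [r2, 2 * pi])) (\<lambda>x. c2v (\<Theta> (v2p x)))"
    proof -
      have "v2p ` cbox (vector [r1, 0]) (vector [r2, 2 * pi]) \<subseteq> B"
        by (auto simp: v2p_def B_def cbox_Pair_eq mem_box_cart forall_2)
      moreover have "continuous_on X v2p" "continuous_on Y c2v" for X Y
        using linear_continuous_on linear_conv_bounded_linear linear_v2p linear_c2v by blast+
      ultimately show ?thesis using continuous_on_compose2[OF _ continuous_on_compose2[OF cont\<Theta>]] by (metis subset_UNIV)
    qed
    then have "(\<lambda>x. c2v (\<Theta> (v2p x))) absolutely_integrable_on (cbox (vector [r1, 0]) (vector [r2, 2 * pi]))"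
      by (rule absolutely_integrable_continuous)
    then show ?thesis
      by (rule set_integrable_subset[OF _ Seb]) (auto simp: Smem mem_box_cart forall_2)
  qed
  have bl: "bounded_linear c2v" "bounded_linear v2c"
    using linear_c2v linear_v2c linear_conv_bounded_linear by blast+
  have Ic: "((\<lambda>x. c2v (\<Theta> (v2p x))) has_integral c2v I) S"
    using has_integral_linear[OF IS bl(1)] by (simp add: o_def)
  have "(\<lambda>x. \<bar>det (matrix (h' x))\<bar> *\<^sub>R f2 (h x)) absolutely_integrable_on S \<and> integral S (\<lambda>x. \<bar>det (matrix (h' x))\<bar> *\<^sub>R f2 (h x)) = c2v I"
  proof
    show "(\<lambda>x. \<bar>det (matrix (h' x))\<bar> *\<^sub>R f2 (h x)) absolutely_integrable_on S"
      using abs eqn by (subst set_integrable_cong[OF refl refl eqn])  auto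
    show "integral S (\<lambda>x. \<bar>det (matrix (h' x))\<bar> *\<^sub>R f2 (h x)) = c2v I"
    proof -
      have "integral S (\<lambda>x. \<bar>det (matrix (h' x))\<bar> *\<^sub>R f2 (h x)) = integral S (\<lambda>x. c2v (\<Theta> (v2p x)))"
        by (rule integral_cong) (rule eqn)
      then show ?thesis using integral_unique[OF Ic] by simp
    qed
  qed
  then have "f2 absolutely_integrable_on (h ` S) \<and> integral (h ` S) f2 = c2v I"
    using has_absolute_integral_change_of_variables[OF Seb dh hinj] by blast
  then have f2I: "(f2 has_integral c2v I) (h ` S)"
    using absolutely_integrable_on_def has_integral_integrable_integral by blast
  have hS: "h ` S = c2v ` (g ` (P ` S))" by (auto simp: h_def)
  have "compact A"
  proof -
    have "A = cball 0 r2 - ball 0 r1" by (auto simp: A_def)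
    then show ?thesis by (simp add: compact_diff)
  qed
  then have "bounded (g ` A)" using contg by (intro compact_imp_bounded compact_continuous_image)
  moreover have "g ` (P ` S) \<subseteq> g ` A" using PA by blast
  ultimately have "bounded (g ` (P ` S))" using bounded_subset by blast
  then have bh: "bounded (h ` S)" unfolding hS by (rule bounded_linear_image[OF _ bl(1)])
  have "((\<lambda>z. f2 (c2v z)) has_integral c2v I) (v2c ` (h ` S))" by (rule has_integral_c2v[OF f2I bh])
  then have "((\<lambda>z. c2v (f z)) has_integral c2v I) (g ` (P ` S))" unfolding hS by (simp add: f2_def image_image)
  from has_integral_linear[OF this bl(2)] have main: "(f has_integral I) (g ` (P ` S))" by (simp add: o_def)
  define L where "L = {z. r1 < norm z \<and> norm z < r2} \<inter> {z. Im z = 0}"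
  have "negligible L"
  proof -
    have "negligible {z::complex. \<i> \<bullet> z = 0}" by (rule negligible_hyperplane) simp
    then show ?thesis by (rule negligible_subset) (auto simp: L_def)
  qed
  moreover have "g differentiable_on L" unfolding differentiable_on_def
  proof
    fix z assume "z \<in> L"
    then have "(g has_field_derivative g' z) (at z)" by (intro der) (auto simp: L_def)
    then show "g differentiable at z within L"
      using has_field_derivative_imp_has_derivative differentiable_def differentiable_at_withinI by blast
  qed
  ultimately have neg: "negligible (g ` L)" by (intro negligible_differentiable_image_negligible) auto
  have "(f has_integral I) (g ` {z. r1 < norm z \<and> norm z < r2})"
  proof -
    have "g ` P ` S \<subseteq> g ` {z. r1 < cmod z \<and> cmod z < r2}" unfolding PS by (rule image_mono) auto
    moreover have "negligible (g ` {z. r1 < cmod z \<and> cmod z < r2} - g ` P ` S)"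
      unfolding PS by (rule negligible_subset[OF neg]) (auto simp: L_def)
    ultimately show ?thesis using main has_integral_spike_set_eq[of "g ` P ` S" "g ` {z. r1 < cmod z \<and> cmod z < r2}" f I]
      by (metis (no_types, lifting) Diff_eq_empty_iff has_integral_spike_set_eq negligible_empty negligible_subset Collect_subset mem_Collect_eq subsetI)
  qed
  then show ?thesis unfolding I_def \<Theta>_def by simp
qed

text \<open>Cauchy's formula for the k-th Taylor coefficient; the mean does not depend on the
  radius.\<close>

lemma circle_mean:
  fixes E :: "complex \<Rightarrow> complex"
  assumes E: "E holomorphic_on cball 0 r" and r: "0 < r"
  shows "((\<lambda>t. E (of_real r * cis t) / (of_real r * cis t) ^ k) has_integral 2 * pi * ((deriv ^^ k) E 0 / fact k)) {0..2 * pi}"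
proof -
  have "continuous_on (cball 0 r) E" "E holomorphic_on ball 0 r"
    using E by (auto intro: holomorphic_on_imp_continuous_on elim: holomorphic_on_subset)
  then have "((\<lambda>u. E u / (u - 0) ^ Suc k) has_contour_integral (2 * pi * \<i>) / fact k * (deriv ^^ k) E 0) (circlepath 0 r)"
    using r by (intro Cauchy_has_contour_integral_higher_derivative_circlepath) auto
  then have "((\<lambda>t. E (of_real r * cis t) / (of_real r * cis t) ^ Suc k * r * \<i> * cis t) has_integral (2 * pi * \<i>) / fact k * (deriv ^^ k) E 0) {0..2 * pi}"
    unfolding circlepath_def by (subst (asm) has_contour_integral_part_circlepath_iff) auto
  from has_integral_mult_right[OF this, of "- \<i>"]
  have "((\<lambda>t. - \<i> * (E (of_real r * cis t) / (of_real r * cis t) ^ Suc k * r * \<i> * cis t)) has_integral - \<i> * ((2 * pi * \<i>) / fact k * (deriv ^^ k) E 0)) {0..2 * pi}" .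
  moreover have "- \<i> * (E (of_real r * cis t) / (of_real r * cis t) ^ Suc k * r * \<i> * cis t) = E (of_real r * cis t) / (of_real r * cis t) ^ k" for t
  proof -
    define w where "w = of_real r * cis t"
    have w: "w \<noteq> 0" using r by (simp add: w_def)
    have "- \<i> * (x / w ^ Suc k * r * \<i> * cis t) = (- \<i> * \<i>) * (x / w ^ Suc k * w)" for x
      by (simp add: w_def algebra_simps)
    also have "(- \<i> * \<i>) * (x / w ^ Suc k * w) = x / w ^ k" for x using w by simp
    finally show ?thesis unfolding w_def .
  qed
  moreover have "- \<i> * ((2 * pi * \<i>) / fact k * (deriv ^^ k) E 0) = 2 * pi * ((deriv ^^ k) E 0 / fact k)" by (simp add: field_simps)
  ultimately show ?thesis by simp
qed

section \<open>The quadrature identity\<close>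

locale laurent_map =
  fixes \<kappa> d :: nat and a :: "nat \<Rightarrow> complex" and f E :: "complex \<Rightarrow> complex"
  assumes k1: "\<kappa> \<le> 1"
begin

definition p where "p z = (\<Sum>k=1..d. a k * z ^ k)" for z
definition g where "g z = p z - of_nat \<kappa> / z" for z
text \<open>This is z g'(z).\<close>

definition W where "W z = (\<Sum>k=1..d. of_nat k * a k * z ^ k) + of_nat \<kappa> / z" for z
definition e where "e k = (deriv ^^ (k + \<kappa>)) E 0 / fact (k + \<kappa>)" for k

lemma p_deriv: "(p has_field_derivative (\<Sum>k=1..d. of_nat k * a k * z ^ (k - 1))) (at z)"
  unfolding p_def by (auto intro!: derivative_eq_intros sum.cong)

lemma p_deriv_W: "z * (\<Sum>k=1..d. of_nat k * a k * z ^ (k - 1)) = (\<Sum>k=1..d. of_nat k * a k * z ^ k)"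
  unfolding sum_distrib_left
proof (rule sum.cong[OF refl])
  fix k assume "k \<in> {1..d}"
  then have "z ^ k = z * z ^ (k - 1)" by (simp flip: power_Suc)
  then show "z * (of_nat k * a k * z ^ (k - 1)) = of_nat k * a k * z ^ k" by simp
qed

lemma g_deriv: "z \<noteq> 0 \<Longrightarrow> (g has_field_derivative W z / z) (at z)"
proof -
  assume z: "z \<noteq> 0"
  have "(g has_field_derivative (\<Sum>k=1..d. of_nat k * a k * z ^ (k - 1)) + of_nat \<kappa> / z^2) (at z)"
    unfolding g_def using z p_deriv by (auto intro!: derivative_eq_intros simp: power2_eq_square)
  moreover have "W z / z = (\<Sum>k=1..d. of_nat k * a k * z ^ (k - 1)) + of_nat \<kappa> / z^2"
    unfolding W_def p_deriv_W[symmetric] using z by (simp add: add_divide_distrib power2_eq_square)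
  ultimately show ?thesis by simp
qed

lemma W_cnj:
  assumes r: "r > 0" and z: "norm z = r"
  shows "cnj (W z) = (\<Sum>k=1..d. of_nat k * cnj (a k) * of_real (r ^ (2 * k)) / z ^ k) + of_nat \<kappa> * z / of_real (r^2)"
proof -
  have nz: "z \<noteq> 0" using assms by auto
  have zz: "cnj z = of_real (r^2) / z" using complex_norm_square[of z] z nz by (simp add: field_simps)
  have "cnj (W z) = (\<Sum>k=1..d. of_nat k * cnj (a k) * cnj z ^ k) + of_nat \<kappa> / cnj z" by (simp add: W_def)
  also have "(\<Sum>k=1..d. of_nat k * cnj (a k) * cnj z ^ k) = (\<Sum>k=1..d. of_nat k * cnj (a k) * of_real (r ^ (2 * k)) / z ^ k)"
    by (rule sum.cong[OF refl]) (simp add: zz power_divide power_mult)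
  also have "of_nat \<kappa> / cnj z = of_nat \<kappa> * z / of_real (r^2)" unfolding zz by simp
  finally show ?thesis .
qed

end

text \<open>E continues z^\<kappa> * z g'(z) * f (g z) to the centre. In the unbounded case z g'(z)
  has a simple pole there, which the factor z removes, and E 0 = 0 expresses that f vanishes at
  infinity.\<close>

locale laurent_quadrature = laurent_map +
  assumes inj: "inj_on g (ball 0 1 - {0})" and f_cont: "continuous_on (g ` (cball 0 1 - {0})) f"
    and E_hol: "E holomorphic_on ball 0 1"
    and E_eq: "\<And>z. z \<noteq> 0 \<Longrightarrow> norm z < 1 \<Longrightarrow> E z = z ^ \<kappa> * W z * f (g z)"
    and E_0: "\<kappa> = 1 \<Longrightarrow> E 0 = 0"
begin

lemma circle_integral:
  assumes r: "0 < r" "r < 1"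
  shows "((\<lambda>t. of_real (r * (norm (W (of_real r * cis t) / (of_real r * cis t)))^2) * f (g (of_real r * cis t)))
     has_integral (\<Sum>k=1..d. of_real (2 * real k * r ^ (2 * k - 1)) * (pi * cnj (a k) * e k))) {0..2 * pi}"
proof -
  define z where "z t = of_real r * cis t" for t
  have nz: "norm (z t) = r" "z t \<noteq> 0" for t using r by (auto simp: z_def norm_mult)
  define c where "c k = of_nat k * cnj (a k) * of_real (r ^ (2 * k)) / of_real r" for k
  have integrand: "of_real (r * (norm (W (z t) / z t))^2) * f (g (z t)) =
     (\<Sum>k=1..d. c k * (E (z t) / z t ^ (k + \<kappa>))) + of_nat \<kappa> / of_real (r^3) * (E (z t) / z t ^ 0)" for t
  proof -
    have Ez: "W (z t) * f (g (z t)) = E (z t) / z t ^ \<kappa>" using E_eq[OF nz(2), of t] nz(1)[of t] nz(2)[of t] r by simp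
    have "of_real (r * (norm (W (z t) / z t))^2) = cnj (W (z t)) * W (z t) / of_real r"
      using r nz(1)[of t] complex_norm_square[of "W (z t)"]
      by (simp add: norm_divide power_divide power2_eq_square mult_ac)
    then have "of_real (r * (norm (W (z t) / z t))^2) * f (g (z t)) = cnj (W (z t)) * (W (z t) * f (g (z t))) / of_real r"
      by simp
    also have "\<dots> = cnj (W (z t)) * (E (z t) / z t ^ \<kappa>) / of_real r" unfolding Ez ..
    also have "\<dots> = (\<Sum>k=1..d. c k * (E (z t) / z t ^ (k + \<kappa>))) + of_nat \<kappa> * z t / of_real (r^2) * (E (z t) / z t ^ \<kappa>) / of_real r"
      unfolding W_cnj[OF r(1) nz(1)] distrib_right add_divide_distrib sum_distrib_right sum_divide_distrib
      by (rule arg_cong2[where f = "(+)"], rule sum.cong) (auto simp: c_def power_add)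
    also have "of_nat \<kappa> * z t / of_real (r^2) * (E (z t) / z t ^ \<kappa>) / of_real r = of_nat \<kappa> / of_real (r^3) * (E (z t) / z t ^ 0)"
    proof (cases "\<kappa> = 0")
      case False
      then have "\<kappa> = 1" using k1 by simp
      then show ?thesis using nz(2)[of t] by (simp add: power2_eq_square power3_eq_cube)
    qed simp
    finally show ?thesis .
  qed
  have m: "((\<lambda>t. E (z t) / z t ^ j) has_integral 2 * pi * ((deriv ^^ j) E 0 / fact j)) {0..2 * pi}" for j
    unfolding z_def by (rule circle_mean) (use E_hol r in \<open>auto elim: holomorphic_on_subset\<close>)
  have I: "((\<lambda>t. (\<Sum>k=1..d. c k * (E (z t) / z t ^ (k + \<kappa>))) + of_nat \<kappa> / of_real (r^3) * (E (z t) / z t ^ 0)) has_integral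
      (\<Sum>k=1..d. c k * (2 * pi * ((deriv ^^ (k + \<kappa>)) E 0 / fact (k + \<kappa>)))) + of_nat \<kappa> / of_real (r^3) * (2 * pi * ((deriv ^^ 0) E 0 / fact 0))) {0..2 * pi}"
    by (intro has_integral_add has_integral_sum has_integral_mult_right m) auto
  \<comment> \<open>The conjugate of the pole term contributes the mean of E itself, which is E
    0.\<close>
  have z0: "of_nat \<kappa> / of_real (r^3) * (2 * pi * ((deriv ^^ 0) E 0 / fact 0)) = 0" using E_0 k1 by (cases "\<kappa> = 0") auto
  have ck: "c k * (2 * pi * ((deriv ^^ (k + \<kappa>)) E 0 / fact (k + \<kappa>))) = of_real (2 * real k * r ^ (2 * k - 1)) * (pi * cnj (a k) * e k)" if "k \<in> {1..d}" for k
  proof -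
    have "r ^ (2 * k) = r * r ^ (2 * k - 1)" using that by (simp flip: power_Suc)
    then have "c k = of_nat k * cnj (a k) * of_real (r ^ (2 * k - 1))" using r by (simp add: c_def)
    then show ?thesis by (simp add: e_def mult_ac)
  qed
  have "(\<Sum>k=1..d. c k * (2 * pi * ((deriv ^^ (k + \<kappa>)) E 0 / fact (k + \<kappa>)))) =
      (\<Sum>k=1..d. of_real (2 * real k * r ^ (2 * k - 1)) * (pi * cnj (a k) * e k))" by (rule sum.cong[OF refl ck])
  then show ?thesis unfolding z_def[symmetric] integrand using I unfolding z0 by simp
qed

lemma ring_integral:
  assumes r: "0 < r1" "r1 < r2" "r2 < 1"
  shows "(f has_integral (\<Sum>k=1..d. pi * cnj (a k) * e k * of_real (r2 ^ (2 * k) - r1 ^ (2 * k)))) (g ` {z. r1 < norm z \<and> norm z < r2})"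
proof -
  have "(f has_integral integral {r1..r2} (\<lambda>r. integral {0..2 * pi} (\<lambda>t. of_real (r * (norm (W (of_real r * cis t) / (of_real r * cis t)))^2) * f (g (of_real r * cis t)))))
     (g ` {z. r1 < norm z \<and> norm z < r2})"
  proof (rule polar_change_of_variables[OF r(1,2)])
    show "(g has_field_derivative W z / z) (at z)" if "r1 \<le> norm z" for z by (rule g_deriv) (use that r in auto)
    show "continuous_on {z. r1 \<le> cmod z \<and> cmod z \<le> r2} (\<lambda>z. W z / z)"
      unfolding W_def using r by (intro continuous_intros) auto
    show "inj_on g {z. r1 < cmod z \<and> cmod z < r2}" by (rule inj_on_subset[OF inj]) (use r in auto)
    show "continuous_on (g ` {z. r1 \<le> cmod z \<and> cmod z \<le> r2}) f"
      by (rule continuous_on_subset[OF f_cont], rule image_mono) (use r in auto)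
  qed
  moreover have "integral {r1..r2} (\<lambda>r. integral {0..2 * pi} (\<lambda>t. of_real (r * (norm (W (of_real r * cis t) / (of_real r * cis t)))^2) * f (g (of_real r * cis t))))
     = integral {r1..r2} (\<lambda>r. \<Sum>k=1..d. of_real (2 * real k * r ^ (2 * k - 1)) * (pi * cnj (a k) * e k))"
    by (rule integral_cong, rule integral_unique, rule circle_integral) (use r in auto)
  moreover have "((\<lambda>r. \<Sum>k=1..d. of_real (2 * real k * r ^ (2 * k - 1)) * (pi * cnj (a k) * e k)) has_integral
     (\<Sum>k=1..d. of_real (r2 ^ (2 * k) - r1 ^ (2 * k)) * (pi * cnj (a k) * e k))) {r1..r2}"
  proof (intro has_integral_sum has_integral_mult_left)
    fix k
    have "((\<lambda>r. 2 * real k * r ^ (2 * k - 1)) has_integral r2 ^ (2 * k) - r1 ^ (2 * k)) {r1..r2}"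
    proof (rule fundamental_theorem_of_calculus)
      fix x
      have "((\<lambda>r. r ^ (2 * k)) has_real_derivative real (2 * k) * x ^ (2 * k - 1)) (at x)" by (auto intro!: derivative_eq_intros)
      then show "((\<lambda>r. r ^ (2 * k)) has_vector_derivative 2 * real k * x ^ (2 * k - 1)) (at x within {r1..r2})"
        by (simp add: has_real_derivative_iff_has_vector_derivative has_vector_derivative_at_within)
    qed (use r in auto)
    from has_integral_linear[OF this bounded_linear_of_real[where 'a=complex]]
    show "((\<lambda>r. complex_of_real (2 * real k * r ^ (2 * k - 1))) has_integral of_real (r2 ^ (2 * k) - r1 ^ (2 * k))) {r1..r2}"
      by (simp only: o_def)
  qed auto
  ultimately show ?thesis by (simp add: integral_unique mult_ac)
qed

lemma g_cont: "continuous_on (- {0}) g"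
  using g_deriv by (intro continuous_at_imp_continuous_on) (auto dest: DERIV_isCont)

text \<open>Exhaustion by smaller rings and dominated convergence. This reaches \<rho> = 0, where
  polar coordinates degenerate, and the outer radius 1, where E need not be holomorphic.\<close>

lemma outer_ring_integral:
  assumes \<rho>: "0 \<le> \<rho>" "\<rho> < 1" and bdd: "bounded (g ` {z. \<rho> < norm z \<and> norm z < 1})"
    and B: "\<And>z. \<rho> < norm z \<Longrightarrow> norm z < 1 \<Longrightarrow> norm (f (g z)) \<le> B"
  shows "(f has_integral (\<Sum>k=1..d. pi * cnj (a k) * e k * of_real (1 - \<rho> ^ (2 * k)))) (g ` {z. \<rho> < norm z \<and> norm z < 1})"
proof -
  define S where "S = g ` {z. \<rho> < norm z \<and> norm z < 1}"
  \<comment> \<open>The denominators start at 3, so the smaller rings are never empty.\<close>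
  define \<eta> where "\<eta> n = (1 - \<rho>) / real (Suc (n + 2))" for n
  have \<eta>: "0 < \<eta> n" "\<eta> n \<le> (1 - \<rho>) / 3" for n
    unfolding \<eta>_def using \<rho> by (simp, intro divide_left_mono) auto
  have \<eta>lim: "\<eta> \<longlonglongrightarrow> 0"
  proof -
    have "(\<lambda>n. (1 - \<rho>) * inverse (real (Suc (n + 2)))) \<longlonglongrightarrow> (1 - \<rho>) * 0"
      by (intro tendsto_intros LIMSEQ_ignore_initial_segment[OF LIMSEQ_inverse_real_of_nat, of 2])
    then show ?thesis unfolding \<eta>_def[abs_def] divide_inverse by simp
  qed
  define R where "R n = {z::complex. \<rho> + \<eta> n < norm z \<and> norm z < 1 - \<eta> n}" for n
  define I where "I n = (\<Sum>k=1..d. pi * cnj (a k) * e k * of_real ((1 - \<eta> n) ^ (2 * k) - (\<rho> + \<eta> n) ^ (2 * k)))" for n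
  have In: "(f has_integral I n) (g ` R n)" for n
    unfolding I_def R_def using \<eta>[of n] \<rho> by (intro ring_integral) auto
  have sub: "g ` R n \<subseteq> S" for n unfolding S_def R_def using \<eta>[of n] by (intro image_mono) auto
  define fn where "fn n w = (if w \<in> g ` R n then f w else 0)" for n w
  have fnI: "(fn n has_integral I n) S" for n
    unfolding fn_def using In sub by (simp add: has_integral_restrict)
  have openS: "open S"
  proof -
    have "open {z::complex. \<rho> < norm z \<and> norm z < 1}"
      by (intro open_Collect_conj open_Collect_less continuous_intros)
    moreover have "g holomorphic_on {z. \<rho> < norm z \<and> norm z < 1}"
    proof -
      have "g field_differentiable (at z)" if "z \<in> {z. \<rho> < norm z \<and> norm z < 1}" for z
        using g_deriv[of z] that \<rho> field_differentiable_def by (metis (no_types, lifting) mem_Collect_eq norm_zero not_le)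
      then show ?thesis by (auto simp: holomorphic_on_def intro: field_differentiable_at_within)
    qed
    moreover have "inj_on g {z. \<rho> < norm z \<and> norm z < 1}" by (rule inj_on_subset[OF inj]) (use \<rho> in auto)
    ultimately show ?thesis unfolding S_def by (intro open_mapping_thm3)
  qed
  have lm: "S \<in> lmeasurable" using bdd openS unfolding S_def[symmetric] by (intro lmeasurable_open)
  have B0: "B \<ge> 0"
  proof -
    have "norm (f (g (of_real ((1 + \<rho>) / 2)))) \<le> B" by (rule B) (use \<rho> in \<open>auto simp: norm_divide simp flip: of_real_add\<close>)
    then show ?thesis using norm_ge_zero order_trans by blast
  qed
  have conv: "(\<lambda>n. fn n w) \<longlonglongrightarrow> f w" if w: "w \<in> S" for w
  proof -
    obtain z where z: "\<rho> < norm z" "norm z < 1" "w = g z" using w by (auto simp: S_def)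
    have "\<forall>\<^sub>F n in sequentially. \<eta> n < min (norm z - \<rho>) (1 - norm z)"
      using \<eta>lim z by (intro order_tendstoD(2)[of _ 0]) auto
    then have "\<forall>\<^sub>F n in sequentially. fn n w = f w"
      by (rule eventually_mono) (use z in \<open>auto simp: fn_def R_def\<close>)
    then show ?thesis by (rule tendsto_eventually)
  qed
  have dc: "f integrable_on S" "(\<lambda>n. integral S (fn n)) \<longlonglongrightarrow> integral S f"
  proof -
    have 1: "fn n integrable_on S" for n using fnI by blast
    have 2: "(\<lambda>_. B) integrable_on S" using lm by (simp add: integrable_on_const)
    have 3: "norm (fn n w) \<le> B" if "w \<in> S" for n w using that B B0 by (auto simp: S_def fn_def)
    show "f integrable_on S" "(\<lambda>n. integral S (fn n)) \<longlonglongrightarrow> integral S f"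
      using dominated_convergence[of fn S "\<lambda>_. B" f, OF 1 2 3 conv] by auto
  qed
  have "(\<lambda>n. I n) \<longlonglongrightarrow> (\<Sum>k=1..d. pi * cnj (a k) * e k * of_real ((1 - 0) ^ (2 * k) - (\<rho> + 0) ^ (2 * k)))"
    unfolding I_def by (intro tendsto_intros \<eta>lim)
  moreover have "integral S (fn n) = I n" for n using fnI by (rule integral_unique)
  ultimately have "integral S f = (\<Sum>k=1..d. pi * cnj (a k) * e k * of_real (1 - \<rho> ^ (2 * k)))"
    using dc(2) LIMSEQ_unique by fastforce
  then show ?thesis using dc(1) unfolding S_def[symmetric] by (metis integrable_integral)
qed

end

section \<open>Power series of the moments\<close>

lemma fps_mult_compose_nth:
  fixes A F V :: "'a::comm_ring_1 fps"
  assumes V: "fps_nth V 0 = 0" and n: "n \<le> M"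
  shows "fps_nth (A * fps_compose F V) n = (\<Sum>i\<le>M. fps_nth F i * fps_nth (A * V ^ i) n)"
proof -
  have c: "fps_nth (fps_compose F V) m = (\<Sum>i\<le>M. fps_nth F i * fps_nth (V ^ i) m)" if "m \<le> n" for m
  proof -
    have "(\<Sum>i=0..m. fps_nth F i * fps_nth (V ^ i) m) = (\<Sum>i\<le>M. fps_nth F i * fps_nth (V ^ i) m)"
      using that n startsby_zero_power_prefix[OF V] by (intro sum.mono_neutral_left) auto
    then show ?thesis by (simp add: fps_compose_def)
  qed
  have "fps_nth (A * fps_compose F V) n = (\<Sum>j=0..n. \<Sum>i\<le>M. fps_nth A j * (fps_nth F i * fps_nth (V ^ i) (n - j)))"
    unfolding fps_mult_nth by (rule sum.cong[OF refl]) (simp add: c sum_distrib_left)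
  also have "\<dots> = (\<Sum>i\<le>M. \<Sum>j=0..n. fps_nth A j * (fps_nth F i * fps_nth (V ^ i) (n - j)))" by (rule sum.swap)
  also have "\<dots> = (\<Sum>i\<le>M. fps_nth F i * fps_nth (A * V ^ i) n)"
    unfolding fps_mult_nth by (simp add: sum_distrib_left mult_ac)
  finally show ?thesis .
qed

text \<open>The power series of z^(2 \<kappa>) g'(z).\<close>

definition weight_series :: "nat \<Rightarrow> nat \<Rightarrow> (nat \<Rightarrow> complex) \<Rightarrow> complex fps" where
  "weight_series \<kappa> d a = (\<Sum>k=1..d. fps_const (of_nat k * a k) * fps_X ^ (k + 2 * \<kappa> - 1)) + fps_const (of_nat \<kappa>)"

text \<open>Times z this is the local coordinate at the node as a function of z: g itself in the
  bounded case, where the node is 0, and 1 / g in the unbounded case, where it is infinity.\<close>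

definition coordinate_series :: "nat \<Rightarrow> nat \<Rightarrow> (nat \<Rightarrow> complex) \<Rightarrow> complex fps" where
  "coordinate_series \<kappa> d a = (if \<kappa> = 0 then \<Sum>k=1..d. fps_const (a k) * fps_X ^ (k - 1)
     else inverse ((\<Sum>k=1..d. fps_const (a k) * fps_X ^ (k + 1)) - 1))"

text \<open>Up to the factor pi, the weight with which the i-th Taylor coefficient of f at the node
  enters the area integral. Up to sign these numbers become the coefficients of the quadrature
  function.\<close>

definition quadrature_coeff :: "nat \<Rightarrow> nat \<Rightarrow> (nat \<Rightarrow> complex) \<Rightarrow> nat \<Rightarrow> complex" where
  "quadrature_coeff \<kappa> d a i = (\<Sum>k=1..d. cnj (a k) *
     fps_nth (fps_X ^ (1 - \<kappa>) * weight_series \<kappa> d a * (fps_X * coordinate_series \<kappa> d a) ^ i) (k + \<kappa>))"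

lemma series_nth_0:
  assumes "\<kappa> \<le> 1" "d \<ge> 1"
  shows "fps_nth (weight_series \<kappa> d a) 0 = (if \<kappa> = 0 then a 1 else 1)"
    and "fps_nth (coordinate_series \<kappa> d a) 0 = (if \<kappa> = 0 then a 1 else - 1)"
proof -
  have "(\<Sum>k=1..d. of_nat k * a k * (if k - 1 = 0 then 1 else 0)) = (\<Sum>k=1..d. if k = 1 then a 1 else 0)"
    by (rule sum.cong) auto
  moreover have "(\<Sum>k=1..d. a k * (if k - 1 = 0 then 1 else 0)) = (\<Sum>k=1..d. if k = 1 then a 1 else 0)"
    by (rule sum.cong) auto
  moreover have "\<kappa> = 0 \<or> \<kappa> = 1" using assms by auto
  ultimately show "fps_nth (weight_series \<kappa> d a) 0 = (if \<kappa> = 0 then a 1 else 1)"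
    and "fps_nth (coordinate_series \<kappa> d a) 0 = (if \<kappa> = 0 then a 1 else - 1)"
    using assms(2)
    by (auto simp: weight_series_def coordinate_series_def fps_sum_nth fps_X_power_nth if_distrib cong: if_cong)
qed

lemma quadrature_coeff_shift:
  "quadrature_coeff \<kappa> d a i = (\<Sum>k=1..d. cnj (a k) * (if k + \<kappa> < 1 - \<kappa> + i then 0
     else fps_nth (weight_series \<kappa> d a * coordinate_series \<kappa> d a ^ i) (k + \<kappa> - (1 - \<kappa> + i))))"
proof -
  have "fps_X ^ (1 - \<kappa>) * weight_series \<kappa> d a * (fps_X * coordinate_series \<kappa> d a) ^ i =
     fps_X ^ (1 - \<kappa> + i) * (weight_series \<kappa> d a * coordinate_series \<kappa> d a ^ i)"
    by (simp add: power_mult_distrib power_add mult_ac)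
  then show ?thesis by (simp only: quadrature_coeff_def fps_X_power_mult_nth)
qed

text \<open>At this index only the summand k = d reaches the required degree. In the application it
  does not vanish, and so the quadrature function has order exactly d.\<close>

lemma quadrature_coeff_lead:
  assumes "\<kappa> \<le> 1" "d \<ge> 1"
  shows "quadrature_coeff \<kappa> d a (d + 2 * \<kappa> - 1) = cnj (a d) * (if \<kappa> = 0 then a 1 ^ d else (- 1) ^ (d + 1))"
proof -
  have e: "1 - \<kappa> + (d + 2 * \<kappa> - 1) = d + \<kappa>" using assms by auto
  have "quadrature_coeff \<kappa> d a (d + 2 * \<kappa> - 1) = (\<Sum>k=1..d. if k = d then cnj (a d) *
     fps_nth (weight_series \<kappa> d a * coordinate_series \<kappa> d a ^ (d + 2 * \<kappa> - 1)) 0 else 0)"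
    unfolding quadrature_coeff_shift e by (rule sum.cong) auto
  also have "\<dots> = cnj (a d) * (fps_nth (weight_series \<kappa> d a) 0 * fps_nth (coordinate_series \<kappa> d a) 0 ^ (d + 2 * \<kappa> - 1))"
    using assms by (simp add: fps_power_zeroth)
  also have "fps_nth (weight_series \<kappa> d a) 0 * fps_nth (coordinate_series \<kappa> d a) 0 ^ (d + 2 * \<kappa> - 1) =
      (if \<kappa> = 0 then a 1 ^ d else (- 1) ^ (d + 1))"
    unfolding series_nth_0[OF assms] using assms by (cases d) (auto simp: le_Suc_eq)
  finally show ?thesis .
qed

text \<open>The weights stop at the index d - 1, as the denominator z^d of the bounded case
  requires.\<close>

lemma quadrature_coeff_degree: "quadrature_coeff 0 d a d = 0"
  unfolding quadrature_coeff_shift by (rule sum.neutral) auto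

lemma sum_moments:
  assumes "E has_fps_expansion fps_X ^ (1 - \<kappa>) * weight_series \<kappa> d a * fps_compose F (fps_X * coordinate_series \<kappa> d a)"
  shows "(\<Sum>k=1..d. cnj (a k) * ((deriv ^^ (k + \<kappa>)) E 0 / fact (k + \<kappa>))) = (\<Sum>i\<le>d + \<kappa>. fps_nth F i * quadrature_coeff \<kappa> d a i)"
proof -
  define V where "V = fps_X * coordinate_series \<kappa> d a"
  define A where "A = fps_X ^ (1 - \<kappa>) * weight_series \<kappa> d a"
  have "(\<Sum>k=1..d. cnj (a k) * ((deriv ^^ (k + \<kappa>)) E 0 / fact (k + \<kappa>))) = (\<Sum>k=1..d. cnj (a k) * fps_nth (A * fps_compose F V) (k + \<kappa>))"
    unfolding fps_nth_fps_expansion[OF assms[folded V_def A_def]] ..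
  also have "\<dots> = (\<Sum>k=1..d. \<Sum>i\<le>d + \<kappa>. cnj (a k) * (fps_nth F i * fps_nth (A * V ^ i) (k + \<kappa>)))"
    unfolding sum_distrib_left[symmetric]
    by (intro sum.cong refl arg_cong2[where f = "(*)"] fps_mult_compose_nth) (auto simp: V_def)
  also have "\<dots> = (\<Sum>i\<le>d + \<kappa>. \<Sum>k=1..d. cnj (a k) * (fps_nth F i * fps_nth (A * V ^ i) (k + \<kappa>)))" by (rule sum.swap)
  also have "\<dots> = (\<Sum>i\<le>d + \<kappa>. fps_nth F i * quadrature_coeff \<kappa> d a i)"
    by (simp add: quadrature_coeff_def V_def A_def sum_distrib_left mult_ac)
  finally show ?thesis .
qed

lemma weight_expansion:
  assumes "\<kappa> \<le> 1"
  shows "(\<lambda>z. (\<Sum>k=1..d. of_nat k * a k * z ^ (k + \<kappa>)) + of_nat \<kappa>) has_fps_expansion fps_X ^ (1 - \<kappa>) * weight_series \<kappa> d a"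
proof -
  have "(\<lambda>z. (\<Sum>k=1..d. of_nat k * a k * z ^ (k + \<kappa>)) + of_nat \<kappa>) has_fps_expansion
      (\<Sum>k=1..d. fps_const (of_nat k * a k) * fps_X ^ (k + \<kappa>)) + fps_const (of_nat \<kappa>)"
    by (intro fps_expansion_intros)
  also have "(\<Sum>k=1..d. fps_const (of_nat k * a k) * fps_X ^ (k + \<kappa>)) + fps_const (of_nat \<kappa>) = fps_X ^ (1 - \<kappa>) * weight_series \<kappa> d a"
  proof (cases "\<kappa> = 0")
    case True
    have "fps_const (of_nat k * a k) * fps_X ^ k = fps_X * (fps_const (of_nat k * a k) * fps_X ^ (k - 1))" if "k \<in> {1..d}" for k
      using that by (cases k) auto
    then have "(\<Sum>k=1..d. fps_const (of_nat k * a k) * fps_X ^ k) = (\<Sum>k=1..d. fps_X * (fps_const (of_nat k * a k) * fps_X ^ (k - 1)))"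
      by (rule sum.cong[OF refl])
    then show ?thesis unfolding weight_series_def True by (simp add: sum_distrib_left)
  next
    case False
    then have "\<kappa> = 1" using assms by simp
    then show ?thesis by (simp add: weight_series_def)
  qed
  finally show ?thesis .
qed

lemma coordinate_expansion_bounded: "(\<lambda>z. \<Sum>k=1..d. a k * z ^ k) has_fps_expansion fps_X * coordinate_series 0 d a"
proof -
  have "(\<lambda>z. \<Sum>k=1..d. a k * z ^ k) has_fps_expansion (\<Sum>k=1..d. fps_const (a k) * fps_X ^ k)"
    by (intro fps_expansion_intros)
  also have "(\<Sum>k=1..d. fps_const (a k) * fps_X ^ k) = fps_X * coordinate_series 0 d a"
    unfolding coordinate_series_def by (simp add: sum_distrib_left) (rule sum.cong, simp, metis Suc_pred' atLeastAtMost_iff mult.left_commute power_Suc One_nat_def Suc_le_eq)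
  finally show ?thesis .
qed

lemma coordinate_expansion_unbounded:
  "(\<lambda>z. z * inverse ((\<Sum>k=1..d. a k * z ^ (k + 1)) - 1)) has_fps_expansion fps_X * coordinate_series 1 d a"
proof -
  have "fps_nth ((\<Sum>k=1..d. fps_const (a k) * fps_X ^ (k + 1)) - 1) 0 \<noteq> 0"
    by (simp add: fps_sum_nth)
  moreover have "coordinate_series 1 d a = inverse ((\<Sum>k=1..d. fps_const (a k) * fps_X ^ (k + 1)) - 1)"
    unfolding coordinate_series_def by (rule if_not_P) simp
  ultimately show ?thesis by (simp only:) (intro fps_expansion_intros)
qed

text \<open>The bound B secures integrability; the estimate itself uses the bound b on the set A
  that contains the difference of S and T.\<close>

lemma integral_symdiff_bound:
  fixes f :: "'a::euclidean_space \<Rightarrow> 'b::euclidean_space"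
  assumes lm: "S \<in> lmeasurable" "T \<in> lmeasurable" "A \<in> lmeasurable" and cont: "continuous_on (S \<union> T) f"
    and B: "\<And>x. x \<in> S \<union> T \<Longrightarrow> norm (f x) \<le> B" and sub: "(S - T) \<union> (T - S) \<subseteq> A"
    and b: "\<And>x. x \<in> A \<Longrightarrow> x \<in> S \<union> T \<Longrightarrow> norm (f x) \<le> b" "b \<ge> 0"
  shows "norm (integral T f - integral S f) \<le> 2 * b * measure lebesgue A"
proof -
  have int: "f integrable_on X" if X: "X \<in> lmeasurable" "X \<subseteq> S \<union> T" for X
  proof (rule measurable_bounded_by_integrable_imp_integrable[where g = "\<lambda>_. B"])
    show "f \<in> borel_measurable (lebesgue_on X)"
      using continuous_on_subset[OF cont X(2)] X(1) by (intro continuous_imp_measurable_on_sets_lebesgue) auto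
    show "(\<lambda>_. B) integrable_on X" using X(1) by (rule integrable_on_const)
  qed (use X B in auto)
  have bd: "norm (integral X f) \<le> b * measure lebesgue A" if X: "X \<in> lmeasurable" "X \<subseteq> S \<union> T" "X \<subseteq> A" for X
  proof -
    have "norm (integral X f) \<le> integral X (\<lambda>_. b)"
      by (rule integral_norm_bound_integral[OF int[OF X(1,2)] integrable_on_const[OF X(1)]]) (use X b in auto)
    also have "\<dots> = b * measure lebesgue X"
      using integral_mult_right[of X b "\<lambda>_. 1::real"] lmeasure_integral[OF X(1)] by simp
    also have "\<dots> \<le> b * measure lebesgue A"
      using X lm(3) b(2) by (intro mult_left_mono measure_mono_fmeasurable) auto
    finally show ?thesis .
  qed
  have split: "integral X f = integral (X \<inter> Y) f + integral (X - Y) f"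
    if "X \<in> lmeasurable" "Y \<in> lmeasurable" "X \<subseteq> S \<union> T" for X Y
  proof -
    have X: "X \<inter> Y \<inter> (X - Y) = {}" by blast
    have "X \<inter> Y \<in> lmeasurable" "X - Y \<in> lmeasurable" using that by (auto intro: fmeasurable.Int fmeasurable.Diff)
    then have "integral ((X \<inter> Y) \<union> (X - Y)) f = integral (X \<inter> Y) f + integral (X - Y) f"
      using that by (intro integral_Un int) (auto simp: X)
    moreover have "(X \<inter> Y) \<union> (X - Y) = X" by blast
    ultimately show ?thesis by simp
  qed
  have "integral T f - integral S f = integral (T - S) f - integral (S - T) f"
    using split[of T S] split[of S T] lm by (simp add: Int_commute)
  moreover have "norm (integral (T - S) f) \<le> b * measure lebesgue A" "norm (integral (S - T) f) \<le> b * measure lebesgue A"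
    using sub lm by (auto intro!: bd fmeasurable.Diff)
  ultimately show ?thesis using norm_triangle_ineq4[of "integral (T - S) f" "integral (S - T) f"] by simp
qed

section \<open>Area integrals of test functions in the two cases\<close>

lemma bounded_quadrature:
  fixes a :: "nat \<Rightarrow> complex" and d :: nat
  defines "p \<equiv> (\<lambda>z. \<Sum>k=1..d. a k * z ^ k)"
  assumes inj: "inj_on p (ball 0 1)" and \<Omega>: "\<Omega> = p ` ball 0 1" and f: "f holomorphic_on \<Omega>" "continuous_on (closure \<Omega>) f"
  shows "(f has_integral pi * (\<Sum>i<d. fps_nth (fps_expansion f 0) i * quadrature_coeff 0 d a i)) \<Omega>"
proof -
  define E where "E z = ((\<Sum>k=1..d. of_nat k * a k * z ^ (k + 0)) + of_nat 0) * f (p z)" for z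
  interpret M: laurent_map 0 d a f E by unfold_locales simp
  have Mg: "M.g = p" by (simp add: fun_eq_iff M.g_def M.p_def p_def)
  have p_hol: "p holomorphic_on X" for X unfolding p_def by (intro holomorphic_intros)
  have open\<Omega>: "open \<Omega>" unfolding \<Omega> by (rule open_mapping_thm3[OF p_hol]) (use inj in auto)
  have z0: "0 \<in> \<Omega>" unfolding \<Omega> by (rule image_eqI[of _ _ 0]) (auto simp: p_def intro!: sum.neutral[symmetric])
  have cl: "p ` cball 0 1 \<subseteq> closure \<Omega>"
  proof -
    have "p ` closure (ball 0 1) \<subseteq> closure (p ` ball 0 1)"
      by (rule image_closure_subset[OF holomorphic_on_imp_continuous_on[OF p_hol] closed_closure closure_subset])
    then show ?thesis by (simp add: \<Omega>)
  qed
  have fp: "(\<lambda>z. f (p z)) holomorphic_on ball 0 1"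
    using holomorphic_on_compose_gen[OF p_hol f(1), of "ball 0 1"] by (simp add: \<Omega> o_def)
  interpret L: laurent_quadrature 0 d a f E
  proof unfold_locales
    show "inj_on M.g (ball 0 1 - {0})" unfolding Mg using inj by (rule inj_on_subset) auto
    show "continuous_on (M.g ` (cball 0 1 - {0})) f" unfolding Mg by (rule continuous_on_subset[OF f(2)]) (use cl in auto)
    show "E holomorphic_on ball 0 1" unfolding E_def by (intro holomorphic_intros fp)
    show "E z = z ^ 0 * M.W z * f (M.g z)" for z unfolding Mg by (simp add: E_def M.W_def)
  qed simp
  have "compact (p ` cball 0 1)" using holomorphic_on_imp_continuous_on[OF p_hol] by (intro compact_continuous_image) auto
  then have "bounded (p ` cball 0 1)" "bounded (f ` (p ` cball 0 1))"
    using compact_continuous_image[OF continuous_on_subset[OF f(2) cl]] by (auto intro: compact_imp_bounded)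
  then obtain B where B: "\<And>z. norm z \<le> 1 \<Longrightarrow> norm (f (p z)) \<le> B" and bdd0: "bounded (p ` cball 0 1)"
    unfolding bounded_iff[of "f ` (p ` cball 0 1)"] by fastforce
  have bdd: "bounded (p ` {z. 0 < norm z \<and> norm z < 1})" by (rule bounded_subset[OF bdd0]) auto
  have "(f has_integral (\<Sum>k=1..d. pi * cnj (a k) * M.e k * of_real (1 - 0 ^ (2 * k)))) (M.g ` {z. 0 < norm z \<and> norm z < 1})"
    by (rule L.outer_ring_integral[where B = B]) (use B bdd Mg in auto)
  moreover have "(\<Sum>k=1..d. pi * cnj (a k) * M.e k * of_real (1 - 0 ^ (2 * k))) = pi * (\<Sum>i<d. fps_nth (fps_expansion f 0) i * quadrature_coeff 0 d a i)"
  proof -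
    have "(\<Sum>k=1..d. pi * cnj (a k) * M.e k * of_real (1 - 0 ^ (2 * k))) = pi * (\<Sum>k=1..d. cnj (a k) * ((deriv ^^ (k + 0)) E 0 / fact (k + 0)))"
      unfolding sum_distrib_left by (rule sum.cong) (auto simp: M.e_def)
    also have "(\<Sum>k=1..d. cnj (a k) * ((deriv ^^ (k + 0)) E 0 / fact (k + 0))) = (\<Sum>i\<le>d + 0. fps_nth (fps_expansion f 0) i * quadrature_coeff 0 d a i)"
    proof (rule sum_moments)
      have "(\<lambda>z. ((\<Sum>k=1..d. of_nat k * a k * z ^ (k + 0)) + of_nat 0) * (f \<circ> p) z) has_fps_expansion
          fps_X ^ (1 - 0) * weight_series 0 d a * fps_compose (fps_expansion f 0) (fps_X * coordinate_series 0 d a)"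
        unfolding p_def
        by (intro has_fps_expansion_mult weight_expansion has_fps_expansion_compose has_fps_expansion_fps_expansion[OF open\<Omega> z0 f(1)] coordinate_expansion_bounded) auto
      then show "E has_fps_expansion fps_X ^ (1 - 0) * weight_series 0 d a * fps_compose (fps_expansion f 0) (fps_X * coordinate_series 0 d a)"
        unfolding E_def[abs_def] o_def .
    qed
    also have "\<dots> = (\<Sum>i<d. fps_nth (fps_expansion f 0) i * quadrature_coeff 0 d a i)"
      by (simp add: lessThan_Suc_atMost[symmetric] quadrature_coeff_degree del: One_nat_def)
    finally show ?thesis .
  qed
  ultimately have I: "(f has_integral pi * (\<Sum>i<d. fps_nth (fps_expansion f 0) i * quadrature_coeff 0 d a i)) (p ` {z. 0 < norm z \<and> norm z < 1})"
    unfolding Mg by simp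
  \<comment> \<open>The centre was left out for polar coordinates; its image is negligible.\<close>
  have "ball 0 1 = insert (0::complex) {z. 0 < norm z \<and> norm z < 1}" by auto
  then have \<Omega>i: "\<Omega> = insert (p 0) (p ` {z. 0 < norm z \<and> norm z < 1})" unfolding \<Omega> by simp
  have "negligible {p 0}" by simp
  show ?thesis
    by (rule iffD1[OF has_integral_spike_set_eq I]; rule negligible_subset[OF \<open>negligible {p 0}\<close>]) (auto simp: \<Omega>i)
qed

text \<open>The test function in the coordinate u = 1 / w at infinity. The function h represents it
  near u = 0 only, so holomorphy is glued from h there and from f elsewhere.\<close>

lemma inverted_test_function:
  fixes f :: "complex \<Rightarrow> complex" and \<Omega> :: "complex set"
  defines "\<phi> \<equiv> (\<lambda>u. if u = 0 then 0 else f (inverse u))" and "Y \<equiv> insert 0 {u. u \<noteq> 0 \<and> inverse u \<in> \<Omega>}"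
  assumes \<Omega>: "open \<Omega>" and R: "R > 0" "- \<Omega> \<subseteq> ball 0 R" and f: "f holomorphic_on \<Omega>"
    and e: "e > 0" "h holomorphic_on ball 0 e" "h 0 = 0" "\<And>w. w \<in> ball 0 e - {0} \<Longrightarrow> inverse w \<in> \<Omega> \<Longrightarrow> h w = f (inverse w)"
  shows "cball 0 (1 / R) \<subseteq> Y" and "open Y" and "\<phi> holomorphic_on Y"
proof -
  show sub: "cball 0 (1 / R) \<subseteq> Y"
  proof
    fix u :: complex assume u: "u \<in> cball 0 (1 / R)"
    show "u \<in> Y"
    proof (cases "u = 0")
      case False
      then have "norm (inverse u) \<ge> R" unfolding norm_inverse using u R(1) by (simp add: field_simps)
      then have "inverse u \<notin> - \<Omega>" using R(2) by (meson leD mem_ball_0 subsetD)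
      then show ?thesis using False by (simp add: Y_def)
    qed (simp add: Y_def)
  qed
  define \<delta> where "\<delta> = min e (1 / R)"
  have \<delta>: "\<delta> > 0" "ball 0 \<delta> \<subseteq> ball 0 e" "ball 0 \<delta> \<subseteq> cball 0 (1 / R)" using e R by (auto simp: \<delta>_def)
  have o: "open {u. u \<noteq> 0 \<and> inverse u \<in> \<Omega>}"
  proof -
    have "open ((- {0}) \<inter> inverse -` \<Omega>)" by (rule continuous_open_preimage) (use \<Omega> in \<open>auto intro!: continuous_intros\<close>)
    moreover have "(- {0}) \<inter> inverse -` \<Omega> = {u. u \<noteq> 0 \<and> inverse u \<in> \<Omega>}" by auto
    ultimately show ?thesis by simp
  qed
  have Y: "Y = {u. u \<noteq> 0 \<and> inverse u \<in> \<Omega>} \<union> ball 0 \<delta>" using \<delta> sub by (auto simp: Y_def)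
  show "open Y" unfolding Y by (intro open_Un open_ball o)
  have "(f \<circ> inverse) holomorphic_on {u. u \<noteq> 0 \<and> inverse u \<in> \<Omega>}"
    by (rule holomorphic_on_compose_gen[OF _ f]) (auto intro!: holomorphic_intros)
  then have 1: "\<phi> holomorphic_on {u. u \<noteq> 0 \<and> inverse u \<in> \<Omega>}" by (rule holomorphic_transform) (auto simp: \<phi>_def)
  have 2: "\<phi> holomorphic_on ball 0 \<delta>"
  proof (rule holomorphic_transform[OF holomorphic_on_subset[OF e(2) \<delta>(2)]])
    fix u :: complex assume u: "u \<in> ball 0 \<delta>"
    show "h u = \<phi> u"
    proof (cases "u = 0")
      case False
      have "u \<in> Y" using u \<delta>(3) sub by blast
      then have "inverse u \<in> \<Omega>" using False by (simp add: Y_def)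
      moreover have "u \<in> ball 0 e - {0}" using u \<delta>(2) False by blast
      ultimately show ?thesis using e(4)[of u] False by (simp add: \<phi>_def)
    qed (simp add: \<phi>_def e(3))
  qed
  show "\<phi> holomorphic_on Y" unfolding Y using 1 2 o by (intro holomorphic_on_Un) auto
qed

text \<open>The substitution w = 1 / u turns a power moment over a large circle into a Taylor
  coefficient at 0.\<close>

lemma circle_moment_inverted:
  assumes \<phi>: "\<phi> holomorphic_on cball 0 (1 / R)" and R: "R > 0"
  shows "((\<lambda>w. \<phi> (inverse w) * w ^ k) has_contour_integral 2 * pi * \<i> * ((deriv ^^ (k + 1)) \<phi> 0 / fact (k + 1))) (circlepath 0 R)"
proof -
  define J where "J = 2 * pi * ((deriv ^^ (k + 1)) \<phi> 0 / fact (k + 1))"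
  define F where "F t = \<phi> (of_real (1 / R) * cis t) / (of_real (1 / R) * cis t) ^ (k + 1)" for t
  have "(F has_integral J) (cbox 0 (2 * pi))"
    using circle_mean[OF \<phi>, of "k + 1"] R unfolding F_def[abs_def] J_def by simp
  \<comment> \<open>Inversion reverses the direction of the circle; the reflection t -> 2 pi - t
    undoes this.\<close>
  from has_integral_affinity[OF this, of "-1" "2 * pi"]
  have "((\<lambda>t. F (- t + 2 * pi)) has_integral J) ((\<lambda>x. 2 * pi - x) ` {0..2 * pi})" by (simp add: algebra_simps)
  moreover have "(\<lambda>x. 2 * pi - x) ` {0..2 * pi} = {0..2 * pi}" by simp
  ultimately have "((\<lambda>t. F (- t + 2 * pi)) has_integral J) {0..2 * pi}" by (simp only:)
  from has_integral_mult_right[OF this, of \<i>]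
  have "((\<lambda>t. \<i> * F (- t + 2 * pi)) has_integral \<i> * J) {0..2 * pi}" .
  moreover have "\<i> * F (- t + 2 * pi) = \<phi> (inverse (0 + of_real R * cis t)) * (0 + of_real R * cis t) ^ k * of_real R * \<i> * cis t" for t
  proof -
    define w where "w = of_real R * cis t"
    have "complex_of_real (1 / R) = inverse (of_real R)" by (simp add: inverse_eq_divide)
    moreover have "cis (- t + 2 * pi) = inverse (cis t)" by (simp add: cis_inverse) (simp add: complex_eq_iff cos_diff sin_diff)
    ultimately have "of_real (1 / R) * cis (- t + 2 * pi) = inverse w" unfolding w_def by (simp only: inverse_mult_distrib)
    then have "F (- t + 2 * pi) = \<phi> (inverse w) * w ^ (k + 1)" unfolding F_def by (simp add: power_inverse divide_inverse)
    then have "\<i> * F (- t + 2 * pi) = \<phi> (inverse w) * w ^ k * w * \<i>" by (simp add: mult_ac)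
    also have "\<dots> = \<phi> (inverse w) * w ^ k * of_real R * \<i> * cis t" by (simp add: w_def mult_ac)
    finally show ?thesis by (simp add: w_def)
  qed
  ultimately have "((\<lambda>t. \<phi> (inverse (0 + of_real R * cis t)) * (0 + of_real R * cis t) ^ k * of_real R * \<i> * cis t) has_integral \<i> * J) {0..2 * pi}"
    by (simp only:)
  then show ?thesis unfolding circlepath_def J_def
    by (subst has_contour_integral_part_circlepath_iff) (auto simp: mult_ac)
qed

lemma measure_annulus:
  assumes "0 \<le> q" "q \<le> R"
  shows "cball (0::complex) (R + q) - ball 0 (R - q) \<in> lmeasurable"
    and "measure lebesgue (cball (0::complex) (R + q) - ball 0 (R - q)) = 4 * pi * R * q"
proof -
  show "cball (0::complex) (R + q) - ball 0 (R - q) \<in> lmeasurable" by (intro fmeasurable.Diff) auto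
  have "measure lebesgue (cball (0::complex) (R + q) - ball 0 (R - q)) = measure lebesgue (cball (0::complex) (R + q)) - measure lebesgue (ball (0::complex) (R - q))"
    by (rule measurable_measure_Diff) (use assms in auto)
  also have "measure lebesgue (cball (0::complex) (R + q)) = pi * (R + q)^2"
    using content_cball[of "R + q" "0::complex"] assms by (simp add: measure_completion unit_ball_vol_2)
  also have "measure lebesgue (ball (0::complex) (R - q)) = pi * (R - q)^2"
    using content_ball[of "R - q" "0::complex"] assms by (simp add: measure_completion unit_ball_vol_2)
  finally show "measure lebesgue (cball (0::complex) (R + q) - ball 0 (R - q)) = 4 * pi * R * q"
    by (simp add: power2_eq_square algebra_simps)
qed

lemma norm_power_sum_le:
  fixes a :: "nat \<Rightarrow> complex"
  assumes "norm z \<le> 1"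
  shows "norm (\<Sum>k=1..d. a k * z ^ k) \<le> (\<Sum>k=1..d. norm (a k)) * norm z"
proof -
  have "norm (\<Sum>k=1..d. a k * z ^ k) \<le> (\<Sum>k=1..d. norm (a k) * norm z)"
  proof (rule order_trans[OF norm_sum], rule sum_mono)
    fix k assume "k \<in> {1..d}"
    then have "norm z ^ k \<le> norm z ^ 1" using assms by (intro power_decreasing) auto
    then show "norm (a k * z ^ k) \<le> norm (a k) * norm z" by (simp add: norm_mult norm_power mult_left_mono)
  qed
  then show ?thesis by (simp add: sum_distrib_right)
qed

text \<open>Rings in the disc give the integral over the image of 1 / R < norm z < 1, while the
  principal value uses the part of the domain in the disc of radius R. The two sets differ inside an
  annulus around the circle of radius R. Its width is of order 1 / R, so its area stays bounded,
  while f tends to 0 there.\<close>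

lemma unbounded_quadrature:
  fixes a :: "nat \<Rightarrow> complex" and d :: nat and f :: "complex \<Rightarrow> complex"
  defines "g \<equiv> (\<lambda>z. (\<Sum>k=1..d. a k * z ^ k) - 1 / z)" and "\<phi> \<equiv> (\<lambda>u. if u = 0 then 0 else f (inverse u))"
  assumes inj: "inj_on g (ball 0 1 - {0})" and \<Omega>: "\<Omega> = g ` (ball 0 1 - {0})" and cl: "g ` (cball 0 1 - {0}) \<subseteq> closure \<Omega>"
    and f: "f holomorphic_on \<Omega>" "continuous_on (closure \<Omega>) f" and Y: "open Y" "0 \<in> Y" "\<phi> holomorphic_on Y"
  shows "((\<lambda>R. integral (\<Omega> \<inter> ball 0 R) f) \<longlongrightarrow> pi * (\<Sum>i\<le>d + 1. fps_nth (fps_expansion \<phi> 0) i * quadrature_coeff 1 d a i)) at_top"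
proof -
  define Wp where "Wp z = (\<Sum>k=1..d. of_nat k * a k * z ^ (k + 1)) + of_nat 1" for z :: complex
  define V where "V z = z * inverse ((\<Sum>k=1..d. a k * z ^ (k + 1)) - 1)" for z
  define E where "E z = (if z = 0 then 0 else Wp z * f (g z))" for z
  interpret M: laurent_map 1 d a f E by unfold_locales simp
  have Mg: "M.g = g" unfolding fun_eq_iff M.g_def M.p_def g_def by simp
  have MW: "z * M.W z = Wp z" if "z \<noteq> 0" for z
    unfolding M.W_def Wp_def using that by (simp add: distrib_left sum_distrib_left mult_ac)
  have g_hol: "g holomorphic_on X" if "0 \<notin> X" for X
    unfolding g_def using that by (intro holomorphic_intros) auto
  have g_cont: "continuous_on X g" if "0 \<notin> X" for X by (rule holomorphic_on_imp_continuous_on[OF g_hol[OF that]])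
  have open\<Omega>: "open \<Omega>" unfolding \<Omega> by (rule open_mapping_thm3[OF g_hol]) (use inj in \<open>auto simp: open_delete\<close>)
  have expE: "E has_fps_expansion fps_X ^ (1 - 1) * weight_series 1 d a * fps_compose (fps_expansion \<phi> 0) (fps_X * coordinate_series 1 d a)"
  proof -
    have 1: "(\<lambda>z. Wp z * (\<phi> \<circ> V) z) has_fps_expansion fps_X ^ (1 - 1) * weight_series 1 d a * fps_compose (fps_expansion \<phi> 0) (fps_X * coordinate_series 1 d a)"
      unfolding Wp_def V_def
      by (intro has_fps_expansion_mult weight_expansion has_fps_expansion_compose has_fps_expansion_fps_expansion[OF Y] coordinate_expansion_unbounded) auto
    have "open {z. norm (\<Sum>k=1..d. a k * z ^ (k + 1)) < 1}" by (intro open_Collect_less continuous_intros)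
    then have "\<forall>\<^sub>F z in nhds 0. z \<in> {z. norm (\<Sum>k=1..d. a k * z ^ (k + 1)) < 1}" by (rule eventually_nhds_in_open) simp
    then have "\<forall>\<^sub>F z in nhds 0. Wp z * (\<phi> \<circ> V) z = E z"
    proof (rule eventually_mono)
      fix z assume z: "z \<in> {z. norm (\<Sum>k=1..d. a k * z ^ (k + 1)) < 1}"
      define s where "s = (\<Sum>k=1..d. a k * z ^ (k + 1))"
      have s1: "s - 1 \<noteq> 0" using z by (auto simp: s_def)
      have sz: "s = z * (\<Sum>k=1..d. a k * z ^ k)" by (simp add: s_def sum_distrib_left mult_ac)
      show "Wp z * (\<phi> \<circ> V) z = E z"
      proof (cases "z = 0")
        case False
        then have "V z \<noteq> 0" "inverse (V z) = g z"
          using s1 unfolding V_def s_def[symmetric] by (auto simp: g_def sz field_simps)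
        then show ?thesis using False by (simp add: \<phi>_def E_def)
      qed (simp add: \<phi>_def E_def V_def)
    qed
    then show ?thesis using 1 unfolding has_fps_expansion_def by (auto elim: eventually_elim2)
  qed
  have E_hol: "E holomorphic_on ball 0 1"
  proof -
    obtain s where s: "open s" "0 \<in> s" "E holomorphic_on s" using has_fps_expansion_imp_holomorphic[OF expE] by metis
    have "(f \<circ> g) holomorphic_on (ball 0 1 - {0})"
      by (rule holomorphic_on_compose_gen[OF g_hol f(1)]) (auto simp: \<Omega>)
    then have "(\<lambda>z. Wp z * f (g z)) holomorphic_on (ball 0 1 - {0})" unfolding Wp_def o_def by (intro holomorphic_intros)
    then have "E holomorphic_on (ball 0 1 - {0})" by (rule holomorphic_transform) (auto simp: E_def)
    then have "E holomorphic_on (ball 0 1 - {0}) \<union> s" using s by (intro holomorphic_on_Un) (auto simp: open_delete)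
    then show ?thesis by (rule holomorphic_on_subset) (use s in auto)
  qed
  interpret L: laurent_quadrature 1 d a f E
  proof unfold_locales
    show "inj_on M.g (ball 0 1 - {0})" unfolding Mg by (rule inj)
    show "continuous_on (M.g ` (cball 0 1 - {0})) f" unfolding Mg by (rule continuous_on_subset[OF f(2) cl])
    show "E z = z ^ 1 * M.W z * f (M.g z)" if "z \<noteq> 0" for z unfolding Mg using MW[OF that] that by (simp add: E_def)
  qed (auto simp: E_hol, simp add: E_def)
  define C where "C = (\<Sum>k=1..d. norm (a k))"
  have C0: "C \<ge> 0" unfolding C_def by (intro sum_nonneg) auto
  have gC: "norm (g z) \<le> 1 / norm z + C * norm z" "norm (g z) \<ge> 1 / norm z - C * norm z" if "norm z \<le> 1" for z
  proof -
    have "norm (\<Sum>k=1..d. a k * z ^ k) \<le> C * norm z" unfolding C_def by (rule norm_power_sum_le[OF that])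
    moreover have "norm (1 / z) = 1 / norm z" by (simp add: norm_divide)
    ultimately show "norm (g z) \<le> 1 / norm z + C * norm z" "norm (g z) \<ge> 1 / norm z - C * norm z"
      unfolding g_def using norm_triangle_ineq4[of "\<Sum>k=1..d. a k * z ^ k" "1 / z"] norm_triangle_ineq3[of "\<Sum>k=1..d. a k * z ^ k" "1 / z"] by linarith+
  qed
  define S where "S R = g ` {z. 1 / R < norm z \<and> norm z < 1}" for R
  define J where "J R = (\<Sum>k=1..d. pi * cnj (a k) * M.e k * of_real (1 - (1 / R) ^ (2 * k)))" for R
  have S: "(f has_integral J R) (S R)" "bounded (S R)" "open (S R)" "S R \<subseteq> \<Omega>" if R: "R > 1" for R
  proof -
    let ?A = "{z::complex. 1 / R \<le> norm z \<and> norm z \<le> 1}"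
    have "?A = cball 0 1 - ball 0 (1 / R)" by auto
    then have "compact ?A" by (simp add: compact_diff)
    moreover have "0 \<notin> ?A" using R by auto
    ultimately have cg: "compact (g ` ?A)" using g_cont by (intro compact_continuous_image)
    have gA: "g ` ?A \<subseteq> closure \<Omega>" by (rule order_trans[OF image_mono cl]) (use R in auto)
    have "compact (f ` (g ` ?A))" by (rule compact_continuous_image[OF continuous_on_subset[OF f(2) gA] cg])
    then obtain B where "\<forall>y\<in>f ` (g ` ?A). norm y \<le> B" using compact_imp_bounded[of "f ` (g ` ?A)"] by (auto simp: bounded_iff)
    then have B: "norm (f (g z)) \<le> B" if "z \<in> ?A" for z using that by blast
    show bS: "bounded (S R)" unfolding S_def by (rule bounded_subset[OF compact_imp_bounded[OF cg]]) auto
    show "S R \<subseteq> \<Omega>" unfolding S_def \<Omega> using R by (intro image_mono) auto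
    show "open (S R)" unfolding S_def
    proof (rule open_mapping_thm3[OF g_hol])
      show "0 \<notin> {z::complex. 1 / R < norm z \<and> norm z < 1}" using R by auto
      show "open {z::complex. 1 / R < norm z \<and> norm z < 1}" by (intro open_Collect_conj open_Collect_less continuous_intros)
      show "inj_on g {z. 1 / R < norm z \<and> norm z < 1}" by (rule inj_on_subset[OF inj]) (use R in auto)
    qed
    show "(f has_integral J R) (S R)" unfolding J_def S_def
      by (rule L.outer_ring_integral[where B = B, unfolded Mg]) (use R B bS in \<open>auto simp: S_def\<close>)
  qed
  have lim: "((\<lambda>R::real. 1 / R) \<longlongrightarrow> 0) at_top"
    using tendsto_inverse_0_at_top[OF filterlim_ident] by (simp add: inverse_eq_divide)
  have "(J \<longlongrightarrow> (\<Sum>k=1..d. pi * cnj (a k) * M.e k * of_real (1 - 0 ^ (2 * k)))) at_top"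
    unfolding J_def by (intro tendsto_intros lim)
  also have "(\<Sum>k=1..d. pi * cnj (a k) * M.e k * of_real (1 - 0 ^ (2 * k))) = pi * (\<Sum>k=1..d. cnj (a k) * ((deriv ^^ (k + 1)) E 0 / fact (k + 1)))"
    unfolding sum_distrib_left M.e_def by (rule sum.cong) auto
  also have "\<dots> = pi * (\<Sum>i\<le>d + 1. fps_nth (fps_expansion \<phi> 0) i * quadrature_coeff 1 d a i)"
    by (rule arg_cong2[where f = "(*)", OF refl]) (rule sum_moments[OF expE])
  finally have Jlim: "(J \<longlongrightarrow> pi * (\<Sum>i\<le>d + 1. fps_nth (fps_expansion \<phi> 0) i * quadrature_coeff 1 d a i)) at_top" .
  have lim0: "((\<lambda>R. integral (\<Omega> \<inter> ball 0 R) f - integral (S R) f) \<longlongrightarrow> 0) at_top"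
  proof (rule tendstoI)
    fix \<epsilon> :: real assume \<epsilon>: "\<epsilon> > 0"
    \<comment> \<open>The final bound is 16 pi C \<eta>; the summand 1 covers C = 0.\<close>
    define \<eta> where "\<eta> = \<epsilon> / (16 * pi * C + 1)"
    have \<eta>: "\<eta> > 0" using \<epsilon> C0 by (auto simp: \<eta>_def intro!: divide_pos_pos add_nonneg_pos)
    have "isCont \<phi> 0" using holomorphic_on_imp_continuous_on[OF Y(3)] Y(1,2) continuous_on_eq_continuous_at by blast
    then obtain \<delta> where \<delta>: "\<delta> > 0" "\<And>u. norm u < \<delta> \<Longrightarrow> norm (\<phi> u) < \<eta>"
      unfolding continuous_at_eps_delta using \<eta> by (auto simp: \<phi>_def dist_norm)
    show "\<forall>\<^sub>F R in at_top. dist (integral (\<Omega> \<inter> ball 0 R) f - integral (S R) f) 0 < \<epsilon>"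
    proof (rule eventually_mono[OF eventually_gt_at_top[of "max 2 (max (2 * C) (2 / \<delta>))"]])
      fix R assume "R > max 2 (max (2 * C) (2 / \<delta>))"
      then have R: "R > 2" "R > 2 * C" "R > 2 / \<delta>" by auto
      \<comment> \<open>On the difference of the two sets norm z is at most 2 / R, so g z differs
        from - 1 / z by at most 2 C / R.\<close>
      define q where "q = 2 * C / R"
      have q: "0 \<le> q" "q \<le> 1" "C / R \<le> q" using R C0 by (auto simp: q_def field_simps)
      have q1: "q \<le> R" using q(2) R(1) by simp
      define A where "A = cball (0::complex) (R + q) - ball 0 (R - q)"
      define T where "T = \<Omega> \<inter> ball 0 R"
      have R1: "R > 1" using R by simp
      have mem: "w \<in> A \<longleftrightarrow> R - q \<le> norm w \<and> norm w \<le> R + q" for w unfolding A_def by auto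
      have sub1: "S R - T \<subseteq> A"
      proof
        fix w assume w: "w \<in> S R - T"
        then obtain z where z: "w = g z" "1 / R < norm z" "norm z < 1" by (auto simp: S_def)
        have "w \<notin> ball 0 R" using w S(4)[OF R1] by (auto simp: T_def)
        then have wR: "norm w \<ge> R" by simp
        have nz: "norm z > 0" using z(2) R by (meson divide_nonneg_pos le_less_trans less_trans zero_le_one zero_less_numeral)
        have up: "norm w \<le> 1 / norm z + C * norm z" using gC(1)[of z] z by simp
        have "C * norm z \<le> C" using C0 z(3) by (simp add: mult_left_le)
        then have "1 / norm z \<ge> R / 2" using up wR R(2) by simp
        then have "norm z \<le> 2 / R" using nz R(1) by (simp add: field_simps)
        then have "C * norm z \<le> q" using mult_left_mono[OF _ C0, of "norm z" "2 / R"] by (simp add: q_def mult.commute)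
        moreover have "1 / norm z < R" using z(2) nz R(1) by (simp add: field_simps)
        ultimately show "w \<in> A" using up wR q unfolding mem by simp
      qed
      have sub2: "T - S R \<subseteq> A"
      proof
        fix w assume w: "w \<in> T - S R"
        then obtain z where z': "w = g z" "z \<in> ball 0 1 - {0}" unfolding T_def \<Omega> by blast
        have z: "w = g z" "norm z < 1" "z \<noteq> 0" "norm w < R" using z' w by (auto simp: T_def)
        have zR: "norm z \<le> 1 / R" using w z by (force simp: S_def)
        then have "1 / norm z \<ge> R" using z(3) R(1) by (simp add: field_simps)
        moreover have "C * norm z \<le> C / R" using mult_left_mono[OF zR C0] by simp
        ultimately show "w \<in> A" using gC(2)[of z] z q unfolding mem by simp
      qed
      have lmS: "S R \<in> lmeasurable" using S(2,3)[OF R1] by (intro lmeasurable_open)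
      have lmT: "T \<in> lmeasurable" unfolding T_def using open\<Omega> by (intro lmeasurable_open) (auto intro: bounded_subset[OF bounded_ball])
      have ST: "S R \<union> T \<subseteq> \<Omega>" using S(4)[OF R1] by (auto simp: T_def)
      have "bounded T" unfolding T_def by (rule bounded_subset[OF bounded_ball]) auto
      then obtain R' where R': "S R \<union> T \<subseteq> cball 0 R'"
        using S(2)[OF R1] bounded_subset_ballD[of "S R \<union> T" 0] ball_subset_cball by (metis bounded_Un order_trans)
      have "compact (f ` (closure \<Omega> \<inter> cball 0 R'))"
        by (intro compact_continuous_image continuous_on_subset[OF f(2)]) (auto intro: closed_Int_compact)
      then obtain B where "\<forall>y\<in>f ` (closure \<Omega> \<inter> cball 0 R'). norm y \<le> B"
        using compact_imp_bounded[of "f ` (closure \<Omega> \<inter> cball 0 R')"] by (auto simp: bounded_iff)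
      then have B: "norm (f w) \<le> B" if "w \<in> closure \<Omega> \<inter> cball 0 R'" for w using that by blast
      have B': "norm (f w) \<le> B" if "w \<in> S R \<union> T" for w using B[of w] that R' ST closure_subset[of \<Omega>] by blast
      have small: "norm (f w) \<le> \<eta>" if "w \<in> A" for w
      proof -
        have w: "norm w \<ge> R / 2" using that q R unfolding mem by simp
        then have w0: "norm w > 0" using R(1) by linarith
        have "norm (inverse w) \<le> 2 / R" unfolding norm_inverse using w w0 R(1) by (simp add: field_simps)
        also have "2 / R < \<delta>" using R(1,3) \<delta>(1) by (simp add: field_simps)
        finally have "norm (\<phi> (inverse w)) < \<eta>" by (rule \<delta>(2))
        then show ?thesis using w0 by (auto simp: \<phi>_def)
      qed
      have "norm (integral T f - integral (S R) f) \<le> 2 * \<eta> * measure lebesgue A"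
      proof (rule integral_symdiff_bound[OF lmS lmT])
        show "A \<in> lmeasurable" unfolding A_def by (rule measure_annulus(1)[OF q(1) q1])
        show "continuous_on (S R \<union> T) f" by (rule continuous_on_subset[OF holomorphic_on_imp_continuous_on[OF f(1)] ST])
        show "S R - T \<union> (T - S R) \<subseteq> A" using sub1 sub2 by blast
      qed (use B' small \<eta> in auto)
      also have "measure lebesgue A = 8 * pi * C" unfolding A_def measure_annulus(2)[OF q(1) q1] using R(1) by (simp add: q_def)
      also have "2 * \<eta> * (8 * pi * C) < \<epsilon>"
      proof -
        have "16 * pi * C + 1 > 0" using C0 by (simp add: add_nonneg_pos)
        then show ?thesis using \<epsilon> by (simp add: \<eta>_def field_simps)
      qed
      finally show "dist (integral (\<Omega> \<inter> ball 0 R) f - integral (S R) f) 0 < \<epsilon>" by (simp add: T_def)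
    qed
  qed
  have "\<forall>\<^sub>F R in at_top. J R = integral (S R) f"
    by (rule eventually_mono[OF eventually_gt_at_top[of 1]]) (rule integral_unique[OF S(1), symmetric])
  then have "((\<lambda>R. integral (\<Omega> \<inter> ball 0 R) f - J R) \<longlongrightarrow> 0) at_top"
    by (intro Lim_transform_eventually[OF lim0]) (rule eventually_mono, assumption, simp)
  from tendsto_add[OF this Jlim] show ?thesis by simp
qed

section \<open>Existence of extreme domains\<close>

lemma simply_connected_conformal_disc:
  assumes "q holomorphic_on ball 0 1" "inj_on q (ball 0 1)"
  shows "simply_connected (q ` ball 0 1)"
proof (rule homeomorphic_simply_connected[OF invariance_of_domain_homeomorphic])
  show "continuous_on (ball 0 1) q" by (rule holomorphic_on_imp_continuous_on[OF assms(1)])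
  show "inj_on q (ball 0 1)" by (rule assms(2))
  show "simply_connected (ball (0::complex) 1)" by (rule convex_imp_simply_connected) simp
qed auto

lemma coprime_monom_complex:
  fixes P :: "complex poly"
  assumes "poly P 0 \<noteq> 0"
  shows "coprime P (monom 1 n)"
proof (rule coprimeI)
  fix r assume r: "r dvd P" "r dvd monom 1 n"
  have r0: "r \<noteq> 0" using r(2) by auto
  show "is_unit r"
  proof (rule ccontr)
    assume "\<not> is_unit r"
    then have "\<not> constant (poly r)" using is_unit_iff_degree[OF r0] by (simp add: constant_degree)
    then obtain z where z: "poly r z = 0" using fundamental_theorem_of_algebra by blast
    then have "poly (monom 1 n) z = 0" "poly P z = 0" using r by (auto elim!: dvdE)
    then show False using assms by (auto simp: poly_monom)
  qed
qed

text \<open>The coefficients enter in reverse order so that the quotient is the sum of the terms c m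
  / z^(m + 1), whose residue against f picks the m-th Taylor coefficient.\<close>

lemma residue_reversed_poly:
  assumes A: "open A" "0 \<in> A" "f holomorphic_on A" and d: "d \<ge> 1"
  shows "residue (\<lambda>z. f z * (poly (\<Sum>m<d. monom (c m) (d - 1 - m)) z / poly (monom 1 d) z)) 0 =
    (\<Sum>i<d. fps_nth (fps_expansion f 0) i * c i)"
proof -
  define h where "h z = f z * (\<Sum>m<d. c m * z ^ (d - 1 - m))" for z
  have eq: "(\<lambda>z. f z * (poly (\<Sum>m<d. monom (c m) (d - 1 - m)) z / poly (monom 1 d) z)) = (\<lambda>z. h z / z ^ Suc (d - 1))"
    using d by (simp add: h_def poly_sum poly_monom fun_eq_iff)
  have res: "residue (\<lambda>z. h z / z ^ Suc (d - 1)) 0 = (deriv ^^ (d - 1)) h 0 / fact (d - 1)"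
    by (rule residue_holomorphic_over_power'[OF A(1,2)]) (use A(3) in \<open>auto simp: h_def intro!: holomorphic_intros\<close>)
  have "h has_fps_expansion fps_expansion f 0 * (\<Sum>m<d. fps_const (c m) * fps_X ^ (d - 1 - m))"
    unfolding h_def[abs_def] by (intro fps_expansion_intros has_fps_expansion_fps_expansion[OF A])
  from fps_nth_fps_expansion[OF this, of "d - 1"]
  have "(deriv ^^ (d - 1)) h 0 / fact (d - 1) = fps_nth (fps_expansion f 0 * (\<Sum>m<d. fps_const (c m) * fps_X ^ (d - 1 - m))) (d - 1)" ..
  also have "\<dots> = (\<Sum>m<d. fps_nth (fps_const (c m) * (fps_expansion f 0 * fps_X ^ (d - 1 - m))) (d - 1))"
    by (simp only: sum_distrib_left fps_sum_nth mult.left_commute)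
  also have "\<dots> = (\<Sum>m<d. fps_nth (fps_expansion f 0) m * c m)"
    by (rule sum.cong) (auto simp: fps_X_power_mult_right_nth mult.commute)
  finally show ?thesis unfolding eq res .
qed

context family
begin

definition coef :: "(nat \<Rightarrow> real) \<Rightarrow> nat \<Rightarrow> complex" where
  "coef x k = (if k = 1 then of_nat (1 - \<kappa>) else 0) + (if k = d then 1 / of_nat d else 0) + (if k \<in> K then bc N x k / of_nat k else 0)"

lemma px_eq_sum: "px \<kappa> d x z = (\<Sum>k=1..d. coef x k * z ^ k)"
proof -
  have "coef x k * z ^ k = (if k = 1 then of_nat (1 - \<kappa>) * z else 0) + (if k = d then z ^ d / of_nat d else 0) + (if k \<in> K then bc N x k / of_nat k * z ^ k else 0)" for k
    by (auto simp: coef_def distrib_right)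
  moreover have "(\<Sum>k=1..d. if k \<in> K then bc N x k / of_nat k * z ^ k else 0) = hx \<kappa> d x z"
  proof -
    have "{1..d} \<inter> K = K" using k1 d2 by (auto simp: idx_def)
    then show ?thesis unfolding hx_def by (simp flip: sum.inter_restrict)
  qed
  ultimately show ?thesis using d2 by (simp add: sum.distrib px_def)
qed

lemma coef_top: "coef x d = 1 / of_nat d"
  using d2 k1 by (auto simp: coef_def idx_def)

lemma coef_1: "\<kappa> = 0 \<Longrightarrow> coef x 1 = 1"
  unfolding coef_def using d2 by (auto simp: idx_def)

end

lemma extreme_BQD_exists:
  assumes d: "d \<ge> 2"
  shows "\<exists>\<Omega>. extreme_BQD \<Omega> d"
proof -
  interpret F: family 0 d by unfold_locales (use d in auto)
  obtain x where x: "x \<in> F.U"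
    and dbl: "card ((\<lambda>t::real. reflected_curve.G 0 (px 0 d x) (of_real t)) ` {t\<in>{0..<2 * pi}. \<exists>s. univalent_curve.dbl 0 (px 0 d x) s t}) = d - 2"
    by (rule F.extremal_curve)
  interpret C: univalent_curve 0 "freq 0 d" "px 0 d x" by (rule F.U_univalent[OF x])
  define a where "a = F.coef x"
  have pa: "px 0 d x = (\<lambda>z. \<Sum>k=1..d. a k * z ^ k)" by (simp only: fun_eq_iff F.px_eq_sum a_def) simp
  have Cg: "C.g = (\<lambda>z. \<Sum>k=1..d. a k * z ^ k)" unfolding pa[symmetric] by (simp add: fun_eq_iff C.g_def)
  have D: "punctured_disc 0 = ball 0 1" by (auto simp: punctured_disc_def)
  have C\<Omega>: "C.\<Omega> = (\<lambda>z. \<Sum>k=1..d. a k * z ^ k) ` ball 0 1" unfolding C.\<Omega>_def Cg D ..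
  have inj: "inj_on (\<lambda>z. \<Sum>k=1..d. a k * z ^ k) (ball 0 1)" using C.inj unfolding Cg D .
  have z0: "0 \<in> C.\<Omega>" unfolding C\<Omega> by (rule image_eqI[of _ _ 0]) (auto intro!: sum.neutral[symmetric])
  define c where "c = quadrature_coeff 0 d a"
  define P where "P = (\<Sum>m<d. monom (c m) (d - 1 - m))"
  \<comment> \<open>This is the constant term of P; as it is nonzero, P is coprime to z^d and the
    order is exactly d.\<close>
  have lead: "c (d - 1) \<noteq> 0"
    using quadrature_coeff_lead[of 0 d a] d F.coef_top[of x] F.coef_1[of x] by (simp add: c_def a_def)
  have "poly P 0 = (\<Sum>m<d. if m = d - 1 then c m else 0)"
    unfolding P_def poly_sum by (rule sum.cong) (auto simp: poly_monom power_0_left)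
  also have "\<dots> = c (d - 1)" using d by (simp add: sum.delta)
  finally have P0: "poly P 0 \<noteq> 0" using lead by simp
  have "degree P \<le> d - 1"
    unfolding P_def by (rule degree_sum_le) (auto intro: order_trans[OF degree_monom_le])
  then have degP: "degree P < d" using d by simp
  have q0: "{z::complex. poly (monom 1 d) z = 0} = {0}" using d by (auto simp: poly_monom)
  have "BQD_with C.\<Omega> P (monom 1 d)"
    unfolding BQD_with_def q0
  proof (intro conjI allI impI)
    have "compact ((\<lambda>z. \<Sum>k=1..d. a k * z ^ k) ` cball 0 1)" by (intro compact_continuous_image continuous_intros) auto
    then show "bounded C.\<Omega>" unfolding C\<Omega> by (rule bounded_subset[OF compact_imp_bounded]) auto
    show "C.\<Omega> \<noteq> {}" using z0 by blast
    show "coprime P (monom 1 d)" by (rule coprime_monom_complex[OF P0])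
    show "degree P < degree (monom (1::complex) d)" using degP by (simp add: degree_monom_eq)
    fix f assume f: "f holomorphic_on C.\<Omega> \<and> continuous_on (closure C.\<Omega>) f"
    have "(f has_integral pi * (\<Sum>i<d. fps_nth (fps_expansion f 0) i * c i)) C.\<Omega>"
      unfolding c_def by (rule bounded_quadrature[OF inj C\<Omega>]) (use f in auto)
    then show "(f has_integral pi * (\<Sum>b\<in>{0}. residue (\<lambda>z. f z * (poly P z / poly (monom 1 d) z)) b)) C.\<Omega>"
      using residue_reversed_poly[OF C.open_\<Omega> z0, of f d c] f d unfolding P_def by simp
  qed (use z0 C.open_\<Omega> C.connected_\<Omega> C.interior_closure_\<Omega> in auto)
  moreover have "max (degree P) (degree (monom (1::complex) d)) = d" using degP by (simp add: degree_monom_eq)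
  moreover have "simply_connected C.\<Omega>"
    unfolding C\<Omega> by (rule simply_connected_conformal_disc[OF _ inj]) (intro holomorphic_intros)
  moreover obtain t where "C.f t = 0" using F.cusp_count(2)[OF x] by blast
  note cl = C.boundary_classification[OF this]
  have "card {z. boundary_cusp C.\<Omega> z} = d - 1" using F.cusp_count(1)[OF x] unfolding cl by simp
  moreover from this have "finite {z. boundary_cusp C.\<Omega> z}" using d by (intro card_ge_0_finite) simp
  moreover have "card {z. boundary_double_point C.\<Omega> z} = d - 2" using dbl unfolding cl .
  moreover have "finite {z. boundary_double_point C.\<Omega> z}"
    unfolding cl by (rule finite_imageI, rule finite_subset[OF _ C.finite_doubles[of 0 "2 * pi"]]) auto
  ultimately have "extreme_BQD C.\<Omega> d" unfolding extreme_BQD_def using q0 by blast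
  then show ?thesis ..
qed

lemma extreme_UQD_exists:
  assumes d: "d \<ge> 2"
  shows "\<exists>\<Omega>. extreme_UQD \<Omega> d"
proof -
  interpret F: family 1 d by unfold_locales (use d in auto)
  obtain x where x: "x \<in> F.U"
    and dbl: "card ((\<lambda>t::real. reflected_curve.G 1 (px 1 d x) (of_real t)) ` {t\<in>{0..<2 * pi}. \<exists>s. univalent_curve.dbl 1 (px 1 d x) s t}) = d - 2"
    by (rule F.extremal_curve)
  interpret C: univalent_curve 1 "freq 1 d" "px 1 d x" by (rule F.U_univalent[OF x])
  define a where "a = F.coef x"
  have pa: "px 1 d x z = (\<Sum>k=1..d. a k * z ^ k)" for z unfolding a_def by (rule F.px_eq_sum)
  have Cg: "C.g = (\<lambda>z. (\<Sum>k=1..d. a k * z ^ k) - 1 / z)" unfolding fun_eq_iff C.g_def pa by simp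
  have D: "punctured_disc 1 = ball 0 1 - {0}" by (auto simp: punctured_disc_def)
  have C\<Omega>: "C.\<Omega> = (\<lambda>z. (\<Sum>k=1..d. a k * z ^ k) - 1 / z) ` (ball 0 1 - {0})" unfolding C.\<Omega>_def Cg D ..
  have inj: "inj_on (\<lambda>z. (\<Sum>k=1..d. a k * z ^ k) - 1 / z) (ball 0 1 - {0})" using C.inj unfolding Cg D .
  have cl: "(\<lambda>z. (\<Sum>k=1..d. a k * z ^ k) - 1 / z) ` (cball 0 1 - {0}) \<subseteq> closure C.\<Omega>"
    unfolding C.closure_\<Omega> Cg by (rule image_mono) auto
  obtain q where q: "q holomorphic_on ball 0 1" "inj_on q (ball 0 1)"
    and ex: "\<exists>b. b \<notin> C.\<Omega> \<and> q ` ball 0 1 = insert 0 ((\<lambda>w. inverse (w - b)) ` C.\<Omega>)"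
    by (rule C.disc_chart) (rule that, assumption, assumption, blast)
  then obtain b where b: "b \<notin> C.\<Omega>" "q ` ball 0 1 = insert 0 ((\<lambda>w. inverse (w - b)) ` C.\<Omega>)" by blast
  \<comment> \<open>A neighbourhood of 0 in the chart corresponds to a neighbourhood of infinity in
    the domain.\<close>
  have bdd: "bounded (- C.\<Omega>)"
  proof -
    have "open (q ` ball 0 1)" by (rule open_mapping_thm3[OF q(1) open_ball q(2)])
    moreover have "0 \<in> q ` ball 0 1" unfolding b(2) by simp
    ultimately obtain r where r: "r > 0" "ball 0 r \<subseteq> q ` ball 0 1" using open_contains_ball by metis
    have "- C.\<Omega> \<subseteq> cball b (1 / r)"
    proof
      fix w assume w: "w \<in> - C.\<Omega>"
      show "w \<in> cball b (1 / r)"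
      proof (rule ccontr)
        assume "w \<notin> cball b (1 / r)"
        then have n: "norm (w - b) > 1 / r" by (simp add: dist_norm norm_minus_commute)
        then have wb: "norm (w - b) > 0" using r(1) by (meson divide_nonneg_pos le_less_trans zero_le_one)
        then have "norm (inverse (w - b)) < r" unfolding norm_inverse using n r(1) by (simp add: field_simps)
        then have "inverse (w - b) \<in> insert 0 ((\<lambda>w. inverse (w - b)) ` C.\<Omega>)" using r(2) b(2) by auto
        then show False using w wb by auto
      qed
    qed
    then show ?thesis using bounded_subset bounded_cball by blast
  qed
  define c where "c = quadrature_coeff 1 d a"
  \<comment> \<open>The integral over the large circle is subtracted in the definition, hence the
    sign. The monomial z^k picks the Taylor coefficient of index k + 1; index 0 is missing because
    the test function vanishes at infinity.\<close>
  define P where "P = (\<Sum>k\<le>d. monom (- c (k + 1)) k)"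
  have lead: "c (d + 1) \<noteq> 0"
    using quadrature_coeff_lead[of 1 d a] d F.coef_top[of x] by (simp add: c_def a_def)
  have "coeff P d = - c (d + 1)" unfolding P_def by (simp add: coeff_sum)
  then have "d \<le> degree P" using lead by (intro le_degree) simp
  moreover have "degree P \<le> d"
    unfolding P_def by (rule degree_sum_le) (auto intro: order_trans[OF degree_monom_le])
  ultimately have degP: "degree P = d" by simp
  have "UQD_with C.\<Omega> P 1"
    unfolding UQD_with_def
  proof (intro conjI allI impI)
    fix f R assume f: "f holomorphic_on C.\<Omega> \<and> continuous_on (closure C.\<Omega>) f \<and>
        (\<exists>e>0. \<exists>g. g holomorphic_on ball 0 e \<and> g 0 = 0 \<and> (\<forall>w\<in>ball 0 e - {0}. inverse w \<in> C.\<Omega> \<longrightarrow> g w = f (inverse w)))"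
      and R: "0 < R" "- C.\<Omega> \<union> {z. poly 1 z = 0} \<subseteq> ball 0 R"
    then obtain e h where e: "e > 0" "h holomorphic_on ball 0 e" "h 0 = 0" "\<And>w. w \<in> ball 0 e - {0} \<Longrightarrow> inverse w \<in> C.\<Omega> \<Longrightarrow> h w = f (inverse w)"
      by blast
    have f1: "f holomorphic_on C.\<Omega>" "continuous_on (closure C.\<Omega>) f" using f by auto
    define \<phi> where "\<phi> = (\<lambda>u. if u = 0 then 0 else f (inverse u))"
    define Y where "Y = insert 0 {u. u \<noteq> 0 \<and> inverse u \<in> C.\<Omega>}"
    have R': "- C.\<Omega> \<subseteq> ball 0 R" using R(2) by blast
    have Y: "cball 0 (1 / R) \<subseteq> Y" "open Y" "\<phi> holomorphic_on Y"
      unfolding Y_def \<phi>_def by (rule inverted_test_function[OF C.open_\<Omega> R(1) R' f1(1) e]; assumption)+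
    have lim: "((\<lambda>R. integral (C.\<Omega> \<inter> ball 0 R) f) \<longlongrightarrow> pi * (\<Sum>i\<le>d + 1. fps_nth (fps_expansion \<phi> 0) i * c i)) at_top"
      unfolding \<phi>_def c_def by (rule unbounded_quadrature[OF inj C\<Omega> cl f1 Y(2)]) (use Y(3) in \<open>auto simp: Y_def \<phi>_def\<close>)
    define b where "b i = (deriv ^^ i) \<phi> 0 / fact i" for i
    have b0: "b 0 = 0" by (simp add: b_def \<phi>_def)
    have bF: "fps_nth (fps_expansion \<phi> 0) i = b i" for i by (simp add: b_def fps_expansion_def)
    have "((\<lambda>w. \<Sum>k\<le>d. - c (k + 1) * (\<phi> (inverse w) * w ^ k)) has_contour_integral (\<Sum>k\<le>d. - c (k + 1) * (2 * pi * \<i> * b (k + 1)))) (circlepath 0 R)"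
      unfolding b_def
      by (intro has_contour_integral_sum has_contour_integral_lmul circle_moment_inverted R(1) holomorphic_on_subset[OF Y(3,1)]) auto
    then have "((\<lambda>w. f w * (poly P w / poly 1 w)) has_contour_integral (\<Sum>k\<le>d. - c (k + 1) * (2 * pi * \<i> * b (k + 1)))) (circlepath 0 R)"
    proof (rule has_contour_integral_eq)
      fix w assume "w \<in> path_image (circlepath 0 R)"
      then have "w \<noteq> 0" using R(1) by auto
      then have "\<phi> (inverse w) = f w" by (simp add: \<phi>_def)
      then show "(\<Sum>k\<le>d. - c (k + 1) * (\<phi> (inverse w) * w ^ k)) = f w * (poly P w / poly 1 w)"
        by (simp add: P_def poly_sum poly_monom sum_distrib_left mult_ac)
    qed
    then have "contour_integral (circlepath 0 R) (\<lambda>w. f w * (poly P w / poly 1 w)) = (\<Sum>k\<le>d. - c (k + 1) * (2 * pi * \<i> * b (k + 1)))"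
      by (rule contour_integral_unique)
    also have "\<dots> = - (2 * \<i>) * (pi * (\<Sum>k\<le>d. b (k + 1) * c (k + 1)))"
      by (simp add: sum_distrib_left sum_negf[symmetric] mult_ac)
    also have "(\<Sum>k\<le>d. b (k + 1) * c (k + 1)) = (\<Sum>i\<le>d + 1. b i * c i)"
      using sum.atMost_Suc_shift[of "\<lambda>i. b i * c i" d] by (simp add: b0)
    finally have ci: "contour_integral (circlepath 0 R) (\<lambda>w. f w * (poly P w / poly 1 w)) = - (2 * \<i>) * (pi * (\<Sum>i\<le>d + 1. b i * c i))" .
    show "((\<lambda>R. integral (C.\<Omega> \<inter> ball 0 R) f) \<longlongrightarrow>
         pi * (\<Sum>a\<in>{z. poly 1 z = 0}. residue (\<lambda>z. f z * (poly P z / poly 1 z)) a) -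
         contour_integral (circlepath 0 R) (\<lambda>z. f z * (poly P z / poly 1 z)) / (2 * \<i>)) at_top"
      unfolding ci using lim unfolding bF by simp
  qed (use bdd C.open_\<Omega> C.connected_\<Omega> C.interior_closure_\<Omega> in auto)
  moreover have "max (degree P) (degree (1 :: complex poly)) = d" "degree P > degree (1 :: complex poly)" using degP d by auto
  moreover have "simply_connected (insert 0 ((\<lambda>z. inverse (z - b)) ` C.\<Omega>))"
    unfolding b(2)[symmetric] by (rule simply_connected_conformal_disc[OF q])
  moreover obtain t where "C.f t = 0" using F.cusp_count(2)[OF x] by blast
  note cl = C.boundary_classification[OF this]
  have "card {z. boundary_cusp C.\<Omega> z} = d + 1" using F.cusp_count(1)[OF x] unfolding cl by simp
  moreover from this have "finite {z. boundary_cusp C.\<Omega> z}" by (intro card_ge_0_finite) simp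
  moreover have "card {z. boundary_double_point C.\<Omega> z} = d - 2" using dbl unfolding cl .
  moreover have "finite {z. boundary_double_point C.\<Omega> z}"
    unfolding cl by (rule finite_imageI, rule finite_subset[OF _ C.finite_doubles[of 0 "2 * pi"]]) auto
  moreover have "{z::complex. poly 1 z = 0} = {}" by simp
  ultimately have "extreme_UQD C.\<Omega> d" unfolding extreme_UQD_def using b(1) by blast
  then show ?thesis ..
qed

theorem theoremD:
  fixes d :: nat
  assumes "d \<ge> 2"
  shows "(\<exists>\<Omega>. extreme_BQD \<Omega> d) \<and> (\<exists>\<Omega>. extreme_UQD \<Omega> d)"
  using extreme_BQD_exists[OF assms] extreme_UQD_exists[OF assms] by blast

end
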